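(* Let $k\ge1$ and $n>2k$. Let $\mathrm{I}_{k,n}\subseteq\mathbb{C}[p_I : I\in\binom{[n]}{k}]$ be the ideal generated by the Plücker relations together with the quadrics $$\sum_{\ell=1}^{n}\varepsilon(I\ell)\,\varepsilon(J\ell)\,p_{I\ell}\,p_{J\ell},\qquad I,J\in\binom{[n]}{k-1}.$$ Then $\mathrm{I}_{k,n}$ is the prime ideal of the orthogonal Grassmannian $\mathrm{OGr}(k,n)$, the variety of $k$-dimensional subspaces of $\mathbb{C}^n$ isotropic for $(x,y)=\sum_{i=1}^n x_iy_i$, in its Plücker embedding. In particular, with $m:=\lfloor n/2\rfloor$ and $D:=k(n-k)-\binom{k+1}{2}$, the degree of $\mathrm{I}_{k,n}$ equals $$D!\Big(\prod_{\substack{1\le i\le k\\ k<j\le m}}\frac{1}{(2m-i-j)(j-i)}\Big)\Big(\prod_{1\le i<j\le k}\frac{2}{2m-i-j}\Big)$$ if $n=2m$, and $$D!\Big(\prod_{1\le i\le k}\frac{2}{2m-2i+1}\Big)\Big(\prod_{\substack{1\le i\le k\\ k<j\le m}}\frac{1}{(2m-i-j+1)(j-i)}\Big)\Big(\prod_{1\le i<j\le k}\frac{2}{2m-i-j+1}\Big)$$ if $n=2m+1$.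
   Context: For $I=\{i_1<\dots<i_{k-1}\}$ and $\ell\in[n]$, $I\ell$ is the string $i_1\cdots i_{k-1}\ell$; $p_{I\ell}$ denotes the variable indexed by the set $I\cup\{\ell\}$ (interpreted as $0$ if $\ell\in I$), and $\varepsilon(I\ell)$ is the sign of the permutation sorting the string $I\ell$. *)

theory Defs
  imports
    "HOL-Library.Poly_Mapping"
    "HOL-Computational_Algebra.Polynomial"
    "HOL-Combinatorics.Permutations"
    "HOL-Algebra.Ideal"
    "Jordan_Normal_Form.Determinant"
    "Jordan_Normal_Form.VS_Connect"
begin

text \<open>A multivariate polynomial maps each monomial (a finitely supported exponent function)
  to its coefficient; the variables are indexed by sets of positive integers.\<close>

type_synonym pmonom = "nat set \<Rightarrow>\<^sub>0 nat"
type_synonym ppoly = "pmonom \<Rightarrow>\<^sub>0 complex"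

definition ksubsets :: "nat \<Rightarrow> nat \<Rightarrow> nat set set" where
  "ksubsets k n = {S. S \<subseteq> {1..n} \<and> card S = k}"

definition plucker_ring :: "nat \<Rightarrow> nat \<Rightarrow> ppoly ring" where
  "plucker_ring k n =
    \<lparr>carrier = {f. \<forall>m \<in> Poly_Mapping.keys f. Poly_Mapping.keys m \<subseteq> ksubsets k n},
     mult = (*), one = 1, zero = 0, add = (+)\<rparr>"

lemma cring_plucker_ring: "cring (plucker_ring k n)"
proof (rule cringI)
  show "abelian_group (plucker_ring k n)"
  proof (rule abelian_groupI)
    fix x y assume "x \<in> carrier (plucker_ring k n)" "y \<in> carrier (plucker_ring k n)"
    then show "x \<oplus>\<^bsub>plucker_ring k n\<^esub> y \<in> carrier (plucker_ring k n)"
      using Poly_Mapping.keys_add[of x y] by (fastforce simp: plucker_ring_def)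
  next
    fix x assume "x \<in> carrier (plucker_ring k n)"
    then show "\<exists>y\<in>carrier (plucker_ring k n). y \<oplus>\<^bsub>plucker_ring k n\<^esub> x = \<zero>\<^bsub>plucker_ring k n\<^esub>"
      by (intro bexI[of _ "- x"]) (auto simp: plucker_ring_def)
  qed (auto simp: plucker_ring_def algebra_simps)
  show "Group.comm_monoid (plucker_ring k n)"
  proof (rule comm_monoidI)
    fix x y assume xy: "x \<in> carrier (plucker_ring k n)" "y \<in> carrier (plucker_ring k n)"
    have "Poly_Mapping.keys m \<subseteq> ksubsets k n" if m: "m \<in> Poly_Mapping.keys (x * y)" for m
    proof -
      obtain a b where ab: "a \<in> Poly_Mapping.keys x" "b \<in> Poly_Mapping.keys y" "m = a + b"
        using Poly_Mapping.keys_mult[of x y] m by blast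
      then show ?thesis
        using xy Poly_Mapping.keys_add[of a b] by (fastforce simp: plucker_ring_def)
    qed
    then show "x \<otimes>\<^bsub>plucker_ring k n\<^esub> y \<in> carrier (plucker_ring k n)"
      by (simp add: plucker_ring_def)
  qed (auto simp: plucker_ring_def algebra_simps)
qed (auto simp: plucker_ring_def algebra_simps)

definition pvar :: "nat set \<Rightarrow> ppoly" where
  "pvar S = Poly_Mapping.single (Poly_Mapping.single S 1) 1"

definition peval :: "ppoly \<Rightarrow> (nat set \<Rightarrow> complex) \<Rightarrow> complex" where
  "peval f q = (\<Sum>m \<in> Poly_Mapping.keys f. Poly_Mapping.lookup f m *
     (\<Prod>S \<in> Poly_Mapping.keys m. q S ^ Poly_Mapping.lookup m S))"

definition pscale :: "complex \<Rightarrow> ppoly \<Rightarrow> ppoly" where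
  "pscale c f = Poly_Mapping.single 0 c * f"

lemma vector_space_pscale: "vector_space pscale"
  by unfold_locales
    (simp_all add: pscale_def algebra_simps single_add mult_single flip: mult.assoc)

definition monom_degree :: "pmonom \<Rightarrow> nat" where
  "monom_degree m = (\<Sum>S \<in> Poly_Mapping.keys m. Poly_Mapping.lookup m S)"

definition graded_part :: "nat \<Rightarrow> nat \<Rightarrow> nat \<Rightarrow> ppoly set" where
  "graded_part k n d =
    {f \<in> carrier (plucker_ring k n). \<forall>m \<in> Poly_Mapping.keys f. monom_degree m = d}"

text \<open>The permutation in the definition is unique when the entries of the string are distinct.\<close>

definition string_sign :: "nat list \<Rightarrow> int" where
  "string_sign xs =
    sign (THE \<pi>. \<pi> permutes {..<length xs} \<and> sorted (permute_list \<pi> xs))"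

definition app_sign :: "nat set \<Rightarrow> nat \<Rightarrow> int" where
  "app_sign I l = string_sign (sorted_list_of_set I @ [l])"

definition app_var :: "nat set \<Rightarrow> nat \<Rightarrow> ppoly" where
  "app_var I l = (if l \<in> I then 0 else pvar (I \<union> {l}))"

text \<open>The usual exchange relations
  \<open>\<Sum>r. (-1)^r p(i\<^sub>1,\<dots>,i\<^bsub>k-1\<^esub>,j\<^sub>r) p(j\<^sub>0,\<dots>,j\<^bsub>r-1\<^esub>,j\<^bsub>r+1\<^esub>,\<dots>,j\<^sub>k)\<close> for alternating \<open>p\<close>, up to a
  global sign: \<open>app_sign (J - {j\<^sub>r}) j\<^sub>r = (-1)^(k-r)\<close>.\<close>

definition plucker_relation :: "nat set \<Rightarrow> nat set \<Rightarrow> ppoly" where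
  "plucker_relation I J =
    (\<Sum>l\<in>J. of_int (app_sign I l * app_sign (J - {l}) l) * app_var I l * pvar (J - {l}))"

definition ortho_quadric :: "nat \<Rightarrow> nat set \<Rightarrow> nat set \<Rightarrow> ppoly" where
  "ortho_quadric n I J =
    (\<Sum>l=1..n. of_int (app_sign I l * app_sign J l) * app_var I l * app_var J l)"

definition ortho_plucker_ideal :: "nat \<Rightarrow> nat \<Rightarrow> ppoly set" where
  "ortho_plucker_ideal k n =
    genideal (plucker_ring k n)
      ({plucker_relation I J | I J. I \<in> ksubsets (k - 1) n \<and> J \<in> ksubsets (k + 1) n} \<union>
       {ortho_quadric n I J | I J. I \<in> ksubsets (k - 1) n \<and> J \<in> ksubsets (k - 1) n})"

abbreviation subspace_vs :: "nat \<Rightarrow> complex vec set \<Rightarrow> (complex, complex vec) module" where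
  "subspace_vs n W \<equiv> (module_vec TYPE(complex) n)\<lparr>carrier := W\<rparr>"

text \<open>The product on vectors is the bilinear form \<open>\<Sum>i. x\<^sub>i y\<^sub>i\<close>, without conjugation.\<close>

definition OGr :: "nat \<Rightarrow> nat \<Rightarrow> complex vec set set" where
  "OGr k n = {W. subspace class_ring W (module_vec TYPE(complex) n) \<and>
     vectorspace.dim class_ring (subspace_vs n W) = k \<and>
     (\<forall>x\<in>W. \<forall>y\<in>W. x \<bullet> y = 0)}"

definition ordered_basis :: "nat \<Rightarrow> complex vec set \<Rightarrow> complex vec list \<Rightarrow> bool" where
  "ordered_basis n W B \<longleftrightarrow>
    distinct B \<and> vectorspace.basis class_ring (subspace_vs n W) (set B)"

text \<open>Vectors are indexed from 0, whereas the sets \<open>S \<subseteq> {1..n}\<close> are 1-based.\<close>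

definition plucker_coord :: "complex vec list \<Rightarrow> nat set \<Rightarrow> complex" where
  "plucker_coord B S =
    det (mat (length B) (length B)
      (\<lambda>(a, b). (B ! a) $ (sorted_list_of_set S ! b - 1)))"

text \<open>The point of projective space assigned to \<open>W\<close>, as the set of all its
  homogeneous coordinate vectors.\<close>

definition plucker_point :: "nat \<Rightarrow> complex vec set \<Rightarrow> (nat set \<Rightarrow> complex) set" where
  "plucker_point n W =
    {(\<lambda>S. c * plucker_coord B S) | c B. c \<noteq> 0 \<and> ordered_basis n W B}"

definition vanishing_ideal ::
    "nat \<Rightarrow> nat \<Rightarrow> (nat set \<Rightarrow> complex) set set \<Rightarrow> ppoly set" where
  "vanishing_ideal k n X =
    {f \<in> carrier (plucker_ring k n). \<forall>P\<in>X. \<forall>q\<in>P. peval f q = 0}"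

text \<open>The dimension of the degree-\<open>d\<close> part of the quotient ring; all spaces involved are
  finite-dimensional.\<close>

definition hilbert_function :: "nat \<Rightarrow> nat \<Rightarrow> ppoly set \<Rightarrow> nat \<Rightarrow> nat" where
  "hilbert_function k n I d =
    vector_space.dim pscale (graded_part k n d) -
    vector_space.dim pscale (I \<inter> graded_part k n d)"

definition hilbert_polynomial :: "nat \<Rightarrow> nat \<Rightarrow> ppoly set \<Rightarrow> real poly" where
  "hilbert_polynomial k n I =
    (THE h. \<forall>\<^sub>F d in sequentially. poly h (real d) = real (hilbert_function k n I d))"

definition ideal_degree :: "nat \<Rightarrow> nat \<Rightarrow> ppoly set \<Rightarrow> real" where
  "ideal_degree k n I =
    fact (Polynomial.degree (hilbert_polynomial k n I)) *
    Polynomial.lead_coeff (hilbert_polynomial k n I)"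

end

theory Submission
  imports Defs
begin

text \<open>The Casimir operator of \<open>so(n)\<close> acts on polynomials in the Plucker coordinates by a second-order
  operator. Modulo the ideal \<open>I\<close> of the statement it acts on degree \<open>d\<close> by a single scalar, because the failure
  of the operator to be a derivation on products is expressed through the Plucker relations and the
  orthogonality quadrics. Let \<open>P\<close> be the ideal of the orbit of one isotropic subspace under plane rotations; it
  contains \<open>I\<close> and the vanishing ideal, and it is prime because the orbit is swept out by polynomial curves.

  Take any quotient of the degree \<open>d\<close> part which is stable under \<open>so(n)\<close>, on which the Casimir
  operator is that scalar, and in which the extremal weight vectors survive. Taking the trace of the
  Casimir operator against a torus element gives a differential equation for the character; after
  multiplication by the Weyl denominator it becomes an eigenvalue equation for the Laplacian, so only exponents of a
  fixed length survive. All weights are bounded by the extremal ones, which leaves the Weyl numerator.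
  Hence all such quotients have the dimension given by Weyl's formula. This applies to \<open>P\<close> and to the
  image of the shifted Casimir operator, which lies in \<open>I\<close>, and therefore \<open>I = P\<close>. The dimension formula is a
  polynomial in \<open>d\<close> whose leading coefficient is the stated degree.\<close>

section \<open>Weyl alternants, denominators and characters as functions of real torus
  parameters\<close>

section \<open>Alternants\<close>

text \<open>Neither complete reducibility nor highest weight theory enters, and the quotient by
  \<open>I\<close> is not attacked directly. In each degree \<open>casimir_image\<close> lies in
  \<open>I\<close>, which lies in the orbit ideal, and the conditions on a quotient are checked only
  for these two ends: stability of the lower end is centrality of the Casimir operator, and survival
  of the extremal vectors is tested by evaluation at orbit points, hence in the upper end. The trace
  of two opposite root operators against a torus element comes from cyclicity and the commutator:
  moving the torus element past a root operator multiplies by a number \<open>q\<close>, exchanging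
  the operators adds Cartan elements, and \<open>q\<close> different from 1 makes the resulting
  linear equation solvable. For even \<open>n\<close> the Weyl group contains only even numbers of
  sign changes, yet the alternants run over all of them. Since \<open>n > 2 * k\<close>, the last
  coordinate of the shifted weight is zero as is that of \<open>rho\<close>, so both alternants are
  merely doubled and one treatment covers both parities. The same inequality gives
  \<open>rho n (k - 1) > 0\<close>; for \<open>n = 2 * k\<close> a sign change in the last
  coordinate would give further weights of the critical length.\<close>

lemma poly_eq_prod_roots:
  fixes q :: "real poly"
  assumes "degree q \<le> m" "\<And>j. j < m \<Longrightarrow> poly q (x j) = 0" "inj_on x {..<m}"
  shows "q = Polynomial.smult (coeff q m) (\<Prod>j<m. [:- x j, 1:])"
proof (rule ccontr)
  let ?P = "\<Prod>j<m. [:- x j, 1:]"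
  define r where "r = q - Polynomial.smult (coeff q m) ?P"
  assume "q \<noteq> Polynomial.smult (coeff q m) ?P"
  then have r0: "r \<noteq> 0" by (simp add: r_def)
  have mon: "degree (\<Prod>j<m. [:- x j, 1:]) = m \<and> coeff (\<Prod>j<m. [:- x j, 1:]) m = 1" for m
  proof (induction m)
    case (Suc m)
    let ?Q = "\<Prod>j<m. [:- x j, 1:]"
    note IH = conjunct1[OF Suc] conjunct2[OF Suc]
    have q0: "?Q \<noteq> 0" using IH by auto
    have "degree (\<Prod>j<Suc m. [:- x j, 1:]) = degree (?Q * [:- x m, 1:])" by simp
    also have "\<dots> = degree ?Q + degree [:- x m, 1:]" using q0 by (intro degree_mult_eq) auto
    also have "\<dots> = Suc m" unfolding IH by simp
    finally have d: "degree (\<Prod>j<Suc m. [:- x j, 1:]) = Suc m" .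
    have "coeff (?Q * [:- x m, 1:]) (Suc m) = 1" using IH coeff_eq_0[of ?Q "Suc m"] by (simp add: coeff_pCons)
    then show ?case using d by simp
  qed simp
  have "coeff r m = 0" using mon[of m] by (simp add: r_def)
  moreover have "degree r \<le> m" unfolding r_def using assms(1) mon[of m]
    by (intro degree_diff_le) (auto intro: order.trans[OF degree_smult_le])
  \<comment> \<open>The difference of the two sides has lost its top coefficient, so it has degree
    below \<open>m\<close> but \<open>m\<close> distinct roots; for \<open>m = 0\<close> it is the
    zero constant.\<close>
  ultimately have "degree r < m \<or> m = 0 \<and> r = 0" using r0 by (metis le_neq_implies_less leading_coeff_0_iff)
  then have dr: "degree r < m" using r0 by blast
  have "x ` {..<m} \<subseteq> {y. poly r y = 0}"
    using assms(2) by (auto simp: r_def poly_prod intro!: prod_zero)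
  then have "card (x ` {..<m}) \<le> card {y. poly r y = 0}" using poly_roots_finite[OF r0] by (intro card_mono)
  also have "\<dots> \<le> degree r" by (rule card_poly_roots_bound[OF r0])
  finally show False using dr card_image[OF assms(3)] by simp
qed

text \<open>A triangular change of basis away from the Vandermonde determinant. In the induction the
  last node becomes a variable \<open>y\<close>: the determinant is then a polynomial
  \<open>q\<close> in \<open>y\<close> vanishing at the earlier nodes, with top coefficient the
  determinant for \<open>m\<close> nodes times that of \<open>p m\<close>. When two earlier nodes
  coincide both sides are zero.\<close>

lemma det_poly_vandermonde:
  fixes p :: "nat \<Rightarrow> real poly" and x :: "nat \<Rightarrow> real"
  assumes "\<And>r. degree (p r) \<le> r"
  shows "det (mat m m (\<lambda>(r, j). poly (p r) (x j))) = (\<Prod>r<m. coeff (p r) r) * (\<Prod>b<m. \<Prod>a<b. x b - x a)"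
proof (induction m)
  case 0 then show ?case by simp
next
  case (Suc m)
  define A where "A y = mat (Suc m) (Suc m) (\<lambda>(r, j). poly (p r) (if j = m then y else x j))" for y
  define C where "C r = cofactor (A 0) r m" for r
  have exp: "det (A y) = (\<Sum>r<Suc m. poly (p r) y * C r)" for y
  proof -
    have "det (A y) = (\<Sum>r<Suc m. A y $$ (r, m) * cofactor (A y) r m)"
      by (rule laplace_expansion_column) (auto simp: A_def)
    also have "\<dots> = (\<Sum>r<Suc m. poly (p r) y * C r)"
    proof (intro sum.cong refl arg_cong2[of _ _ _ _ "(*)"])
      fix r assume r: "r \<in> {..<Suc m}"
      show "A y $$ (r, m) = poly (p r) y" using r by (simp add: A_def)
      have "mat_delete (A y) r m = mat_delete (A 0) r m"
        by (rule eq_matI) (use r in \<open>auto simp: mat_delete_def A_def\<close>)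
      then show "cofactor (A y) r m = C r" by (simp add: cofactor_def C_def)
    qed
    finally show ?thesis .
  qed
  have Cm: "C m = det (mat m m (\<lambda>(r, j). poly (p r) (x j)))"
  proof -
    have "mat_delete (A 0) m m = mat m m (\<lambda>(r, j). poly (p r) (x j))"
      by (rule eq_matI) (auto simp: mat_delete_def A_def)
    then show ?thesis by (simp add: C_def cofactor_def)
  qed
  have zero: "det (A y) = 0" if "y = x j" "j < m" for y j
    by (rule det_identical_columns[of _ "Suc m" j m]) (use that in \<open>auto simp: A_def intro!: eq_vecI\<close>)
  define q where "q = (\<Sum>r<Suc m. Polynomial.smult (C r) (p r))"
  have q: "poly q y = det (A y)" for y by (simp add: exp q_def poly_sum mult.commute)
  have Ax: "A (x m) = mat (Suc m) (Suc m) (\<lambda>(r, j). poly (p r) (x j))"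
    by (rule eq_matI) (auto simp: A_def)
  have dq: "degree q \<le> m" unfolding q_def
  proof (rule degree_sum_le)
    fix r assume "r \<in> {..<Suc m}"
    then have "degree (p r) \<le> m" using assms[of r] by simp
    then show "degree (Polynomial.smult (C r) (p r)) \<le> m" by (rule order.trans[OF degree_smult_le])
  qed simp
  have cq: "coeff q m = C m * coeff (p m) m"
  proof -
    have "coeff (p r) m = 0" if "r < m" for r using assms[of r] that by (intro coeff_eq_0) simp
    then show ?thesis by (simp add: q_def coeff_sum)
  qed
  show ?case
  proof (cases "inj_on x {..<m}")
    case True
    have "q = Polynomial.smult (coeff q m) (\<Prod>j<m. [:- x j, 1:])"
      by (rule poly_eq_prod_roots[OF dq _ True]) (use zero q in auto)
    then have "poly q (x m) = coeff q m * (\<Prod>j<m. x m - x j)"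
      by (metis (no_types, lifting) poly_smult poly_prod prod.cong poly_pCons poly_0 mult_zero_right add_0_right mult_1_right add.commute diff_conv_add_uminus)
    then have "det (A (x m)) = C m * coeff (p m) m * (\<Prod>j<m. x m - x j)" using q cq by simp
    then show ?thesis unfolding Ax Cm Suc by (simp add: mult_ac)
  next
    case False
    then obtain a b where ab: "a < b" "b < m" "x a = x b"
      by (auto simp: inj_on_def) (metis nat_neq_iff)
    have "det (A (x m)) = 0"
      by (rule det_identical_columns[of _ "Suc m" a b]) (use ab in \<open>auto simp: A_def intro!: eq_vecI\<close>)
    moreover have "(\<Prod>b<Suc m. \<Prod>a<b. x b - x a) = 0"
    proof -
      have z: "(\<Prod>a<b. x b - x a) = 0" by (rule prod_zero, simp, rule bexI[of _ a]) (use ab in auto)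
      show ?thesis by (rule prod_zero, simp, rule bexI[of _ b], rule z) (use ab in simp)
    qed
    ultimately show ?thesis unfolding Ax by simp
  qed
qed

text \<open>The character of a single sign change of a coordinate. For odd \<open>n\<close> it is a
  reflection in the Weyl group and counts -1; for even \<open>n\<close> it is outside the Weyl group
  and counts +1, which makes \<open>gfun\<close> a doubled hyperbolic cosine instead of a doubled
  hyperbolic sine.\<close>

definition sgnn :: "nat \<Rightarrow> real" where "sgnn n = (if even n then 1 else -1)"

definition gfun :: "nat \<Rightarrow> real \<Rightarrow> real" where "gfun n x = exp x + sgnn n * exp (- x)"

text \<open>The part of the Weyl denominator that comes from the short root of one coordinate; such
  roots exist only for odd \<open>n\<close>.\<close>

definition Gfac :: "nat \<Rightarrow> real \<Rightarrow> real" where "Gfac n x = (if even n then 1 else exp (x / 2) - exp (- x / 2))"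

text \<open>A difference of two values at \<open>x\<close> and \<open>y\<close> is the product of
  the denominator factors of the roots \<open>x - y\<close> and \<open>x + y\<close>.\<close>

definition Yfun :: "real \<Rightarrow> real" where "Yfun x = exp x + exp (- x)"

text \<open>Half the sum of the positive roots of \<open>so(n)\<close>; coordinates are indexed from 0, so \<open>rho n (i - 1) = n / 2 - i\<close>.\<close>

definition rho :: "nat \<Rightarrow> nat \<Rightarrow> real" where "rho n i = real n / 2 - real i - 1"

definition alt :: "nat \<Rightarrow> (nat \<Rightarrow> real) \<Rightarrow> (nat \<Rightarrow> real) \<Rightarrow> real" where
  "alt n l \<theta> = det (mat (n div 2) (n div 2) (\<lambda>(i, j). gfun n (l i * \<theta> j)))"

text \<open>Rescaled Chebyshev polynomials in \<open>2 cosh x\<close>: they represent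
  \<open>2 cosh (r x)\<close> for even \<open>n\<close> and
  \<open>sinh ((r + 1/2) x) / sinh (x / 2)\<close> for odd \<open>n\<close>. The constant 2 is the
  only one that is not monic.\<close>

fun Cheb :: "nat \<Rightarrow> nat \<Rightarrow> real poly" where
  "Cheb n 0 = (if even n then [:2:] else [:1:])"
| "Cheb n (Suc 0) = (if even n then [:0, 1:] else [:1, 1:])"
| "Cheb n (Suc (Suc r)) = [:0, 1:] * Cheb n (Suc r) - Cheb n r"

lemma Cheb_degree: "degree (Cheb n r) \<le> r"
proof (induction r rule: Cheb.induct[of "\<lambda>n r. degree (Cheb n r) \<le> r", rotated 3])
  case (3 n r)
  have "degree ([:0, 1:] * Cheb n (Suc r)) \<le> Suc (Suc r)"
    using 3(1) degree_mult_le[of "[:0, 1:]" "Cheb n (Suc r)"] by simp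
  then show ?case using 3(2) by (auto intro!: degree_diff_le)
qed auto

lemma Cheb_coeff: "coeff (Cheb n (Suc r)) (Suc r) = 1"
proof (induction r)
  case (Suc r)
  have "coeff (Cheb n r) (Suc (Suc r)) = 0" using Cheb_degree[of n r] by (intro coeff_eq_0) simp
  then show ?case using Suc by simp
qed simp

lemma Cheb_eval:
  "gfun n ((real r + (if even n then 0 else 1/2)) * x) = Gfac n x * poly (Cheb n r) (Yfun x)"
proof (induction n r rule: Cheb.induct)
  case (1 n) then show ?case by (auto simp: gfun_def sgnn_def Gfac_def)
next
  case (2 n)
  show ?case
  proof (cases "even n")
    case True then show ?thesis by (simp add: gfun_def sgnn_def Gfac_def Yfun_def)
  next
    case False
    have e: "exp (x / 2) * exp x = exp (3/2 * x)" "exp (x / 2) * exp (- x) = exp (- x / 2)" "exp (- x / 2) * exp x = exp (x / 2)"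
      "exp (- x / 2) * exp (- x) = exp (- (3/2 * x))" by (simp_all add: exp_add[symmetric])
    have "Gfac n x * poly (Cheb n (Suc 0)) (Yfun x) = (exp (x / 2) - exp (- x / 2)) * (1 + (exp x + exp (- x)))"
      using False by (simp add: Gfac_def Yfun_def)
    also have "\<dots> = exp (3/2 * x) - exp (- (3/2 * x))" unfolding distrib_left left_diff_distrib e by simp
    finally show ?thesis using False by (simp add: gfun_def sgnn_def)
  qed
next
  case (3 n r)
  define h where "h = (if even n then 0 else 1/2 :: real)"
  have a: "gfun n (y + x) = Yfun x * gfun n y - gfun n (y - x)" for y
    by (simp add: gfun_def Yfun_def algebra_simps exp_add[symmetric])
  have "gfun n ((real (Suc (Suc r)) + h) * x) = gfun n ((real (Suc r) + h) * x + x)" by (simp add: algebra_simps)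
  also have "\<dots> = Yfun x * gfun n ((real (Suc r) + h) * x) - gfun n ((real r + h) * x)"
    unfolding a by (simp add: algebra_simps)
  finally show ?case using 3 unfolding h_def[symmetric] by (simp add: algebra_simps)
qed

text \<open>Weyl's denominator formula, by pulling \<open>Gfac\<close> out of each column and
  recognising a Vandermonde determinant in Chebyshev polynomials. The constant stays unevaluated
  because it cancels wherever two alternants are compared.\<close>

lemma alt_product:
  "\<exists>C. C \<noteq> 0 \<and> (\<forall>\<theta>. alt n (rho n) \<theta> = C * (\<Prod>j<n div 2. Gfac n (\<theta> j)) * (\<Prod>b<n div 2. \<Prod>a<b. Yfun (\<theta> b) - Yfun (\<theta> a)))"
proof -
  define m where "m = n div 2"
  \<comment> \<open>Row \<open>i\<close> has frequency \<open>rho n i\<close>, which is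
    \<open>m - 1 - i\<close> plus 0 or 1/2, so the rows must be reversed to have increasing
    degree.\<close>
  define rv where "rv i = (if i < m then m - 1 - i else i)" for i
  have rv: "rv permutes {0..<m}"
    by (rule bij_imp_permutes[of _ _, OF bij_betwI[of _ _ _ rv]]) (auto simp: rv_def)
  define C where "C = of_int (sign rv) * (\<Prod>r<m. coeff (Cheb n r) r)"
  have "coeff (Cheb n r) r \<noteq> 0" for r by (cases r) (auto simp: Cheb_coeff)
  then have C0: "C \<noteq> 0" by (simp add: C_def sign_def)
  have "alt n (rho n) \<theta> = C * (\<Prod>j<m. Gfac n (\<theta> j)) * (\<Prod>b<m. \<Prod>a<b. Yfun (\<theta> b) - Yfun (\<theta> a))" for \<theta>
  proof -
    define V where "V = mat m m (\<lambda>(r, j). poly (Cheb n r) (Yfun (\<theta> j)))"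
    have ent: "gfun n (rho n i * \<theta> j) = Gfac n (\<theta> j) * V $$ (rv i, j)" if ij: "i < m" "j < m" for i j
    proof -
      have "rho n i = real (m - 1 - i) + (if even n then 0 else 1/2)"
      proof (cases "even n")
        case True
        then have "real n = 2 * real m" unfolding m_def by (metis even_two_times_div_two of_nat_mult of_nat_numeral)
        then show ?thesis using True ij by (simp add: rho_def of_nat_diff)
      next
        case False
        then have "n = 2 * m + 1" unfolding m_def by presburger
        then have "real n = 2 * real m + 1" by simp
        then show ?thesis using False ij by (simp add: rho_def of_nat_diff field_simps)
      qed
      then show ?thesis using Cheb_eval[of n "m - 1 - i" "\<theta> j"] ij by (simp add: V_def rv_def)
    qed
    have "alt n (rho n) \<theta> = (\<Sum>p | p permutes {0..<m}. of_int (sign p) * (\<Prod>i=0..<m. gfun n (rho n i * \<theta> (p i))))"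
      unfolding alt_def m_def[symmetric] by (subst det_def'[of _ m]) (auto intro!: sum.cong prod.cong dest: permutes_in_image)
    also have "\<dots> = (\<Sum>p | p permutes {0..<m}. (\<Prod>j=0..<m. Gfac n (\<theta> j)) * (of_int (sign p) * (\<Prod>i=0..<m. V $$ (rv i, p i))))"
    proof (rule sum.cong[OF refl])
      fix p assume "p \<in> {p. p permutes {0..<m}}"
      then have p: "p permutes {0..<m}" by simp
      have "(\<Prod>i=0..<m. gfun n (rho n i * \<theta> (p i))) = (\<Prod>i=0..<m. Gfac n (\<theta> (p i))) * (\<Prod>i=0..<m. V $$ (rv i, p i))"
        unfolding prod.distrib[symmetric] by (intro prod.cong refl ent) (use permutes_in_image[OF p] in auto)
      also have "(\<Prod>i=0..<m. Gfac n (\<theta> (p i))) = (\<Prod>i=0..<m. Gfac n (\<theta> i))"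
        by (rule prod.permute[OF p, symmetric, unfolded o_def])
      finally show "of_int (sign p) * (\<Prod>i=0..<m. gfun n (rho n i * \<theta> (p i))) = (\<Prod>j=0..<m. Gfac n (\<theta> j)) * (of_int (sign p) * (\<Prod>i=0..<m. V $$ (rv i, p i)))"
        by (simp add: mult_ac)
    qed
    also have "\<dots> = (\<Prod>j=0..<m. Gfac n (\<theta> j)) * det (mat m m (\<lambda>(i, j). V $$ (rv i, j)))"
      unfolding sum_distrib_left[symmetric] by (subst det_def'[of _ m]) (auto intro!: sum.cong prod.cong dest: permutes_in_image)
    also have "det (mat m m (\<lambda>(i, j). V $$ (rv i, j))) = of_int (sign rv) * det V"
      by (rule det_permute_rows[OF _ rv]) (simp add: V_def)
    also have "det V = (\<Prod>r<m. coeff (Cheb n r) r) * (\<Prod>b<m. \<Prod>a<b. Yfun (\<theta> b) - Yfun (\<theta> a))"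
      unfolding V_def by (rule det_poly_vandermonde) (rule Cheb_degree)
    finally show ?thesis by (simp add: C_def mult_ac atLeast0LessThan)
  qed
  then show ?thesis using C0 unfolding m_def by blast
qed

section \<open>Logarithmic derivatives of the denominator\<close>

text \<open>At \<open>exp x\<close> this is the hyperbolic cotangent of \<open>x / 2\<close>, twice
  the logarithmic derivative of \<open>exp (x / 2) - exp (- x / 2)\<close>. Accordingly
  \<open>Qfun\<close> is twice the logarithmic derivative of the Weyl denominator in the direction
  of coordinate \<open>j\<close>.\<close>

definition Kfun :: "real \<Rightarrow> real" where "Kfun z = (z + 1) / (z - 1)"

definition Qfun :: "nat \<Rightarrow> (nat \<Rightarrow> real) \<Rightarrow> nat \<Rightarrow> real" where
  "Qfun n \<theta> j = (\<Sum>i\<in>{..<n div 2}-{j}. Kfun (exp (\<theta> j + \<theta> i)) + Kfun (exp (\<theta> j - \<theta> i))) + (if odd n then Kfun (exp (\<theta> j)) else 0)"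

text \<open>Joins the two roots that involve a given pair of coordinates: with \<open>a\<close> and
  \<open>b\<close> the exponentials of the parameters, the right side is twice the logarithmic
  derivative of a difference of \<open>Yfun\<close> values.\<close>

lemma Kfun_pair:
  assumes "a > 0" "b > 0" "a * b \<noteq> 1" "a \<noteq> b"
  shows "Kfun (a * b) + Kfun (a / b) = 2 * ((a - 1 / a) / ((a + 1 / a) - (b + 1 / b)))"
proof -
  have n: "a * b - 1 \<noteq> 0" "a / b - 1 \<noteq> 0" using assms by (auto simp: field_simps)
  have e: "(a + 1 / a) - (b + 1 / b) = (a * b - 1) * (a / b - 1) / a" using assms(1,2) by (simp add: field_simps)
  have "Kfun (a * b) + Kfun (a / b) = ((a * b + 1) * (a / b - 1) + (a / b + 1) * (a * b - 1)) / ((a * b - 1) * (a / b - 1))"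
    unfolding Kfun_def using n by (simp add: add_frac_eq mult.commute)
  also have "(a * b + 1) * (a / b - 1) + (a / b + 1) * (a * b - 1) = 2 * (a * a - 1)" using assms(2) by (simp add: field_simps)
  finally have k: "Kfun (a * b) + Kfun (a / b) = 2 * (a * a - 1) / ((a * b - 1) * (a / b - 1))" .
  define d where "d = (a * b - 1) * (a / b - 1)"
  have "d \<noteq> 0" using n by (simp add: d_def)
  then have "2 * (a * a - 1) / d = 2 * ((a - 1 / a) / (d / a))" using assms(1) by (simp add: field_simps)
  then show ?thesis unfolding e k d_def .
qed

text \<open>All roots are nonzero at such a point, so the Weyl denominator does not vanish
  there.\<close>

definition generic :: "nat \<Rightarrow> (nat \<Rightarrow> real) \<Rightarrow> bool" where
  "generic n \<theta> \<longleftrightarrow> (\<forall>j<n div 2. \<theta> j > 0) \<and> inj_on \<theta> {..<n div 2}"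

lemma Yfun_inj: assumes "a \<ge> 0" "b \<ge> 0" "Yfun a = Yfun b" shows "a = (b::real)"
proof -
  have "(exp a - exp b) * (exp a * exp b - 1) = exp a * exp b * (Yfun a - Yfun b)"
    by (simp add: Yfun_def exp_minus field_simps)
  then have "exp a = exp b \<or> exp (a + b) = exp 0" using assms(3) by (simp add: exp_add)
  then show ?thesis using assms by auto
qed

lemma Yfun_deriv: "(Yfun has_field_derivative (exp x - exp (- x))) (at x)"
  unfolding Yfun_def by (auto intro!: derivative_eq_intros)

lemma Gfac_deriv:
  assumes "x > 0"
  shows "(Gfac n has_field_derivative Gfac n x * (if odd n then Kfun (exp x) / 2 else 0)) (at x)"
proof (cases "even n")
  case True then show ?thesis by (simp add: Gfac_def[abs_def])
next
  case False
  have d: "((\<lambda>x. exp (x / 2) - exp (- x / 2)) has_field_derivative (exp (x / 2) + exp (- x / 2)) / 2) (at x)"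
    by (auto intro!: derivative_eq_intros simp: field_simps)
  have n0: "exp x - 1 \<noteq> 0" using assms by simp
  have "exp (x / 2) * exp (x / 2) = exp x" by (simp add: exp_add[symmetric])
  then have "(exp (x / 2) - exp (- x / 2)) * Kfun (exp x) = exp (x / 2) + exp (- x / 2)"
    unfolding Kfun_def using n0 by (simp add: exp_minus field_simps)
  then show ?thesis using d False by (simp add: Gfac_def[abs_def])
qed

text \<open>Logarithmic differentiation of the product in \<open>alt_product\<close>, legitimate
  because no factor vanishes at a generic point. The division by 2 compensates the factor 2 built
  into \<open>Kfun\<close>.\<close>

lemma alt_deriv:
  assumes "generic n \<theta>" "j < n div 2"
  shows "((\<lambda>t. alt n (rho n) (\<theta>(j := t))) has_field_derivative alt n (rho n) \<theta> * (Qfun n \<theta> j / 2)) (at (\<theta> j))"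
proof -
  let ?m = "n div 2"
  obtain C where "C \<noteq> 0" and C: "\<And>\<theta>. alt n (rho n) \<theta> = C * (\<Prod>j<?m. Gfac n (\<theta> j)) * (\<Prod>b<?m. \<Prod>a<b. Yfun (\<theta> b) - Yfun (\<theta> a))"
    using alt_product[of n] by blast
  have pos: "i < ?m \<Longrightarrow> \<theta> i > 0" for i using assms(1) by (simp add: generic_def)
  have dist: "Yfun (\<theta> a) \<noteq> Yfun (\<theta> b)" if "a < ?m" "b < ?m" "a \<noteq> b" for a b
    using Yfun_inj[of "\<theta> a" "\<theta> b"] pos that assms(1) by (auto simp: generic_def inj_on_def less_imp_le)
  define Y' where "Y' = exp (\<theta> j) - exp (- \<theta> j)"
  have dY: "((\<lambda>t. Yfun ((\<theta>(j := t)) a)) has_field_derivative (if a = j then Y' else 0)) (at (\<theta> j))" for a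
    using Yfun_deriv[of "\<theta> j"] by (cases "a = j") (auto simp: Y'_def)
  have dG: "((\<lambda>t. \<Prod>i<?m. Gfac n ((\<theta>(j := t)) i)) has_field_derivative (\<Prod>i<?m. Gfac n (\<theta> i)) * (if odd n then Kfun (exp (\<theta> j)) / 2 else 0)) (at (\<theta> j))"
  proof -
    have "((\<lambda>t. Gfac n t * (\<Prod>i\<in>{..<?m}-{j}. Gfac n (\<theta> i))) has_field_derivative Gfac n (\<theta> j) * (if odd n then Kfun (exp (\<theta> j)) / 2 else 0) * (\<Prod>i\<in>{..<?m}-{j}. Gfac n (\<theta> i))) (at (\<theta> j))"
      by (intro DERIV_cmult_right Gfac_deriv pos assms(2))
    moreover have "(\<Prod>i<?m. Gfac n ((\<theta>(j := t)) i)) = Gfac n t * (\<Prod>i\<in>{..<?m}-{j}. Gfac n (\<theta> i))" for t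
    proof -
      have "(\<Prod>i<?m. Gfac n ((\<theta>(j := t)) i)) = Gfac n ((\<theta>(j := t)) j) * (\<Prod>i\<in>{..<?m}-{j}. Gfac n ((\<theta>(j := t)) i))"
        using assms(2) by (intro prod.remove) auto
      also have "(\<Prod>i\<in>{..<?m}-{j}. Gfac n ((\<theta>(j := t)) i)) = (\<Prod>i\<in>{..<?m}-{j}. Gfac n (\<theta> i))" by (intro prod.cong) auto
      finally show ?thesis by simp
    qed
    moreover have "(\<Prod>i<?m. Gfac n (\<theta> i)) = Gfac n (\<theta> j) * (\<Prod>i\<in>{..<?m}-{j}. Gfac n (\<theta> i))"
      using assms(2) by (intro prod.remove) auto
    ultimately show ?thesis by (simp add: mult_ac)
  qed
  define Pr where "Pr = (SIGMA b:{..<?m}. {..<b})"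
  define f where "f ab t = Yfun ((\<theta>(j := t)) (fst ab)) - Yfun ((\<theta>(j := t)) (snd ab))" for ab :: "nat \<times> nat" and t
  define f' where "f' ab = (if fst ab = j then Y' else 0) - (if snd ab = j then Y' else 0)" for ab :: "nat \<times> nat"
  have prdf: "(\<Prod>b<?m. \<Prod>a<b. Yfun ((\<theta>(j := t)) b) - Yfun ((\<theta>(j := t)) a)) = (\<Prod>ab\<in>Pr. f ab t)" for t
    unfolding Pr_def f_def by (subst prod.Sigma) (auto simp: case_prod_unfold)
  have f0: "f ab (\<theta> j) = Yfun (\<theta> (fst ab)) - Yfun (\<theta> (snd ab))" for ab by (simp add: f_def)
  have "((\<lambda>t. \<Prod>ab\<in>Pr. f ab t) has_field_derivative (\<Prod>ab\<in>Pr. f ab (\<theta> j)) * (\<Sum>ab\<in>Pr. f' ab / f ab (\<theta> j))) (at (\<theta> j))"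
  proof (rule has_field_derivative_prod')
    fix ab assume "ab \<in> Pr"
    then have "fst ab < ?m" "snd ab < ?m" "fst ab \<noteq> snd ab" by (auto simp: Pr_def)
    then show "f ab (\<theta> j) \<noteq> 0" unfolding f0 using dist[of "fst ab" "snd ab"] by simp
    show "(f ab has_field_derivative f' ab) (at (\<theta> j))"
      unfolding f_def[abs_def] f'_def by (intro DERIV_diff dY)
  qed
  \<comment> \<open>Only pairs containing \<open>j\<close> contribute. If \<open>j\<close> is the
    smaller index, the minus sign of the derivative reverses the difference in the denominator, so
    both positions give the same kind of term.\<close>
  moreover have "(\<Sum>ab\<in>Pr. f' ab / f ab (\<theta> j)) = (\<Sum>i\<in>{..<?m}-{j}. Y' / (Yfun (\<theta> j) - Yfun (\<theta> i)))"
  proof -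
    define h where "h i = Y' / (Yfun (\<theta> j) - Yfun (\<theta> i))" for i
    have "(\<Sum>ab\<in>Pr. f' ab / f ab (\<theta> j)) = (\<Sum>b<?m. \<Sum>a<b. f' (b, a) / (Yfun (\<theta> b) - Yfun (\<theta> a)))"
      unfolding Pr_def f0 by (subst sum.Sigma) (auto simp: case_prod_unfold)
    also have "\<dots> = (\<Sum>b<?m. \<Sum>a<b. (if b = j then h a else 0) + (if a = j then h b else 0))"
    proof (intro sum.cong refl)
      fix b a :: nat assume "a \<in> {..<b}"
      then have "a \<noteq> b" by simp
      have "- (Y' / (Yfun (\<theta> b) - Yfun (\<theta> j))) = Y' / (Yfun (\<theta> j) - Yfun (\<theta> b))"
        by (metis minus_diff_eq minus_divide_right)
      then show "f' (b, a) / (Yfun (\<theta> b) - Yfun (\<theta> a)) = (if b = j then h a else 0) + (if a = j then h b else 0)"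
        using \<open>a \<noteq> b\<close> by (auto simp: f'_def h_def)
    qed
    also have "\<dots> = (\<Sum>b<?m. (if b = j then \<Sum>a<b. h a else 0) + (if j < b then h b else 0))"
      by (intro sum.cong refl) (auto simp: sum.distrib sum.delta)
    also have "\<dots> = (\<Sum>a<j. h a) + (\<Sum>b\<in>{b\<in>{..<?m}. j < b}. h b)"
      using assms(2) sum.inter_filter[of "{..<?m}" h "\<lambda>b. j < b"] by (simp add: sum.distrib sum.delta)
    also have "\<dots> = (\<Sum>i\<in>{..<?m}-{j}. h i)"
      using assms(2) by (subst sum.union_disjoint[symmetric]) (auto intro!: sum.cong)
    finally show ?thesis by (simp add: h_def)
  qed
  ultimately have dP: "((\<lambda>t. \<Prod>ab\<in>Pr. f ab t) has_field_derivative (\<Prod>ab\<in>Pr. f ab (\<theta> j)) * (\<Sum>i\<in>{..<?m}-{j}. Y' / (Yfun (\<theta> j) - Yfun (\<theta> i)))) (at (\<theta> j))"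
    by simp
  have Q: "Qfun n \<theta> j / 2 = (\<Sum>i\<in>{..<?m}-{j}. Y' / (Yfun (\<theta> j) - Yfun (\<theta> i))) + (if odd n then Kfun (exp (\<theta> j)) / 2 else 0)"
  proof -
    have "Kfun (exp (\<theta> j + \<theta> i)) + Kfun (exp (\<theta> j - \<theta> i)) = 2 * (Y' / (Yfun (\<theta> j) - Yfun (\<theta> i)))" if "i \<in> {..<?m} - {j}" for i
    proof -
      have "exp (\<theta> j) * exp (\<theta> i) \<noteq> 1" using pos[of i] pos[of j] that assms(2) by (simp add: exp_add[symmetric])
      moreover have "exp (\<theta> j) \<noteq> exp (\<theta> i)" using that assms by (auto simp: generic_def inj_on_def)
      ultimately show ?thesis using Kfun_pair[of "exp (\<theta> j)" "exp (\<theta> i)"]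
        by (simp add: exp_add exp_diff Y'_def Yfun_def exp_minus inverse_eq_divide)
    qed
    then have "(\<Sum>i\<in>{..<?m}-{j}. Kfun (exp (\<theta> j + \<theta> i)) + Kfun (exp (\<theta> j - \<theta> i))) = 2 * (\<Sum>i\<in>{..<?m}-{j}. Y' / (Yfun (\<theta> j) - Yfun (\<theta> i)))"
      unfolding sum_distrib_left by (intro sum.cong refl)
    then show ?thesis unfolding Qfun_def by (simp add: add_divide_distrib)
  qed
  have P0: "(\<Prod>ab\<in>Pr. f ab (\<theta> j)) = (\<Prod>b<?m. \<Prod>a<b. Yfun (\<theta> b) - Yfun (\<theta> a))"
    using prdf[of "\<theta> j"] by simp
  have "((\<lambda>t. C * ((\<Prod>i<?m. Gfac n ((\<theta>(j := t)) i)) * (\<Prod>ab\<in>Pr. f ab t))) has_field_derivative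
     C * ((\<Prod>i<?m. Gfac n (\<theta> i)) * (if odd n then Kfun (exp (\<theta> j)) / 2 else 0) * (\<Prod>ab\<in>Pr. f ab (\<theta> j)) + 
      (\<Prod>ab\<in>Pr. f ab (\<theta> j)) * (\<Sum>i\<in>{..<?m}-{j}. Y' / (Yfun (\<theta> j) - Yfun (\<theta> i))) * (\<Prod>i<?m. Gfac n ((\<theta>(j := \<theta> j)) i)))) (at (\<theta> j))"
    by (intro DERIV_cmult DERIV_mult dG dP)
  then show ?thesis unfolding C prdf Q P0[symmetric] by (simp add: algebra_simps)
qed

section \<open>Characters\<close>

text \<open>The sum of \<open>rho\<close> and the weight with \<open>k\<close> entries
  \<open>d\<close> followed by zeros, which is the highest weight to be isolated.\<close>

definition lvec :: "nat \<Rightarrow> nat \<Rightarrow> nat \<Rightarrow> nat \<Rightarrow> real" where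
  "lvec n k d i = rho n i + (if i < k then real d else 0)"

text \<open>The hyperoctahedral group for both parities of \<open>n\<close>. The second component
  lists the coordinates that keep their sign, so \<open>coefW\<close> counts its complement.\<close>

definition signed_perms :: "nat \<Rightarrow> ((nat \<Rightarrow> nat) \<times> nat set) set" where
  "signed_perms m = {p. p permutes {0..<m}} \<times> Pow {0..<m}"

definition eps :: "nat set \<Rightarrow> nat \<Rightarrow> real" where "eps X i = (if i \<in> X then 1 else -1)"

definition coefW :: "nat \<Rightarrow> (nat \<Rightarrow> nat) \<times> nat set \<Rightarrow> real" where
  "coefW n w = of_int (sign (fst w)) * sgnn n ^ card ({0..<n div 2} - snd w)"

definition actW :: "(nat \<Rightarrow> real) \<Rightarrow> (nat \<Rightarrow> nat) \<times> nat set \<Rightarrow> nat \<Rightarrow> real" where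
  "actW l w j = eps (snd w) (inv_into UNIV (fst w) j) * l (inv_into UNIV (fst w) j)"

lemma finite_signed_perms [simp]: "finite (signed_perms m)"
  by (simp add: signed_perms_def finite_permutations)

lemma actW_perm: "w \<in> signed_perms m \<Longrightarrow> actW l w (fst w i) = eps (snd w) i * l i"
  by (auto simp: signed_perms_def actW_def permutes_inverses)

lemma sum_signed_perm:
  assumes "w \<in> signed_perms m"
  shows "(\<Sum>j<m. f j) = (\<Sum>i<m. f (fst w i))"
proof -
  have "fst w permutes {..<m}" using assms by (auto simp: signed_perms_def atLeast0LessThan)
  from sum.permute[OF this, of f] show ?thesis by (simp add: o_def)
qed

lemma eps_sq [simp]: "eps X i * eps X i = 1" by (simp add: eps_def)

lemma sum_actW_sq:
  assumes "w \<in> signed_perms m"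
  shows "(\<Sum>j<m. (actW l w j)\<^sup>2) = (\<Sum>i<m. (l i)\<^sup>2)"
  by (subst sum_signed_perm[OF assms]) (simp add: actW_perm[OF assms] power_mult_distrib power2_eq_square[of "eps _ _"])

text \<open>Each \<open>gfun\<close> in the Leibniz formula has two summands; choosing one in every
  row is choosing the set of unflipped coordinates.\<close>

lemma alt_expand:
  "alt n l \<theta> = (\<Sum>w\<in>signed_perms (n div 2). coefW n w * exp (\<Sum>j<n div 2. actW l w j * \<theta> j))"
proof -
  let ?m = "n div 2"
  have "alt n l \<theta> = (\<Sum>p | p permutes {0..<?m}. of_int (sign p) * (\<Prod>i=0..<?m. gfun n (l i * \<theta> (p i))))"
    unfolding alt_def by (subst det_def'[of _ ?m]) (auto intro!: sum.cong prod.cong dest: permutes_in_image)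
  also have "\<dots> = (\<Sum>p | p permutes {0..<?m}. \<Sum>X\<in>Pow {0..<?m}. coefW n (p, X) * exp (\<Sum>j<?m. actW l (p, X) j * \<theta> j))"
  proof (rule sum.cong[OF refl])
    fix p assume "p \<in> {p. p permutes {0..<?m}}"
    then have p: "p permutes {0..<?m}" by simp
    have "(\<Prod>i=0..<?m. gfun n (l i * \<theta> (p i))) = (\<Sum>X\<in>Pow {0..<?m}. (\<Prod>i\<in>X. exp (l i * \<theta> (p i))) * (\<Prod>i\<in>{0..<?m}-X. sgnn n * exp (- (l i * \<theta> (p i)))))"
      unfolding gfun_def by (rule prod_add) simp
    also have "\<dots> = (\<Sum>X\<in>Pow {0..<?m}. sgnn n ^ card ({0..<?m} - X) * exp (\<Sum>j<?m. actW l (p, X) j * \<theta> j))"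
    proof (rule sum.cong[OF refl])
      fix X assume X: "X \<in> Pow {0..<?m}"
      then have w: "(p, X) \<in> signed_perms ?m" using p by (simp add: signed_perms_def)
      have fX: "finite X" using X finite_subset by auto
      have h1: "(\<Prod>i\<in>X. exp (l i * \<theta> (p i))) = exp (\<Sum>i\<in>X. eps X i * l i * \<theta> (p i))"
        by (simp add: exp_sum[OF fX] eps_def)
      have h2: "(\<Prod>i\<in>{0..<?m}-X. sgnn n * exp (- (l i * \<theta> (p i)))) = sgnn n ^ card ({0..<?m} - X) * exp (\<Sum>i\<in>{0..<?m}-X. eps X i * l i * \<theta> (p i))"
        by (simp add: prod.distrib exp_sum eps_def)
      have h3: "(\<Sum>i\<in>X. eps X i * l i * \<theta> (p i)) + (\<Sum>i\<in>{0..<?m}-X. eps X i * l i * \<theta> (p i)) = (\<Sum>i\<in>{0..<?m}. eps X i * l i * \<theta> (p i))"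
        using X by (intro sum.subset_diff[symmetric, THEN trans[rotated]]) (auto simp: add.commute)
      have h4: "(\<Sum>j<?m. actW l (p, X) j * \<theta> j) = (\<Sum>i\<in>{0..<?m}. eps X i * l i * \<theta> (p i))"
        using sum_signed_perm[OF w, of "\<lambda>j. actW l (p, X) j * \<theta> j"] actW_perm[OF w] by (simp add: atLeast0LessThan)
      show "(\<Prod>i\<in>X. exp (l i * \<theta> (p i))) * (\<Prod>i\<in>{0..<?m}-X. sgnn n * exp (- (l i * \<theta> (p i)))) = 
         sgnn n ^ card ({0..<?m} - X) * exp (\<Sum>j<?m. actW l (p, X) j * \<theta> j)"
        unfolding h1 h2 h4 h3[symmetric] exp_add by (simp only: mult_ac)
    qed
    finally show "of_int (sign p) * (\<Prod>i=0..<?m. gfun n (l i * \<theta> (p i))) = (\<Sum>X\<in>Pow {0..<?m}. coefW n (p, X) * exp (\<Sum>j<?m. actW l (p, X) j * \<theta> j))"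
      by (simp add: coefW_def sum_distrib_left mult.assoc)
  qed
  also have "\<dots> = (\<Sum>w\<in>signed_perms ?m. coefW n w * exp (\<Sum>j<?m. actW l w j * \<theta> j))"
    unfolding signed_perms_def by (simp add: sum.cartesian_product finite_permutations)
  finally show ?thesis .
qed

text \<open>The same partial derivative computed twice: term by term in \<open>alt_expand\<close>
  and from the product in \<open>alt_deriv\<close>.\<close>

lemma alt_expand_deriv:
  assumes "generic n \<theta>" "j < n div 2"
  shows "(\<Sum>w\<in>signed_perms (n div 2). coefW n w * (actW (rho n) w j * exp (\<Sum>i<n div 2. actW (rho n) w i * \<theta> i))) = alt n (rho n) \<theta> * (Qfun n \<theta> j / 2)"
proof -
  let ?m = "n div 2"
  have in1: "((\<lambda>t. actW (rho n) w i * (\<theta>(j := t)) i) has_field_derivative (if i = j then actW (rho n) w j else 0)) (at (\<theta> j))" for w i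
    by (cases "i = j") (auto intro!: derivative_eq_intros)
  have in2: "((\<lambda>t. \<Sum>i<?m. actW (rho n) w i * (\<theta>(j := t)) i) has_field_derivative actW (rho n) w j) (at (\<theta> j))" for w
  proof -
    have "((\<lambda>t. \<Sum>i<?m. actW (rho n) w i * (\<theta>(j := t)) i) has_field_derivative (\<Sum>i<?m. if i = j then actW (rho n) w j else 0)) (at (\<theta> j))"
      by (rule DERIV_sum) (rule in1)
    then show ?thesis using assms(2) by (simp only: sum.delta finite_lessThan lessThan_iff if_True)
  qed
  have "((\<lambda>t. alt n (rho n) (\<theta>(j := t))) has_field_derivative 
     (\<Sum>w\<in>signed_perms ?m. coefW n w * (exp (\<Sum>i<?m. actW (rho n) w i * (\<theta>(j := \<theta> j)) i) * actW (rho n) w j))) (at (\<theta> j))"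
    unfolding alt_expand by (intro DERIV_sum DERIV_cmult DERIV_chain'[OF in2 DERIV_exp, THEN DERIV_cong]) (simp add: mult.commute)
  from DERIV_unique[OF this alt_deriv[OF assms]] show ?thesis by (simp add: mult_ac)
qed

text \<open>After division by the fastest growing exponential, letting \<open>t\<close> tend to
  infinity isolates the coefficient of the largest exponent; induction removes it. Only positive
  \<open>t\<close> may be assumed, since a ray of generic points is half a line.\<close>

lemma exp_independent:
  fixes C :: "real \<Rightarrow> real"
  assumes "finite S" "\<And>t. t > 0 \<Longrightarrow> (\<Sum>s\<in>S. C s * exp (t * s)) = 0" "s \<in> S"
  shows "C s = 0"
  using assms
proof (induction "card S" arbitrary: S s)
  case 0 then show ?case by simp
next
  case (Suc N)
  define M where "M = Max S"
  have ne: "S \<noteq> {}" using Suc.prems(3) by auto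
  have MS: "M \<in> S" unfolding M_def by (rule Max_in[OF Suc.prems(1) ne])
  have lt: "s < M" if "s \<in> S - {M}" for s using that Suc.prems(1) by (metis DiffE Max_ge M_def insertI1 order_le_less)
  have "((\<lambda>t. \<Sum>s\<in>S. C s * exp (t * (s - M))) \<longlongrightarrow> (\<Sum>s\<in>S. if s = M then C s else 0)) at_top"
  proof (intro tendsto_sum)
    fix s assume s: "s \<in> S"
    show "((\<lambda>t. C s * exp (t * (s - M))) \<longlongrightarrow> (if s = M then C s else 0)) at_top"
    proof (cases "s = M")
      case False
      then have "s - M < 0" using lt s by auto
      then have "filterlim (\<lambda>t. t * (s - M)) at_bot at_top"
        using filterlim_tendsto_neg_mult_at_bot[OF tendsto_const _ filterlim_ident, of "s - M"] by (simp add: mult.commute)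
      then have "((\<lambda>t. exp (t * (s - M))) \<longlongrightarrow> 0) at_top" by (rule filterlim_compose[OF exp_at_bot])
      from tendsto_mult[OF tendsto_const this, of "C s"] show ?thesis using False by simp
    qed simp
  qed
  moreover have "(\<Sum>s\<in>S. C s * exp (t * (s - M))) = 0" if "t > 0" for t
  proof -
    have "(\<Sum>s\<in>S. C s * exp (t * (s - M))) = exp (- (t * M)) * (\<Sum>s\<in>S. C s * exp (t * s))"
      unfolding sum_distrib_left by (intro sum.cong refl) (simp add: right_diff_distrib exp_diff exp_minus field_simps)
    then show ?thesis using Suc.prems(2)[OF that] by simp
  qed
  then have "eventually (\<lambda>t. (\<Sum>s\<in>S. C s * exp (t * (s - M))) = 0) at_top"
    by (intro eventually_mono[OF eventually_gt_at_top[of "0::real"]])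
  then have "((\<lambda>t. \<Sum>s\<in>S. C s * exp (t * (s - M))) \<longlongrightarrow> 0) at_top" by (rule tendsto_eventually)
  ultimately have "(\<Sum>s\<in>S. if s = M then C s else 0) = 0" using tendsto_unique trivial_limit_at_top_linorder by blast
  then have CM: "C M = 0" using MS Suc.prems(1) by (simp add: sum.delta')
  show ?case
  proof (cases "s = M")
    case False
    show ?thesis
    proof (rule Suc.hyps(1)[of "S - {M}"])
      show "N = card (S - {M})" using Suc.hyps(2) MS Suc.prems(1) by simp
      show "(\<Sum>s\<in>S - {M}. C s * exp (t * s)) = 0" if "t > 0" for t
        using Suc.prems(2)[OF that] CM MS Suc.prems(1) by (simp add: sum.remove)
    qed (use Suc.prems False in auto)
  qed (use CM in simp)
qed

text \<open>Powers of one number \<open>y > 1\<close> serve as direction. Two vectors that differ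
  below \<open>m\<close> have scalar products that differ by a nonzero polynomial in
  \<open>y\<close>, so only finitely many \<open>y\<close> are bad.\<close>

lemma generic_direction:
  assumes "finite (V :: (nat \<Rightarrow> real) set)"
  obtains \<eta> where "\<And>j. \<eta> j > 0" "inj \<eta>"
    "\<And>v v'. v \<in> V \<Longrightarrow> v' \<in> V \<Longrightarrow> (\<Sum>j<m. v j * \<eta> j) = (\<Sum>j<m. v' j * \<eta> j) \<Longrightarrow> (\<forall>j<m. v j = v' j)"
proof -
  define P where "P v v' = (\<Sum>j<m. Polynomial.monom (v j - v' j) j)" for v v' :: "nat \<Rightarrow> real"
  define Bad where "Bad = (\<Union>v\<in>V. \<Union>v'\<in>V. if P v v' = 0 then {} else {y. poly (P v v') y = 0})"
  have "finite Bad" unfolding Bad_def using assms by (auto intro!: finite_UN_I poly_roots_finite)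
  moreover have "infinite {1::real<..}" by (rule infinite_Ioi)
  ultimately obtain y where y: "y \<in> {1<..}" "y \<notin> Bad" by (meson finite_subset subsetI)
  show ?thesis
  proof (rule that[of "\<lambda>j. y ^ j"])
    show "y ^ j > 0" for j using y by simp
    show "inj (\<lambda>j. y ^ j)" using y by (intro injI) (simp add: power_inject_exp)
    fix v v' assume v: "v \<in> V" "v' \<in> V" and eq: "(\<Sum>j<m. v j * y ^ j) = (\<Sum>j<m. v' j * y ^ j)"
    have "poly (P v v') y = 0" using eq by (simp add: P_def poly_sum poly_monom left_diff_distrib sum_subtractf)
    then have P0: "P v v' = 0" using v y(2) by (auto simp: Bad_def split: if_splits)
    show "\<forall>j<m. v j = v' j"
    proof (intro allI impI)
      fix j assume "j < m"
      then have "coeff (P v v') j = v j - v' j" by (simp add: P_def coeff_sum coeff_monom sum.delta)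
      then show "v j = v' j" using P0 by simp
    qed
  qed
qed

text \<open>The bounds give a squared length of \<open>\<nu>\<close> of at most
  \<open>k * d * d\<close> and a scalar product with \<open>\<rho>\<close> of at most
  \<open>d\<close> times the sum of its first \<open>k\<close> entries. Equal total length forces
  equality in both, and strict decrease and positivity of \<open>\<rho>\<close> at the threshold
  \<open>k - 1\<close> then determine \<open>\<nu>\<close>.\<close>

lemma extremal_weight:
  fixes \<nu> \<rho> :: "nat \<Rightarrow> real" and k m :: nat and d :: real
  assumes k: "1 \<le> k" "k \<le> m" and d: "d \<ge> 0"
    and nu: "\<And>i. i < m \<Longrightarrow> \<bar>\<nu> i\<bar> \<le> d" "(\<Sum>i<m. \<bar>\<nu> i\<bar>) \<le> k * d"
    and rho: "\<And>i j. i < j \<Longrightarrow> j < m \<Longrightarrow> \<rho> j < \<rho> i" "\<And>i. i < m \<Longrightarrow> \<rho> i \<ge> 0" "\<rho> (k - 1) > 0"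
    and eq: "(\<Sum>i<m. (\<rho> i + \<nu> i)\<^sup>2) = (\<Sum>i<m. (\<rho> i + (if i < k then d else 0))\<^sup>2)"
    and i: "i < m"
  shows "\<nu> i = (if i < k then d else 0)"
proof -
  define \<kappa> where "\<kappa> = \<rho> (k - 1)"
  have split: "(\<Sum>i<m. f i) = (\<Sum>i<k. f i) + (\<Sum>i\<in>{k..<m}. f i)" for f :: "nat \<Rightarrow> real"
    using k sum.atLeastLessThan_concat[of 0 k m f] by (simp add: atLeast0LessThan)
  have rk: "\<rho> i \<ge> \<kappa>" if "i < k" for i
  proof (cases "i = k - 1")
    case False
    then have "i < k - 1" "k - 1 < m" using that k by auto
    then show ?thesis using rho(1) unfolding \<kappa>_def by (simp add: less_imp_le)
  qed (simp add: \<kappa>_def)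
  have rk': "\<rho> i < \<kappa>" if "i \<in> {k..<m}" for i
    using rho(1)[of "k - 1" i] that k unfolding \<kappa>_def by auto
  have nu2: "(\<Sum>i<m. (\<nu> i)\<^sup>2) \<le> k * d * d"
  proof -
    have "(\<Sum>i<m. (\<nu> i)\<^sup>2) \<le> (\<Sum>i<m. \<bar>\<nu> i\<bar> * d)"
    proof (rule sum_mono)
      fix i assume "i \<in> {..<m}"
      then have "\<bar>\<nu> i\<bar> * \<bar>\<nu> i\<bar> \<le> \<bar>\<nu> i\<bar> * d" using nu(1)[of i] by (intro mult_left_mono) auto
      then show "(\<nu> i)\<^sup>2 \<le> \<bar>\<nu> i\<bar> * d" by (simp add: power2_eq_square)
    qed
    also have "\<dots> = (\<Sum>i<m. \<bar>\<nu> i\<bar>) * d" by (simp add: sum_distrib_right)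
    also have "\<dots> \<le> k * d * d" using nu(2) d by (rule mult_right_mono)
    finally show ?thesis .
  qed
  \<comment> \<open>Three nonnegative defects measured against the threshold
    \<open>\<kappa>\<close>: the first \<open>k\<close> entries not reaching \<open>d\<close>, mass
    sitting beyond position \<open>k\<close>, and total mass below \<open>k * d\<close>. Their sum
    is the defect of the scalar product with \<open>\<rho>\<close>.\<close>
  define T1 where "T1 = (\<Sum>i<k. (\<rho> i - \<kappa>) * (d - \<nu> i))"
  define T2 where "T2 = (\<Sum>i\<in>{k..<m}. \<kappa> * \<bar>\<nu> i\<bar> - \<rho> i * \<nu> i)"
  define T3 where "T3 = \<kappa> * (k * d - (\<Sum>i<k. \<nu> i) - (\<Sum>i\<in>{k..<m}. \<bar>\<nu> i\<bar>))"
  have key: "d * (\<Sum>i<k. \<rho> i) - (\<Sum>i<m. \<rho> i * \<nu> i) = T1 + T2 + T3"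
    unfolding T1_def T2_def T3_def split
    by (simp add: algebra_simps sum_subtractf sum.distrib sum_distrib_left sum_distrib_right)
  have t1: "T1 \<ge> 0" unfolding T1_def
  proof (intro sum_nonneg mult_nonneg_nonneg)
    fix i assume "i \<in> {..<k}"
    then show "0 \<le> \<rho> i - \<kappa>" "0 \<le> d - \<nu> i" using rk[of i] nu(1)[of i] k by auto
  qed
  have t2i: "\<kappa> * \<bar>\<nu> i\<bar> - \<rho> i * \<nu> i \<ge> (\<kappa> - \<rho> i) * \<bar>\<nu> i\<bar>" if "i \<in> {k..<m}" for i
    using rho(2)[of i] that abs_ge_self[of "\<nu> i"] mult_left_mono[of "\<nu> i" "\<bar>\<nu> i\<bar>" "\<rho> i"] by (auto simp: left_diff_distrib)
  have t2p: "(\<kappa> - \<rho> i) * \<bar>\<nu> i\<bar> \<ge> 0" if "i \<in> {k..<m}" for i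
    using rk'[OF that] by (intro mult_nonneg_nonneg) auto
  have t2: "T2 \<ge> 0" unfolding T2_def by (intro sum_nonneg order.trans[OF t2p t2i])
  have kd: "(\<Sum>i<k. \<nu> i) + (\<Sum>i\<in>{k..<m}. \<bar>\<nu> i\<bar>) \<le> k * d"
  proof -
    have "(\<Sum>i<k. \<nu> i) \<le> (\<Sum>i<k. \<bar>\<nu> i\<bar>)" by (rule sum_mono) simp
    then show ?thesis using nu(2) unfolding split by linarith
  qed
  then have t3: "T3 \<ge> 0" unfolding T3_def \<kappa>_def using rho(3) by (intro mult_nonneg_nonneg) auto
  have e1: "(\<Sum>i<m. (\<rho> i + \<nu> i)\<^sup>2) = (\<Sum>i<m. (\<rho> i)\<^sup>2) + 2 * (\<Sum>i<m. \<rho> i * \<nu> i) + (\<Sum>i<m. (\<nu> i)\<^sup>2)"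
    by (simp add: power2_sum sum.distrib sum_distrib_left algebra_simps)
  have e2: "(\<Sum>i<m. (\<rho> i + (if i < k then d else 0))\<^sup>2) = (\<Sum>i<m. (\<rho> i)\<^sup>2) + 2 * (d * (\<Sum>i<k. \<rho> i)) + k * d * d"
    unfolding split by (simp add: power2_sum sum.distrib sum_distrib_left algebra_simps power2_eq_square)
  have "T1 + T2 + T3 \<le> 0" using eq e1 e2 key nu2 by linarith
  then have z: "T1 = 0" "T2 = 0" "T3 = 0" using t1 t2 t3 by linarith+
  have nz: "\<nu> i = 0" if i: "i \<in> {k..<m}" for i
  proof -
    have "\<kappa> * \<bar>\<nu> i\<bar> - \<rho> i * \<nu> i = 0"
      using z(2) i unfolding T2_def by (subst (asm) sum_nonneg_eq_0_iff) (use order.trans[OF t2p t2i] in auto)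
    then have "(\<kappa> - \<rho> i) * \<bar>\<nu> i\<bar> \<le> 0" using t2i[OF i] by simp
    then show ?thesis using rk'[OF i] by (simp add: mult_le_0_iff)
  qed
  then have "(\<Sum>i\<in>{k..<m}. \<bar>\<nu> i\<bar>) = 0" by simp
  then have "(\<Sum>i<k. d - \<nu> i) = 0" using z(3) rho(3) unfolding T3_def \<kappa>_def by (auto simp: sum_subtractf)
  moreover have "\<forall>i\<in>{..<k}. d - \<nu> i \<ge> 0" using nu(1) k by (auto intro: order.trans[OF abs_ge_self])
  ultimately have "\<forall>i\<in>{..<k}. d - \<nu> i = 0" by (subst (asm) sum_nonneg_eq_0_iff) auto
  then show ?thesis using nz[of i] i by auto
qed

lemma rho_props:
  assumes "1 \<le> k" "2 * k < n"
  shows "\<And>i j. i < j \<Longrightarrow> rho n j < rho n i" "\<And>i. i < n div 2 \<Longrightarrow> rho n i \<ge> 0" "rho n (k - 1) > 0" "k \<le> n div 2"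
    "\<And>i. i < n div 2 \<Longrightarrow> odd n \<Longrightarrow> rho n i > 0"
proof -
  show "rho n j < rho n i" if "i < j" for i j using that by (simp add: rho_def)
  show "rho n i \<ge> 0" if "i < n div 2" for i
  proof -
    have "2 * (i + 1) \<le> n" using that by auto
    then have "real (2 * (i + 1)) \<le> real n" by (rule of_nat_mono)
    then show ?thesis by (simp add: rho_def)
  qed
  show "rho n (k - 1) > 0" using assms by (simp add: rho_def of_nat_diff)
  show "k \<le> n div 2" using assms by auto
  show "rho n i > 0" if "i < n div 2" "odd n" for i
  proof -
    have "2 * (i + 1) < n" using that by presburger
    then have "real (2 * (i + 1)) < real n" by (simp only: of_nat_less_iff)
    then show ?thesis by (simp add: rho_def)
  qed
qed

text \<open>The classical Casimir eigenvalue. It is half of \<open>cas_eig\<close>, because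
  \<open>Cas\<close> runs over ordered pairs of indices.\<close>

lemma lvec_norm:
  assumes "1 \<le> k" "2 * k < n"
  shows "(\<Sum>i<n div 2. (lvec n k d i)\<^sup>2) - (\<Sum>i<n div 2. (rho n i)\<^sup>2) = real (k * d * (d + n - k - 1))"
proof -
  let ?m = "n div 2"
  have km: "k \<le> ?m" by (rule rho_props(4)[OF assms])
  have "(\<Sum>i<?m. (lvec n k d i)\<^sup>2) - (\<Sum>i<?m. (rho n i)\<^sup>2) = (\<Sum>i<?m. if i < k then 2 * rho n i * real d + (real d)\<^sup>2 else 0)"
    unfolding sum_subtractf[symmetric] by (intro sum.cong refl) (simp add: lvec_def power2_sum)
  also have "\<dots> = (\<Sum>i<k. 2 * rho n i * real d + (real d)\<^sup>2)"
    using km by (intro sum.mono_neutral_cong_right) auto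
  also have "\<dots> = real k * (real d)\<^sup>2 + real d * (\<Sum>i<k. 2 * rho n i)"
    by (simp add: sum.distrib sum_distrib_left mult_ac)
  also have "(\<Sum>i<k. 2 * rho n i) = real k * (real n - real k - 1)" for k
    by (induction k) (auto simp: rho_def algebra_simps)
  also have "real k * (real d)\<^sup>2 + real d * (real k * (real n - real k - 1)) = real (k * d * (d + n - k - 1))"
  proof -
    have "real (d + n - k - 1) = real d + real n - real k - 1" using assms by (simp add: of_nat_diff)
    then show ?thesis by (simp only: of_nat_mult) (simp add: power2_eq_square algebra_simps)
  qed
  finally show ?thesis .
qed

text \<open>The trace hypothesis is a second-order equation for the character whose first-order part
  is the logarithmic derivative of the Weyl denominator. Multiplying by the denominator absorbs that
  part: every exponent \<open>w rho + weight\<close> is weighted by the excess \<open>q\<close> of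
  its squared length, and the weighted sum is zero. Independence of exponentials cancels all terms
  with nonzero \<open>q\<close>, and \<open>extremal_weight\<close> identifies the remaining
  ones.\<close>

lemma alternant_times_character:
  fixes wt :: "'x \<Rightarrow> nat \<Rightarrow> int"
  assumes fin: "finite B" and k: "1 \<le> k" "2 * k < n"
    and tr: "\<And>\<theta>. generic n \<theta> \<Longrightarrow> (\<Sum>x\<in>B. exp (\<Sum>j<n div 2. of_int (wt x j) * \<theta> j) *
        ((\<Sum>j<n div 2. (of_int (wt x j))\<^sup>2) + (\<Sum>j<n div 2. Qfun n \<theta> j * of_int (wt x j)) - real (k * d * (d + n - k - 1)))) = 0"
    and bnd: "\<And>x j. x \<in> B \<Longrightarrow> j < n div 2 \<Longrightarrow> \<bar>wt x j\<bar> \<le> int d" "\<And>x. x \<in> B \<Longrightarrow> (\<Sum>j<n div 2. \<bar>wt x j\<bar>) \<le> int (k * d)"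
    and ext: "\<And>w. w \<in> signed_perms (n div 2) \<Longrightarrow> card {x\<in>B. \<forall>j<n div 2. real_of_int (wt x j) = actW (\<lambda>i. if i < k then real d else 0) w j} = 1"
  shows "alt n (rho n) \<theta> * (\<Sum>x\<in>B. exp (\<Sum>j<n div 2. of_int (wt x j) * \<theta> j)) = alt n (lvec n k d) \<theta>"
proof -
  define m where "m = n div 2"
  define W where "W = signed_perms m"
  define I where "I = W \<times> B"
  define lam where "lam i = (if i < k then real d else 0)" for i
  define L where "L = (\<Sum>i<m. (lvec n k d i)\<^sup>2)"
  \<comment> \<open>Zero from position \<open>m\<close> on, so that agreement of the relevant
    coordinates is equality of functions.\<close>
  define vec where "vec p j = (if j < m then actW (rho n) (fst p) j + of_int (wt (snd p) j) else 0)" for p j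
  define q where "q p = (\<Sum>j<m. (vec p j)\<^sup>2) - L" for p
  define a where "a p = coefW n (fst p)" for p :: "((nat \<Rightarrow> nat) \<times> nat set) \<times> 'x"
  have finI: "finite I" using fin by (simp add: I_def W_def)
  have vdot: "(\<Sum>j<m. vec (w, x) j * \<theta> j) = (\<Sum>j<m. actW (rho n) w j * \<theta> j) + (\<Sum>j<m. of_int (wt x j) * \<theta> j)" for w x \<theta>
    by (simp add: vec_def sum.distrib distrib_right)
  have gen: "(\<Sum>p\<in>I. a p * q p * exp (\<Sum>j<m. vec p j * \<theta> j)) = 0" if g: "generic n \<theta>" for \<theta>
  proof -
    let ?ew = "\<lambda>w. exp (\<Sum>j<m. actW (rho n) w j * \<theta> j)" and ?ex = "\<lambda>x. exp (\<Sum>j<m. of_int (wt x j) * \<theta> j)"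
    let ?A = "alt n (rho n) \<theta>"
    have qe: "q (w, x) = ((\<Sum>j<m. (of_int (wt x j))\<^sup>2) - real (k * d * (d + n - k - 1))) + 2 * (\<Sum>j<m. of_int (wt x j) * actW (rho n) w j)" if "w \<in> W" for w x
    proof -
      have "(\<Sum>j<m. (vec (w, x) j)\<^sup>2) = (\<Sum>j<m. (actW (rho n) w j)\<^sup>2) + (\<Sum>j<m. (of_int (wt x j))\<^sup>2) + 2 * (\<Sum>j<m. of_int (wt x j) * actW (rho n) w j)"
        by (simp add: vec_def power2_sum sum.distrib sum_distrib_left mult_ac)
      moreover have "(\<Sum>j<m. (actW (rho n) w j)\<^sup>2) = (\<Sum>i<m. (rho n i)\<^sup>2)" using that unfolding W_def by (rule sum_actW_sq)
      ultimately show ?thesis using lvec_norm[OF k, of d] by (simp add: q_def L_def m_def)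
    qed
    have "(\<Sum>p\<in>I. a p * q p * exp (\<Sum>j<m. vec p j * \<theta> j)) = (\<Sum>x\<in>B. \<Sum>w\<in>W. coefW n w * q (w, x) * (?ew w * ?ex x))"
      unfolding I_def by (subst sum.cartesian_product', subst sum.swap) (simp add: a_def vdot exp_add)
    also have "\<dots> = (\<Sum>x\<in>B. ?ex x * (((\<Sum>j<m. (of_int (wt x j))\<^sup>2) - real (k * d * (d + n - k - 1))) * (\<Sum>w\<in>W. coefW n w * ?ew w)
        + 2 * (\<Sum>j<m. of_int (wt x j) * (\<Sum>w\<in>W. coefW n w * (actW (rho n) w j * ?ew w)))))"
    proof (rule sum.cong[OF refl])
      fix x
      have "(\<Sum>w\<in>W. coefW n w * q (w, x) * (?ew w * ?ex x)) = (\<Sum>w\<in>W. ?ex x * (((\<Sum>j<m. (of_int (wt x j))\<^sup>2) - real (k * d * (d + n - k - 1))) * (coefW n w * ?ew w)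
         + 2 * (\<Sum>j<m. of_int (wt x j) * (coefW n w * (actW (rho n) w j * ?ew w)))))"
        by (intro sum.cong refl) (simp add: qe algebra_simps sum_distrib_left sum_distrib_right)
      also have "\<dots> = ?ex x * (((\<Sum>j<m. (of_int (wt x j))\<^sup>2) - real (k * d * (d + n - k - 1))) * (\<Sum>w\<in>W. coefW n w * ?ew w)
        + 2 * (\<Sum>w\<in>W. \<Sum>j<m. of_int (wt x j) * (coefW n w * (actW (rho n) w j * ?ew w))))"
        by (simp only: sum_distrib_left[symmetric] sum.distrib)
      also have "(\<Sum>w\<in>W. \<Sum>j<m. of_int (wt x j) * (coefW n w * (actW (rho n) w j * ?ew w))) = (\<Sum>j<m. of_int (wt x j) * (\<Sum>w\<in>W. coefW n w * (actW (rho n) w j * ?ew w)))"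
        by (subst sum.swap) (simp only: sum_distrib_left)
      finally show "(\<Sum>w\<in>W. coefW n w * q (w, x) * (?ew w * ?ex x)) = ?ex x * (((\<Sum>j<m. (of_int (wt x j))\<^sup>2) - real (k * d * (d + n - k - 1))) * (\<Sum>w\<in>W. coefW n w * ?ew w)
        + 2 * (\<Sum>j<m. of_int (wt x j) * (\<Sum>w\<in>W. coefW n w * (actW (rho n) w j * ?ew w))))" .
    qed
    also have "\<dots> = (\<Sum>x\<in>B. ?ex x * (((\<Sum>j<m. (of_int (wt x j))\<^sup>2) - real (k * d * (d + n - k - 1))) * ?A
        + 2 * (\<Sum>j<m. of_int (wt x j) * (?A * (Qfun n \<theta> j / 2)))))"
    proof -
      have A1: "(\<Sum>w\<in>W. coefW n w * ?ew w) = ?A" using alt_expand[of n "rho n" \<theta>] by (simp only: W_def m_def)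
      have "(\<Sum>j<m. of_int (wt x j) * (\<Sum>w\<in>W. coefW n w * (actW (rho n) w j * ?ew w))) = (\<Sum>j<m. of_int (wt x j) * (?A * (Qfun n \<theta> j / 2)))" for x
      proof (rule sum.cong[OF refl])
        fix j assume "j \<in> {..<m}"
        then have "(\<Sum>w\<in>W. coefW n w * (actW (rho n) w j * ?ew w)) = ?A * (Qfun n \<theta> j / 2)"
          using alt_expand_deriv[OF g, of j] by (simp only: W_def m_def lessThan_iff)
        then show "of_int (wt x j) * (\<Sum>w\<in>W. coefW n w * (actW (rho n) w j * ?ew w)) = of_int (wt x j) * (?A * (Qfun n \<theta> j / 2))"
          by (simp only:)
      qed
      then show ?thesis by (simp only: A1)
    qed
    also have "\<dots> = (\<Sum>x\<in>B. ?A * (?ex x * ((\<Sum>j<m. (of_int (wt x j))\<^sup>2) + (\<Sum>j<m. Qfun n \<theta> j * of_int (wt x j)) - real (k * d * (d + n - k - 1)))))"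
    proof (rule sum.cong[OF refl])
      fix x
      have "2 * (\<Sum>j<m. of_int (wt x j) * (?A * (Qfun n \<theta> j / 2))) = ?A * (\<Sum>j<m. Qfun n \<theta> j * of_int (wt x j))"
        unfolding sum_distrib_left by (intro sum.cong refl) simp
      then show "?ex x * (((\<Sum>j<m. (of_int (wt x j))\<^sup>2) - real (k * d * (d + n - k - 1))) * ?A + 2 * (\<Sum>j<m. of_int (wt x j) * (?A * (Qfun n \<theta> j / 2)))) =
          ?A * (?ex x * ((\<Sum>j<m. (of_int (wt x j))\<^sup>2) + (\<Sum>j<m. Qfun n \<theta> j * of_int (wt x j)) - real (k * d * (d + n - k - 1))))"
        by (simp only:) (simp add: algebra_simps)
    qed
    also have "\<dots> = ?A * 0" unfolding sum_distrib_left[symmetric] using tr[OF g] by (simp only: m_def)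
    finally show ?thesis by simp
  qed
  \<comment> \<open>A direction that separates the finitely many exponents: along the ray through
    \<open>\<eta>\<close> no two distinct exponents are confused, and one real variable
    suffices.\<close>
  obtain \<eta> where eta: "\<And>j. \<eta> j > (0::real)" "inj \<eta>"
    "\<And>v v'. v \<in> vec ` I \<Longrightarrow> v' \<in> vec ` I \<Longrightarrow> (\<Sum>j<m. v j * \<eta> j) = (\<Sum>j<m. v' j * \<eta> j) \<Longrightarrow> (\<forall>j<m. v j = v' j)"
    using generic_direction[of "vec ` I" m] finI by blast
  define s where "s p = (\<Sum>j<m. vec p j * \<eta> j)" for p
  have same: "vec p = vec p'" if "p \<in> I" "p' \<in> I" "s p = s p'" for p p'
    using eta(3)[of "vec p" "vec p'"] that unfolding s_def by (auto simp: vec_def fun_eq_iff)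
  have fib: "(\<Sum>p\<in>{p\<in>I. s p = r}. a p * q p) = 0" if r: "r \<in> s ` I" for r
  proof (rule exp_independent[of "s ` I" "\<lambda>r. \<Sum>p\<in>{p\<in>I. s p = r}. a p * q p"])
    fix t :: real assume t: "t > 0"
    have "generic n (\<lambda>j. t * \<eta> j)" unfolding generic_def using t eta(1,2) by (auto simp: inj_on_def inj_def)
    from gen[OF this] have "0 = (\<Sum>p\<in>I. a p * q p * exp (t * s p))"
      by (simp add: s_def sum_distrib_left mult_ac)
    also have "\<dots> = (\<Sum>r\<in>s ` I. \<Sum>p\<in>{p\<in>I. s p = r}. a p * q p * exp (t * s p))"
      using finI by (rule sum.image_gen)
    also have "\<dots> = (\<Sum>r\<in>s ` I. (\<Sum>p\<in>{p\<in>I. s p = r}. a p * q p) * exp (t * r))"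
      unfolding sum_distrib_right by (intro sum.cong refl) auto
    finally show "(\<Sum>r\<in>s ` I. (\<Sum>p\<in>{p\<in>I. s p = r}. a p * q p) * exp (t * r)) = 0" by simp
  qed (use finI r in auto)
  \<comment> \<open>Terms with the same exponent share the value of \<open>q\<close>, so a zero sum
    weighted by a nonzero \<open>q\<close> is a zero sum without it. The conclusion concerns
    coefficients only and therefore holds at every \<open>\<theta>\<close>, generic or not.\<close>
  have cancel: "(\<Sum>p\<in>{p\<in>I. q p \<noteq> 0}. a p * exp (\<Sum>j<m. vec p j * \<theta> j)) = 0" for \<theta>
  proof -
    have "(\<Sum>p\<in>{p\<in>I. q p \<noteq> 0}. a p * exp (\<Sum>j<m. vec p j * \<theta> j)) = (\<Sum>r\<in>s ` {p\<in>I. q p \<noteq> 0}. \<Sum>p\<in>{p\<in>{p\<in>I. q p \<noteq> 0}. s p = r}. a p * exp (\<Sum>j<m. vec p j * \<theta> j))"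
      using finI by (intro sum.image_gen) auto
    also have "\<dots> = 0"
    proof (rule sum.neutral, rule ballI)
      fix r assume "r \<in> s ` {p\<in>I. q p \<noteq> 0}"
      then obtain p0 where p0: "p0 \<in> I" "q p0 \<noteq> 0" "r = s p0" by auto
      have v: "vec p = vec p0" if "p \<in> I" "s p = r" for p
        by (rule same[OF that(1) p0(1) trans[OF that(2) p0(3)]])
      have qq: "q p = q p0" if "p \<in> I" "s p = r" for p unfolding q_def v[OF that] ..
      have "q p \<noteq> 0" if "p \<in> I" "s p = r" for p unfolding qq[OF that] by (rule p0(2))
      then have seteq: "{p\<in>{p\<in>I. q p \<noteq> 0}. s p = r} = {p\<in>I. s p = r}" by blast
      have "(\<Sum>p\<in>{p\<in>{p\<in>I. q p \<noteq> 0}. s p = r}. a p * exp (\<Sum>j<m. vec p j * \<theta> j)) = (\<Sum>p\<in>{p\<in>I. s p = r}. a p * exp (\<Sum>j<m. vec p0 j * \<theta> j))"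
        by (rule sum.cong[OF seteq]) (simp only: v mem_Collect_eq)
      also have "\<dots> = (\<Sum>p\<in>{p\<in>I. s p = r}. a p) * exp (\<Sum>j<m. vec p0 j * \<theta> j)" by (simp add: sum_distrib_right)
      finally have e1: "(\<Sum>p\<in>{p\<in>{p\<in>I. q p \<noteq> 0}. s p = r}. a p * exp (\<Sum>j<m. vec p j * \<theta> j)) = (\<Sum>p\<in>{p\<in>I. s p = r}. a p) * exp (\<Sum>j<m. vec p0 j * \<theta> j)" .
      have "(\<Sum>p\<in>{p\<in>I. s p = r}. a p) * q p0 = (\<Sum>p\<in>{p\<in>I. s p = r}. a p * q p)"
        unfolding sum_distrib_right by (rule sum.cong[OF refl]) (simp only: qq mem_Collect_eq)
      then have "(\<Sum>p\<in>{p\<in>I. s p = r}. a p) * q p0 = 0" using fib[of r] p0 by simp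
      then have "(\<Sum>p\<in>{p\<in>I. s p = r}. a p) = 0" using p0(2) by simp
      then show "(\<Sum>p\<in>{p\<in>{p\<in>I. q p \<noteq> 0}. s p = r}. a p * exp (\<Sum>j<m. vec p j * \<theta> j)) = 0" unfolding e1 by simp
    qed
    finally show ?thesis .
  qed
  have iff: "q (w, x) = 0 \<longleftrightarrow> (\<forall>j<m. of_int (wt x j) = actW lam w j)" if w: "w \<in> W" and x: "x \<in> B" for w x
  proof -
    have w': "w \<in> signed_perms m" using w by (simp add: W_def)
    have fw: "fst w permutes {..<m}" using w' by (auto simp: signed_perms_def atLeast0LessThan)
    \<comment> \<open>The signed permutation is undone on the weight instead of being applied to
      \<open>rho\<close>, which keeps \<open>rho\<close> in the decreasing order that
      \<open>extremal_weight\<close> demands.\<close>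
    define \<nu> where "\<nu> i = eps (snd w) i * of_int (wt x (fst w i))" for i
    have im: "fst w i < m \<longleftrightarrow> i < m" for i using permutes_in_image[OF fw, of i] by simp
    have "(\<Sum>j<m. (vec (w, x) j)\<^sup>2) = (\<Sum>i<m. (vec (w, x) (fst w i))\<^sup>2)" by (rule sum_signed_perm[OF w'])
    also have "\<dots> = (\<Sum>i<m. (rho n i + \<nu> i)\<^sup>2)"
      by (intro sum.cong refl) (auto simp: vec_def im actW_perm[OF w'] \<nu>_def eps_def power2_eq_square algebra_simps)
    finally have n1: "(\<Sum>j<m. (vec (w, x) j)\<^sup>2) = (\<Sum>i<m. (rho n i + \<nu> i)\<^sup>2)" .
    have L: "L = (\<Sum>i<m. (rho n i + (if i < k then real d else 0))\<^sup>2)" by (simp add: L_def lvec_def)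
    have eqv: "(\<forall>j<m. of_int (wt x j) = actW lam w j) \<longleftrightarrow> (\<forall>i<m. \<nu> i = lam i)"
    proof
      assume h: "\<forall>j<m. of_int (wt x j) = actW lam w j"
      show "\<forall>i<m. \<nu> i = lam i"
      proof (intro allI impI)
        fix i assume "i < m"
        then have "of_int (wt x (fst w i)) = eps (snd w) i * lam i" using h im actW_perm[OF w'] by auto
        then show "\<nu> i = lam i" by (simp add: \<nu>_def mult.assoc[symmetric])
      qed
    next
      assume h: "\<forall>i<m. \<nu> i = lam i"
      show "\<forall>j<m. of_int (wt x j) = actW lam w j"
      proof (intro allI impI)
        fix j assume j: "j < m"
        define i where "i = inv_into UNIV (fst w) j"
        have ij: "fst w i = j" unfolding i_def using permutes_inverses(1)[OF fw] by simp
        then have "i < m" using im j by auto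
        then have "\<nu> i = lam i" using h by blast
        then have "eps (snd w) i * of_int (wt x j) = lam i" unfolding \<nu>_def ij .
        then have "of_int (wt x j) = eps (snd w) i * lam i" by (auto simp: eps_def split: if_splits)
        then show "of_int (wt x j) = actW lam w j" by (simp add: actW_def i_def)
      qed
    qed
    have abs: "\<bar>\<nu> i\<bar> = of_int \<bar>wt x (fst w i)\<bar>" for i by (simp add: \<nu>_def eps_def)
    show ?thesis unfolding eqv
    proof
      assume "q (w, x) = 0"
      then have eq: "(\<Sum>i<m. (rho n i + \<nu> i)\<^sup>2) = (\<Sum>i<m. (rho n i + (if i < k then real d else 0))\<^sup>2)"
        by (simp add: q_def n1 L)
      show "\<forall>i<m. \<nu> i = lam i"
      proof (intro allI impI)
        fix i assume i: "i < m"
        have "\<nu> i = (if i < k then real d else 0)"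
        proof (rule extremal_weight[where \<rho>="rho n" and m=m and k=k and d="real d"])
          show "\<bar>\<nu> i\<bar> \<le> real d" if "i < m" for i
            unfolding abs using bnd(1)[OF x, of "fst w i"] im that unfolding m_def by (metis of_int_le_iff of_int_of_nat_eq)
          have "(\<Sum>i<m. \<bar>\<nu> i\<bar>) = (\<Sum>j<m. of_int \<bar>wt x j\<bar>)" unfolding abs by (rule sum_signed_perm[OF w', symmetric])
          also have "\<dots> = of_int (\<Sum>j<m. \<bar>wt x j\<bar>)" by simp
          also have "\<dots> \<le> of_int (int (k * d))" using bnd(2)[OF x] unfolding m_def by (simp only: of_int_le_iff)
          finally show "(\<Sum>i<m. \<bar>\<nu> i\<bar>) \<le> real k * real d" by simp
        qed (use k rho_props[OF k] eq i in \<open>auto simp: m_def\<close>)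
        then show "\<nu> i = lam i" by (simp add: lam_def)
      qed
    next
      assume "\<forall>i<m. \<nu> i = lam i"
      then have "(\<Sum>i<m. (rho n i + \<nu> i)\<^sup>2) = L" unfolding L by (intro sum.cong) (auto simp: lam_def)
      then show "q (w, x) = 0" by (simp add: q_def n1)
    qed
  qed
  have "alt n (rho n) \<theta> * (\<Sum>x\<in>B. exp (\<Sum>j<m. of_int (wt x j) * \<theta> j)) = (\<Sum>p\<in>I. a p * exp (\<Sum>j<m. vec p j * \<theta> j))"
    unfolding alt_expand m_def[symmetric] W_def[symmetric] sum_product I_def sum.cartesian_product'
    by (simp add: a_def vdot exp_add mult.assoc)
  also have "\<dots> = (\<Sum>p\<in>{p\<in>I. q p = 0}. a p * exp (\<Sum>j<m. vec p j * \<theta> j)) + (\<Sum>p\<in>{p\<in>I. q p \<noteq> 0}. a p * exp (\<Sum>j<m. vec p j * \<theta> j))"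
    using finI by (subst sum.union_disjoint[symmetric]) (auto intro!: sum.cong)
  also have "\<dots> = (\<Sum>p\<in>{p\<in>I. q p = 0}. a p * exp (\<Sum>j<m. vec p j * \<theta> j))" by (simp add: cancel)
  also have "\<dots> = (\<Sum>p\<in>(SIGMA w:W. {x\<in>B. q (w, x) = 0}). a p * exp (\<Sum>j<m. vec p j * \<theta> j))"
    by (intro sum.cong) (auto simp: I_def)
  also have "\<dots> = (\<Sum>w\<in>W. \<Sum>x\<in>{x\<in>B. q (w, x) = 0}. coefW n w * exp (\<Sum>j<m. vec (w, x) j * \<theta> j))"
    using fin by (subst sum.Sigma) (auto simp: W_def a_def case_prod_unfold)
  also have "\<dots> = (\<Sum>w\<in>W. coefW n w * exp (\<Sum>j<m. actW (lvec n k d) w j * \<theta> j))"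
  proof (rule sum.cong[OF refl])
    fix w assume w: "w \<in> W"
    have set: "{x\<in>B. q (w, x) = 0} = {x\<in>B. \<forall>j<m. of_int (wt x j) = actW lam w j}" using iff[OF w] by blast
    have "vec (w, x) j = actW (lvec n k d) w j" if "x \<in> {x\<in>B. q (w, x) = 0}" "j < m" for x j
    proof -
      have "of_int (wt x j) = actW lam w j" using that iff[OF w] by blast
      then have "vec (w, x) j = actW (rho n) w j + actW lam w j" using that(2) by (simp add: vec_def)
      then show ?thesis by (simp add: actW_def lvec_def lam_def algebra_simps)
    qed
    then have "(\<Sum>x\<in>{x\<in>B. q (w, x) = 0}. coefW n w * exp (\<Sum>j<m. vec (w, x) j * \<theta> j)) = (\<Sum>x\<in>{x\<in>B. q (w, x) = 0}. coefW n w * exp (\<Sum>j<m. actW (lvec n k d) w j * \<theta> j))"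
      by (intro sum.cong refl arg_cong2[of _ _ _ _ "(*)"] arg_cong[of _ _ exp]) auto
    also have "\<dots> = coefW n w * exp (\<Sum>j<m. actW (lvec n k d) w j * \<theta> j)"
      unfolding set using ext[of w] w by (simp add: W_def m_def lam_def[abs_def])
    finally show "(\<Sum>x\<in>{x\<in>B. q (w, x) = 0}. coefW n w * exp (\<Sum>j<m. vec (w, x) j * \<theta> j)) = coefW n w * exp (\<Sum>j<m. actW (lvec n k d) w j * \<theta> j)" .
  qed
  also have "\<dots> = alt n (lvec n k d) \<theta>" unfolding alt_expand W_def m_def ..
  finally show ?thesis by (simp add: m_def)
qed

section \<open>Weyl's dimension formula as a limit of the character formula\<close>

lemma sinh_quotient_limit: "((\<lambda>t. (exp (t * a) - exp (- (t * a))) / t) \<longlongrightarrow> 2 * a) (at_right (0::real))"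
proof -
  have "((\<lambda>t. exp (t * a) - exp (- (t * a))) has_field_derivative 2 * a) (at 0)"
    by (auto intro!: derivative_eq_intros)
  then have "((\<lambda>t. (exp (t * a) - exp (- (t * a))) / t) \<longlongrightarrow> 2 * a) (at 0)"
    by (simp add: DERIV_def)
  then show ?thesis by (rule filterlim_mono) (simp_all add: at_le)
qed

text \<open>\<open>Yfun x - 2\<close> is the square of \<open>exp (x / 2) - exp (- x / 2)\<close>,
  which reduces the second-order limit to the first-order one.\<close>

lemma Yfun_limit: "((\<lambda>t. (Yfun (t * a) - Yfun (t * b)) / t\<^sup>2) \<longlongrightarrow> a\<^sup>2 - b\<^sup>2) (at_right 0)"
proof -
  have "((\<lambda>t. ((exp (t * (a / 2)) - exp (- (t * (a / 2)))) / t)\<^sup>2 - ((exp (t * (b / 2)) - exp (- (t * (b / 2)))) / t)\<^sup>2) \<longlongrightarrow> (2 * (a / 2))\<^sup>2 - (2 * (b / 2))\<^sup>2) (at_right 0)"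
    by (intro tendsto_intros sinh_quotient_limit)
  moreover have sq: "(exp (t * (c / 2)) - exp (- (t * (c / 2))))\<^sup>2 = Yfun (t * c) - 2" for t c :: real
  proof -
    have "exp (t * (c / 2)) * exp (t * (c / 2)) = exp (t * c)" "exp (- (t * (c / 2))) * exp (- (t * (c / 2))) = exp (- (t * c))"
      "exp (t * (c / 2)) * exp (- (t * (c / 2))) = 1" by (simp_all add: exp_add[symmetric])
    then show ?thesis by (simp add: power2_eq_square Yfun_def algebra_simps)
  qed
  ultimately show ?thesis by (simp add: power_divide diff_divide_distrib[symmetric])
qed

lemma Gfac_limit: "odd n \<Longrightarrow> ((\<lambda>t. Gfac n (t * a) / t) \<longlongrightarrow> a) (at_right 0)"
  using sinh_quotient_limit[of "a / 2"] by (simp add: Gfac_def)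

text \<open>The character at the identity is 0/0 in the quotient of alternants, so it is approached
  along \<open>t * rho\<close> from the right. There numerator and denominator both factor;
  normalising short-root factors by \<open>t\<close> and \<open>Yfun\<close> differences by the
  square of \<open>t\<close> gives the limit.\<close>

theorem character_dimension:
  fixes wt :: "'x \<Rightarrow> nat \<Rightarrow> int"
  assumes fin: "finite B" and k: "1 \<le> k" "2 * k < n"
    and F: "\<And>\<theta>. alt n (rho n) \<theta> * (\<Sum>x\<in>B. exp (\<Sum>j<n div 2. of_int (wt x j) * \<theta> j)) = alt n (lvec n k d) \<theta>"
  shows "real (card B) = (if odd n then (\<Prod>j<n div 2. lvec n k d j / rho n j) else 1) *
    (\<Prod>b<n div 2. \<Prod>a<b. ((lvec n k d b)\<^sup>2 - (lvec n k d a)\<^sup>2) / ((rho n b)\<^sup>2 - (rho n a)\<^sup>2))"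
proof -
  let ?m = "n div 2"
  define l where "l = lvec n k d"
  obtain C where C0: "C \<noteq> 0" and C: "\<And>\<theta>. alt n (rho n) \<theta> = C * (\<Prod>j<?m. Gfac n (\<theta> j)) * (\<Prod>b<?m. \<Prod>a<b. Yfun (\<theta> b) - Yfun (\<theta> a))"
    using alt_product[of n] by blast
  note rp = rho_props[OF k]
  \<comment> \<open>An entry depends only on the product of frequency and parameter, so
    transposition exchanges the roles of \<open>l\<close> and \<open>rho n\<close>. This makes the
    numerator a value of the denominator, where the product formula applies.\<close>
  have tr: "alt n l (\<lambda>j. t * rho n j) = alt n (rho n) (\<lambda>j. t * l j)" for t
  proof -
    have "mat ?m ?m (\<lambda>(i, j). gfun n (l i * (t * rho n j))) = (mat ?m ?m (\<lambda>(i, j). gfun n (rho n i * (t * l j))))\<^sup>T"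
      by (rule eq_matI) (auto simp: mult_ac)
    then show ?thesis unfolding alt_def using det_transpose[of "mat ?m ?m (\<lambda>(i, j). gfun n (rho n i * (t * l j)))" ?m] by simp
  qed
  define GR where "GR t = (if odd n then \<Prod>j<?m. (Gfac n (t * l j) / t) / (Gfac n (t * rho n j) / t) else 1)" for t
  define YR where "YR t = (\<Prod>b<?m. \<Prod>a<b. ((Yfun (t * l b) - Yfun (t * l a)) / t\<^sup>2) / ((Yfun (t * rho n b) - Yfun (t * rho n a)) / t\<^sup>2))" for t
  have chi: "(\<Sum>x\<in>B. exp (\<Sum>j<?m. of_int (wt x j) * (t * rho n j))) = GR t * YR t" if t: "t > 0" for t
  proof -
    have G0: "Gfac n (t * rho n j) \<noteq> 0" if "j < ?m" for j
      using rp(5)[OF that] t by (auto simp: Gfac_def)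
    have Y0: "Yfun (t * rho n b) - Yfun (t * rho n a) \<noteq> 0" if "b < ?m" "a < b" for a b
      using Yfun_inj[of "t * rho n b" "t * rho n a"] rp(1)[OF that(2)] rp(2)[of a] rp(2)[of b] that t by auto
    have "C * (\<Prod>j<?m. Gfac n (t * rho n j)) * (\<Prod>b<?m. \<Prod>a<b. Yfun (t * rho n b) - Yfun (t * rho n a)) * (\<Sum>x\<in>B. exp (\<Sum>j<?m. of_int (wt x j) * (t * rho n j)))
       = C * (\<Prod>j<?m. Gfac n (t * l j)) * (\<Prod>b<?m. \<Prod>a<b. Yfun (t * l b) - Yfun (t * l a))"
      using F[of "\<lambda>j. t * rho n j"] tr[of t] unfolding l_def[symmetric] by (simp add: C)
    moreover have "(\<Prod>j<?m. Gfac n (t * rho n j)) \<noteq> 0" using G0 by simp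
    moreover have "(\<Prod>b<?m. \<Prod>a<b. Yfun (t * rho n b) - Yfun (t * rho n a)) \<noteq> 0" using Y0 by simp
    ultimately have "(\<Sum>x\<in>B. exp (\<Sum>j<?m. of_int (wt x j) * (t * rho n j))) = ((\<Prod>j<?m. Gfac n (t * l j)) / (\<Prod>j<?m. Gfac n (t * rho n j))) *
        ((\<Prod>b<?m. \<Prod>a<b. Yfun (t * l b) - Yfun (t * l a)) / (\<Prod>b<?m. \<Prod>a<b. Yfun (t * rho n b) - Yfun (t * rho n a)))"
      using C0 by (simp add: field_simps)
    also have "(\<Prod>j<?m. Gfac n (t * l j)) / (\<Prod>j<?m. Gfac n (t * rho n j)) = GR t"
      unfolding GR_def prod_dividef[symmetric] using t by (auto simp: Gfac_def)
    also have "(\<Prod>b<?m. \<Prod>a<b. Yfun (t * l b) - Yfun (t * l a)) / (\<Prod>b<?m. \<Prod>a<b. Yfun (t * rho n b) - Yfun (t * rho n a)) = YR t"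
      unfolding YR_def prod_dividef[symmetric] using t by simp
    finally show ?thesis .
  qed
  have "((\<lambda>t. \<Sum>x\<in>B. exp (\<Sum>j<?m. of_int (wt x j) * (t * rho n j))) \<longlongrightarrow> (\<Sum>x\<in>B. exp (\<Sum>j<?m. of_int (wt x j) * (0 * rho n j)))) (at_right 0)"
    by (intro tendsto_intros)
  then have lim1: "((\<lambda>t. \<Sum>x\<in>B. exp (\<Sum>j<?m. of_int (wt x j) * (t * rho n j))) \<longlongrightarrow> real (card B)) (at_right 0)" by simp
  have "(GR \<longlongrightarrow> (if odd n then (\<Prod>j<?m. l j / rho n j) else 1)) (at_right 0)"
  proof (cases "odd n")
    case True
    have "((\<lambda>t. \<Prod>j<?m. (Gfac n (t * l j) / t) / (Gfac n (t * rho n j) / t)) \<longlongrightarrow> (\<Prod>j<?m. l j / rho n j)) (at_right 0)"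
      by (intro tendsto_prod tendsto_divide Gfac_limit True) (use rp(5) True in force)
    then show ?thesis using True by (simp add: GR_def[abs_def])
  next
    case False
    then show ?thesis by (simp add: GR_def[abs_def])
  qed
  moreover have "(YR \<longlongrightarrow> (\<Prod>b<?m. \<Prod>a<b. ((l b)\<^sup>2 - (l a)\<^sup>2) / ((rho n b)\<^sup>2 - (rho n a)\<^sup>2))) (at_right 0)"
    unfolding YR_def[abs_def]
  proof (intro tendsto_prod tendsto_divide Yfun_limit)
    fix a b assume ab: "b \<in> {..<?m}" "a \<in> {..<b}"
    then have "rho n b < rho n a" "0 \<le> rho n b" using rp by auto
    then show "(rho n b)\<^sup>2 - (rho n a)\<^sup>2 \<noteq> 0" by (metis power2_eq_iff_nonneg eq_iff_diff_eq_0 less_imp_le order_le_less_trans order_less_irrefl)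
  qed
  ultimately have "((\<lambda>t. GR t * YR t) \<longlongrightarrow> (if odd n then (\<Prod>j<?m. l j / rho n j) else 1) * (\<Prod>b<?m. \<Prod>a<b. ((l b)\<^sup>2 - (l a)\<^sup>2) / ((rho n b)\<^sup>2 - (rho n a)\<^sup>2))) (at_right 0)"
    by (rule tendsto_mult)
  moreover have "eventually (\<lambda>t. GR t * YR t = (\<Sum>x\<in>B. exp (\<Sum>j<?m. of_int (wt x j) * (t * rho n j)))) (at_right 0)"
    using eventually_at_right_less[of "0::real"] by (rule eventually_mono) (simp add: chi)
  ultimately have "((\<lambda>t. \<Sum>x\<in>B. exp (\<Sum>j<?m. of_int (wt x j) * (t * rho n j))) \<longlongrightarrow> (if odd n then (\<Prod>j<?m. l j / rho n j) else 1) * (\<Prod>b<?m. \<Prod>a<b. ((l b)\<^sup>2 - (l a)\<^sup>2) / ((rho n b)\<^sup>2 - (rho n a)\<^sup>2))) (at_right 0)"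
    by (rule Lim_transform_eventually)
  from tendsto_unique[OF _ lim1 this] show ?thesis by (simp add: l_def)
qed

section \<open>The polynomial ring: constants, induction principles, evaluations, derivations and
  grading\<close>

definition const_poly :: "complex \<Rightarrow> ppoly" where "const_poly c = Poly_Mapping.single 0 c"

lemma const_poly_simps [simp]:
  "const_poly 0 = 0" "const_poly 1 = 1" "const_poly (a + b) = const_poly a + const_poly b"
  "const_poly (a * b) = const_poly a * const_poly b" "const_poly (- a) = - const_poly a"
  "const_poly (a - b) = const_poly a - const_poly b"
  by (simp_all add: const_poly_def single_add mult_single single_uminus single_diff)

lemma const_poly_of_int [simp]: "const_poly (of_int z) = of_int z"
  by (induction z rule: int_induct[of _ 0]) (auto simp: algebra_simps)

lemma const_poly_of_nat [simp]: "const_poly (of_nat z) = of_nat z"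
  by (induction z) (auto simp: algebra_simps)

lemma pscale_eq: "pscale c f = const_poly c * f"
  by (simp add: pscale_def const_poly_def)

lemma const_poly_sum: "const_poly (\<Sum>x\<in>A. f x) = (\<Sum>x\<in>A. const_poly (f x))"
  by (induction A rule: infinite_finite_induct) auto

lemma ppoly_as_sum_of_terms:
  "f = (\<Sum>m\<in>Poly_Mapping.keys f. Poly_Mapping.single m (Poly_Mapping.lookup f m))"
  by (rule poly_mapping_eqI) 
     (auto simp: lookup_sum lookup_single when_def sum.delta in_keys_iff)

lemma monom_var_induct [case_names zero add]:
  fixes m :: "'a \<Rightarrow>\<^sub>0 nat"
  assumes "P 0" and "\<And>m x. x \<in> A \<Longrightarrow> P m \<Longrightarrow> P (Poly_Mapping.single x 1 + m)"
    and "Poly_Mapping.keys m \<subseteq> A"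
  shows "P m"
  using assms(3)
proof (induction "\<Sum>x\<in>Poly_Mapping.keys m. Poly_Mapping.lookup m x" arbitrary: m)
  case 0
  then have "m = 0" by (auto simp: poly_mapping_eq_iff fun_eq_iff in_keys_iff)
  then show ?case using assms(1) by simp
next
  case (Suc k)
  obtain x where x: "x \<in> Poly_Mapping.keys m"
    using Suc(2) by fastforce
  define m' where "m' = m - Poly_Mapping.single x 1"
  have m: "m = Poly_Mapping.single x 1 + m'"
    using x by (intro poly_mapping_eqI) (auto simp: m'_def lookup_add lookup_minus lookup_single when_def in_keys_iff)
  have sub: "Poly_Mapping.keys m' \<subseteq> Poly_Mapping.keys m"
    by (auto simp: m'_def in_keys_iff lookup_minus)
  have "(\<Sum>y\<in>Poly_Mapping.keys m. Poly_Mapping.lookup m y) = 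
        (\<Sum>y\<in>Poly_Mapping.keys m. Poly_Mapping.lookup (Poly_Mapping.single x 1) y) + (\<Sum>y\<in>Poly_Mapping.keys m. Poly_Mapping.lookup m' y)"
    unfolding sum.distrib[symmetric] lookup_add[symmetric] m[symmetric] ..
  also have "(\<Sum>y\<in>Poly_Mapping.keys m. Poly_Mapping.lookup (Poly_Mapping.single x (1::nat)) y) = 1"
    using x by (simp add: lookup_single when_def sum.delta')
  also have "(\<Sum>y\<in>Poly_Mapping.keys m. Poly_Mapping.lookup m' y) = (\<Sum>y\<in>Poly_Mapping.keys m'. Poly_Mapping.lookup m' y)"
    by (rule sum.mono_neutral_right) (use sub in \<open>auto simp: in_keys_iff\<close>)
  finally have "k = (\<Sum>y\<in>Poly_Mapping.keys m'. Poly_Mapping.lookup m' y)"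
    using Suc(2) by simp
  then have "P m'" using Suc(1) sub Suc(3) by blast
  then show ?case using assms(2) m x Suc(3) by blast
qed

lemma single_add_one_monom:
  "Poly_Mapping.single (Poly_Mapping.single S 1 + m) c = pvar S * Poly_Mapping.single m c"
  by (simp add: pvar_def mult_single)

lemma ppoly_induct [case_names const add mult]:
  assumes "\<And>c. P (const_poly c)" "\<And>f g. P f \<Longrightarrow> P g \<Longrightarrow> P (f + g)"
    "\<And>S f. P f \<Longrightarrow> P (pvar S * f)"
  shows "P f"
proof -
  have mon: "P (Poly_Mapping.single m c)" for m c
    by (induction m rule: monom_var_induct[where A=UNIV])
       (use assms in \<open>auto simp: const_poly_def simp: single_add_one_monom simp del: One_nat_def\<close>)
  have "P (\<Sum>m\<in>A. Poly_Mapping.single m (Poly_Mapping.lookup f m))" if "finite A" for A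
    using that by (induction A) (use assms(1)[of 0] mon assms(2) in auto)
  then show ?thesis using ppoly_as_sum_of_terms[of f] by (metis finite_keys)
qed

section \<open>Evaluation homomorphisms\<close>

text \<open>The target ring is left open because the construction is used twice: with complex values
  it is \<open>peval\<close>, and with polynomials over \<open>ppoly\<close> as values it produces
  derivations.\<close>

locale ppoly_hom =
  fixes \<phi> :: "complex \<Rightarrow> 'b::comm_ring_1" and v :: "nat set \<Rightarrow> 'b"
  assumes phi: "\<phi> 0 = 0" "\<phi> 1 = 1" "\<And>x y. \<phi> (x + y) = \<phi> x + \<phi> y" "\<And>x y. \<phi> (x * y) = \<phi> x * \<phi> y"
begin

definition mev :: "pmonom \<Rightarrow> 'b" where
  "mev m = (\<Prod>S\<in>Poly_Mapping.keys m. v S ^ Poly_Mapping.lookup m S)"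

definition hev :: "ppoly \<Rightarrow> 'b" where
  "hev f = (\<Sum>m\<in>Poly_Mapping.keys f. \<phi> (Poly_Mapping.lookup f m) * mev m)"

lemma mev_superset:
  assumes "finite A" "Poly_Mapping.keys m \<subseteq> A"
  shows "mev m = (\<Prod>S\<in>A. v S ^ Poly_Mapping.lookup m S)"
  unfolding mev_def by (rule prod.mono_neutral_left) (use assms in \<open>auto simp: in_keys_iff\<close>)

lemma hev_superset:
  assumes "finite A" "Poly_Mapping.keys f \<subseteq> A"
  shows "hev f = (\<Sum>m\<in>A. \<phi> (Poly_Mapping.lookup f m) * mev m)"
  unfolding hev_def by (rule sum.mono_neutral_left) (use assms phi in \<open>auto simp: in_keys_iff\<close>)

lemma mev_add: "mev (m + m') = mev m * mev m'"
proof -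
  let ?A = "Poly_Mapping.keys m \<union> Poly_Mapping.keys m'"
  have "mev (m + m') = (\<Prod>S\<in>?A. v S ^ Poly_Mapping.lookup (m + m') S)"
    by (rule mev_superset) (auto dest: subsetD[OF Poly_Mapping.keys_add])
  also have "\<dots> = mev m * mev m'"
    by (simp add: mev_superset[of ?A] lookup_add power_add prod.distrib)
  finally show ?thesis .
qed

lemma hev_add: "hev (f + g) = hev f + hev g"
proof -
  let ?A = "Poly_Mapping.keys f \<union> Poly_Mapping.keys g"
  have "hev (f + g) = (\<Sum>m\<in>?A. \<phi> (Poly_Mapping.lookup (f + g) m) * mev m)"
    by (rule hev_superset) (auto dest: subsetD[OF Poly_Mapping.keys_add])
  also have "\<dots> = hev f + hev g"
    by (simp add: hev_superset[of ?A] lookup_add phi algebra_simps sum.distrib)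
  finally show ?thesis .
qed

lemma hev_single: "hev (Poly_Mapping.single m c) = \<phi> c * mev m"
  by (simp add: hev_def phi(1))

lemma hev_const [simp]: "hev (const_poly c) = \<phi> c"
  by (simp add: const_poly_def hev_single mev_def)

lemma hev_0 [simp]: "hev 0 = 0" by (simp add: hev_def)
lemma hev_1 [simp]: "hev 1 = 1" using hev_const[of 1] phi by (simp del: hev_const)

lemma hev_var [simp]: "hev (pvar S) = v S"
  by (simp add: pvar_def hev_single mev_def phi)

lemma hev_var_mult: "hev (pvar S * f) = v S * hev f"
proof -
  have *: "hev (pvar S * Poly_Mapping.single m c) = v S * hev (Poly_Mapping.single m c)" for m c
    using mev_add[of "Poly_Mapping.single S 1" m]
    by (simp add: pvar_def mult_single hev_single mev_def[of "Poly_Mapping.single S _"] del: One_nat_def) 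
  have sum: "hev (\<Sum>m\<in>A. F m) = (\<Sum>m\<in>A. hev (F m))" for F :: "pmonom \<Rightarrow> ppoly" and A
    by (induction A rule: infinite_finite_induct) (auto simp: hev_add)
  show ?thesis
    by (subst (1 2) ppoly_as_sum_of_terms[of f]) (simp only: sum_distrib_left sum *)
qed

lemma hev_mult: "hev (f * g) = hev f * hev g"
proof (induction f rule: ppoly_induct)
  case (const c)
  show ?case
  proof (induction g rule: ppoly_induct)
    case (const c') then show ?case by (simp add: phi flip: const_poly_simps)
  next
    case (add f g) then show ?case by (simp add: hev_add algebra_simps)
  next
    case (mult S f) then show ?case 
      by (simp add: hev_var_mult mult.left_commute[of _ "pvar S"] mult.left_commute[of _ "v S"])
  qed
qed (simp_all add: hev_add hev_var_mult distrib_right mult.assoc)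

lemma hev_uminus [simp]: "hev (- f) = - hev f"
  using hev_add[of f "- f"] by (simp add: eq_neg_iff_add_eq_0 add.commute)
lemma hev_diff: "hev (f - g) = hev f - hev g"
  using hev_add[of f "- g"] by simp
lemma hev_sum: "hev (\<Sum>m\<in>A. F m) = (\<Sum>m\<in>A. hev (F m))"
    by (induction A rule: infinite_finite_induct) (auto simp: hev_add)
lemma hev_of_nat [simp]: "hev (of_nat z) = of_nat z"
  by (induction z) (auto simp: hev_add)
lemma hev_of_int [simp]: "hev (of_int z) = of_int z"
  by (cases z) (auto simp: hev_diff)

end

interpretation peval: ppoly_hom "\<lambda>c. c" q
  rewrites "ppoly_hom.hev (\<lambda>c. c) q f = peval f q" for q f
proof -
  show h: "ppoly_hom (\<lambda>c. c)" by unfold_locales auto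
  show "ppoly_hom.hev (\<lambda>c. c) q f = peval f q"
    by (simp add: ppoly_hom.hev_def[OF h] peval_def ppoly_hom.mev_def[OF h])
qed

section \<open>Derivations\<close>

text \<open>Dual numbers: substituting \<open>pvar S\<close> plus \<open>\<delta> S\<close> times a
  formal variable is multiplicative, and the linear coefficient of the result is the derivation.
  Higher coefficients occur but never influence the two that are read off.\<close>

locale ppoly_deriv = fixes \<delta> :: "nat set \<Rightarrow> ppoly"
begin

sublocale dual: ppoly_hom "\<lambda>c. [:const_poly c:]" "\<lambda>S. [:pvar S, \<delta> S:]"
  by unfold_locales auto

definition der :: "ppoly \<Rightarrow> ppoly" where
  "der f = coeff (dual.hev f) 1"

lemma coeff_dual_0: "coeff (dual.hev f) 0 = f"
  by (induction f rule: ppoly_induct) 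
     (auto simp: dual.hev_add dual.hev_mult)

lemma der_mult: "der (f * g) = der f * g + f * der g"
  by (simp add: der_def dual.hev_mult coeff_mult coeff_dual_0 algebra_simps)
lemma der_add: "der (f + g) = der f + der g" by (simp add: der_def dual.hev_add)
lemma der_diff: "der (f - g) = der f - der g" by (simp add: der_def dual.hev_diff)
lemma der_uminus: "der (- g) = - der g" by (simp add: der_def)
lemma der_const [simp]: "der (const_poly c) = 0" by (simp add: der_def)
lemma der_0 [simp]: "der 0 = 0" by (simp add: der_def)
lemma der_1 [simp]: "der 1 = 0" by (simp add: der_def)
lemma der_var [simp]: "der (pvar S) = \<delta> S" by (simp add: der_def)
lemma der_sum: "der (\<Sum>x\<in>A. F x) = (\<Sum>x\<in>A. der (F x))"
  by (induction A rule: infinite_finite_induct) (auto simp: der_add)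
lemma der_const_mult: "der (const_poly c * f) = const_poly c * der f" by (simp add: der_mult)

end

section \<open>The graded pieces\<close>

lemma carrier_plucker_iff: "f \<in> carrier (plucker_ring k n) \<longleftrightarrow> (\<forall>m\<in>Poly_Mapping.keys f. Poly_Mapping.keys m \<subseteq> ksubsets k n)"
  by (simp add: plucker_ring_def)

lemma plucker_ring_simps [simp]: "x \<oplus>\<^bsub>plucker_ring k n\<^esub> y = x + y" "x \<otimes>\<^bsub>plucker_ring k n\<^esub> y = x * y"
  "\<zero>\<^bsub>plucker_ring k n\<^esub> = 0" "\<one>\<^bsub>plucker_ring k n\<^esub> = 1"
  by (simp_all add: plucker_ring_def)

context fixes k n :: nat begin

interpretation R: cring "plucker_ring k n" by (rule cring_plucker_ring)

lemma carrier_add: "f \<in> carrier (plucker_ring k n) \<Longrightarrow> g \<in> carrier (plucker_ring k n) \<Longrightarrow> f + g \<in> carrier (plucker_ring k n)"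
  using R.add.m_closed[of f g] by simp
lemma carrier_mult: "f \<in> carrier (plucker_ring k n) \<Longrightarrow> g \<in> carrier (plucker_ring k n) \<Longrightarrow> f * g \<in> carrier (plucker_ring k n)"
  using R.m_closed[of f g] by simp
lemma carrier_0: "0 \<in> carrier (plucker_ring k n)" using R.zero_closed by simp
lemma carrier_const: "const_poly c \<in> carrier (plucker_ring k n)"
  by (auto simp: carrier_plucker_iff const_poly_def)
lemma carrier_var: "S \<in> ksubsets k n \<Longrightarrow> pvar S \<in> carrier (plucker_ring k n)"
  by (auto simp: carrier_plucker_iff pvar_def)
lemma carrier_uminus: "f \<in> carrier (plucker_ring k n) \<Longrightarrow> - f \<in> carrier (plucker_ring k n)"
  using carrier_mult[of "const_poly (-1)" f] carrier_const[of "-1"] by simp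
lemma carrier_sum: "(\<And>x. x \<in> A \<Longrightarrow> F x \<in> carrier (plucker_ring k n)) \<Longrightarrow> (\<Sum>x\<in>A. F x) \<in> carrier (plucker_ring k n)"
  by (induction A rule: infinite_finite_induct) (auto intro: carrier_add carrier_0)

lemma graded_subset: "graded_part k n d \<subseteq> carrier (plucker_ring k n)" by (auto simp: graded_part_def)
lemma graded_add: "f \<in> graded_part k n d \<Longrightarrow> g \<in> graded_part k n d \<Longrightarrow> f + g \<in> graded_part k n d"
  using Poly_Mapping.keys_add[of f g] by (fastforce simp: graded_part_def intro: carrier_add)
lemma graded_0: "0 \<in> graded_part k n d"
  by (auto simp: graded_part_def carrier_0)
lemma graded_sum: "(\<And>x. x \<in> A \<Longrightarrow> F x \<in> graded_part k n d) \<Longrightarrow> (\<Sum>x\<in>A. F x) \<in> graded_part k n d"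
  by (induction A rule: infinite_finite_induct) (auto intro: graded_add graded_0)

lemma monom_degree_superset: "finite A \<Longrightarrow> Poly_Mapping.keys m \<subseteq> A \<Longrightarrow> monom_degree m = (\<Sum>S\<in>A. Poly_Mapping.lookup m S)"
  unfolding monom_degree_def by (rule sum.mono_neutral_left) (auto simp: in_keys_iff)

lemma monom_degree_add: "monom_degree (m + m') = monom_degree m + monom_degree m'"
proof -
  let ?A = "Poly_Mapping.keys m \<union> Poly_Mapping.keys m'"
  have "monom_degree (m + m') = (\<Sum>S\<in>?A. Poly_Mapping.lookup (m + m') S)"
    by (rule monom_degree_superset) (auto dest: subsetD[OF Poly_Mapping.keys_add])
  also have "\<dots> = monom_degree m + monom_degree m'"
    by (simp add: monom_degree_superset[of ?A] lookup_add sum.distrib)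
  finally show ?thesis .
qed

lemma graded_mult: assumes "f \<in> graded_part k n d" "g \<in> graded_part k n e" shows "f * g \<in> graded_part k n (d + e)"
proof -
  have "monom_degree m = d + e" if m: "m \<in> Poly_Mapping.keys (f * g)" for m
  proof -
    obtain a b where "a \<in> Poly_Mapping.keys f" "b \<in> Poly_Mapping.keys g" "m = a + b"
      using Poly_Mapping.keys_mult[of f g] m by blast
    then show ?thesis using assms by (auto simp: graded_part_def monom_degree_add)
  qed
  then show ?thesis using assms by (auto simp: graded_part_def intro: carrier_mult)
qed

lemma graded_const: "const_poly c \<in> graded_part k n 0"
  by (auto simp: graded_part_def carrier_const) (auto simp: const_poly_def monom_degree_def split: if_splits)
lemma graded_var: "S \<in> ksubsets k n \<Longrightarrow> pvar S \<in> graded_part k n 1"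
  by (auto simp: graded_part_def carrier_var) (auto simp: pvar_def monom_degree_def)
lemma graded_scale: "f \<in> graded_part k n d \<Longrightarrow> const_poly c * f \<in> graded_part k n d"
  using graded_mult[OF graded_const] by fastforce
lemma graded_diff: "f \<in> graded_part k n d \<Longrightarrow> g \<in> graded_part k n d \<Longrightarrow> f - g \<in> graded_part k n d"
  using graded_add[of f d "const_poly (-1) * g"] graded_scale[of g d "-1"] by simp

lemma graded_induct [consumes 1, case_names zero one add scale mult]:
  assumes "f \<in> graded_part k n d"
    and "\<And>d. P d 0" "P 0 1" "\<And>d f g. P d f \<Longrightarrow> P d g \<Longrightarrow> P d (f + g)" "\<And>d c f. P d f \<Longrightarrow> P d (const_poly c * f)"
    "\<And>d S f. f \<in> graded_part k n d \<Longrightarrow> P d f \<Longrightarrow> S \<in> ksubsets k n \<Longrightarrow> P (Suc d) (pvar S * f)"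
  shows "P d f"
proof -
  have mon: "P (monom_degree m) (Poly_Mapping.single m 1) \<and> Poly_Mapping.single m 1 \<in> graded_part k n (monom_degree m)" 
    if "Poly_Mapping.keys m \<subseteq> ksubsets k n" for m
    using _ _ that
  proof (rule monom_var_induct, goal_cases)
    case 1 show ?case using assms(3) graded_const[of 1] by (simp add: monom_degree_def const_poly_def)
  next
    case (2 m S)
    then have "P (Suc (monom_degree m)) (pvar S * Poly_Mapping.single m 1)"
      "pvar S * Poly_Mapping.single m 1 \<in> graded_part k n (1 + monom_degree m)"
      using assms(6) graded_mult[OF graded_var] by blast+
    then show ?case unfolding single_add_one_monom
      by (simp add: monom_degree_add monom_degree_def[of "Poly_Mapping.single S _"])
  qed
  have "P d (\<Sum>m\<in>A. Poly_Mapping.single m (Poly_Mapping.lookup f m))" if "finite A" "A \<subseteq> Poly_Mapping.keys f" "A \<noteq> {}" for A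
    using that(1,3,2)
  proof (induction A rule: finite_ne_induct)
    case (singleton m)
    then have "P d (Poly_Mapping.single m 1)" using mon assms(1) by (auto simp: graded_part_def carrier_plucker_iff)
    from assms(5)[OF this, of "Poly_Mapping.lookup f m"] show ?case by (simp add: const_poly_def mult_single)
  next
    case (insert m A)
    then have "P d (Poly_Mapping.single m 1)" using mon assms(1) by (auto simp: graded_part_def carrier_plucker_iff)
    from assms(5)[OF this, of "Poly_Mapping.lookup f m"] show ?case using insert assms(4) by (simp add: const_poly_def mult_single)
  qed
  then have *: "P d f" if "f \<noteq> 0" using ppoly_as_sum_of_terms[of f] that by (metis finite_keys keys_eq_empty subset_refl)
  show ?thesis using * assms(2) by blast
qed

end

section \<open>Alternating variables, the orthogonal Lie algebra and its Casimir operator modulo the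
  quadrics\<close>

section \<open>Alternating string variables\<close>

text \<open>Distinct entries make the sorting permutation unique, so the definite description can be
  evaluated on any witness.\<close>

lemma string_sign_eq:
  assumes "distinct xs" "\<pi> permutes {..<length xs}" "sorted (permute_list \<pi> xs)"
  shows "string_sign xs = sign \<pi>"
proof -
  have "\<pi>' = \<pi>" if p: "\<pi>' permutes {..<length xs}" "sorted (permute_list \<pi>' xs)" for \<pi>'
  proof
    fix i
    have eq: "permute_list \<pi>' xs = permute_list \<pi> xs"
      using p assms by (metis mset_permute_list properties_for_sort)
    show "\<pi>' i = \<pi> i"
    proof (cases "i < length xs")
      case True
      then have "xs ! \<pi>' i = xs ! \<pi> i" 
        using eq permute_list_nth[OF p(1)] permute_list_nth[OF assms(2)] by metis
      moreover have "\<pi>' i < length xs" "\<pi> i < length xs"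
        using permutes_in_image[OF p(1)] permutes_in_image[OF assms(2)] True by auto
      ultimately show ?thesis using assms(1) by (simp add: nth_eq_iff_index_eq)
    next
      case False
      then show ?thesis using p(1) assms(2) by (metis lessThan_iff permutes_not_in)
    qed
  qed
  then have "(THE \<pi>. \<pi> permutes {..<length xs} \<and> sorted (permute_list \<pi> xs)) = \<pi>"
    using assms(2,3) by (intro the_equality conjI) (assumption | blast)+
  then show ?thesis by (simp add: string_sign_def)
qed

lemma sorting_permutation_exists:
  obtains \<pi> where "\<pi> permutes {..<length xs}" "permute_list \<pi> xs = sort xs"
  by (rule mset_eq_permutation[of "sort xs" xs]) auto

lemma string_sign_permute_list:
  assumes "distinct xs" "\<tau> permutes {..<length xs}"
  shows "string_sign (permute_list \<tau> xs) = sign \<tau> * string_sign xs"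
proof -
  obtain \<pi> where pi: "\<pi> permutes {..<length xs}" "permute_list \<pi> xs = sort xs"
    by (rule sorting_permutation_exists)
  define \<pi>' where "\<pi>' = inv_into UNIV \<tau> \<circ> \<pi>"
  have p': "\<pi>' permutes {..<length xs}"
    unfolding \<pi>'_def by (intro permutes_compose pi permutes_inv assms)
  have "\<tau> \<circ> \<pi>' = \<pi>" using assms(2) by (simp add: \<pi>'_def fun_eq_iff permutes_inverses)
  then have "permute_list \<pi>' (permute_list \<tau> xs) = sort xs"
    using permute_list_compose[OF p', of \<tau>] assms pi by (metis permute_list_compose)
  then have "string_sign (permute_list \<tau> xs) = sign \<pi>'"
    using assms p' by (intro string_sign_eq) auto
  also have "sign \<pi>' = sign (inv_into UNIV \<tau>) * sign \<pi>"
    unfolding \<pi>'_def using pi(1) permutes_inv[OF assms(2)]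
    by (metis finite_lessThan permutation_permutes sign_compose)
  also have "sign (inv_into UNIV \<tau>) = sign \<tau>"
    by (rule sign_inverse) (use assms permutation_permutes in blast)
  also have "sign \<pi> = string_sign xs"
    by (rule string_sign_eq[symmetric]) (use pi assms in auto)
  finally show ?thesis .
qed

lemma string_sign_sorted: "sorted xs \<Longrightarrow> distinct xs \<Longrightarrow> string_sign xs = 1"
  using string_sign_eq[of xs id] by (simp add: permutes_id)

text \<open>Alternating extension of the variables to arbitrary strings. With it both families of
  quadrics and the Lie algebra action are expressed without sorting indices.\<close>

definition PS :: "nat list \<Rightarrow> ppoly" where
  "PS s = (if distinct s then of_int (string_sign s) * pvar (set s) else 0)"

lemma PS_permute_list:
  assumes "\<tau> permutes {..<length s}"
  shows "PS (permute_list \<tau> s) = of_int (sign \<tau>) * PS s"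
  using assms by (auto simp: PS_def string_sign_permute_list mult.assoc)

lemma PS_swap:
  assumes "i < length s" "j < length s" "i \<noteq> j"
  shows "PS (s[i := s ! j, j := s ! i]) = - PS s"
proof -
  have p: "transpose i j permutes {..<length s}"
    using assms by (intro permutes_swap_id) auto
  have "permute_list (transpose i j) s = s[i := s ! j, j := s ! i]"
    by (rule nth_equalityI)
       (use assms in \<open>auto simp: permute_list_def transpose_def nth_list_update\<close>)
  then show ?thesis using PS_permute_list[OF p] assms by (simp add: sign_swap_id)
qed

lemma PS_repeat: "i < length s \<Longrightarrow> j < length s \<Longrightarrow> i \<noteq> j \<Longrightarrow> s ! i = s ! j \<Longrightarrow> PS s = 0"
  by (auto simp: PS_def distinct_conv_nth)

lemma PS_sorted_list_of_set [simp]: "finite S \<Longrightarrow> PS (sorted_list_of_set S) = pvar S"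
  by (simp add: PS_def string_sign_sorted)

lemma app_sign_app_var:
  "finite I \<Longrightarrow> of_int (app_sign I l) * app_var I l = PS (sorted_list_of_set I @ [l])"
  by (auto simp: PS_def app_sign_def app_var_def)

lemma distinct_permute_sorted:
  assumes "distinct s"
  obtains \<tau> where "\<tau> permutes {..<length s}" "s = permute_list \<tau> (sorted_list_of_set (set s))"
proof -
  have srt: "sorted_list_of_set (set s) = sort s"
    using assms by (simp add: sorted_list_of_set_sort_remdups distinct_remdups_id)
  obtain p where "p permutes {..<length (sort s)}" "permute_list p (sort s) = s"
    by (rule mset_eq_permutation[of s "sort s"]) auto
  then show ?thesis using that[of p] srt by simp
qed

lemma ksubsets_finite: "S \<in> ksubsets k n \<Longrightarrow> finite S" "finite (ksubsets k n)"
  by (auto simp: ksubsets_def intro: finite_subset)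

lemma PS_graded: "set s \<subseteq> {1..n} \<Longrightarrow> length s = k \<Longrightarrow> PS s \<in> graded_part k n 1"
  using graded_scale[OF graded_var, of "set s" k n "of_int (string_sign s)"] 
  by (auto simp: PS_def graded_0 ksubsets_def distinct_card)

section \<open>The action of the general linear Lie algebra\<close>

text \<open>The matrix unit that sends \<open>b\<close> to \<open>a\<close>, acting on the exterior
  power: one position at a time is replaced.\<close>

definition Evar :: "nat \<Rightarrow> nat \<Rightarrow> nat set \<Rightarrow> ppoly" where
  "Evar a b S = (\<Sum>i<card S. if sorted_list_of_set S ! i = b then PS ((sorted_list_of_set S)[i := a]) else 0)"

definition E :: "nat \<Rightarrow> nat \<Rightarrow> ppoly \<Rightarrow> ppoly" where
  "E a b = ppoly_deriv.der (Evar a b)"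

lemmas E_mult = ppoly_deriv.der_mult[of "Evar a b" for a b, folded E_def]
lemmas E_add = ppoly_deriv.der_add[of "Evar a b" for a b, folded E_def]
lemmas E_diff = ppoly_deriv.der_diff[of "Evar a b" for a b, folded E_def]
lemmas E_uminus = ppoly_deriv.der_uminus[of "Evar a b" for a b, folded E_def]
lemmas E_const [simp] = ppoly_deriv.der_const[of "Evar a b" for a b, folded E_def]
lemmas E_0 [simp] = ppoly_deriv.der_0[of "Evar a b" for a b, folded E_def]
lemmas E_1 [simp] = ppoly_deriv.der_1[of "Evar a b" for a b, folded E_def]
lemmas E_var = ppoly_deriv.der_var[of "Evar a b" for a b, folded E_def]
lemmas E_sum = ppoly_deriv.der_sum[of "Evar a b" for a b, folded E_def]
lemmas E_const_mult = ppoly_deriv.der_const_mult[of "Evar a b" for a b, folded E_def]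

text \<open>A distinct string is a permutation of its sorted form, and both sides change by the same
  sign. If two positions agree, replacing any other position leaves the repetition in place, and the
  replacements at the two positions are swaps of each other and cancel.\<close>

lemma E_PS: "E a b (PS s) = (\<Sum>i<length s. if s ! i = b then PS (s[i := a]) else 0)"
proof (cases "distinct s")
  case True
  define s0 where "s0 = sorted_list_of_set (set s)"
  obtain \<tau> where t: "\<tau> permutes {..<length s}" "s = permute_list \<tau> s0"
    by (rule distinct_permute_sorted[OF True, folded s0_def])
  have len: "length s0 = length s" using True by (simp add: s0_def distinct_card)
  have inj: "\<tau> i = \<tau> j \<longleftrightarrow> i = j" for i j using permutes_inj[OF t(1)] by (simp add: inj_eq)
  have s_nth: "s ! i = s0 ! \<tau> i" if "i < length s" for i
    by (subst t(2)) (use that t(1) len in \<open>simp add: permute_list_nth\<close>)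
  have upd: "s[i := a] = permute_list \<tau> (s0[\<tau> i := a])" if "i < length s" for i
    by (rule nth_equalityI)
       (use that len permutes_in_image[OF t(1)] in \<open>auto simp: permute_list_nth t(1) nth_list_update inj s_nth\<close>)
  have "E a b (PS s) = of_int (sign \<tau>) * E a b (PS s0)"
    using t len by (metis E_const_mult PS_permute_list const_poly_of_int)
  also have "E a b (PS s0) = (\<Sum>i<length s. if s0 ! i = b then PS (s0[i := a]) else 0)"
    unfolding s0_def by (simp add: E_var Evar_def distinct_card[OF True])
  also have "\<dots> = (\<Sum>i<length s. if s0 ! \<tau> i = b then PS (s0[\<tau> i := a]) else 0)"
    by (rule sum.permute[OF t(1), unfolded o_def])
  also have "of_int (sign \<tau>) * \<dots> = (\<Sum>i<length s. if s ! i = b then PS (s[i := a]) else 0)"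
    unfolding sum_distrib_left
    by (rule sum.cong) (use t(1) len PS_permute_list[of \<tau> "s0[\<tau> i := a]" for i] in \<open>auto simp: s_nth upd\<close>)
  finally show ?thesis .
next
  case False
  then obtain p q where pq: "p < length s" "q < length s" "p \<noteq> q" "s ! p = s ! q"
    by (auto simp: distinct_conv_nth)
  let ?f = "\<lambda>i. if s ! i = b then PS (s[i := a]) else 0"
  have "(\<Sum>i<length s. ?f i) = (\<Sum>i\<in>{p,q}. ?f i)"
  proof (rule sum.mono_neutral_right)
    show "\<forall>i\<in>{..<length s} - {p, q}. ?f i = 0"
      using pq by (auto intro!: PS_repeat[of p _ q])
  qed (use pq in auto)
  also have "\<dots> = 0"
  proof -
    have "s[p := a] = (s[q := a])[p := (s[q := a]) ! q, q := (s[q := a]) ! p]"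
      by (rule nth_equalityI) (use pq in \<open>auto simp: nth_list_update\<close>)
    then have "PS (s[p := a]) = - PS (s[q := a])"
      using PS_swap[of p "s[q := a]" q] pq by simp
    then show ?thesis using pq by simp
  qed
  finally show ?thesis using False by (simp add: PS_def)
qed

lemma pvar_cases: obtains s where "pvar S = PS s" "length s = card S" "set s = S" | "\<And>a b. E a b (pvar S) = 0"
proof (cases "finite S")
  case True
  then show ?thesis using that(1)[of "sorted_list_of_set S"] by simp
next
  case False
  then show ?thesis using that(2) by (simp add: E_var Evar_def)
qed

lemma sum_off_diagonal:
  fixes f :: "nat \<Rightarrow> nat \<Rightarrow> 'a::ab_group_add"
  shows "(\<Sum>i<k. \<Sum>j<k. f i j) = (\<Sum>i<k. f i i) + (\<Sum>i<k. \<Sum>j\<in>{..<k}-{i}. f i j)"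
  unfolding sum.distrib[symmetric]
  by (intro sum.cong refl) (simp add: sum.remove)

lemma sum_off_diagonal_swap:
  fixes f :: "nat \<Rightarrow> nat \<Rightarrow> 'a::ab_group_add"
  shows "(\<Sum>i<k. \<Sum>j\<in>{..<k}-{i}. f i j) = (\<Sum>i<k. \<Sum>j\<in>{..<k}-{i}. f j i)"
  using sum_off_diagonal[of f k] sum_off_diagonal[of "\<lambda>i j. f j i" k] sum.swap[of f "{..<k}" "{..<k}"]
  by simp

text \<open>Separates the terms where the second operator hits the entry just written. These alone
  survive in the commutator, because replacements at two different positions commute.\<close>

lemma E_E_PS:
  "E a b (E c d (PS s)) = (\<Sum>i<length s. if s ! i = d \<and> b = c then PS (s[i := a]) else 0) +
     (\<Sum>i<length s. \<Sum>j\<in>{..<length s}-{i}. if s ! i = d \<and> s ! j = b then PS (s[i := c, j := a]) else 0)"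
proof -
  have "E a b (E c d (PS s)) = (\<Sum>i<length s. \<Sum>j<length s. 
      if s ! i = d \<and> s[i := c] ! j = b then PS (s[i := c, j := a]) else 0)"
    by (subst E_PS) (auto simp: E_sum E_PS if_distrib[of "E a b"] intro!: sum.cong)
  also have "\<dots> = (\<Sum>i<length s. if s ! i = d \<and> b = c then PS (s[i := a]) else 0) +
     (\<Sum>i<length s. \<Sum>j\<in>{..<length s}-{i}. if s ! i = d \<and> s ! j = b then PS (s[i := c, j := a]) else 0)"
    by (subst sum_off_diagonal) (auto intro!: sum.cong arg_cong2[of _ _ _ _ "(+)"])
  finally show ?thesis .
qed

lemma E_commutator:
  "E a b (E c d f) - E c d (E a b f) = (if b = c then E a d f else 0) - (if d = a then E c b f else 0)"
proof (induction f rule: ppoly_induct)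
  case (add f g)
  have "E a b (E c d f) = E c d (E a b f) + ((if b = c then E a d f else 0) - (if d = a then E c b f else 0))"
    "E a b (E c d g) = E c d (E a b g) + ((if b = c then E a d g else 0) - (if d = a then E c b g else 0))"
    using add by (metis add_diff_cancel_left' diff_add_cancel add.commute)+
  then show ?case by (simp add: E_add)
next
  case (mult S f)
  have "E a b (E c d (pvar S)) - E c d (E a b (pvar S)) = (if b = c then E a d (pvar S) else 0) - (if d = a then E c b (pvar S) else 0)"
  proof (cases rule: pvar_cases[of S])
    case (1 s)
    have "(\<Sum>i<length s. \<Sum>j\<in>{..<length s}-{i}. if s ! i = d \<and> s ! j = b then PS (s[i := c, j := a]) else 0)
       = (\<Sum>i<length s. \<Sum>j\<in>{..<length s}-{i}. if s ! i = b \<and> s ! j = d then PS (s[i := a, j := c]) else 0)"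
      by (subst sum_off_diagonal_swap) (intro sum.cong refl, auto intro!: arg_cong[of _ _ PS] list_update_swap)
    then show ?thesis unfolding 1(1) E_E_PS 
      by (auto simp: E_PS intro!: sum.cong)
  qed simp
  then have *: "E a b (E c d (pvar S)) = E c d (E a b (pvar S)) + (if b = c then E a d (pvar S) else 0) - (if d = a then E c b (pvar S) else 0)"
    by (simp add: algebra_simps)
  from mult have **: "E a b (E c d f) = E c d (E a b f) + (if b = c then E a d f else 0) - (if d = a then E c b f else 0)"
    by (simp add: algebra_simps)
  show ?case by (auto simp: E_mult E_add * ** algebra_simps split: if_splits)
qed simp

lemma E_graded: 
  assumes "f \<in> graded_part k n d" "a \<in> {1..n}"
  shows "E a b f \<in> graded_part k n d"
  using assms(1)
proof (induction rule: graded_induct)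
  case (mult d S f)
  have fin: "finite S" "card S = k" "S \<subseteq> {1..n}" using mult by (auto simp: ksubsets_def intro: finite_subset)
  have "E a b (pvar S) \<in> graded_part k n 1"
    unfolding E_var Evar_def
  proof (rule graded_sum)
    fix i assume "i \<in> {..<card S}"
    have "set ((sorted_list_of_set S)[i := a]) \<subseteq> {1..n}"
      using set_update_subset_insert[of "sorted_list_of_set S" i a] fin assms(2) by auto
    then show "(if sorted_list_of_set S ! i = b then PS ((sorted_list_of_set S)[i := a]) else 0) \<in> graded_part k n 1"
      using fin PS_graded[of "(sorted_list_of_set S)[i := a]" n k] by (auto simp: graded_0)
  qed
  then show ?case using graded_mult[of "E a b (pvar S)" k n 1 f d] graded_mult[OF graded_var[OF mult(2)], of "E a b f" d] mult
    by (auto simp: E_mult intro: graded_add)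
qed (auto simp: E_add E_const_mult graded_0 intro: graded_add graded_scale)

section \<open>The orthogonal Lie algebra and its Casimir operator\<close>

definition D :: "nat \<Rightarrow> nat \<Rightarrow> ppoly \<Rightarrow> ppoly" where "D a b f = E a b f - E b a f"

lemma D_mult: "D a b (f * g) = D a b f * g + f * D a b g" by (simp add: D_def E_mult algebra_simps)
lemma D_add: "D a b (f + g) = D a b f + D a b g" by (simp add: D_def E_add)
lemma D_diff: "D a b (f - g) = D a b f - D a b g" by (simp add: D_def E_diff)
lemma D_uminus: "D a b (- f) = - D a b f" by (simp add: D_def E_uminus)
lemma D_const [simp]: "D a b (const_poly c) = 0" by (simp add: D_def)
lemma D_0 [simp]: "D a b 0 = 0" by (simp add: D_def)
lemma D_1 [simp]: "D a b 1 = 0" by (simp add: D_def)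
lemma D_sum: "D a b (\<Sum>x\<in>A. F x) = (\<Sum>x\<in>A. D a b (F x))" by (simp add: D_def E_sum sum_subtractf)
lemma D_const_mult: "D a b (const_poly c * f) = const_poly c * D a b f" by (simp add: D_mult)
lemma D_antisym: "D b a f = - D a b f" by (simp add: D_def)
lemma D_graded: "f \<in> graded_part k n d \<Longrightarrow> a \<in> {1..n} \<Longrightarrow> b \<in> {1..n} \<Longrightarrow> D a b f \<in> graded_part k n d"
  unfolding D_def by (intro graded_diff E_graded)

lemma D_commutator:
  "D a b (D c d f) = D c d (D a b f) + (if b = c then D a d f else 0) - (if a = c then D b d f else 0)
     - (if b = d then D a c f else 0) + (if a = d then D b c f else 0)"
proof -
  have sub: "x = y + z" if "x - y = z" for x y z :: ppoly using that by (simp add: algebra_simps)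
  note e = sub[OF E_commutator]
  show ?thesis
    unfolding D_def E_diff e[of a b c d] e[of a b d c] e[of b a c d] e[of b a d c]
    by (cases "a = c"; cases "a = d"; cases "b = c"; cases "b = d"; simp)
qed

text \<open>Ordered pairs count every generator twice, and squaring skew generators makes the
  eigenvalues nonpositive; \<open>cas_eig\<close> absorbs both conventions.\<close>

definition Cas :: "nat \<Rightarrow> ppoly \<Rightarrow> ppoly" where
  "Cas n f = (\<Sum>a\<in>{1..n}. \<Sum>b\<in>{1..n}. D a b (D a b f))"

lemma Cas_add: "Cas n (f + g) = Cas n f + Cas n g" by (simp add: Cas_def D_add sum.distrib)
lemma Cas_const_mult: "Cas n (const_poly c * f) = const_poly c * Cas n f" 
  by (simp add: Cas_def D_const_mult sum_distrib_left)
lemma Cas_graded: "f \<in> graded_part k n d \<Longrightarrow> Cas n f \<in> graded_part k n d"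
  unfolding Cas_def by (intro graded_sum D_graded)

lemma Cas_mult:
  "Cas n (f * g) = Cas n f * g + f * Cas n g + 2 * (\<Sum>a\<in>{1..n}. \<Sum>b\<in>{1..n}. D a b f * D a b g)"
  by (simp add: Cas_def D_mult D_add sum.distrib sum_distrib_left sum_distrib_right algebra_simps)

text \<open>Centrality. The commutator with \<open>D a b\<close> is the term \<open>K a b\<close>;
  summed before and after one factor \<open>D a b\<close> it gives two collections of products that
  cancel by antisymmetry. This is what makes the image of the shifted operator stable under
  so(n).\<close>

lemma Cas_D:
  assumes "c \<in> {1..n}" "d \<in> {1..n}"
  shows "D c d (Cas n f) = Cas n (D c d f)"
proof -
  define K where "K a b g = (if d = a then D c b g else 0) - (if c = a then D d b g else 0)
     - (if d = b then D c a g else 0) + (if c = b then D d a g else 0)" for a b g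
  have com: "D c d (D a b g) = D a b (D c d g) + K a b g" for a b g
    using D_commutator[of c d a b g] by (simp add: K_def algebra_simps)
  have "D c d (D a b (D a b f)) = D a b (D a b (D c d f)) + (D a b (K a b f) + K a b (D a b f))" for a b
    by (simp add: com D_add)
  then have "D c d (Cas n f) = Cas n (D c d f) + ((\<Sum>a\<in>{1..n}. \<Sum>b\<in>{1..n}. D a b (K a b f)) + (\<Sum>a\<in>{1..n}. \<Sum>b\<in>{1..n}. K a b (D a b f)))"
    by (simp add: Cas_def D_sum sum.distrib)
  moreover have "(\<Sum>a\<in>{1..n}. \<Sum>b\<in>{1..n}. K a b (D a b f)) = 
     (\<Sum>b\<in>{1..n}. D c b (D d b f)) - (\<Sum>b\<in>{1..n}. D d b (D c b f))
     - (\<Sum>a\<in>{1..n}. D c a (D a d f)) + (\<Sum>a\<in>{1..n}. D d a (D a c f))"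
  proof -
    have "(\<Sum>a\<in>{1..n}. \<Sum>b\<in>{1..n}. if d = a then D c b (D a b f) else 0) = (\<Sum>b\<in>{1..n}. D c b (D d b f))"
      "(\<Sum>a\<in>{1..n}. \<Sum>b\<in>{1..n}. if c = a then D d b (D a b f) else 0) = (\<Sum>b\<in>{1..n}. D d b (D c b f))"
      by (subst sum.swap, use assms in \<open>simp add: sum.delta\<close>)+
    moreover have "(\<Sum>a\<in>{1..n}. \<Sum>b\<in>{1..n}. if d = b then D c a (D a b f) else 0) = (\<Sum>a\<in>{1..n}. D c a (D a d f))"
      "(\<Sum>a\<in>{1..n}. \<Sum>b\<in>{1..n}. if c = b then D d a (D a b f) else 0) = (\<Sum>a\<in>{1..n}. D d a (D a c f))"
      using assms by (simp_all add: sum.delta)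
    ultimately show ?thesis unfolding K_def by (simp add: sum.distrib sum_subtractf)
  qed
  moreover have "(\<Sum>a\<in>{1..n}. \<Sum>b\<in>{1..n}. D a b (K a b f)) = 
     (\<Sum>b\<in>{1..n}. D d b (D c b f)) - (\<Sum>b\<in>{1..n}. D c b (D d b f))
     - (\<Sum>a\<in>{1..n}. D a d (D c a f)) + (\<Sum>a\<in>{1..n}. D a c (D d a f))"
  proof -
    have "(\<Sum>a\<in>{1..n}. \<Sum>b\<in>{1..n}. if d = a then D a b (D c b f) else 0) = (\<Sum>b\<in>{1..n}. D d b (D c b f))"
      "(\<Sum>a\<in>{1..n}. \<Sum>b\<in>{1..n}. if c = a then D a b (D d b f) else 0) = (\<Sum>b\<in>{1..n}. D c b (D d b f))"
      by (subst sum.swap, use assms in \<open>simp add: sum.delta\<close>)+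
    moreover have "(\<Sum>a\<in>{1..n}. \<Sum>b\<in>{1..n}. if d = b then D a b (D c a f) else 0) = (\<Sum>a\<in>{1..n}. D a d (D c a f))"
      "(\<Sum>a\<in>{1..n}. \<Sum>b\<in>{1..n}. if c = b then D a b (D d a f) else 0) = (\<Sum>a\<in>{1..n}. D a c (D d a f))"
      using assms by (simp_all add: sum.delta)
    moreover have "D a b (K a b f) = (if d = a then D a b (D c b f) else 0) - (if c = a then D a b (D d b f) else 0)
     - (if d = b then D a b (D c a f) else 0) + (if c = b then D a b (D d a f) else 0)" for a b
      by (simp add: K_def D_add D_diff)
    ultimately show ?thesis by (simp add: sum.distrib sum_subtractf)
  qed
  moreover have "(\<Sum>a\<in>{1..n}. D c a (D a d f)) = - (\<Sum>a\<in>{1..n}. D c a (D d a f))"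
    "(\<Sum>a\<in>{1..n}. D a d (D c a f)) = - (\<Sum>a\<in>{1..n}. D d a (D c a f))"
    by (simp_all only: D_antisym[of _ d] D_uminus sum_negf)
  moreover have "(\<Sum>a\<in>{1..n}. D d a (D a c f)) = - (\<Sum>a\<in>{1..n}. D d a (D c a f))"
    "(\<Sum>a\<in>{1..n}. D a c (D d a f)) = - (\<Sum>a\<in>{1..n}. D c a (D d a f))"
    by (simp_all only: D_antisym[of _ c] D_uminus sum_negf)
  ultimately show ?thesis by simp
qed

lemma sum_swap3: "(\<Sum>a\<in>A. \<Sum>b\<in>B. \<Sum>i\<in>C. F a b i) = (\<Sum>i\<in>C. \<Sum>a\<in>A. \<Sum>b\<in>B. F a b i)"
  by (simp add: sum.swap[of _ C] )

lemma sum_delta2: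
  assumes "finite A" "x \<in> A" "y \<in> A"
  shows "(\<Sum>a\<in>A. \<Sum>b\<in>A. if x = a \<and> y = b then F a b else 0) = F x y"
proof -
  have "(\<Sum>a\<in>A. \<Sum>b\<in>A. if x = a \<and> y = b then F a b else 0) = (\<Sum>a\<in>A. if x = a then F a y else 0)"
    by (rule sum.cong) (use assms in \<open>auto simp: sum.delta\<close>)
  then show ?thesis using assms by (simp add: sum.delta)
qed

text \<open>Writing over the same position gives \<open>n\<close> copies for each of the
  \<open>k\<close> positions; the two-position terms exchange two letters and contribute -1 for each
  of the \<open>k * (k - 1)\<close> ordered pairs.\<close>

lemma sum_E_E_transpose_PS:
  assumes s: "set s \<subseteq> {1..n}" "length s = k"
  shows "(\<Sum>a\<in>{1..n}. \<Sum>b\<in>{1..n}. E a b (E b a (PS s))) = of_int (int k * (int n - int k + 1)) * PS s"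
proof -
  have nth: "i < k \<Longrightarrow> s ! i \<in> {1..n}" for i using s nth_mem by blast
  have "(\<Sum>a\<in>{1..n}. \<Sum>b\<in>{1..n}. E a b (E b a (PS s))) = 
      (\<Sum>i<k. \<Sum>a\<in>{1..n}. \<Sum>b\<in>{1..n}. if s ! i = a then PS (s[i := a]) else 0) +
      (\<Sum>i<k. \<Sum>j\<in>{..<k}-{i}. \<Sum>a\<in>{1..n}. \<Sum>b\<in>{1..n}. if s ! i = a \<and> s ! j = b then PS (s[i := b, j := a]) else 0)"
    unfolding E_E_PS sum.distrib s(2) by (simp only: sum_swap3[where C="{..<k}"] sum_swap3[where C="{..<k}-{x}" for x] simp_thms)
  also have "(\<Sum>i<k. \<Sum>a\<in>{1..n}. \<Sum>b\<in>{1..n}. if s ! i = a then PS (s[i := a]) else 0) = (\<Sum>i<k. of_nat n * PS s)"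
  proof (intro sum.cong refl)
    fix i assume "i \<in> {..<k}"
    have "(\<Sum>a\<in>{1..n}. \<Sum>b\<in>{1..n}. if s ! i = a then PS (s[i := a]) else 0) = 
       (\<Sum>a\<in>{1..n}. if s ! i = a then of_nat n * PS (s[i := a]) else 0)"
      by (intro sum.cong refl) auto
    also have "\<dots> = of_nat n * PS s" using nth[of i] \<open>i \<in> {..<k}\<close> by (simp add: sum.delta)
    finally show "(\<Sum>a\<in>{1..n}. \<Sum>b\<in>{1..n}. if s ! i = a then PS (s[i := a]) else 0) = of_nat n * PS s" .
  qed
  also have "\<dots> = of_int (int k * int n) * PS s" by simp
  also have "(\<Sum>i<k. \<Sum>j\<in>{..<k}-{i}. \<Sum>a\<in>{1..n}. \<Sum>b\<in>{1..n}. if s ! i = a \<and> s ! j = b then PS (s[i := b, j := a]) else 0) =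
      (\<Sum>i<k. \<Sum>j\<in>{..<k}-{i}. - PS s)"
    by (intro sum.cong refl, subst sum_delta2) (use nth s in \<open>auto simp: PS_swap\<close>)
  also have "\<dots> = - of_int (int k * (int k - 1)) * PS s"
    by (cases k) (auto simp: sum_negf)
  finally show ?thesis by (simp add: algebra_simps)
qed

text \<open>Two-position terms write the same letter twice and vanish; a single position survives
  only with \<open>a = b\<close> equal to its letter.\<close>

lemma sum_E_E_PS:
  assumes s: "set s \<subseteq> {1..n}" "length s = k"
  shows "(\<Sum>a\<in>{1..n}. \<Sum>b\<in>{1..n}. E a b (E a b (PS s))) = of_nat k * PS s"
proof -
  have nth: "i < k \<Longrightarrow> s ! i \<in> {1..n}" for i using s nth_mem by blast
  have "(\<Sum>a\<in>{1..n}. \<Sum>b\<in>{1..n}. E a b (E a b (PS s))) = 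
      (\<Sum>i<k. \<Sum>a\<in>{1..n}. \<Sum>b\<in>{1..n}. if s ! i = b \<and> b = a then PS (s[i := a]) else 0) +
      (\<Sum>i<k. \<Sum>j\<in>{..<k}-{i}. \<Sum>a\<in>{1..n}. \<Sum>b\<in>{1..n}. if s ! i = b \<and> s ! j = b then PS (s[i := a, j := a]) else 0)"
    unfolding E_E_PS sum.distrib s(2) by (simp only: sum_swap3[where C="{..<k}"] sum_swap3[where C="{..<k}-{x}" for x] simp_thms)
  also have "(\<Sum>i<k. \<Sum>a\<in>{1..n}. \<Sum>b\<in>{1..n}. if s ! i = b \<and> b = a then PS (s[i := a]) else 0) = (\<Sum>i<k. PS s)"
  proof (intro sum.cong refl)
    fix i assume "i \<in> {..<k}"
    then have "(\<Sum>a\<in>{1..n}. \<Sum>b\<in>{1..n}. if s ! i = a \<and> s ! i = b then PS (s[i := a]) else 0) = PS s"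
      using nth by (subst sum_delta2) auto
    moreover have "(if s ! i = b \<and> b = a then PS (s[i := a]) else 0) = (if s ! i = a \<and> s ! i = b then PS (s[i := a]) else 0)" for a b
      by auto
    ultimately show "(\<Sum>a\<in>{1..n}. \<Sum>b\<in>{1..n}. if s ! i = b \<and> b = a then PS (s[i := a]) else 0) = PS s"
      by simp
  qed
  also have "(\<Sum>i<k. \<Sum>j\<in>{..<k}-{i}. \<Sum>a\<in>{1..n}. \<Sum>b\<in>{1..n}. if s ! i = b \<and> s ! j = b then PS (s[i := a, j := a]) else 0) = 0"
  proof (intro sum.neutral ballI)
    fix i j a b assume "i \<in> {..<k}" "j \<in> {..<k} - {i}"
    then have "PS (s[i := a, j := a]) = 0" using s by (intro PS_repeat[of i _ j]) auto
    then show "(if s ! i = b \<and> s ! j = b then PS (s[i := a, j := a]) else 0) = 0" by simp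
  qed
  finally show ?thesis by simp
qed

lemma Cas_PS:
  assumes s: "set s \<subseteq> {1..n}" "length s = k"
  shows "Cas n (PS s) = of_int (- 2 * int k * (int n - int k)) * PS s"
proof -
  let ?S = "\<lambda>F. \<Sum>a\<in>{1..n}. \<Sum>b\<in>{1..n}. F a b"
  have "Cas n (PS s) = ?S (\<lambda>a b. E a b (E a b (PS s))) + ?S (\<lambda>a b. E b a (E b a (PS s))) 
       - ?S (\<lambda>a b. E a b (E b a (PS s))) - ?S (\<lambda>a b. E b a (E a b (PS s)))"
    by (simp add: Cas_def D_def E_diff sum.distrib sum_subtractf)
  moreover have "?S (\<lambda>a b. E b a (E b a (PS s))) = ?S (\<lambda>a b. E a b (E a b (PS s)))" by (rule sum.swap)
  moreover have "?S (\<lambda>a b. E b a (E a b (PS s))) = ?S (\<lambda>a b. E a b (E b a (PS s)))" by (rule sum.swap)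
  ultimately have "Cas n (PS s) = 2 * (of_nat k * PS s) - 2 * (of_int (int k * (int n - int k + 1)) * PS s)"
    by (simp only: sum_E_E_PS[OF s] sum_E_E_transpose_PS[OF s]) simp
  then show ?thesis by (simp add: algebra_simps)
qed

text \<open>The cross term of the Casimir operator on a product, which is its failure to be a
  derivation. The first sum contracts the two strings with the bilinear form and is the source of
  the orthogonality quadrics; the second exchanges a letter and is the source of the Plucker
  relations.\<close>

lemma sum_D_PS_D_PS:
  assumes s: "set s \<subseteq> {1..n}" "length s = k" and s': "set s' \<subseteq> {1..n}" "length s' = k"
  shows "(\<Sum>a\<in>{1..n}. \<Sum>b\<in>{1..n}. D a b (PS s) * D a b (PS s')) = 
    2 * (\<Sum>i<k. \<Sum>j<k. if s ! i = s' ! j then \<Sum>a\<in>{1..n}. PS (s[i := a]) * PS (s'[j := a]) else 0)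
   - 2 * (\<Sum>i<k. \<Sum>j<k. PS (s[i := s' ! j]) * PS (s'[j := s ! i]))"
proof -
  let ?S = "\<lambda>F. \<Sum>a\<in>{1..n}. \<Sum>b\<in>{1..n}. F a b"
  have nth: "i < k \<Longrightarrow> s ! i \<in> {1..n}" for i using s nth_mem by blast
  have nth': "i < k \<Longrightarrow> s' ! i \<in> {1..n}" for i using s' nth_mem by blast
  have "?S (\<lambda>a b. D a b (PS s) * D a b (PS s')) = ?S (\<lambda>a b. E a b (PS s) * E a b (PS s')) + ?S (\<lambda>a b. E b a (PS s) * E b a (PS s')) 
       - ?S (\<lambda>a b. E a b (PS s) * E b a (PS s')) - ?S (\<lambda>a b. E b a (PS s) * E a b (PS s'))"
    by (simp add: D_def algebra_simps sum.distrib sum_subtractf)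
  moreover have "?S (\<lambda>a b. E b a (PS s) * E b a (PS s')) = ?S (\<lambda>a b. E a b (PS s) * E a b (PS s'))" by (rule sum.swap)
  moreover have "?S (\<lambda>a b. E b a (PS s) * E a b (PS s')) = ?S (\<lambda>a b. E a b (PS s) * E b a (PS s'))" by (rule sum.swap)
  moreover have "?S (\<lambda>a b. E a b (PS s) * E b a (PS s')) = (\<Sum>i<k. \<Sum>j<k. PS (s[i := s' ! j]) * PS (s'[j := s ! i]))"
  proof -
    have "?S (\<lambda>a b. E a b (PS s) * E b a (PS s')) = 
       (\<Sum>i<k. \<Sum>j<k. ?S (\<lambda>a b. if s' ! j = a \<and> s ! i = b then PS (s[i := a]) * PS (s'[j := b]) else 0))"
      unfolding E_PS s s' sum_product by (simp only: sum_swap3[where C="{..<k}"]) (auto intro!: sum.cong)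
    also have "\<dots> = (\<Sum>i<k. \<Sum>j<k. PS (s[i := s' ! j]) * PS (s'[j := s ! i]))"
      by (intro sum.cong refl, subst sum_delta2) (use nth nth' in auto)
    finally show ?thesis .
  qed
  moreover have "?S (\<lambda>a b. E a b (PS s) * E a b (PS s')) = (\<Sum>i<k. \<Sum>j<k. if s ! i = s' ! j then \<Sum>a\<in>{1..n}. PS (s[i := a]) * PS (s'[j := a]) else 0)"
  proof -
    have "?S (\<lambda>a b. E a b (PS s) * E a b (PS s')) = 
       (\<Sum>i<k. \<Sum>j<k. ?S (\<lambda>a b. if s ! i = b \<and> s ! i = s' ! j then PS (s[i := a]) * PS (s'[j := a]) else 0))"
      unfolding E_PS s s' sum_product by (simp only: sum_swap3[where C="{..<k}"]) (auto intro!: sum.cong)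
    also have "\<dots> = (\<Sum>i<k. \<Sum>j<k. if s ! i = s' ! j then \<Sum>a\<in>{1..n}. PS (s[i := a]) * PS (s'[j := a]) else 0)"
      by (intro sum.cong refl) (use nth nth' in \<open>auto simp: sum.delta\<close>)
    finally show ?thesis .
  qed
  ultimately show ?thesis by simp
qed

section \<open>The Casimir operator modulo the quadrics\<close>

text \<open>The permutation sorting \<open>v\<close> also acts on the longer string, fixing its last
  position.\<close>

lemma string_sign_append:
  assumes "distinct v"
  shows "PS (v @ [l]) = of_int (string_sign v) * PS (sorted_list_of_set (set v) @ [l])"
    "distinct (v @ [l]) \<Longrightarrow> string_sign (v @ [l]) = string_sign v * app_sign (set v) l"
proof -
  define v0 where "v0 = sorted_list_of_set (set v)"
  obtain \<tau> where t: "\<tau> permutes {..<length v}" "v = permute_list \<tau> v0"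
    by (rule distinct_permute_sorted[OF assms, folded v0_def])
  have len: "length v0 = length v" using assms by (simp add: v0_def distinct_card)
  have t': "\<tau> permutes {..<length (v0 @ [l])}"
    by (rule permutes_subset[OF t(1)]) (simp add: len)
  have v: "v @ [l] = permute_list \<tau> (v0 @ [l])"
  proof (rule nth_equalityI)
    show "length (v @ [l]) = length (permute_list \<tau> (v0 @ [l]))" by (simp add: len)
    fix i assume i: "i < length (v @ [l])"
    have "(v @ [l]) ! i = (v0 @ [l]) ! \<tau> i"
    proof (cases "i < length v")
      case True
      then have "\<tau> i < length v" using permutes_in_image[OF t(1)] by auto
      moreover have "v ! i = v0 ! \<tau> i"
        by (subst t(2)) (use True t(1) len in \<open>simp add: permute_list_nth\<close>)
      ultimately show ?thesis using True len by (simp add: nth_append)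
    next
      case False
      then have "i = length v" "\<tau> i = i" using i permutes_not_in[OF t(1)] by auto
      then show ?thesis by (simp add: nth_append len)
    qed
    then show "(v @ [l]) ! i = permute_list \<tau> (v0 @ [l]) ! i"
      using permute_list_nth[OF t'] i len by simp
  qed
  have "string_sign v0 = 1" unfolding v0_def by (rule string_sign_sorted) auto
  then have sg: "string_sign v = sign \<tau>"
    using string_sign_permute_list[of v0 \<tau>, folded t(2)] t(1) len by (simp add: v0_def)
  show "PS (v @ [l]) = of_int (string_sign v) * PS (sorted_list_of_set (set v) @ [l])"
    using PS_permute_list[OF t'] by (simp only: v sg v0_def)
  show "string_sign (v @ [l]) = string_sign v * app_sign (set v) l" if "distinct (v @ [l])"
  proof -
    have "distinct (v0 @ [l])" using that by (simp add: v0_def)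
    from string_sign_permute_list[OF this t'] show ?thesis by (simp only: v sg v0_def app_sign_def)
  qed
qed

lemma string_sign_pm_one: "distinct v \<Longrightarrow> string_sign v * string_sign v = 1"
  using string_sign_eq sorting_permutation_exists[of v] by (metis sign_idempotent sorted_sort)

text \<open>The generators of the ideal carry their free index at the end of a string. Moving
  position \<open>i\<close> there costs a factor that does not depend on the letter placed in
  it.\<close>

lemma PS_update_last:
  assumes "i < length s"
  obtains t \<epsilon> where "length t = length s - 1" "set t \<subseteq> set s" "\<And>a. PS (s[i := a]) = of_int \<epsilon> * PS (t @ [a])"
proof (cases "i = length s - 1")
  case True
  then have "s[i := a] = butlast s @ [a]" for a
    using assms by (metis append_butlast_last_id length_butlast list.size(3) list_update_length not_less_zero)
  then show ?thesis using that[of "butlast s" 1] by (auto dest: in_set_butlastD)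
next
  case False
  define t where "t = (butlast s)[i := last s]"
  have len: "length t = length s - 1" by (simp add: t_def)
  have "s \<noteq> []" using assms by auto
  have "PS (s[i := a]) = of_int (-1) * PS (t @ [a])" for a
  proof -
    have "t @ [a] = (s[i := a])[i := s[i := a] ! (length s - 1), length s - 1 := s[i := a] ! i]"
      by (rule nth_equalityI) (use False assms last_conv_nth[of s] \<open>s \<noteq> []\<close> in \<open>auto simp: t_def nth_append nth_list_update nth_butlast\<close>)
    then show ?thesis using PS_swap[of i "s[i := a]" "length s - 1"] False assms by simp
  qed
  moreover have "set t \<subseteq> set s"
  proof -
    have "set (butlast s) \<subseteq> set s" by (auto dest: in_set_butlastD)
    then show ?thesis using set_update_subset_insert[of "butlast s" i "last s"] last_in_set[OF \<open>s \<noteq> []\<close>]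
      unfolding t_def by blast
  qed
  ultimately show ?thesis using that len by blast
qed

text \<open>Minus the eigenvalue of the Casimir operator on the representation whose highest weight
  is \<open>d\<close> times the \<open>k\<close>-th fundamental one.\<close>

definition cas_eig :: "nat \<Rightarrow> nat \<Rightarrow> nat \<Rightarrow> nat" where
  "cas_eig k n d = 2 * k * d * (d + n - k - 1)"

context
  fixes k n :: nat
  assumes k: "k \<ge> 1"
begin

interpretation R: cring "plucker_ring k n" by (rule cring_plucker_ring)

abbreviation "OPI \<equiv> ortho_plucker_ideal k n"

lemma plucker_gens_carrier:
  "{plucker_relation I J | I J. I \<in> ksubsets (k - 1) n \<and> J \<in> ksubsets (k + 1) n} \<union>
       {ortho_quadric n I J | I J. I \<in> ksubsets (k - 1) n \<and> J \<in> ksubsets (k - 1) n} \<subseteq> carrier (plucker_ring k n)"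
proof -
  have av: "of_int (app_sign I l) * app_var I l \<in> carrier (plucker_ring k n)" if "I \<in> ksubsets (k - 1) n" "l \<in> {1..n}" for I l
  proof -
    have "set (sorted_list_of_set I @ [l]) \<subseteq> {1..n}" "length (sorted_list_of_set I @ [l]) = k" "finite I"
      using that k ksubsets_finite(1)[OF that(1)] by (auto simp: ksubsets_def)
    then show ?thesis using PS_graded[of "sorted_list_of_set I @ [l]" n k] graded_subset app_sign_app_var by auto
  qed
  have "ortho_quadric n I J \<in> carrier (plucker_ring k n)" if "I \<in> ksubsets (k - 1) n" "J \<in> ksubsets (k - 1) n" for I J
  proof -
    have "ortho_quadric n I J = (\<Sum>l=1..n. (of_int (app_sign I l) * app_var I l) * (of_int (app_sign J l) * app_var J l))"
      by (simp add: ortho_quadric_def algebra_simps)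
    moreover have "\<dots> \<in> carrier (plucker_ring k n)"
      by (rule carrier_sum, rule carrier_mult) (use av that in blast)+
    ultimately show ?thesis by simp
  qed
  moreover have "plucker_relation I J \<in> carrier (plucker_ring k n)" if "I \<in> ksubsets (k - 1) n" "J \<in> ksubsets (k + 1) n" for I J
  proof -
    have "plucker_relation I J = (\<Sum>l\<in>J. (of_int (app_sign I l) * app_var I l) * (const_poly (of_int (app_sign (J - {l}) l)) * pvar (J - {l})))"
      unfolding plucker_relation_def by (intro sum.cong refl) (simp add: mult_ac)
    moreover have "J - {l} \<in> ksubsets k n" if "l \<in> J" for l using that \<open>J \<in> _\<close> by (auto simp: ksubsets_def)
    moreover have "l \<in> {1..n}" if "l \<in> J" for l using that \<open>J \<in> _\<close> by (auto simp: ksubsets_def)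
    moreover have "(\<Sum>l\<in>J. (of_int (app_sign I l) * app_var I l) * (const_poly (of_int (app_sign (J - {l}) l)) * pvar (J - {l}))) \<in> carrier (plucker_ring k n)"
      if "\<And>l. l \<in> J \<Longrightarrow> l \<in> {1..n}" "\<And>l. l \<in> J \<Longrightarrow> J - {l} \<in> ksubsets k n"
      by (rule carrier_sum, rule carrier_mult[OF av[OF \<open>I \<in> _\<close> that(1)] carrier_mult[OF carrier_const carrier_var[OF that(2)]]])
    ultimately show ?thesis by simp
  qed
  ultimately show ?thesis by auto
qed

lemma OPI_ideal: "ideal OPI (plucker_ring k n)"
  unfolding ortho_plucker_ideal_def by (rule R.genideal_ideal[OF plucker_gens_carrier])

lemma OPI_plucker: "I \<in> ksubsets (k - 1) n \<Longrightarrow> J \<in> ksubsets (k + 1) n \<Longrightarrow> plucker_relation I J \<in> OPI"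
  and OPI_ortho: "I \<in> ksubsets (k - 1) n \<Longrightarrow> J \<in> ksubsets (k - 1) n \<Longrightarrow> ortho_quadric n I J \<in> OPI"
  unfolding ortho_plucker_ideal_def using R.genideal_self[OF plucker_gens_carrier] by blast+

lemma OPI_add: "f \<in> OPI \<Longrightarrow> g \<in> OPI \<Longrightarrow> f + g \<in> OPI"
  using additive_subgroup.a_closed[OF ideal.axioms(1)[OF OPI_ideal]] by fastforce
lemma OPI_0: "0 \<in> OPI"
  using additive_subgroup.zero_closed[OF ideal.axioms(1)[OF OPI_ideal]] by simp
lemma OPI_mult: "f \<in> OPI \<Longrightarrow> g \<in> carrier (plucker_ring k n) \<Longrightarrow> g * f \<in> OPI"
  using ideal.I_l_closed[OF OPI_ideal] by fastforce
lemma OPI_const_mult: "f \<in> OPI \<Longrightarrow> const_poly c * f \<in> OPI"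
  by (intro OPI_mult carrier_const)
lemma OPI_of_int_mult: "f \<in> OPI \<Longrightarrow> of_int c * f \<in> OPI"
  using OPI_const_mult[of f "of_int c"] by simp
lemma OPI_sum: "(\<And>x. x \<in> A \<Longrightarrow> F x \<in> OPI) \<Longrightarrow> (\<Sum>x\<in>A. F x) \<in> OPI"
  by (induction A rule: infinite_finite_induct) (auto intro: OPI_add OPI_0)

lemma ortho_string_in_OPI:
  assumes t: "length t = k - 1" "set t \<subseteq> {1..n}" "length t' = k - 1" "set t' \<subseteq> {1..n}"
  shows "(\<Sum>a\<in>{1..n}. PS (t @ [a]) * PS (t' @ [a])) \<in> OPI"
proof (cases "distinct t \<and> distinct t'")
  case True
  have "PS (t @ [a]) * PS (t' @ [a]) = of_int (string_sign t * string_sign t') * 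
     (of_int (app_sign (set t) a * app_sign (set t') a) * app_var (set t) a * app_var (set t') a)" for a
  proof -
    have "PS (t @ [a]) = of_int (string_sign t) * (of_int (app_sign (set t) a) * app_var (set t) a)"
      "PS (t' @ [a]) = of_int (string_sign t') * (of_int (app_sign (set t') a) * app_var (set t') a)"
      using True string_sign_append(1)[of t a] string_sign_append(1)[of t' a] by (simp_all only: app_sign_app_var finite_set)
    then show ?thesis by (simp add: mult_ac)
  qed
  then have "(\<Sum>a\<in>{1..n}. PS (t @ [a]) * PS (t' @ [a])) = of_int (string_sign t * string_sign t') * ortho_quadric n (set t) (set t')"
    by (simp only: ortho_quadric_def sum_distrib_left)
  moreover have "set t \<in> ksubsets (k-1) n" "set t' \<in> ksubsets (k-1) n"
    using True t by (auto simp: ksubsets_def distinct_card)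
  ultimately show ?thesis using OPI_ortho by (simp only: OPI_of_int_mult)
next
  case False
  then have "PS (t @ [a]) * PS (t' @ [a]) = 0" for a by (auto simp: PS_def)
  then show ?thesis by (simp add: OPI_0)
qed

text \<open>The exchange form of the relation: in the sum over \<open>J\<close>, the set of
  \<open>x\<close> and the letters of \<open>s\<close>, the term of \<open>x\<close> is the product
  on the left and each remaining term swaps \<open>x\<close> with one letter. For strings with a
  repetition, or with \<open>x\<close> already in \<open>s\<close>, the difference is identically
  zero.\<close>

lemma plucker_string_in_OPI:
  assumes t: "length t = k - 1" "set t \<subseteq> {1..n}" and s: "length s = k" "set s \<subseteq> {1..n}" and x: "x \<in> {1..n}"
  shows "PS (t @ [x]) * PS s - (\<Sum>j<k. PS (t @ [s ! j]) * PS (s[j := x])) \<in> OPI"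
proof -
  consider "\<not> distinct t" | "\<not> distinct s" | "distinct s" "x \<in> set s" | "distinct t" "distinct s" "x \<notin> set s" by blast
  then show ?thesis
  proof cases
    case 1
    then have "PS (t @ [a]) = 0" for a by (auto simp: PS_def)
    then show ?thesis by (simp add: OPI_0)
  next
    case 2
    then obtain p q where pq: "p < k" "q < k" "p \<noteq> q" "s ! p = s ! q"
      using s by (auto simp: distinct_conv_nth)
    let ?f = "\<lambda>j. PS (t @ [s ! j]) * PS (s[j := x])"
    have "(\<Sum>j<k. ?f j) = (\<Sum>j\<in>{p,q}. ?f j)"
    proof (rule sum.mono_neutral_right)
      show "\<forall>i\<in>{..<k} - {p, q}. ?f i = 0"
      proof
        fix i assume "i \<in> {..<k} - {p, q}"
        then have "PS (s[i := x]) = 0" using pq s by (intro PS_repeat[of p _ q]) auto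
        then show "?f i = 0" by simp
      qed
    qed (use pq in auto)
    also have "\<dots> = 0"
    proof -
      have "s[p := x] = (s[q := x])[p := (s[q := x]) ! q, q := (s[q := x]) ! p]"
        by (rule nth_equalityI) (use pq s in \<open>auto simp: nth_list_update\<close>)
      then have "PS (s[p := x]) = - PS (s[q := x])"
        using PS_swap[of p "s[q := x]" q] pq s by simp
      then show ?thesis using pq by simp
    qed
    finally show ?thesis using 2 by (simp add: OPI_0 PS_def)
  next
    case 3
    then obtain p where p: "p < k" "s ! p = x" using s by (auto simp: in_set_conv_nth)
    let ?f = "\<lambda>j. PS (t @ [s ! j]) * PS (s[j := x])"
    have "(\<Sum>j<k. ?f j) = (\<Sum>j\<in>{p}. ?f j)"
    proof (rule sum.mono_neutral_right)
      show "\<forall>i\<in>{..<k} - {p}. ?f i = 0"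
      proof
        fix i assume "i \<in> {..<k} - {p}"
        then have "PS (s[i := x]) = 0" using p s by (intro PS_repeat[of p _ i]) auto
        then show "?f i = 0" by simp
      qed
    qed (use p in auto)
    then show ?thesis using p by (auto simp: OPI_0)
  next
    case 4
    define J where "J = insert x (set s)"
    define \<eta> where "\<eta> = string_sign (s @ [x])"
    have I: "set t \<in> ksubsets (k-1) n" using 4 t by (auto simp: ksubsets_def distinct_card)
    have J: "J \<in> ksubsets (k+1) n" using 4 s x by (auto simp: J_def ksubsets_def distinct_card)
    have tt: "of_int (app_sign (set t) l) * app_var (set t) l = of_int (string_sign t) * PS (t @ [l])" for l
      using string_sign_append(1)[OF 4(1), of l] string_sign_pm_one[OF 4(1)]
      by (simp add: app_sign_app_var mult.assoc[symmetric] flip: of_int_mult)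
    have Jx: "J - {x} = set s" using 4 by (auto simp: J_def)
    have x1: "of_int (app_sign (J - {x}) x) * pvar (J - {x}) = of_int \<eta> * PS s"
    proof -
      have "\<eta> = string_sign s * app_sign (set s) x"
        using string_sign_append(2)[OF 4(2), of x] 4 by (simp add: \<eta>_def)
      then have "\<eta> * string_sign s = app_sign (set s) x" using string_sign_pm_one[OF 4(2)] by (simp add: algebra_simps)
      then show ?thesis using 4 by (simp add: Jx PS_def mult.assoc[symmetric] flip: of_int_mult)
    qed
    have x2: "of_int (app_sign (J - {s ! j}) (s ! j)) * pvar (J - {s ! j}) = - of_int \<eta> * PS (s[j := x])" if j: "j < k" for j
    proof -
      let ?u = "s @ [x]"
      \<comment> \<open>Exchanging \<open>x\<close> with the letter at \<open>j\<close> is one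
        transposition of \<open>s @ [x]\<close>; hence the sign opposite to that of the term of
        \<open>x\<close>.\<close>
      have sw: "s[j := x] @ [s ! j] = permute_list (transpose j k) ?u"
        by (rule nth_equalityI) (use j s in \<open>auto simp: permute_list_def transpose_def nth_list_update nth_append\<close>)
      have tp: "transpose j k permutes {..<length ?u}" using j s by (intro permutes_swap_id) auto
      have du: "distinct ?u" using 4 by auto
      have "string_sign (s[j := x] @ [s ! j]) = - \<eta>"
        unfolding sw string_sign_permute_list[OF du tp] using j by (simp add: \<eta>_def sign_swap_id)
      moreover have d: "distinct (s[j := x] @ [s ! j])" unfolding sw using tp du by (simp only: distinct_permute_list)
      moreover have "set (s[j := x]) = J - {s ! j}"
      proof -
        have "set (s[j := x] @ [s ! j]) = J" unfolding sw using tp by (simp only: set_permute_list) (simp add: J_def)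
        then show ?thesis using d by auto
      qed
      ultimately have "- \<eta> = string_sign (s[j := x]) * app_sign (J - {s ! j}) (s ! j)"
        using string_sign_append(2)[of "s[j := x]" "s ! j"] by simp
      then have "app_sign (J - {s ! j}) (s ! j) = - \<eta> * string_sign (s[j := x])"
        using string_sign_pm_one[of "s[j := x]"] d by (simp add: algebra_simps)
      then show ?thesis using d \<open>set (s[j := x]) = J - {s ! j}\<close> by (simp add: PS_def)
    qed
    have "plucker_relation (set t) J = (\<Sum>l\<in>J. (of_int (app_sign (set t) l) * app_var (set t) l) * (of_int (app_sign (J - {l}) l) * pvar (J - {l})))"
      by (simp add: plucker_relation_def algebra_simps)
    also have "\<dots> = (of_int (string_sign t) * PS (t @ [x])) * (of_int \<eta> * PS s) + 
       (\<Sum>l\<in>set s. (of_int (string_sign t) * PS (t @ [l])) * (of_int (app_sign (J - {l}) l) * pvar (J - {l})))"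
      unfolding tt x1[symmetric] using 4 by (subst J_def) (simp add: J_def)
    also have "(\<Sum>l\<in>set s. (of_int (string_sign t) * PS (t @ [l])) * (of_int (app_sign (J - {l}) l) * pvar (J - {l}))) =
       (\<Sum>j<k. (of_int (string_sign t) * PS (t @ [s ! j])) * (of_int (app_sign (J - {s ! j}) (s ! j)) * pvar (J - {s ! j})))"
      by (rule sum.reindex_bij_betw[symmetric]) (use bij_betw_nth[of s "{..<k}" "set s"] 4 s in auto)
    also have "\<dots> = (\<Sum>j<k. (of_int (string_sign t) * PS (t @ [s ! j])) * (- of_int \<eta> * PS (s[j := x])))"
      by (rule sum.cong) (use x2 in auto)
    finally have "plucker_relation (set t) J = of_int (string_sign t * \<eta>) * 
        (PS (t @ [x]) * PS s - (\<Sum>j<k. PS (t @ [s ! j]) * PS (s[j := x])))"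
      by (simp add: algebra_simps sum_distrib_left sum_negf)
    moreover have "(string_sign t * \<eta>) * (string_sign t * \<eta>) = 1"
      using string_sign_pm_one[OF 4(1)] string_sign_pm_one[of "s @ [x]"] 4 by (simp add: \<eta>_def algebra_simps)
    ultimately have "of_int (string_sign t * \<eta>) * plucker_relation (set t) J = 
        PS (t @ [x]) * PS s - (\<Sum>j<k. PS (t @ [s ! j]) * PS (s[j := x]))"
      by (simp only: mult.assoc[symmetric] of_int_mult[symmetric]) simp
    then show ?thesis using OPI_of_int_mult[OF OPI_plucker[OF I J], of "string_sign t * \<eta>"] by simp
  qed
qed

text \<open>Contractions are orthogonality quadrics. For each fixed position \<open>i\<close> the
  exchange sum over \<open>j\<close> is the original product modulo a Plucker relation, and the
  \<open>k\<close> positions together give the coefficient \<open>2 * k\<close>.\<close>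

lemma sum_D_PS_D_PS_in_OPI:
  assumes s: "set s \<subseteq> {1..n}" "length s = k" and s': "set s' \<subseteq> {1..n}" "length s' = k"
  shows "(\<Sum>a\<in>{1..n}. \<Sum>b\<in>{1..n}. D a b (PS s) * D a b (PS s')) + of_nat (2 * k) * (PS s * PS s') \<in> OPI"
proof -
  have nth: "i < k \<Longrightarrow> s ! i \<in> {1..n}" for i using s nth_mem by blast
  have A: "(\<Sum>a\<in>{1..n}. PS (s[i := a]) * PS (s'[j := a])) \<in> OPI" if ij: "i < k" "j < k" for i j
  proof -
    obtain t \<epsilon> where t: "length t = length s - 1" "set t \<subseteq> set s" "\<And>a. PS (s[i := a]) = of_int \<epsilon> * PS (t @ [a])"
      using PS_update_last[of i s] ij s by metis
    obtain t' \<epsilon>' where t': "length t' = length s' - 1" "set t' \<subseteq> set s'" "\<And>a. PS (s'[j := a]) = of_int \<epsilon>' * PS (t' @ [a])"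
      using PS_update_last[of j s'] ij s' by metis
    have "(\<Sum>a\<in>{1..n}. PS (s[i := a]) * PS (s'[j := a])) = of_int (\<epsilon> * \<epsilon>') * (\<Sum>a\<in>{1..n}. PS (t @ [a]) * PS (t' @ [a]))"
      unfolding t(3) t'(3) sum_distrib_left by (simp add: algebra_simps)
    moreover have "(\<Sum>a\<in>{1..n}. PS (t @ [a]) * PS (t' @ [a])) \<in> OPI"
      by (rule ortho_string_in_OPI) (use t t' s s' in auto)
    ultimately show ?thesis by (simp only: OPI_of_int_mult)
  qed
  have B: "PS s * PS s' - (\<Sum>j<k. PS (s[i := s' ! j]) * PS (s'[j := s ! i])) \<in> OPI" if i: "i < k" for i
  proof -
    obtain t \<epsilon> where t: "length t = length s - 1" "set t \<subseteq> set s" "\<And>a. PS (s[i := a]) = of_int \<epsilon> * PS (t @ [a])"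
      using PS_update_last[of i s] i s by metis
    have "PS s = of_int \<epsilon> * PS (t @ [s ! i])" using t(3)[of "s ! i"] by simp
    then have "PS s * PS s' - (\<Sum>j<k. PS (s[i := s' ! j]) * PS (s'[j := s ! i])) = 
       of_int \<epsilon> * (PS (t @ [s ! i]) * PS s' - (\<Sum>j<k. PS (t @ [s' ! j]) * PS (s'[j := s ! i])))"
      unfolding t(3) right_diff_distrib sum_distrib_left by (simp add: algebra_simps)
    moreover have "PS (t @ [s ! i]) * PS s' - (\<Sum>j<k. PS (t @ [s' ! j]) * PS (s'[j := s ! i])) \<in> OPI"
      by (rule plucker_string_in_OPI) (use t s s' nth[OF i] in auto)
    ultimately show ?thesis by (simp only: OPI_of_int_mult)
  qed
  have "(\<Sum>i<k. PS s * PS s' - (\<Sum>j<k. PS (s[i := s' ! j]) * PS (s'[j := s ! i]))) \<in> OPI"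
    using B by (intro OPI_sum) auto
  then have b: "of_nat k * (PS s * PS s') - (\<Sum>i<k. \<Sum>j<k. PS (s[i := s' ! j]) * PS (s'[j := s ! i])) \<in> OPI"
    by (simp add: sum_subtractf)
  have a: "(\<Sum>i<k. \<Sum>j<k. if s ! i = s' ! j then \<Sum>a\<in>{1..n}. PS (s[i := a]) * PS (s'[j := a]) else 0) \<in> OPI"
    using A by (intro OPI_sum) (auto intro: OPI_0)
  have "of_int 2 * ((\<Sum>i<k. \<Sum>j<k. if s ! i = s' ! j then \<Sum>a\<in>{1..n}. PS (s[i := a]) * PS (s'[j := a]) else 0)
      + (of_nat k * (PS s * PS s') - (\<Sum>i<k. \<Sum>j<k. PS (s[i := s' ! j]) * PS (s'[j := s ! i])))) \<in> OPI"
    by (intro OPI_of_int_mult OPI_add a b)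
  then show ?thesis unfolding sum_D_PS_D_PS[OF s s'] by (simp add: algebra_simps)
qed

lemma pvar_as_PS: assumes "S \<in> ksubsets k n" 
  obtains s where "pvar S = PS s" "set s \<subseteq> {1..n}" "length s = k"
  using that[of "sorted_list_of_set S"] assms ksubsets_finite(1)[OF assms] by (auto simp: ksubsets_def)

text \<open>By the Leibniz rule every one of the \<open>d\<close> linear factors of \<open>f\<close>
  contributes \<open>2 * k\<close>.\<close>

lemma sum_D_D_in_OPI:
  assumes "f \<in> graded_part k n d" "S \<in> ksubsets k n"
  shows "(\<Sum>a\<in>{1..n}. \<Sum>b\<in>{1..n}. D a b f * D a b (pvar S)) + of_nat (2 * k * d) * (f * pvar S) \<in> OPI"
  using assms(1)
proof (induction rule: graded_induct)
  case (add d f g)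
  from OPI_add[OF this] show ?case by (simp add: D_add algebra_simps sum.distrib)
next
  case (scale d c f)
  have "(\<Sum>a\<in>{1..n}. \<Sum>b\<in>{1..n}. D a b (const_poly c * f) * D a b (pvar S)) + of_nat (2 * k * d) * ((const_poly c * f) * pvar S)
    = const_poly c * ((\<Sum>a\<in>{1..n}. \<Sum>b\<in>{1..n}. D a b f * D a b (pvar S)) + of_nat (2 * k * d) * (f * pvar S))"
    unfolding D_const_mult distrib_left sum_distrib_left mult.assoc by (simp only: mult.left_commute)
  then show ?case using OPI_const_mult[OF scale, of c] by simp
next
  case (mult d T f)
  obtain s where s: "pvar S = PS s" "set s \<subseteq> {1..n}" "length s = k" by (rule pvar_as_PS[OF assms(2)])
  obtain t where t: "pvar T = PS t" "set t \<subseteq> {1..n}" "length t = k" by (rule pvar_as_PS[OF mult(2)])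
  have "pvar T * ((\<Sum>a\<in>{1..n}. \<Sum>b\<in>{1..n}. D a b f * D a b (pvar S)) + of_nat (2 * k * d) * (f * pvar S)) \<in> OPI"
    using mult by (intro OPI_mult carrier_var)
  moreover have "f * ((\<Sum>a\<in>{1..n}. \<Sum>b\<in>{1..n}. D a b (PS t) * D a b (PS s)) + of_nat (2 * k) * (PS t * PS s)) \<in> OPI"
    using mult(1) graded_subset by (intro OPI_mult sum_D_PS_D_PS_in_OPI s t) blast
  ultimately have "pvar T * ((\<Sum>a\<in>{1..n}. \<Sum>b\<in>{1..n}. D a b f * D a b (pvar S)) + of_nat (2 * k * d) * (f * pvar S)) +
    f * ((\<Sum>a\<in>{1..n}. \<Sum>b\<in>{1..n}. D a b (pvar T) * D a b (pvar S)) + of_nat (2 * k) * (pvar T * pvar S)) \<in> OPI"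
    unfolding s(1) t(1) by (rule OPI_add)
  then show ?case
    by (simp add: D_mult algebra_simps sum.distrib sum_distrib_left)
qed (simp_all add: OPI_0)

text \<open>Induction on the degree. Multiplying by a variable adds the eigenvalue
  \<open>2 * k * (n - k)\<close> of the variable and twice the cross term, which is
  \<open>2 * k * d\<close>; this is the recursion satisfied by \<open>cas_eig\<close>.\<close>

lemma Cas_in_OPI:
  assumes "f \<in> graded_part k n d" "n \<ge> k"
  shows "Cas n f + of_nat (cas_eig k n d) * f \<in> OPI"
  using assms(1)
proof (induction rule: graded_induct)
  case zero then show ?case by (simp add: Cas_def OPI_0)
next
  case one then show ?case by (simp add: Cas_def OPI_0 cas_eig_def)
next
  case (add d f g)
  from OPI_add[OF this] show ?case by (simp add: Cas_add algebra_simps)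
next
  case (scale d c f)
  have "Cas n (const_poly c * f) + of_nat (cas_eig k n d) * (const_poly c * f) = const_poly c * (Cas n f + of_nat (cas_eig k n d) * f)"
    unfolding Cas_const_mult distrib_left by (simp only: mult.left_commute)
  then show ?case using OPI_const_mult[OF scale, of c] by simp
next
  case (mult d S f)
  obtain s where s: "pvar S = PS s" "set s \<subseteq> {1..n}" "length s = k" by (rule pvar_as_PS[OF mult(2)])
  have "pvar S * (Cas n f + of_nat (cas_eig k n d) * f) \<in> OPI"
    using mult by (intro OPI_mult carrier_var)
  moreover have "of_int 2 * ((\<Sum>a\<in>{1..n}. \<Sum>b\<in>{1..n}. D a b f * D a b (pvar S)) + of_nat (2 * k * d) * (f * pvar S)) \<in> OPI"
    by (intro OPI_of_int_mult sum_D_D_in_OPI mult)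
  ultimately have "pvar S * (Cas n f + of_nat (cas_eig k n d) * f) + 
    of_int 2 * ((\<Sum>a\<in>{1..n}. \<Sum>b\<in>{1..n}. D a b f * D a b (pvar S)) + of_nat (2 * k * d) * (f * pvar S)) \<in> OPI"
    by (rule OPI_add)
  moreover have c1: "Cas n (pvar S * f) = pvar S * Cas n f + f * Cas n (pvar S) + of_int 2 * (\<Sum>a\<in>{1..n}. \<Sum>b\<in>{1..n}. D a b f * D a b (pvar S))"
    by (simp add: Cas_mult mult.commute)
  moreover have c2: "Cas n (pvar S) = of_int (- 2 * int k * (int n - int k)) * pvar S"
    unfolding s(1) by (rule Cas_PS[OF s(2,3)])
  moreover have "int (cas_eig k n (Suc d)) = int (cas_eig k n d) + 2 * int k * (int n - int k) + 2 * int (2 * k * d)"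
  proof -
    obtain r where "n = k + r" using assms(2) le_Suc_ex by blast
    then show ?thesis by (cases d) (simp_all add: cas_eig_def algebra_simps)
  qed
  then have c3: "(of_nat (cas_eig k n (Suc d)) :: ppoly) = of_nat (cas_eig k n d) + of_int (2 * int k * (int n - int k)) + of_int 2 * of_nat (2 * k * d)"
    by (metis of_int_add of_int_mult of_int_of_nat_eq)
  moreover have "Cas n (pvar S * f) + of_nat (cas_eig k n (Suc d)) * (pvar S * f) = pvar S * (Cas n f + of_nat (cas_eig k n d) * f) + 
    of_int 2 * ((\<Sum>a\<in>{1..n}. \<Sum>b\<in>{1..n}. D a b f * D a b (pvar S)) + of_nat (2 * k * d) * (f * pvar S))"
    by (simp only: c1 c2 c3) (simp add: algebra_simps)
  ultimately show ?case by (simp only:)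
qed

end

section \<open>Points: minors, isotropic subspaces, and the orbit with its prime ideal\<close>

section \<open>Minors and the vanishing of the quadrics\<close>

text \<open>The minor with columns listed by a string, in any order and with repetitions: the value
  of \<open>PS s\<close> at the frame \<open>M\<close>. Rows count from 0, columns from 1.\<close>

definition sd :: "nat \<Rightarrow> (nat \<Rightarrow> nat \<Rightarrow> complex) \<Rightarrow> nat list \<Rightarrow> complex" where
  "sd k M s = det (mat k k (\<lambda>(a, i). M a (s ! i)))"

definition pc :: "nat \<Rightarrow> (nat \<Rightarrow> nat \<Rightarrow> complex) \<Rightarrow> nat set \<Rightarrow> complex" where
  "pc k M S = sd k M (sorted_list_of_set S)"

lemma sd_leibniz: "sd k M s = (\<Sum>p | p permutes {..<k}. of_int (sign p) * (\<Prod>j<k. M (p j) (s ! j)))"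
proof -
  have "sd k M s = (\<Sum>p | p permutes {0..<k}. of_int (sign p) * (\<Prod>j<k. mat k k (\<lambda>(a, i). M a (s ! i)) $$ (p j, j)))"
    unfolding sd_def by (rule det_col) simp
  also have "\<dots> = (\<Sum>p | p permutes {..<k}. of_int (sign p) * (\<Prod>j<k. M (p j) (s ! j)))"
  proof (intro sum.cong arg_cong2[of _ _ _ _ "(*)"] refl prod.cong)
    show "{p. p permutes {0..<k}} = {p. p permutes {..<k}}" by (simp add: atLeast0LessThan)
    fix p j assume "p \<in> {p. p permutes {..<k}}" "j \<in> {..<k}"
    then show "mat k k (\<lambda>(a, i). M a (s ! i)) $$ (p j, j) = M (p j) (s ! j)"
      using permutes_in_image[of p "{..<k}" j] by auto
  qed
  finally show ?thesis .
qed

lemma sd_permute_list: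
  assumes "\<tau> permutes {..<k}" "length s = k"
  shows "sd k M (permute_list \<tau> s) = of_int (sign \<tau>) * sd k M s"
proof -
  let ?i = "inv_into UNIV \<tau>"
  have it: "?i permutes {..<k}" by (rule permutes_inv[OF assms(1)])
  have "sd k M (permute_list \<tau> s) = (\<Sum>p | p permutes {..<k}. of_int (sign p) * (\<Prod>j<k. M (p j) (s ! \<tau> j)))"
    unfolding sd_leibniz using assms by (intro sum.cong refl arg_cong2[of _ _ _ _ "(*)"] prod.cong) (auto simp: permute_list_nth)
  also have "\<dots> = (\<Sum>p | p permutes {..<k}. of_int (sign p) * (\<Prod>j<k. M (p (?i j)) (s ! j)))"
    by (subst prod.permute[OF it]) (simp add: o_def permutes_inverses[OF assms(1)])
  also have "\<dots> = (\<Sum>p | p permutes {..<k}. of_int (sign (p \<circ> \<tau>)) * (\<Prod>j<k. M ((p \<circ> \<tau>) (?i j)) (s ! j)))"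
    by (rule sum_permutations_compose_right[OF assms(1)])
  also have "\<dots> = (\<Sum>p | p permutes {..<k}. of_int (sign \<tau>) * (of_int (sign p) * (\<Prod>j<k. M (p j) (s ! j))))"
  proof (rule sum.cong[OF refl])
    fix p assume "p \<in> {p. p permutes {..<k}}"
    then have "sign (p \<circ> \<tau>) = sign p * sign \<tau>"
      using assms(1) by (metis finite_lessThan mem_Collect_eq permutation_permutes sign_compose)
    then show "of_int (sign (p \<circ> \<tau>)) * (\<Prod>j<k. M ((p \<circ> \<tau>) (?i j)) (s ! j)) = of_int (sign \<tau>) * (of_int (sign p) * (\<Prod>j<k. M (p j) (s ! j)))"
      by (simp add: permutes_inverses[OF assms(1)])
  qed
  finally show ?thesis by (simp add: sd_leibniz sum_distrib_left)
qed

lemma sd_repeat: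
  assumes "\<not> distinct s" "length s = k"
  shows "sd k M s = 0"
proof -
  obtain i j where ij: "i < k" "j < k" "i \<noteq> j" "s ! i = s ! j"
    using assms by (auto simp: distinct_conv_nth)
  show ?thesis unfolding sd_def
    by (rule det_identical_columns[of _ k i j]) (use ij in \<open>auto intro!: eq_vecI\<close>)
qed

lemma peval_PS:
  assumes "length s = k"
  shows "peval (PS s) (\<lambda>S. c * pc k M S) = c * sd k M s"
proof (cases "distinct s")
  case True
  define s0 where "s0 = sorted_list_of_set (set s)"
  obtain \<tau> where t: "\<tau> permutes {..<length s}" "s = permute_list \<tau> s0"
    by (rule distinct_permute_sorted[OF True, folded s0_def])
  have len: "length s0 = length s" using True by (simp add: s0_def distinct_card)
  have "string_sign s0 = 1" unfolding s0_def by (rule string_sign_sorted) auto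
  then have sg: "string_sign s = sign \<tau>"
    using string_sign_permute_list[of s0 \<tau>, folded t(2)] t(1) len by (simp add: s0_def)
  have "peval (PS s) (\<lambda>S. c * pc k M S) = of_int (sign \<tau>) * (c * sd k M s0)"
    using True by (simp add: PS_def sg peval.hev_mult pc_def s0_def)
  moreover have "sd k M s = of_int (sign \<tau>) * sd k M s0"
    using sd_permute_list[of \<tau> k s0 M, folded t(2)] t(1) len assms by simp
  ultimately show ?thesis by (simp only: mult.left_commute)
next
  case False
  then show ?thesis using sd_repeat[OF False assms] by (simp add: PS_def)
qed

lemma sd_expand_last_column:
  assumes "length t = k - 1" "k \<ge> 1"
  obtains C where "\<And>l. sd k M (t @ [l]) = (\<Sum>a<k. M a l * C a)"
proof -
  define A where "A l = mat k k (\<lambda>(a, i). M a ((t @ [l]) ! i))" for l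
  have "sd k M (t @ [l]) = (\<Sum>a<k. M a l * cofactor (A 0) a (k - 1))" for l
  proof -
    have "sd k M (t @ [l]) = (\<Sum>a<k. A l $$ (a, k - 1) * cofactor (A l) a (k - 1))"
      unfolding sd_def A_def by (rule laplace_expansion_column) (use assms in auto)
    also have "\<dots> = (\<Sum>a<k. M a l * cofactor (A 0) a (k - 1))"
    proof (intro sum.cong refl arg_cong2[of _ _ _ _ "(*)"])
      fix a assume a: "a \<in> {..<k}"
      show "A l $$ (a, k - 1) = M a l" using a assms by (simp add: A_def nth_append)
      have "mat_delete (A l) a (k - 1) = mat_delete (A 0) a (k - 1)"
        by (rule eq_matI) (use assms in \<open>auto simp: mat_delete_def A_def nth_append\<close>)
      then show "cofactor (A l) a (k - 1) = cofactor (A 0) a (k - 1)" by (simp add: cofactor_def)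
    qed
    finally show ?thesis .
  qed
  then show ?thesis using that[of "\<lambda>a. cofactor (A 0) a (k - 1)"] by blast
qed

lemma sd_expand_last_row:
  assumes "length s = Suc k"
  obtains C where "\<And>v. sd (Suc k) (M(k := v)) s = (\<Sum>r<Suc k. v (s ! r) * C r)" "C k = sd k M (butlast s)"
proof -
  define A where "A v = mat (Suc k) (Suc k) (\<lambda>(a, i). (M(k := v)) a (s ! i))" for v
  have 1: "sd (Suc k) (M(k := v)) s = (\<Sum>r<Suc k. v (s ! r) * cofactor (A (\<lambda>_. 0)) k r)" for v
  proof -
    have "sd (Suc k) (M(k := v)) s = (\<Sum>r<Suc k. A v $$ (k, r) * cofactor (A v) k r)"
      unfolding sd_def A_def by (rule laplace_expansion_row) auto
    also have "\<dots> = (\<Sum>r<Suc k. v (s ! r) * cofactor (A (\<lambda>_. 0)) k r)"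
    proof (intro sum.cong refl arg_cong2[of _ _ _ _ "(*)"])
      fix r assume r: "r \<in> {..<Suc k}"
      show "A v $$ (k, r) = v (s ! r)" using r by (simp add: A_def)
      have "mat_delete (A v) k r = mat_delete (A (\<lambda>_. 0)) k r"
        by (rule eq_matI) (use r in \<open>auto simp: mat_delete_def A_def\<close>)
      then show "cofactor (A v) k r = cofactor (A (\<lambda>_. 0)) k r" by (simp add: cofactor_def)
    qed
    finally show ?thesis .
  qed
  have "mat_delete (A (\<lambda>_. 0)) k k = mat k k (\<lambda>(a, i). M a (butlast s ! i))"
    by (rule eq_matI) (use assms in \<open>auto simp: mat_delete_def A_def nth_butlast\<close>)
  then have "cofactor (A (\<lambda>_. 0)) k k = sd k M (butlast s)" by (simp add: cofactor_def sd_def)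
  with 1 show ?thesis using that[of "\<lambda>r. cofactor (A (\<lambda>_. 0)) k r"] by blast
qed

text \<open>Laplace expansion along an extra row \<open>v\<close>; the content is that
  \<open>app_sign\<close> is the sign of the cofactor.\<close>

lemma sum_app_sign_minors:
  assumes J: "finite J" "card J = Suc k"
  shows "(\<Sum>l\<in>J. v l * of_int (app_sign (J - {l}) l) * pc k M (J - {l})) = sd (Suc k) (M(k := v)) (sorted_list_of_set J)"
proof -
  define s where "s = sorted_list_of_set J"
  have s: "length s = Suc k" "distinct s" "set s = J" using J by (auto simp: s_def)
  obtain C where C: "\<And>v. sd (Suc k) (M(k := v)) s = (\<Sum>r<Suc k. v (s ! r) * C r)"
    using sd_expand_last_row[OF s(1)] by metis
  have Cr: "C r = of_int (app_sign (J - {s ! r}) (s ! r)) * pc k M (J - {s ! r})" if r: "r < Suc k" for r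
  proof -
    define l where "l = s ! r"
    \<comment> \<open>The indicator row of \<open>l\<close> extracts one cofactor from each
      expansion: from the sorted string the unknown \<open>C r\<close>, and from the string ending
      in \<open>l\<close> the bare minor. The two strings differ by the permutation that
      \<open>app_sign\<close> measures.\<close>
    define e where "e c = (if c = l then 1 else 0 :: complex)" for c
    have lJ: "l \<in> J" using s r by (auto simp: l_def)
    define u where "u = sorted_list_of_set (J - {l}) @ [l]"
    have u: "length u = Suc k" "distinct u" "set u = J" using J lJ by (auto simp: u_def)
    obtain \<tau> where t: "\<tau> permutes {..<length u}" "u = permute_list \<tau> (sorted_list_of_set (set u))"
      by (rule distinct_permute_sorted[OF u(2)])
    have us: "u = permute_list \<tau> s" using t(2) u by (simp add: s_def)
    have sg: "string_sign u = sign \<tau>"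
      using string_sign_permute_list[of s \<tau>, folded us] t(1) u s string_sign_sorted[of s] by (simp add: s_def)
    have "sd (Suc k) (M(k := e)) s = (\<Sum>i<Suc k. e (s ! i) * C i)" by (rule C)
    also have "\<dots> = (\<Sum>i<Suc k. if r = i then C i else 0)"
      by (intro sum.cong refl) (use s r in \<open>auto simp: e_def l_def nth_eq_iff_index_eq\<close>)
    also have "\<dots> = C r" using r by (simp add: sum.delta)
    finally have 1: "sd (Suc k) (M(k := e)) s = C r" .
    obtain C' where C': "\<And>v. sd (Suc k) (M(k := v)) u = (\<Sum>r<Suc k. v (u ! r) * C' r)" "C' k = sd k M (butlast u)"
      using sd_expand_last_row[OF u(1)] by metis
    have "sd (Suc k) (M(k := e)) u = (\<Sum>i<Suc k. e (u ! i) * C' i)" by (rule C')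
    also have "\<dots> = (\<Sum>i<Suc k. if k = i then C' i else 0)"
    proof (intro sum.cong refl)
      fix i assume "i \<in> {..<Suc k}"
      moreover have "u ! k = l" using u(1) by (simp add: u_def nth_append)
      ultimately have "u ! i = l \<longleftrightarrow> k = i" using u by (auto simp: nth_eq_iff_index_eq)
      then show "e (u ! i) * C' i = (if k = i then C' i else 0)" by (auto simp: e_def)
    qed
    also have "\<dots> = sd k M (butlast u)" using C'(2) by (simp add: sum.delta)
    finally have 2: "sd (Suc k) (M(k := e)) u = pc k M (J - {l})" by (simp add: u_def pc_def)
    have "sd (Suc k) (M(k := e)) u = of_int (sign \<tau>) * sd (Suc k) (M(k := e)) s"
      unfolding us by (rule sd_permute_list) (use t u s in auto)
    then have "pc k M (J - {l}) = of_int (string_sign u) * C r" using 1 2 sg by simp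
    then have "of_int (string_sign u) * pc k M (J - {l}) = of_int (string_sign u * string_sign u) * C r"
      by (simp only: of_int_mult mult.assoc)
    then have "of_int (string_sign u) * pc k M (J - {l}) = C r" by (simp only: string_sign_pm_one[OF u(2)] of_int_1 mult_1)
    then show ?thesis unfolding l_def u_def app_sign_def by (rule sym)
  qed
  have "(\<Sum>l\<in>J. v l * of_int (app_sign (J - {l}) l) * pc k M (J - {l})) = 
      (\<Sum>r<Suc k. v (s ! r) * of_int (app_sign (J - {s ! r}) (s ! r)) * pc k M (J - {s ! r}))"
    by (rule sum.reindex_bij_betw[symmetric]) (use bij_betw_nth[of s "{..<Suc k}" J] s in auto)
  also have "\<dots> = (\<Sum>r<Suc k. v (s ! r) * C r)" by (intro sum.cong refl) (simp add: Cr)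
  finally show ?thesis using C by (simp add: s_def)
qed

text \<open>Expanding the first minor along its last column leaves, for each row \<open>a\<close>, a
  determinant of size \<open>k + 1\<close> in which row \<open>a\<close> of \<open>M\<close> occurs
  twice.\<close>

lemma peval_plucker_relation:
  assumes "k \<ge> 1" and I: "I \<in> ksubsets (k - 1) n" and J: "J \<in> ksubsets (k + 1) n"
  shows "peval (plucker_relation I J) (\<lambda>S. c * pc k M S) = 0"
proof -
  have fin: "finite I" "finite J" using I J by (auto intro: ksubsets_finite)
  have len: "length (sorted_list_of_set I) = k - 1" "card J = Suc k" using I J by (auto simp: ksubsets_def)
  obtain C where C: "\<And>l. sd k M (sorted_list_of_set I @ [l]) = (\<Sum>a<k. M a l * C a)"
    using sd_expand_last_column[OF len(1) assms(1)] by metis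
  have "plucker_relation I J = (\<Sum>l\<in>J. PS (sorted_list_of_set I @ [l]) * (of_int (app_sign (J - {l}) l) * pvar (J - {l})))"
    unfolding plucker_relation_def app_sign_app_var[OF fin(1), symmetric] by (intro sum.cong refl) (simp add: mult_ac)
  then have "peval (plucker_relation I J) (\<lambda>S. c * pc k M S) = 
     (\<Sum>l\<in>J. c * sd k M (sorted_list_of_set I @ [l]) * (of_int (app_sign (J - {l}) l) * (c * pc k M (J - {l}))))"
    using len assms by (simp add: peval.hev_sum peval.hev_mult peval_PS)
  also have "\<dots> = (\<Sum>l\<in>J. \<Sum>a<k. c^2 * C a * (M a l * of_int (app_sign (J - {l}) l) * pc k M (J - {l})))"
    unfolding C by (intro sum.cong refl) (simp add: sum_distrib_left sum_distrib_right power2_eq_square mult_ac)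
  also have "\<dots> = (\<Sum>a<k. c^2 * C a * (\<Sum>l\<in>J. M a l * of_int (app_sign (J - {l}) l) * pc k M (J - {l})))"
    by (subst sum.swap) (simp add: sum_distrib_left)
  also have "\<dots> = (\<Sum>a<k. c^2 * C a * sd (Suc k) (M(k := M a)) (sorted_list_of_set J))"
    by (simp add: sum_app_sign_minors[OF fin(2) len(2)])
  also have "\<dots> = 0"
  proof (intro sum.neutral ballI)
    fix a assume "a \<in> {..<k}"
    then have "sd (Suc k) (M(k := M a)) (sorted_list_of_set J) = 0"
      unfolding sd_def by (intro det_identical_rows[of _ "Suc k" a k]) (auto intro!: eq_vecI)
    then show "c^2 * C a * sd (Suc k) (M(k := M a)) (sorted_list_of_set J) = 0" by simp
  qed
  finally show ?thesis .
qed

definition isotropic_rows :: "nat \<Rightarrow> nat \<Rightarrow> (nat \<Rightarrow> nat \<Rightarrow> complex) \<Rightarrow> bool" where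
  "isotropic_rows k n M \<longleftrightarrow> (\<forall>a<k. \<forall>b<k. (\<Sum>l\<in>{1..n}. M a l * M b l) = 0)"

text \<open>Both minors are linear in the free column, so the sum over that column turns into
  entries of the Gram matrix of the rows.\<close>

lemma peval_ortho_quadric:
  assumes "k \<ge> 1" and I: "I \<in> ksubsets (k - 1) n" and J: "J \<in> ksubsets (k - 1) n" and iso: "isotropic_rows k n M"
  shows "peval (ortho_quadric n I J) (\<lambda>S. c * pc k M S) = 0"
proof -
  have fin: "finite I" "finite J" using I J by (auto intro: ksubsets_finite)
  have len: "length (sorted_list_of_set I) = k - 1" "length (sorted_list_of_set J) = k - 1" using I J by (auto simp: ksubsets_def)
  obtain C where C: "\<And>l. sd k M (sorted_list_of_set I @ [l]) = (\<Sum>a<k. M a l * C a)"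
    using sd_expand_last_column[OF len(1) assms(1)] by metis
  obtain C' where C': "\<And>l. sd k M (sorted_list_of_set J @ [l]) = (\<Sum>a<k. M a l * C' a)"
    using sd_expand_last_column[OF len(2) assms(1)] by metis
  have "ortho_quadric n I J = (\<Sum>l=1..n. PS (sorted_list_of_set I @ [l]) * PS (sorted_list_of_set J @ [l]))"
    unfolding ortho_quadric_def app_sign_app_var[OF fin(1), symmetric] app_sign_app_var[OF fin(2), symmetric] 
    by (intro sum.cong refl) (simp add: mult_ac)
  then have "peval (ortho_quadric n I J) (\<lambda>S. c * pc k M S) = 
     (\<Sum>l=1..n. c * (\<Sum>a<k. M a l * C a) * (c * (\<Sum>b<k. M b l * C' b)))"
    using len assms(1) by (simp add: peval.hev_sum peval.hev_mult peval_PS C C')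
  also have "\<dots> = (\<Sum>l=1..n. \<Sum>a<k. \<Sum>b<k. c^2 * C a * C' b * (M a l * M b l))"
    by (intro sum.cong refl) (simp add: sum_distrib_left sum_distrib_right sum_product power2_eq_square mult_ac)
  also have "\<dots> = (\<Sum>a<k. \<Sum>b<k. c^2 * C a * C' b * (\<Sum>l=1..n. M a l * M b l))"
    by (subst sum.swap, rule sum.cong[OF refl], subst sum.swap, simp add: sum_distrib_left)
  also have "\<dots> = 0" using iso by (simp add: isotropic_rows_def)
  finally show ?thesis .
qed

lemma point_ideal: "ideal {f \<in> carrier (plucker_ring k n). \<forall>q\<in>Q. peval f q = 0} (plucker_ring k n)"
proof -
  interpret R: cring "plucker_ring k n" by (rule cring_plucker_ring)
  show ?thesis
  proof (rule idealI)
    show "ring (plucker_ring k n)" by (rule R.ring_axioms)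
    show "subgroup {f \<in> carrier (plucker_ring k n). \<forall>q\<in>Q. peval f q = 0} (add_monoid (plucker_ring k n))"
    proof (rule R.add.subgroupI)
      fix a b assume a: "a \<in> {f \<in> carrier (plucker_ring k n). \<forall>q\<in>Q. peval f q = 0}"
      have m: "\<ominus>\<^bsub>plucker_ring k n\<^esub> a = - a"
        using a by (intro R.minus_equality) (auto simp: carrier_uminus)
      show "\<ominus>\<^bsub>plucker_ring k n\<^esub> a \<in> {f \<in> carrier (plucker_ring k n). \<forall>q\<in>Q. peval f q = 0}"
        unfolding m using a by (auto simp: carrier_uminus)
    qed (use carrier_0[of k n] in \<open>auto simp: carrier_add peval.hev_add\<close>)
  qed (auto simp: carrier_mult peval.hev_mult)
qed

lemma OPI_subset_point_ideal:
  assumes "k \<ge> 1" "\<And>q. q \<in> Q \<Longrightarrow> \<exists>c M. q = (\<lambda>S. c * pc k M S) \<and> isotropic_rows k n M"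
  shows "ortho_plucker_ideal k n \<subseteq> {f \<in> carrier (plucker_ring k n). \<forall>q\<in>Q. peval f q = 0}"
proof -
  interpret R: cring "plucker_ring k n" by (rule cring_plucker_ring)
  show ?thesis unfolding ortho_plucker_ideal_def
  proof (rule R.genideal_minimal[OF point_ideal])
    show "{plucker_relation I J | I J. I \<in> ksubsets (k - 1) n \<and> J \<in> ksubsets (k + 1) n} \<union>
       {ortho_quadric n I J | I J. I \<in> ksubsets (k - 1) n \<and> J \<in> ksubsets (k - 1) n}
      \<subseteq> {f \<in> carrier (plucker_ring k n). \<forall>q\<in>Q. peval f q = 0}" (is "?G \<subseteq> _")
    proof
      fix f assume f: "f \<in> ?G"
      then have "f \<in> carrier (plucker_ring k n)" using plucker_gens_carrier[OF assms(1)] by blast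
      moreover have "peval f q = 0" if q: "q \<in> Q" for q
      proof -
        obtain c M where "q = (\<lambda>S. c * pc k M S)" "isotropic_rows k n M" using assms(2)[OF q] by blast
        then show ?thesis using f peval_plucker_relation[OF assms(1)] peval_ortho_quadric[OF assms(1)] by blast
      qed
      ultimately show "f \<in> {f \<in> carrier (plucker_ring k n). \<forall>q\<in>Q. peval f q = 0}" by blast
    qed
  qed
qed

section \<open>Isotropic subspaces\<close>

lemma peval_cong:
  assumes "f \<in> carrier (plucker_ring k n)" "\<And>S. S \<in> ksubsets k n \<Longrightarrow> q S = q' S"
  shows "peval f q = peval f q'"
  unfolding peval_def using assms 
  by (intro sum.cong refl arg_cong2[of _ _ _ _ "(*)"] prod.cong) (metis carrier_plucker_iff subsetD)

lemma plucker_coord_eq_pc: "plucker_coord B S = pc (length B) (\<lambda>a c. (B ! a) $ (c - 1)) S"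
  by (simp add: plucker_coord_def pc_def sd_def)

lemma sum_shift_one: "(\<Sum>l\<in>{1..n}. f (l - 1)) = (\<Sum>i\<in>{0..<n}. f i)" for f :: "nat \<Rightarrow> complex"
  by (rule sum.reindex_bij_witness[of _ "\<lambda>i. i + 1" "\<lambda>l. l - 1"]) auto

lemma OPI_subset_vanishing:
  assumes "k \<ge> 1"
  shows "ortho_plucker_ideal k n \<subseteq> vanishing_ideal k n (plucker_point n ` OGr k n)"
proof -
  let ?Q = "\<Union>(plucker_point n ` OGr k n)"
  have "ortho_plucker_ideal k n \<subseteq> {f \<in> carrier (plucker_ring k n). \<forall>q\<in>?Q. peval f q = 0}"
  proof (rule OPI_subset_point_ideal[OF assms])
    fix q assume "q \<in> ?Q"
    then obtain W c B where W: "W \<in> OGr k n" and q: "q = (\<lambda>S. c * plucker_coord B S)" and B: "ordered_basis n W B"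
      by (auto simp: plucker_point_def)
    interpret V: vec_space "TYPE(complex)" n .
    have sub: "subspace class_ring W V.V" using W by (simp add: OGr_def)
    then have vs: "vectorspace class_ring (subspace_vs n W)" by (rule V.subspace_is_vs)
    have bas: "vectorspace.basis class_ring (subspace_vs n W) (set B)" using B by (simp add: ordered_basis_def)
    have BW: "set B \<subseteq> W" using vectorspace.basis_def[OF vs, of "set B"] bas by simp
    have "vectorspace.dim class_ring (subspace_vs n W) = card (set B)"
      by (rule vectorspace.dim_basis[OF vs _ bas]) simp
    then have len: "length B = k" using W B by (simp add: OGr_def ordered_basis_def distinct_card)
    have WC: "W \<subseteq> carrier_vec n" using submodule.subset[OF subspace.submod[OF sub]] by simp
    have "isotropic_rows k n (\<lambda>a c. (B ! a) $ (c - 1))"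
      unfolding isotropic_rows_def
    proof (intro allI impI)
      fix a b assume ab: "a < k" "b < k"
      then have "B ! a \<in> W" "B ! b \<in> W" using BW len by auto
      then have "B ! a \<bullet> B ! b = 0" "B ! b \<in> carrier_vec n" using W WC by (auto simp: OGr_def)
      then show "(\<Sum>l\<in>{1..n}. (B ! a) $ (l - 1) * (B ! b) $ (l - 1)) = 0"
        using sum_shift_one[of "\<lambda>i. (B ! a) $ i * (B ! b) $ i" n] by (simp add: scalar_prod_def)
    qed
    then show "\<exists>c M. q = (\<lambda>S. c * pc k M S) \<and> isotropic_rows k n M"
      unfolding q plucker_coord_eq_pc len by blast
  qed
  also have "\<dots> \<subseteq> vanishing_ideal k n (plucker_point n ` OGr k n)"
    by (auto simp: vanishing_ideal_def)
  finally show ?thesis .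
qed

definition independent_rows :: "nat \<Rightarrow> nat \<Rightarrow> (nat \<Rightarrow> nat \<Rightarrow> complex) \<Rightarrow> bool" where
  "independent_rows k n M \<longleftrightarrow> (\<forall>c. (\<forall>l\<in>{1..n}. (\<Sum>a<k. c a * M a l) = 0) \<longrightarrow> (\<forall>a<k. c a = 0))"

text \<open>Agreement is claimed on \<open>ksubsets k n\<close> only, since \<open>M\<close> may
  have arbitrary entries in columns outside \<open>{1..n}\<close>. By \<open>peval_cong\<close> this
  is all that polynomials of the ring can see.\<close>

lemma isotropic_matrix_in_OGr:
  assumes iso: "isotropic_rows k n M" and ind: "independent_rows k n M" and c: "c \<noteq> 0"
  shows "\<exists>W \<in> OGr k n. \<exists>q \<in> plucker_point n W. \<forall>S\<in>ksubsets k n. q S = c * pc k M S"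
proof -
  interpret V: vec_space "TYPE(complex)" n .
  define row where "row a = vec n (\<lambda>i. M a (i + 1))" for a
  define B where "B = map row [0..<k]"
  have len: "length B = k" by (simp add: B_def)
  have rc: "row a \<in> carrier_vec n" for a by (simp add: row_def)
  have BC: "set B \<subseteq> carrier_vec n" by (auto simp: B_def rc)
  have inj: "inj_on row {..<k}"
  proof (rule inj_onI, rule ccontr)
    fix a b assume ab: "a \<in> {..<k}" "b \<in> {..<k}" "row a = row b" "a \<noteq> b"
    define x where "x i = (if i = a then 1 else if i = b then -1 else 0 :: complex)" for i
    have "(\<Sum>i<k. x i * M i l) = 0" if l: "l \<in> {1..n}" for l
    proof -
      have "M a l = M b l" using arg_cong[OF ab(3), of "\<lambda>v. v $ (l - 1)"] l by (auto simp: row_def)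
      moreover have "(\<Sum>i<k. x i * M i l) = (\<Sum>i\<in>{a,b}. x i * M i l)"
        by (rule sum.mono_neutral_right) (use ab(1,2) in \<open>auto simp: x_def\<close>)
      moreover have "\<dots> = M a l - M b l" unfolding x_def using ab(4) by auto
      ultimately show ?thesis by (simp only: diff_self)
    qed
    then have "\<forall>i<k. x i = 0" using ind unfolding independent_rows_def by blast
    then have "x a = 0" using ab(1) by simp
    then show False by (simp add: x_def)
  qed
  then have dist: "distinct B" by (auto simp: B_def distinct_map atLeast0LessThan)
  have setB: "set B = row ` {..<k}" by (auto simp: B_def)
  have li: "\<not> V.lin_dep (set B)"
  proof (rule V.finite_lin_indpt2)
    show "finite (set B)" by simp
    show "set B \<subseteq> carrier_vec n" using BC by simp
    fix x assume z: "V.lincomb x (set B) = 0\<^sub>v n"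
    have "(\<Sum>a<k. x (row a) * M a l) = 0" if l: "l \<in> {1..n}" for l
    proof -
      have "0 = V.lincomb x (set B) $ (l - 1)" using z l by auto
      also have "\<dots> = (\<Sum>v\<in>set B. x v * v $ (l - 1))" by (rule V.lincomb_index) (use l BC in auto)
      also have "\<dots> = (\<Sum>a<k. x (row a) * row a $ (l - 1))" unfolding setB by (simp add: sum.reindex[OF inj])
      also have "\<dots> = (\<Sum>a<k. x (row a) * M a l)" using l by (intro sum.cong refl) (auto simp: row_def)
      finally show ?thesis by simp
    qed
    then have "\<forall>a<k. x (row a) = 0" using ind[unfolded independent_rows_def, rule_format, of "\<lambda>a. x (row a)"] by blast
    then show "\<forall>v\<in>set B. x v = 0" by (auto simp: setB)
  qed
  define W where "W = V.span (set B)"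
  have subm: "submodule class_ring W V.V" unfolding W_def by (rule V.span_is_submodule) (use BC in simp)
  have sub: "subspace class_ring W V.V" unfolding W_def by (rule V.span_is_subspace) (use BC in simp)
  then have vs: "vectorspace class_ring (subspace_vs n W)" by (rule V.subspace_is_vs)
  have BW: "set B \<subseteq> W" unfolding W_def using BC V.in_own_span by simp
  have bas: "vectorspace.basis class_ring (subspace_vs n W) (set B)"
    using vectorspace.basis_def[OF vs] V.span_li_not_depend[OF BW subm] li BW by (simp add: W_def)
  have dim: "vectorspace.dim class_ring (subspace_vs n W) = k"
    using vectorspace.dim_basis[OF vs _ bas] dist len by (simp add: distinct_card)
  have WC: "W \<subseteq> carrier_vec n" using submodule.subset[OF subm] by simp
  have rr: "row a \<bullet> row b = 0" if "a < k" "b < k" for a b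
  proof -
    have "row a \<bullet> row b = (\<Sum>i\<in>{0..<n}. M a (i + 1) * M b (i + 1))" by (simp add: scalar_prod_def row_def)
    also have "\<dots> = (\<Sum>l\<in>{1..n}. M a (l - 1 + 1) * M b (l - 1 + 1))" 
      by (rule sum_shift_one[of "\<lambda>i. M a (i + 1) * M b (i + 1)", symmetric])
    also have "\<dots> = (\<Sum>l\<in>{1..n}. M a l * M b l)" by (intro sum.cong) auto
    finally show ?thesis using iso that by (simp add: isotropic_rows_def)
  qed
  have orth: "x \<bullet> y = 0" if "x \<in> W" "y \<in> W" for x y
  proof -
    have *: "x \<bullet> y = 0" if x: "x \<in> W" and y: "y \<in> carrier_vec n" "\<And>b. b < k \<Longrightarrow> row b \<bullet> y = 0" for x y
    proof -
      have "x \<in> V.span (set B)" using x W_def by simp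
      then obtain a where a: "x = V.lincomb a (set B)" using V.finite_in_span[of "set B" x] BC by auto
      have "x \<bullet> y = (\<Sum>i\<in>{0..<n}. x $ i * y $ i)" using y by (simp add: scalar_prod_def)
      also have "\<dots> = (\<Sum>i\<in>{0..<n}. \<Sum>v\<in>set B. a v * (v $ i * y $ i))"
        unfolding a by (intro sum.cong refl) (simp add: V.lincomb_index BC sum_distrib_right mult.assoc)
      also have "\<dots> = (\<Sum>v\<in>set B. a v * (\<Sum>i\<in>{0..<n}. v $ i * y $ i))"
        by (subst sum.swap) (simp add: sum_distrib_left)
      also have "\<dots> = (\<Sum>v\<in>set B. a v * (v \<bullet> y))" using y by (simp add: scalar_prod_def)
      also have "\<dots> = 0" using y by (auto simp: setB intro!: sum.neutral)
      finally show ?thesis .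
    qed
    have "row b \<bullet> y = 0" if b: "b < k" for b
      using *[OF \<open>y \<in> W\<close>, of "row b"] rr b rc that comm_scalar_prod[of "row b" n y] WC \<open>y \<in> W\<close> by auto
    then show ?thesis using * that WC by blast
  qed
  have "W \<in> OGr k n" using sub dim orth by (simp add: OGr_def)
  moreover have "(\<lambda>S. c * plucker_coord B S) \<in> plucker_point n W"
    using c dist bas by (auto simp: plucker_point_def ordered_basis_def)
  moreover have "plucker_coord B S = pc k M S" if S: "S \<in> ksubsets k n" for S
    unfolding plucker_coord_def pc_def sd_def len
  proof (intro arg_cong[of _ _ det] eq_matI)
    fix i j assume ij: "i < dim_row (mat k k (\<lambda>(a, i). M a (sorted_list_of_set S ! i)))" "j < dim_col (mat k k (\<lambda>(a, i). M a (sorted_list_of_set S ! i)))"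
    have "sorted_list_of_set S ! j \<in> set (sorted_list_of_set S)"
      by (rule nth_mem) (use ij S in \<open>simp add: ksubsets_def\<close>)
    then have "sorted_list_of_set S ! j \<in> S" using ksubsets_finite(1)[OF S] by simp
    then have "sorted_list_of_set S ! j \<in> {1..n}" using S by (auto simp: ksubsets_def)
    then show "mat k k (\<lambda>(a, b). B ! a $ (sorted_list_of_set S ! b - 1)) $$ (i, j) = mat k k (\<lambda>(a, i). M a (sorted_list_of_set S ! i)) $$ (i, j)"
      using ij by (auto simp: B_def row_def)
  qed auto
  ultimately show ?thesis by (intro bexI[of _ W] bexI[of _ "\<lambda>S. c * plucker_coord B S"]) simp_all
qed

section \<open>The orbit of a coordinate isotropic subspace\<close>

text \<open>A rational parametrisation of plane rotations, multiplied by \<open>1 + z\<^sup>2\<close> to make it polynomial.\<close>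

definition rot :: "nat \<Rightarrow> nat \<Rightarrow> complex \<Rightarrow> (nat \<Rightarrow> nat \<Rightarrow> complex) \<Rightarrow> nat \<Rightarrow> nat \<Rightarrow> complex" where
  "rot a b z M = (\<lambda>r c. if c = a then (1 - z\<^sup>2) * M r a - 2 * z * M r b
     else if c = b then 2 * z * M r a + (1 - z\<^sup>2) * M r b else (1 + z\<^sup>2) * M r c)"

text \<open>The vectors \<open>e + i e'\<close> on disjoint coordinate planes, isotropic and
  mutually orthogonal. Rows are numbered from 0, so row \<open>r\<close> occupies columns
  \<open>2 * r + 1\<close> and \<open>2 * r + 2\<close>.\<close>

definition base_frame :: "nat \<Rightarrow> nat \<Rightarrow> nat \<Rightarrow> complex" where
  "base_frame k r c = (if r < k \<and> c = 2 * r + 1 then 1 else if r < k \<and> c = 2 * r + 2 then \<i> else 0)"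

text \<open>Scaling is a constructor because the polynomial form of a rotation carries the factor
  \<open>1 + z\<^sup>2\<close>, which must be removable.\<close>

inductive_set orbit :: "nat \<Rightarrow> nat \<Rightarrow> (nat \<Rightarrow> nat \<Rightarrow> complex) set" for k n where
  base: "base_frame k \<in> orbit k n"
| rot: "M \<in> orbit k n \<Longrightarrow> a \<in> {1..n} \<Longrightarrow> b \<in> {1..n} \<Longrightarrow> a \<noteq> b \<Longrightarrow> 1 + z\<^sup>2 \<noteq> 0 \<Longrightarrow> rot a b z M \<in> orbit k n"
| scale: "M \<in> orbit k n \<Longrightarrow> c \<noteq> 0 \<Longrightarrow> (\<lambda>r i. c * M r i) \<in> orbit k n"

lemma sum_remove2:
  assumes "finite A" "a \<in> A" "b \<in> A" "a \<noteq> b"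
  shows "sum f A = f a + f b + sum f (A - {a, b})"
proof -
  have "sum f A = f a + (f b + sum f (A - {a} - {b}))"
    using assms by (simp add: sum.remove[of A a] sum.remove[of "A - {a}" b])
  moreover have "A - {a} - {b} = A - {a, b}" by blast
  ultimately show ?thesis by (simp add: add.assoc)
qed

lemma sum_base_frame:
  assumes "2 * k \<le> n" "r < k"
  shows "(\<Sum>l\<in>{1..n}. f l * base_frame k r l) = f (2 * r + 1) + \<i> * f (2 * r + 2)"
proof -
  have "(\<Sum>l\<in>{1..n}. f l * base_frame k r l) = (\<Sum>l\<in>{2*r+1, 2*r+2}. f l * base_frame k r l)"
    by (rule sum.mono_neutral_right) (use assms in \<open>auto simp: base_frame_def\<close>)
  then show ?thesis using assms by (simp add: base_frame_def)
qed

text \<open>A polynomial rotation multiplies the bilinear form by the square of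
  \<open>1 + z\<^sup>2\<close>, because \<open>(1 - z\<^sup>2)\<^sup>2 + (2 * z)\<^sup>2\<close> is
  that square.\<close>

lemma orbit_isotropic:
  assumes "M \<in> orbit k n" "2 * k \<le> n"
  shows "isotropic_rows k n M"
  using assms(1)
proof induction
  case base
  show ?case unfolding isotropic_rows_def
  proof (intro allI impI)
    fix a b assume "a < k" "b < k"
    then show "(\<Sum>l\<in>{1..n}. base_frame k a l * base_frame k b l) = 0"
      unfolding sum_base_frame[OF assms(2) \<open>b < k\<close>] by (auto simp: base_frame_def; presburger)
  qed
next
  case (rot M a b z)
  show ?case unfolding isotropic_rows_def
  proof (intro allI impI)
    fix r r' assume r: "r < k" "r' < k"
    have "(\<Sum>l\<in>{1..n}. rot a b z M r l * rot a b z M r' l) = 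
      rot a b z M r a * rot a b z M r' a + rot a b z M r b * rot a b z M r' b + (\<Sum>l\<in>{1..n}-{a,b}. rot a b z M r l * rot a b z M r' l)"
      by (rule sum_remove2) (use rot in auto)
    also have "(\<Sum>l\<in>{1..n}-{a,b}. rot a b z M r l * rot a b z M r' l) = (\<Sum>l\<in>{1..n}-{a,b}. (1 + z\<^sup>2)\<^sup>2 * (M r l * M r' l))"
      by (intro sum.cong refl) (auto simp: rot_def power2_eq_square)
    also have "\<dots> = (1 + z\<^sup>2)\<^sup>2 * (\<Sum>l\<in>{1..n}-{a,b}. M r l * M r' l)" by (simp add: sum_distrib_left)
    also have "rot a b z M r a * rot a b z M r' a + rot a b z M r b * rot a b z M r' b = (1 + z\<^sup>2)\<^sup>2 * (M r a * M r' a + M r b * M r' b)"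
      using rot(4) by (simp add: rot_def power2_eq_square algebra_simps)
    also have "\<dots> + (1 + z\<^sup>2)\<^sup>2 * (\<Sum>l\<in>{1..n}-{a,b}. M r l * M r' l) = (1 + z\<^sup>2)\<^sup>2 * (\<Sum>l\<in>{1..n}. M r l * M r' l)"
      unfolding distrib_left[symmetric] by (subst sum_remove2[of "{1..n}" a b]) (use rot in auto)
    finally show "(\<Sum>l\<in>{1..n}. rot a b z M r l * rot a b z M r' l) = 0" using rot(6) r by (simp add: isotropic_rows_def)
  qed
next
  case (scale M c)
  have "(\<Sum>l\<in>{1..n}. c * M r l * (c * M r' l)) = c^2 * (\<Sum>l\<in>{1..n}. M r l * M r' l)" for r r'
    by (simp add: sum_distrib_left power2_eq_square mult_ac)
  then show ?case using scale(3) by (simp add: isotropic_rows_def)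
qed

lemma orbit_independent:
  assumes "M \<in> orbit k n" "2 * k \<le> n"
  shows "independent_rows k n M"
  using assms(1)
proof induction
  case base
  show ?case unfolding independent_rows_def
  proof (intro allI impI)
    fix c :: "nat \<Rightarrow> complex" and a assume c: "\<forall>l\<in>{1..n}. (\<Sum>a<k. c a * base_frame k a l) = 0" and a: "a < k"
    have "(\<Sum>r<k. c r * base_frame k r (2 * a + 1)) = (\<Sum>r<k. if a = r then c r else 0)"
      by (intro sum.cong refl) (auto simp: base_frame_def; presburger)
    also have "\<dots> = c a" using a by (simp add: sum.delta)
    finally show "c a = 0" using c a assms(2) by force
  qed
next
  case (rot M a b z)
  show ?case unfolding independent_rows_def
  proof (intro allI impI)
    fix c :: "nat \<Rightarrow> complex" and r assume c: "\<forall>l\<in>{1..n}. (\<Sum>r<k. c r * rot a b z M r l) = 0" and r: "r < k"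
    define X where "X l = (\<Sum>r<k. c r * M r l)" for l
    have "(\<Sum>r<k. c r * rot a b z M r a) = (1 - z\<^sup>2) * X a - 2 * z * X b"
      by (simp add: rot_def X_def sum_distrib_left sum_subtractf algebra_simps)
    then have 1: "(1 - z\<^sup>2) * X a - 2 * z * X b = 0" using c rot(2) by simp
    have "(\<Sum>r<k. c r * rot a b z M r b) = 2 * z * X a + (1 - z\<^sup>2) * X b"
      using rot(4) by (simp add: rot_def X_def sum_distrib_left sum.distrib sum_subtractf algebra_simps)
    then have 2: "2 * z * X a + (1 - z\<^sup>2) * X b = 0" using c rot(3) by simp
    \<comment> \<open>Multiplication by the transposed rotation, which inverts the system up to the
      nonzero scalar.\<close>
    have "(1 - z\<^sup>2) * ((1 - z\<^sup>2) * X a - 2 * z * X b) + 2 * z * (2 * z * X a + (1 - z\<^sup>2) * X b) = (1 + z\<^sup>2)\<^sup>2 * X a"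
      "(1 - z\<^sup>2) * (2 * z * X a + (1 - z\<^sup>2) * X b) - 2 * z * ((1 - z\<^sup>2) * X a - 2 * z * X b) = (1 + z\<^sup>2)\<^sup>2 * X b"
      by (simp_all add: power2_eq_square algebra_simps)
    then have ab: "X a = 0" "X b = 0" using 1 2 rot(5) by auto
    have "X l = 0" if l: "l \<in> {1..n}" "l \<noteq> a" "l \<noteq> b" for l
    proof -
      have "(\<Sum>r<k. c r * rot a b z M r l) = (1 + z\<^sup>2) * X l"
        unfolding X_def sum_distrib_left using l by (intro sum.cong refl) (simp add: rot_def)
      then show ?thesis using c l rot(5) by simp
    qed
    then have "\<forall>l\<in>{1..n}. X l = 0" using ab by blast
    then show "c r = 0" using rot(6)[unfolded independent_rows_def, rule_format, of c r] r unfolding X_def by blast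
  qed
next
  case (scale M c)
  show ?case unfolding independent_rows_def
  proof (intro allI impI)
    fix x :: "nat \<Rightarrow> complex" and r assume x: "\<forall>l\<in>{1..n}. (\<Sum>a<k. x a * (c * M a l)) = 0" and r: "r < k"
    have "(\<Sum>a<k. x a * (c * M a l)) = c * (\<Sum>a<k. x a * M a l)" for l
      by (simp add: sum_distrib_left mult_ac)
    then have "\<forall>l\<in>{1..n}. (\<Sum>a<k. x a * M a l) = 0" using x scale(2) by simp
    then show "x r = 0" using scale(3)[unfolded independent_rows_def, rule_format, of x r] r by blast
  qed
qed

definition flip :: "nat \<Rightarrow> (nat \<Rightarrow> nat \<Rightarrow> complex) \<Rightarrow> nat \<Rightarrow> nat \<Rightarrow> complex" where
  "flip d M = (\<lambda>r c. if c = d then - M r c else M r c)"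

definition qturn :: "nat \<Rightarrow> nat \<Rightarrow> (nat \<Rightarrow> nat \<Rightarrow> complex) \<Rightarrow> nat \<Rightarrow> nat \<Rightarrow> complex" where
  "qturn a b M = (\<lambda>r c. if c = a then - M r b else if c = b then M r a else M r c)"

text \<open>The parameter \<open>z = 1\<close> is a right angle, and the polynomial rotation is then
  twice the quarter turn.\<close>

lemma orbit_qturn:
  assumes "M \<in> orbit k n" "a \<in> {1..n}" "b \<in> {1..n}" "a \<noteq> b"
  shows "qturn a b M \<in> orbit k n"
proof -
  have "(\<lambda>r i. (1/2) * rot a b 1 M r i) \<in> orbit k n"
    by (intro orbit.scale orbit.rot assms) auto
  also have "(\<lambda>r i. (1/2) * rot a b 1 M r i) = qturn a b M"
    by (auto simp: rot_def qturn_def fun_eq_iff)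
  finally show ?thesis .
qed

text \<open>Reflections are not products of rotations, but the last one fixes the base point because
  \<open>n > 2k\<close>: this is where irreducibility of the orthogonal Grassmannian comes from.\<close>

lemma orbit_flip_last:
  assumes "M \<in> orbit k n" "2 * k < n"
  shows "flip n M \<in> orbit k n"
  using assms(1)
proof induction
  case base
  have "flip n (base_frame k) = base_frame k" using assms(2) by (auto simp: flip_def base_frame_def fun_eq_iff)
  then show ?case by (simp add: orbit.base)
next
  case (rot M a b z)
  \<comment> \<open>Conjugating a rotation by the reflection in one of its axes reverses the angle;
    if the plane does not contain that axis, the two commute.\<close>
  have "flip n (rot a b z M) = rot a b (if n = a \<or> n = b then - z else z) (flip n M)"
    using rot(4) by (auto simp: flip_def rot_def fun_eq_iff algebra_simps)
  then show ?case using orbit.rot[OF rot(6) rot(2-4), of "if n = a \<or> n = b then - z else z"] rot(5) by (auto split: if_splits)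
next
  case (scale M c)
  have "flip n (\<lambda>r i. c * M r i) = (\<lambda>r i. c * flip n M r i)" by (auto simp: flip_def fun_eq_iff)
  then show ?case using orbit.scale[OF scale(3,2)] by simp
qed

text \<open>A quarter turn carries coordinate \<open>a\<close> to the last one, where the reflection
  is already known to preserve the orbit.\<close>

lemma orbit_flip:
  assumes "M \<in> orbit k n" "2 * k < n" "a \<in> {1..n}"
  shows "flip a M \<in> orbit k n"
proof (cases "a = n")
  case False
  have "flip a M = qturn n a (flip n (qturn a n M))"
    using False by (auto simp: flip_def qturn_def fun_eq_iff)
  moreover have "qturn n a (flip n (qturn a n M)) \<in> orbit k n"
    by (intro orbit_qturn orbit_flip_last assms) (use assms False in auto)
  ultimately show ?thesis by simp
qed (use orbit_flip_last assms in simp)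

text \<open>A transposition of coordinates reverses orientation, so it is a quarter turn corrected
  by one reflection.\<close>

lemma orbit_swap:
  assumes "M \<in> orbit k n" "2 * k < n" "a \<in> {1..n}" "b \<in> {1..n}"
  shows "(\<lambda>r c. M r (transpose a b c)) \<in> orbit k n"
proof (cases "a = b")
  case False
  have "(\<lambda>r c. M r (transpose a b c)) = flip a (qturn a b M)"
    using False by (auto simp: flip_def qturn_def fun_eq_iff transpose_def)
  moreover have "flip a (qturn a b M) \<in> orbit k n"
    by (intro orbit_flip orbit_qturn assms False)
  ultimately show ?thesis by simp
qed (use assms in simp)

text \<open>The permutation of columns induced by permuting the coordinate planes, plane
  \<open>j\<close> consisting of columns \<open>2 * j - 1\<close> and \<open>2 * j\<close>;
  everything beyond \<open>2 * m\<close> is fixed.\<close>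

definition pcol :: "nat \<Rightarrow> (nat \<Rightarrow> nat) \<Rightarrow> nat \<Rightarrow> nat" where
  "pcol m \<sigma> c = (if c \<in> {1..2*m} then (if odd c then 2 * \<sigma> ((c + 1) div 2) - 1 else 2 * \<sigma> (c div 2)) else c)"

lemma transpose_double:
  assumes "a \<ge> (1::nat)" "b \<ge> 1" "x \<ge> 1"
  shows "transpose (2*a-1) (2*b-1) (2*x-1) = 2 * transpose a b x - 1" "transpose (2*a) (2*b) (2*x) = 2 * transpose a b x"
    "transpose (2*a) (2*b) (2*x-1) = 2*x-1" "transpose (2*a-1) (2*b-1) (2*x) = 2*x"
proof -
  obtain a' b' x' where e: "a = Suc a'" "b = Suc b'" "x = Suc x'" using assms by (metis not0_implies_Suc not_one_le_zero)
  show "transpose (2*a-1) (2*b-1) (2*x-1) = 2 * transpose a b x - 1" "transpose (2*a) (2*b) (2*x) = 2 * transpose a b x"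
    unfolding e by (auto simp: transpose_def)
  have "2*x-1 \<noteq> 2*a" "2*x-1 \<noteq> 2*b" "2*x \<noteq> 2*a-1" "2*x \<noteq> 2*b-1" unfolding e by presburger+
  then show "transpose (2*a) (2*b) (2*x-1) = 2*x-1" "transpose (2*a-1) (2*b-1) (2*x) = 2*x"
    by (simp_all add: transpose_def)
qed

lemma orbit_plane_permutation:
  assumes "\<sigma> permutes {1..m}" "M \<in> orbit k n" "2 * k < n" "2 * m \<le> n"
  shows "(\<lambda>r c. M r (pcol m \<sigma> c)) \<in> orbit k n"
  using assms(1) finite_atLeastAtMost assms(2)
proof (induction arbitrary: M rule: permutes_induct)
  case id
  have "pcol m id = (\<lambda>c. c)" by (auto simp: pcol_def fun_eq_iff elim!: oddE)
  then show ?case using id by (simp only:)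
next
  case (swap a b \<sigma>)
  have ab: "a \<ge> 1" "b \<ge> 1" "a \<le> m" "b \<le> m" using swap by auto
  have "pcol m (transpose a b \<circ> \<sigma>) c = transpose (2*a-1) (2*b-1) (transpose (2*a) (2*b) (pcol m \<sigma> c))" for c
  proof -
    have img: "\<sigma> j \<in> {1..m} \<longleftrightarrow> j \<in> {1..m}" for j using permutes_in_image[OF swap(4)] .
    consider "c \<notin> {1..2*m}" | j where "c = 2 * j - 1" "j \<in> {1..m}" | j where "c = 2 * j" "j \<in> {1..m}"
    proof (cases "c \<in> {1..2*m}")
      case True
      show ?thesis
      proof (cases "odd c")
        case True
        then have "c = 2 * ((c + 1) div 2) - 1" "(c + 1) div 2 \<in> {1..m}" using \<open>c \<in> _\<close> by (auto elim!: oddE)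
        then show ?thesis using that(2) by blast
      next
        case False
        then have "c = 2 * (c div 2)" "c div 2 \<in> {1..m}" using \<open>c \<in> _\<close> by (auto elim!: evenE)
        then show ?thesis using that(3) by blast
      qed
    qed (use that in blast)
    then show ?thesis
    proof cases
      case 1
      then have ne: "c \<noteq> 2*a-1" "c \<noteq> 2*b-1" "c \<noteq> 2*a" "c \<noteq> 2*b" using ab by auto
      show ?thesis by (simp only: pcol_def 1 if_False transpose_def ne)
    next
      case (2 j)
      then have o: "odd c" "c \<in> {1..2*m}" "(c + 1) div 2 = j" by auto
      have "\<sigma> j \<ge> 1" using img[of j] 2 by simp
      then show ?thesis using o ab by (simp only: pcol_def if_True not_False_eq_True o_apply transpose_double)
    next
      case (3 j)
      then have o: "even c" "c \<in> {1..2*m}" "c div 2 = j" by auto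
      have "\<sigma> j \<ge> 1" using img[of j] 3 by simp
      moreover have "transpose a b (\<sigma> j) \<ge> 1" using \<open>\<sigma> j \<ge> 1\<close> ab by (simp add: transpose_def)
      ultimately show ?thesis using o ab by (simp only: pcol_def if_True if_False not_not not_True_eq_False o_apply transpose_double)
    qed
  qed
  moreover have "(\<lambda>r c. M r (transpose (2*a-1) (2*b-1) (transpose (2*a) (2*b) (pcol m \<sigma> c)))) \<in> orbit k n"
  proof -
    have "(\<lambda>r c. M r (transpose (2*a-1) (2*b-1) c)) \<in> orbit k n"
      by (intro orbit_swap swap.prems assms(3)) (use ab assms(4) in auto)
    then have "(\<lambda>r c. M r (transpose (2*a-1) (2*b-1) (transpose (2*a) (2*b) c))) \<in> orbit k n"
      using orbit_swap[of "\<lambda>r c. M r (transpose (2*a-1) (2*b-1) c)" k n "2*a" "2*b"] ab assms(3,4) by simp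
    then show ?thesis using swap(5)[of "\<lambda>r c. M r (transpose (2*a-1) (2*b-1) (transpose (2*a) (2*b) c))"] by simp
  qed
  ultimately show ?case by (simp only:)
qed

lemma orbit_flips:
  assumes "finite A" "A \<subseteq> {1..n}" "M \<in> orbit k n" "2 * k < n"
  shows "(\<lambda>r c. if c \<in> A then - M r c else M r c) \<in> orbit k n"
  using assms(1,2)
proof (induction A)
  case (insert a A)
  have "(\<lambda>r c. if c \<in> insert a A then - M r c else M r c) = flip a (\<lambda>r c. if c \<in> A then - M r c else M r c)"
    using insert(2) by (auto simp: flip_def fun_eq_iff)
  then show ?case using orbit_flip[OF insert(3) assms(4), of a] insert by simp
qed (use assms in simp)

section \<open>The ideal of the orbit\<close>

definition orbit_ideal :: "nat \<Rightarrow> nat \<Rightarrow> ppoly set" where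
  "orbit_ideal k n = {f \<in> carrier (plucker_ring k n). \<forall>q \<in> {(\<lambda>S. c * pc k M S) |c M. c \<noteq> 0 \<and> M \<in> orbit k n}. peval f q = 0}"

lemma orbit_ideal_iff: "f \<in> orbit_ideal k n \<longleftrightarrow> f \<in> carrier (plucker_ring k n) \<and> 
    (\<forall>c M. c \<noteq> 0 \<longrightarrow> M \<in> orbit k n \<longrightarrow> peval f (\<lambda>S. c * pc k M S) = 0)"
  by (auto simp: orbit_ideal_def)

lemma ideal_orbit_ideal: "ideal (orbit_ideal k n) (plucker_ring k n)"
  unfolding orbit_ideal_def by (rule point_ideal)

lemma vanishing_subset_orbit_ideal:
  assumes "2 * k \<le> n"
  shows "vanishing_ideal k n (plucker_point n ` OGr k n) \<subseteq> orbit_ideal k n"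
proof
  fix f assume f: "f \<in> vanishing_ideal k n (plucker_point n ` OGr k n)"
  have "peval f (\<lambda>S. c * pc k M S) = 0" if c: "c \<noteq> 0" and M: "M \<in> orbit k n" for c M
  proof -
    obtain W q where W: "W \<in> OGr k n" "q \<in> plucker_point n W" "\<forall>S\<in>ksubsets k n. q S = c * pc k M S"
      using isotropic_matrix_in_OGr[OF orbit_isotropic[OF M assms] orbit_independent[OF M assms] c] by blast
    have "peval f (\<lambda>S. c * pc k M S) = peval f q"
      by (rule peval_cong) (use f W in \<open>auto simp: vanishing_ideal_def\<close>)
    then show ?thesis using f W by (auto simp: vanishing_ideal_def)
  qed
  then show "f \<in> orbit_ideal k n" using f by (auto simp: orbit_ideal_iff vanishing_ideal_def)
qed

subsection \<open>Primality\<close>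

definition polyfun :: "(complex \<Rightarrow> complex) \<Rightarrow> bool" where
  "polyfun h \<longleftrightarrow> (\<exists>P. \<forall>t. h t = poly P t)"

lemma polyfun_const: "polyfun (\<lambda>_. c)" unfolding polyfun_def by (rule exI[of _ "[:c:]"]) simp
lemma polyfun_id: "polyfun (\<lambda>t. t)" unfolding polyfun_def by (rule exI[of _ "[:0,1:]"]) simp
lemma polyfun_add: "polyfun f \<Longrightarrow> polyfun g \<Longrightarrow> polyfun (\<lambda>t. f t + g t)"
  unfolding polyfun_def by (metis poly_add)
lemma polyfun_diff: "polyfun f \<Longrightarrow> polyfun g \<Longrightarrow> polyfun (\<lambda>t. f t - g t)"
  unfolding polyfun_def by (metis poly_diff)
lemma polyfun_mult: "polyfun f \<Longrightarrow> polyfun g \<Longrightarrow> polyfun (\<lambda>t. f t * g t)"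
  unfolding polyfun_def by (metis poly_mult)
lemma polyfun_power: "polyfun f \<Longrightarrow> polyfun (\<lambda>t. f t ^ i)"
  unfolding polyfun_def by (metis poly_power)
lemma polyfun_sum: "(\<And>x. x \<in> A \<Longrightarrow> polyfun (F x)) \<Longrightarrow> polyfun (\<lambda>t. \<Sum>x\<in>A. F x t)"
  by (induction A rule: infinite_finite_induct) (auto intro: polyfun_const polyfun_add)
lemma polyfun_prod: "(\<And>x. x \<in> A \<Longrightarrow> polyfun (F x)) \<Longrightarrow> polyfun (\<lambda>t. \<Prod>x\<in>A. F x t)"
  by (induction A rule: infinite_finite_induct) (auto intro: polyfun_const polyfun_mult)

lemma polyfun_finite_zeros: 
  assumes "polyfun f" "f t0 \<noteq> 0" shows "finite {t. f t = 0}"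
proof -
  obtain P where P: "\<And>t. f t = poly P t" using assms(1) by (auto simp: polyfun_def)
  then have "P \<noteq> 0" using assms(2) by auto
  then show ?thesis using poly_roots_finite[of P] P by simp
qed

lemma polyfun_peval:
  assumes "\<And>S. polyfun (\<lambda>t. q t S)" shows "polyfun (\<lambda>t. peval f (q t))"
  unfolding peval_def by (intro polyfun_sum polyfun_mult polyfun_prod polyfun_power polyfun_const assms)

lemma polyfun_pc:
  assumes "\<And>r c. polyfun (\<lambda>t. N t r c)" shows "polyfun (\<lambda>t. pc k (N t) S)"
  unfolding pc_def sd_leibniz by (intro polyfun_sum polyfun_mult polyfun_prod polyfun_const assms)

text \<open>Replacing each angle parameter \<open>z\<close> by \<open>t * z\<close> and each scalar
  \<open>x\<close> by \<open>1 + t * (x - 1)\<close> deforms the word that produces \<open>M\<close>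
  into the identity. Only finitely many \<open>t\<close> leave the orbit. The third clause lets the
  argument vary with \<open>t\<close> as well, so that two such families can be composed into one
  polynomial curve.\<close>

lemma orbit_path:
  assumes "M \<in> orbit k n"
  shows "\<exists>\<Gamma>. (\<forall>N. \<Gamma> 0 N = N) \<and> \<Gamma> 1 (base_frame k) = M \<and>
     (\<forall>u N. polyfun u \<longrightarrow> (\<forall>r c. polyfun (\<lambda>t. N t r c)) \<longrightarrow> (\<forall>r c. polyfun (\<lambda>t. \<Gamma> (u t) (N t) r c))) \<and>
     finite {t :: complex. \<exists>N\<in>orbit k n. \<Gamma> t N \<notin> orbit k n}"
  using assms
proof induction
  case base
  show ?case by (rule exI[of _ "\<lambda>_ N. N"]) auto
next
  case (rot M a b z)
  then obtain \<Gamma> where G: "\<And>N. \<Gamma> 0 N = N" "\<Gamma> 1 (base_frame k) = M"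
     "\<And>u N r c. polyfun u \<Longrightarrow> (\<And>r c. polyfun (\<lambda>t. N t r c)) \<Longrightarrow> polyfun (\<lambda>t. \<Gamma> (u t) (N t) r c)"
     "finite {t :: complex. \<exists>N\<in>orbit k n. \<Gamma> t N \<notin> orbit k n}" by blast
  define \<Gamma>' where "\<Gamma>' t N = rot a b (t * z) (\<Gamma> t N)" for t N
  have "polyfun (\<lambda>t. 1 + (t * z)\<^sup>2)" by (intro polyfun_add polyfun_power polyfun_mult polyfun_const polyfun_id)
  then have fin: "finite {t. 1 + (t * z)\<^sup>2 = 0}" by (rule polyfun_finite_zeros[of _ 0]) simp
  have "{t. \<exists>N\<in>orbit k n. \<Gamma>' t N \<notin> orbit k n} \<subseteq> {t. \<exists>N\<in>orbit k n. \<Gamma> t N \<notin> orbit k n} \<union> {t. 1 + (t * z)\<^sup>2 = 0}"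
    using orbit.rot[OF _ rot(2-4)] unfolding \<Gamma>'_def by blast
  then have "finite {t. \<exists>N\<in>orbit k n. \<Gamma>' t N \<notin> orbit k n}" using G(4) fin finite_subset by blast
  moreover have "\<Gamma>' 0 N = N" for N by (auto simp: \<Gamma>'_def G rot_def fun_eq_iff)
  moreover have "\<Gamma>' 1 (base_frame k) = rot a b z M" by (simp add: \<Gamma>'_def G)
  moreover have "polyfun (\<lambda>t. \<Gamma>' (u t) (N t) r c)" if "polyfun u" "\<And>r c. polyfun (\<lambda>t. N t r c)" for u N r c
    unfolding \<Gamma>'_def rot_def
    by (cases "c = a"; cases "c = b"; simp)
       (intro polyfun_add polyfun_diff polyfun_power polyfun_mult polyfun_const G(3) that)+
  ultimately show ?case by (intro exI[of _ \<Gamma>']) blast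
next
  case (scale M x)
  then obtain \<Gamma> where G: "\<And>N. \<Gamma> 0 N = N" "\<Gamma> 1 (base_frame k) = M"
     "\<And>u N r c. polyfun u \<Longrightarrow> (\<And>r c. polyfun (\<lambda>t. N t r c)) \<Longrightarrow> polyfun (\<lambda>t. \<Gamma> (u t) (N t) r c)"
     "finite {t :: complex. \<exists>N\<in>orbit k n. \<Gamma> t N \<notin> orbit k n}" by blast
  define \<Gamma>' where "\<Gamma>' t N = (\<lambda>r c. (1 + t * (x - 1)) * \<Gamma> t N r c)" for t N
  have "polyfun (\<lambda>t. 1 + t * (x - 1))" by (intro polyfun_add polyfun_mult polyfun_const polyfun_id)
  then have fin: "finite {t. 1 + t * (x - 1) = 0}" by (rule polyfun_finite_zeros[of _ 0]) simp
  have "{t. \<exists>N\<in>orbit k n. \<Gamma>' t N \<notin> orbit k n} \<subseteq> {t. \<exists>N\<in>orbit k n. \<Gamma> t N \<notin> orbit k n} \<union> {t. 1 + t * (x - 1) = 0}"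
    using orbit.scale unfolding \<Gamma>'_def by blast
  then have "finite {t. \<exists>N\<in>orbit k n. \<Gamma>' t N \<notin> orbit k n}" using G(4) fin finite_subset by blast
  moreover have "\<Gamma>' 0 N = N" for N by (auto simp: \<Gamma>'_def G fun_eq_iff)
  moreover have "\<Gamma>' 1 (base_frame k) = (\<lambda>r i. x * M r i)" by (simp add: \<Gamma>'_def G)
  moreover have "polyfun (\<lambda>t. \<Gamma>' (u t) (N t) r c)" if "polyfun u" "\<And>r c. polyfun (\<lambda>t. N t r c)" for u N r c
    unfolding \<Gamma>'_def by (intro polyfun_add polyfun_diff polyfun_mult polyfun_const G(3) that)
  ultimately show ?case by (intro exI[of _ \<Gamma>']) blast
qed

text \<open>Irreducibility by curves: \<open>\<Gamma>\<close> run backwards after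
  \<open>\<Delta>\<close> run forwards is a curve through \<open>M1\<close> at 0 and
  \<open>M2\<close> at 1. Neither \<open>f\<close> nor \<open>g\<close> vanishes identically on it,
  so at all but finitely many parameters the product is nonzero at a point of the orbit.\<close>

lemma orbit_ideal_prime:
  assumes "f * g \<in> orbit_ideal k n" "f \<in> carrier (plucker_ring k n)" "g \<in> carrier (plucker_ring k n)"
  shows "f \<in> orbit_ideal k n \<or> g \<in> orbit_ideal k n"
proof (rule ccontr)
  assume "\<not> ?thesis"
  then obtain c1 M1 c2 M2 where 1: "c1 \<noteq> 0" "M1 \<in> orbit k n" "peval f (\<lambda>S. c1 * pc k M1 S) \<noteq> 0"
    and 2: "c2 \<noteq> 0" "M2 \<in> orbit k n" "peval g (\<lambda>S. c2 * pc k M2 S) \<noteq> 0"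
    using assms by (auto simp: orbit_ideal_iff)
  obtain \<Gamma> where G: "\<And>N. \<Gamma> 0 N = N" "\<Gamma> 1 (base_frame k) = M1"
     "\<And>u N r c. polyfun u \<Longrightarrow> (\<And>r c. polyfun (\<lambda>t. N t r c)) \<Longrightarrow> polyfun (\<lambda>t. \<Gamma> (u t) (N t) r c)"
     "finite {t :: complex. \<exists>N\<in>orbit k n. \<Gamma> t N \<notin> orbit k n}" using orbit_path[OF 1(2)] by blast
  obtain \<Delta> where D: "\<And>N. \<Delta> 0 N = N" "\<Delta> 1 (base_frame k) = M2"
     "\<And>u N r c. polyfun u \<Longrightarrow> (\<And>r c. polyfun (\<lambda>t. N t r c)) \<Longrightarrow> polyfun (\<lambda>t. \<Delta> (u t) (N t) r c)"
     "finite {t :: complex. \<exists>N\<in>orbit k n. \<Delta> t N \<notin> orbit k n}" using orbit_path[OF 2(2)] by blast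
  define \<gamma> where "\<gamma> t = \<Gamma> (1 - t) (\<Delta> t (base_frame k))" for t
  define x where "x t = c1 + t * (c2 - c1)" for t
  define q where "q t S = x t * pc k (\<gamma> t) S" for t S
  have px: "polyfun x" unfolding x_def by (intro polyfun_add polyfun_mult polyfun_const polyfun_id)
  have pg: "polyfun (\<lambda>t. \<gamma> t r c)" for r c unfolding \<gamma>_def
    by (intro G(3) D(3) polyfun_diff polyfun_const polyfun_id)
  have pq: "polyfun (\<lambda>t. q t S)" for S unfolding q_def by (intro polyfun_mult px polyfun_pc pg)
  have f: "finite {t. peval f (q t) = 0}"
    by (rule polyfun_finite_zeros[OF polyfun_peval[OF pq], of _ 0]) (use 1 in \<open>simp add: q_def x_def \<gamma>_def G D\<close>)
  have g: "finite {t. peval g (q t) = 0}"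
    by (rule polyfun_finite_zeros[OF polyfun_peval[OF pq], of _ 1]) (use 2 in \<open>simp add: q_def x_def \<gamma>_def G D\<close>)
  have xf: "finite {t. x t = 0}" by (rule polyfun_finite_zeros[OF px, of 0]) (use 1 in \<open>simp add: x_def\<close>)
  have "finite ((\<lambda>t. 1 - t) -` {t. \<exists>N\<in>orbit k n. \<Gamma> t N \<notin> orbit k n})"
    by (rule finite_vimageI[OF G(4)]) (auto intro: injI)
  define Bad where "Bad = {t. peval f (q t) = 0} \<union> {t. peval g (q t) = 0} \<union> {t. x t = 0} \<union>
    {t. \<exists>N\<in>orbit k n. \<Delta> t N \<notin> orbit k n} \<union> ((\<lambda>t. 1 - t) -` {t. \<exists>N\<in>orbit k n. \<Gamma> t N \<notin> orbit k n})"
  have "finite Bad" unfolding Bad_def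
    using f g xf D(4) \<open>finite ((\<lambda>t. 1 - t) -` _)\<close> by (intro finite_UnI)
  then obtain t where t: "t \<notin> Bad"
    using ex_new_if_finite[OF infinite_UNIV_char_0] by metis
  have d: "\<Delta> t (base_frame k) \<in> orbit k n" using t orbit.base unfolding Bad_def by blast
  then have "\<gamma> t \<in> orbit k n" using t unfolding \<gamma>_def Bad_def by blast
  moreover have "x t \<noteq> 0" using t by (simp add: Bad_def)
  ultimately have "peval (f * g) (q t) = 0" using assms(1) unfolding orbit_ideal_iff q_def by blast
  then show False using t by (simp add: peval.hev_mult Bad_def)
qed

subsection \<open>Invariance under the Lie algebra\<close>

lemma carrier_induct [consumes 1, case_names const add mult]:
  assumes "f \<in> carrier (plucker_ring k n)"
    and "\<And>c. P (const_poly c)" "\<And>f g. P f \<Longrightarrow> P g \<Longrightarrow> P (f + g)"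
    "\<And>S f. S \<in> ksubsets k n \<Longrightarrow> P f \<Longrightarrow> P (pvar S * f)"
  shows "P f"
proof -
  have mon: "P (Poly_Mapping.single m c)" if "Poly_Mapping.keys m \<subseteq> ksubsets k n" for m c
    using _ _ that
    by (rule monom_var_induct)
       (use assms(2,4) in \<open>auto simp: const_poly_def single_add_one_monom simp del: One_nat_def\<close>)
  have "P (\<Sum>m\<in>A. Poly_Mapping.single m (Poly_Mapping.lookup f m))" if "finite A" "A \<subseteq> Poly_Mapping.keys f" for A
    using that by (induction A) (use assms(2)[of 0] mon assms(1,3) in \<open>auto simp: carrier_plucker_iff\<close>)
  then show ?thesis using ppoly_as_sum_of_terms[of f] by (metis finite_keys subset_refl)
qed

lemma prod_list_update:
  assumes "i < k" "length s = k"
  shows "(\<Prod>j<k. F j (s[i := x] ! j)) = F i x * (\<Prod>j\<in>{..<k}-{i}. F j (s ! j))"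
proof -
  have "(\<Prod>j<k. F j (s[i := x] ! j)) = F i (s[i := x] ! i) * (\<Prod>j\<in>{..<k}-{i}. F j (s[i := x] ! j))"
    using assms by (intro prod.remove) auto
  also have "(\<Prod>j\<in>{..<k}-{i}. F j (s[i := x] ! j)) = (\<Prod>j\<in>{..<k}-{i}. F j (s ! j))"
    by (intro prod.cong) auto
  finally show ?thesis using assms by simp
qed

lemma sd_list_update:
  assumes "i < k" "length s = k"
  shows "sd k M (s[i := x]) = (\<Sum>p | p permutes {..<k}. of_int (sign p) * (M (p i) x * (\<Prod>j\<in>{..<k}-{i}. M (p j) (s ! j))))"
  unfolding sd_leibniz using prod_list_update[OF assms, of "\<lambda>j y. M (_ j) y"] by simp

lemma rot_zero [simp]: "rot a b 0 M = M"
  by (auto simp: rot_def fun_eq_iff)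

lemma rot_deriv:
  assumes "a \<noteq> b"
  shows "((\<lambda>z. rot a b z M r c) has_field_derivative (if c = a then - 2 * M r b else if c = b then 2 * M r a else 0)) (at 0)"
  unfolding rot_def using assms by (auto intro!: derivative_eq_intros)

text \<open>Differentiating the Leibniz expansion column by column. The factor 2 appears because
  \<open>z\<close> is the tangent of half the angle.\<close>

lemma sd_rot_deriv:
  assumes "length s = k" "a \<noteq> b"
  shows "((\<lambda>z. sd k (rot a b z M) s) has_field_derivative 
     2 * ((\<Sum>i<k. if s ! i = b then sd k M (s[i := a]) else 0) - (\<Sum>i<k. if s ! i = a then sd k M (s[i := b]) else 0))) (at 0)"
proof -
  define e where "e p i = (if s ! i = a then - 2 * M (p i) b else if s ! i = b then 2 * M (p i) a else 0)" for p :: "nat \<Rightarrow> nat" and i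
  let ?R = "\<lambda>p i. \<Prod>j\<in>{..<k}-{i}. M (p j) (s ! j)"
  have "((\<lambda>z. sd k (rot a b z M) s) has_field_derivative 
     (\<Sum>p | p permutes {..<k}. of_int (sign p) * (\<Sum>i<k. e p i * ?R p i))) (at 0)"
    unfolding sd_leibniz
  proof (intro DERIV_sum DERIV_cmult)
    fix p
    have "((\<lambda>z. \<Prod>j<k. rot a b z M (p j) (s ! j)) has_field_derivative (\<Sum>i<k. e p i * (\<Prod>j\<in>{..<k}-{i}. rot a b 0 M (p j) (s ! j)))) (at 0)"
      unfolding e_def by (intro has_field_derivative_prod rot_deriv assms)
    then show "((\<lambda>z. \<Prod>j<k. rot a b z M (p j) (s ! j)) has_field_derivative (\<Sum>i<k. e p i * ?R p i)) (at 0)" by simp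
  qed
  moreover have "(\<Sum>p | p permutes {..<k}. of_int (sign p) * (\<Sum>i<k. e p i * ?R p i)) = 
     (\<Sum>i<k. \<Sum>p | p permutes {..<k}. of_int (sign p) * (e p i * ?R p i))"
    unfolding sum_distrib_left by (rule sum.swap)
  moreover have "(\<Sum>p | p permutes {..<k}. of_int (sign p) * (e p i * ?R p i)) = 
     2 * ((if s ! i = b then sd k M (s[i := a]) else 0) - (if s ! i = a then sd k M (s[i := b]) else 0))" if "i < k" for i
    unfolding e_def sd_list_update[OF that assms(1)] using assms(2)
    by (auto simp: sum_distrib_left mult_ac sum_negf)
  ultimately show ?thesis by (simp add: sum_distrib_left sum_subtractf)
qed

text \<open>Up to a factor 2, \<open>D a b f\<close> is the derivative of \<open>f\<close> along the
  rotation curve at \<open>z = 0\<close>. The curve leaves the orbit only where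
  \<open>1 + z\<^sup>2 = 0\<close>; being polynomial in \<open>z\<close>, the restriction of
  \<open>f\<close> vanishes there too, and so does its derivative.\<close>

lemma orbit_ideal_D:
  assumes f: "f \<in> orbit_ideal k n" and ab: "a \<in> {1..n}" "b \<in> {1..n}" and Dc: "D a b f \<in> carrier (plucker_ring k n)"
  shows "D a b f \<in> orbit_ideal k n"
proof (cases "a = b")
  case True
  then have "D a b f = 0" by (simp add: D_def)
  then show ?thesis by (simp add: orbit_ideal_iff carrier_0)
next
  case False
  have "peval (D a b f) (\<lambda>S. c * pc k M S) = 0" if c: "c \<noteq> 0" and M: "M \<in> orbit k n" for c M
  proof -
    define q where "q z S = c * pc k (rot a b z M) S" for z S
    have q0: "q 0 = (\<lambda>S. c * pc k M S)" by (simp add: q_def[abs_def])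
    have var: "((\<lambda>z. q z S) has_field_derivative 2 * peval (D a b (pvar S)) (q 0)) (at 0)" if S: "S \<in> ksubsets k n" for S
    proof -
      define s where "s = sorted_list_of_set S"
      have s: "length s = k" "pvar S = PS s" using S ksubsets_finite(1)[OF S] by (auto simp: s_def ksubsets_def)
      have if0: "peval (if P then x else 0) y = (if P then peval x y else 0)" for P x y by simp
      have "peval (D a b (pvar S)) (q 0) = c * ((\<Sum>i<k. if s ! i = b then sd k M (s[i := a]) else 0) - (\<Sum>i<k. if s ! i = a then sd k M (s[i := b]) else 0))"
        unfolding s(2) D_def E_PS q0 using s(1)
        by (simp add: peval.hev_diff peval.hev_sum if0 peval_PS right_diff_distrib sum_distrib_left if_distrib[of "(*) c"] cong: if_cong)
      then have "2 * peval (D a b (pvar S)) (q 0) = c * (2 * ((\<Sum>i<k. if s ! i = b then sd k M (s[i := a]) else 0) - (\<Sum>i<k. if s ! i = a then sd k M (s[i := b]) else 0)))"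
        by simp
      then show ?thesis unfolding q_def[abs_def] pc_def s_def[symmetric] by (simp only:) (intro DERIV_cmult sd_rot_deriv s False)
    qed
    have "g \<in> carrier (plucker_ring k n) \<Longrightarrow> ((\<lambda>z. peval g (q z)) has_field_derivative 2 * peval (D a b g) (q 0)) (at 0)" for g
    proof (induction rule: carrier_induct)
      case (const c) then show ?case by simp
    next
      case (add f g)
      from DERIV_add[OF this] show ?case by (simp add: peval.hev_add D_add algebra_simps)
    next
      case (mult S g)
      from DERIV_mult[OF var[OF mult(1)] mult(2)] show ?case by (simp add: peval.hev_add peval.hev_mult D_mult algebra_simps)
    qed
    then have der: "((\<lambda>z. peval f (q z)) has_field_derivative 2 * peval (D a b f) (q 0)) (at 0)"
      using f by (simp add: orbit_ideal_iff)
    have pf: "polyfun (\<lambda>z. peval f (q z))" unfolding q_def[abs_def]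
    proof (intro polyfun_peval polyfun_mult polyfun_const polyfun_pc)
      fix r l show "polyfun (\<lambda>z. rot a b z M r l)" unfolding rot_def
        by (cases "l = a"; cases "l = b"; simp) (intro polyfun_add polyfun_diff polyfun_power polyfun_mult polyfun_const polyfun_id)+
    qed
    have zero: "peval f (q z) = 0" if "1 + z\<^sup>2 \<noteq> 0" for z
      using f c orbit.rot[OF M ab False that] unfolding orbit_ideal_iff q_def by blast
    have "peval f (q z) = 0" for z
    proof (rule ccontr)
      assume "peval f (q z) \<noteq> 0"
      then have fin: "finite {z. peval f (q z) = 0}" by (rule polyfun_finite_zeros[OF pf])
      have "polyfun (\<lambda>z. 1 + z\<^sup>2)" by (intro polyfun_add polyfun_power polyfun_const polyfun_id)
      then have "finite {z::complex. 1 + z\<^sup>2 = 0}" by (rule polyfun_finite_zeros[of _ 0]) simp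
      moreover have "UNIV \<subseteq> {z. peval f (q z) = 0} \<union> {z::complex. 1 + z\<^sup>2 = 0}" using zero by blast
      ultimately have "finite (UNIV :: complex set)" using fin finite_subset by blast
      then show False by (simp add: infinite_UNIV_char_0)
    qed
    then have "((\<lambda>z::complex. 0) has_field_derivative 2 * peval (D a b f) (q 0)) (at 0)" using der by simp
    then have "2 * peval (D a b f) (q 0) = 0" using DERIV_unique DERIV_const by blast
    then show ?thesis by (simp add: q0)
  qed
  then show ?thesis using Dc by (simp add: orbit_ideal_iff)
qed

subsection \<open>Homogeneity\<close>

definition hcomp :: "nat \<Rightarrow> ppoly \<Rightarrow> ppoly" where
  "hcomp d f = (\<Sum>m\<in>{m \<in> Poly_Mapping.keys f. monom_degree m = d}. Poly_Mapping.single m (Poly_Mapping.lookup f m))"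

lemma sum_hcomp: "f = (\<Sum>d\<in>monom_degree ` Poly_Mapping.keys f. hcomp d f)"
  unfolding hcomp_def by (subst sum.image_gen[symmetric]) (auto simp: ppoly_as_sum_of_terms[symmetric])

lemma hcomp_graded:
  assumes "f \<in> carrier (plucker_ring k n)" shows "hcomp d f \<in> graded_part k n d"
  unfolding hcomp_def
proof (rule graded_sum)
  fix m assume "m \<in> {m \<in> Poly_Mapping.keys f. monom_degree m = d}"
  then show "Poly_Mapping.single m (Poly_Mapping.lookup f m) \<in> graded_part k n d"
    using assms by (auto simp: graded_part_def carrier_plucker_iff)
qed

lemma peval_graded_scale:
  assumes "f \<in> graded_part k n d"
  shows "peval f (\<lambda>S. x * q S) = x ^ d * peval f q"
  using assms by (induction rule: graded_induct) (auto simp: peval.hev_add peval.hev_mult algebra_simps)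

text \<open>The points are closed under nonzero scaling. Along a line through the origin
  \<open>f\<close> becomes a polynomial in the scalar, with the values of the homogeneous components
  as coefficients.\<close>

lemma hcomp_orbit_ideal:
  assumes "f \<in> orbit_ideal k n"
  shows "hcomp d f \<in> orbit_ideal k n"
proof -
  have fc: "f \<in> carrier (plucker_ring k n)" using assms by (simp add: orbit_ideal_iff)
  have "peval (hcomp d f) (\<lambda>S. c * pc k M S) = 0" if M: "M \<in> orbit k n" for c M
  proof -
    let ?A = "monom_degree ` Poly_Mapping.keys f"
    define v where "v d = peval (hcomp d f) (\<lambda>S. pc k M S)" for d
    define P where "P = (\<Sum>e\<in>?A. Polynomial.monom (v e) e)"
    have "poly P x = 0" if "x \<noteq> 0" for x
    proof -
      have "0 = peval f (\<lambda>S. x * pc k M S)" using assms M that by (simp add: orbit_ideal_iff)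
      also have "\<dots> = (\<Sum>e\<in>?A. peval (hcomp e f) (\<lambda>S. x * pc k M S))"
        by (subst sum_hcomp) (simp add: peval.hev_sum)
      also have "\<dots> = (\<Sum>e\<in>?A. v e * x ^ e)"
        by (simp add: peval_graded_scale[OF hcomp_graded[OF fc]] v_def mult.commute)
      finally show ?thesis by (simp add: P_def poly_sum poly_monom)
    qed
    then have "UNIV \<subseteq> insert 0 {x. poly P x = 0}" by blast
    then have "P = 0" using poly_roots_finite[of P] infinite_UNIV_char_0 finite_subset by (metis finite_insert)
    have "v d = 0"
    proof (cases "d \<in> ?A")
      case True
      then have "v d = coeff P d" by (simp add: P_def coeff_sum sum.delta coeff_monom)
      then show ?thesis using \<open>P = 0\<close> by simp
    next
      case False
      then have "hcomp d f = 0" by (auto simp: hcomp_def intro!: sum.neutral)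
      then show ?thesis by (simp add: v_def)
    qed
    then show ?thesis by (simp add: peval_graded_scale[OF hcomp_graded[OF fc]] v_def)
  qed
  then show ?thesis using hcomp_graded[OF fc, of d] graded_subset[of k n d] by (auto simp: orbit_ideal_iff)
qed

section \<open>Weight vectors and root vectors with respect to an isotropic basis\<close>

section \<open>Weight vectors\<close>

definition strings :: "nat \<Rightarrow> nat \<Rightarrow> nat list set" where
  "strings k n = {s. length s = k \<and> set s \<subseteq> {1..n}}"

lemma finite_strings [simp]: "finite (strings k n)"
  unfolding strings_def using finite_lists_length_eq[of "{1..n}" k] by (simp add: conj_commute)

lemma strings_nth: "s \<in> strings k n \<Longrightarrow> i < k \<Longrightarrow> s ! i \<in> {1..n}"
  unfolding strings_def using nth_mem by blast

lemma sum_strings_prod: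
  fixes h :: "nat \<Rightarrow> nat \<Rightarrow> 'a::comm_ring_1"
  shows "(\<Sum>s\<in>strings k n. \<Prod>i<k. h i (s ! i)) = (\<Prod>i<k. \<Sum>c\<in>{1..n}. h i c)"
proof (induction k arbitrary: h)
  case 0
  have "strings 0 n = {[]}" by (auto simp: strings_def)
  then show ?case by simp
next
  case (Suc k)
  have S: "strings (Suc k) n = (\<lambda>(c, s). c # s) ` ({1..n} \<times> strings k n)"
    by (auto simp: strings_def image_iff length_Suc_conv)
  have "(\<Sum>s\<in>strings (Suc k) n. \<Prod>i<Suc k. h i (s ! i)) = (\<Sum>(c, s)\<in>{1..n} \<times> strings k n. \<Prod>i<Suc k. h i ((c # s) ! i))"
    unfolding S by (subst sum.reindex) (auto simp: inj_on_def intro!: sum.cong)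
  also have "\<dots> = (\<Sum>c\<in>{1..n}. \<Sum>s\<in>strings k n. h 0 c * (\<Prod>i<k. h (Suc i) (s ! i)))"
    by (simp add: sum.cartesian_product prod.lessThan_Suc_shift del: prod.lessThan_Suc)
  also have "\<dots> = (\<Sum>c\<in>{1..n}. h 0 c) * (\<Sum>s\<in>strings k n. \<Prod>i<k. h (Suc i) (s ! i))"
    by (simp add: sum_product)
  also have "\<dots> = (\<Prod>i<Suc k. \<Sum>c\<in>{1..n}. h i c)"
    using Suc[of "\<lambda>i. h (Suc i)"] by (simp only: prod.lessThan_Suc_shift)
  finally show ?case .
qed

text \<open>The exterior product of the vectors \<open>u 0\<close>, ..., \<open>u (k - 1)\<close>,
  written as a linear form in the variables.\<close>

definition PL :: "nat \<Rightarrow> nat \<Rightarrow> (nat \<Rightarrow> nat \<Rightarrow> complex) \<Rightarrow> ppoly" where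
  "PL k n u = (\<Sum>s\<in>strings k n. const_poly (\<Prod>i<k. u i (s ! i)) * PS s)"

lemma PL_graded: "PL k n u \<in> graded_part k n 1"
  unfolding PL_def by (intro graded_sum graded_scale PS_graded) (auto simp: strings_def)

lemma PL_cong: "(\<And>i c. i < k \<Longrightarrow> c \<in> {1..n} \<Longrightarrow> u i c = u' i c) \<Longrightarrow> PL k n u = PL k n u'"
  unfolding PL_def by (intro sum.cong refl arg_cong2[of _ _ _ _ "(*)"] arg_cong[of _ _ const_poly] prod.cong) (auto dest: strings_nth)

lemma prod_fun_upd:
  assumes "(p::nat) < k"
  shows "(\<Prod>i<k. (u(p := v)) i (s i)) = v (s p) * (\<Prod>i\<in>{..<k}-{p}. u i (s i))"
proof -
  have "(\<Prod>i<k. (u(p := v)) i (s i)) = (u(p := v)) p (s p) * (\<Prod>i\<in>{..<k}-{p}. (u(p := v)) i (s i))"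
    using assms by (intro prod.remove) auto
  also have "(\<Prod>i\<in>{..<k}-{p}. (u(p := v)) i (s i)) = (\<Prod>i\<in>{..<k}-{p}. u i (s i))" by (intro prod.cong) auto
  finally show ?thesis by simp
qed

lemma PL_linear:
  assumes "p < k"
  shows "PL k n (u(p := \<lambda>c. x * v c + y * w c)) = const_poly x * PL k n (u(p := v)) + const_poly y * PL k n (u(p := w))"
  unfolding PL_def prod_fun_upd[OF assms] sum_distrib_left sum.distrib[symmetric]
  by (intro sum.cong refl) (simp add: algebra_simps)

lemma E_PL:
  assumes ab: "a \<in> {1..n}" "b \<in> {1..n}"
  shows "E a b (PL k n u) = (\<Sum>p<k. PL k n (u(p := \<lambda>c. if c = a then u p b else 0)))"
proof -
  have "E a b (PL k n u) = (\<Sum>s\<in>strings k n. \<Sum>p<k. if s ! p = b then const_poly (\<Prod>i<k. u i (s ! i)) * PS (s[p := a]) else 0)"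
    unfolding PL_def E_sum E_const_mult E_PS by (intro sum.cong refl) (auto simp: strings_def sum_distrib_left intro!: sum.cong)
  also have "\<dots> = (\<Sum>p<k. \<Sum>s\<in>strings k n. if s ! p = b then const_poly (\<Prod>i<k. u i (s ! i)) * PS (s[p := a]) else 0)"
    by (rule sum.swap)
  also have "\<dots> = (\<Sum>p<k. PL k n (u(p := \<lambda>c. if c = a then u p b else 0)))"
  proof (intro sum.cong refl)
    fix p assume "p \<in> {..<k}"
    then have p: "p < k" by simp
    have "(\<Sum>s\<in>strings k n. if s ! p = b then const_poly (\<Prod>i<k. u i (s ! i)) * PS (s[p := a]) else 0) = 
      (\<Sum>s\<in>{s\<in>strings k n. s ! p = b}. const_poly (\<Prod>i<k. u i (s ! i)) * PS (s[p := a]))"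
      by (rule sum.inter_filter[symmetric]) simp
    also have "\<dots> = (\<Sum>s\<in>{s\<in>strings k n. s ! p = a}. const_poly (u p b * (\<Prod>i\<in>{..<k}-{p}. u i (s ! i))) * PS s)"
    proof (rule sum.reindex_bij_witness[of _ "\<lambda>s. s[p := b]" "\<lambda>s. s[p := a]"])
      fix s assume s: "s \<in> {s\<in>strings k n. s ! p = b}"
      then have len: "length s = k" by (simp add: strings_def)
      show "s[p := a, p := b] = s" using s by auto
      show "s[p := a] \<in> {s\<in>strings k n. s ! p = a}" using s p ab set_update_subset_insert[of s p a] by (auto simp: strings_def)
      have "(\<Prod>i<k. u i (s ! i)) = u p b * (\<Prod>i\<in>{..<k}-{p}. u i (s ! i))"
        using p s by (subst prod.remove[of _ p]) auto
      moreover have "(\<Prod>i\<in>{..<k}-{p}. u i (s[p := a] ! i)) = (\<Prod>i\<in>{..<k}-{p}. u i (s ! i))" by (intro prod.cong) auto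
      ultimately show "const_poly (u p b * (\<Prod>i\<in>{..<k}-{p}. u i (s[p := a] ! i))) * PS (s[p := a]) = const_poly (\<Prod>i<k. u i (s ! i)) * PS (s[p := a])"
        by (simp only:)
    next
      fix s assume s: "s \<in> {s\<in>strings k n. s ! p = a}"
      show "s[p := b, p := a] = s" using s by auto
      show "s[p := b] \<in> {s\<in>strings k n. s ! p = b}" using s p ab set_update_subset_insert[of s p b] by (auto simp: strings_def)
    qed
    also have "\<dots> = (\<Sum>s\<in>strings k n. if s ! p = a then const_poly (u p b * (\<Prod>i\<in>{..<k}-{p}. u i (s ! i))) * PS s else 0)"
      by (rule sum.inter_filter) simp
    also have "\<dots> = PL k n (u(p := \<lambda>c. if c = a then u p b else 0))"
      unfolding PL_def prod_fun_upd[OF p] by (intro sum.cong refl) auto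
    finally show "(\<Sum>s\<in>strings k n. if s ! p = b then const_poly (\<Prod>i<k. u i (s ! i)) * PS (s[p := a]) else 0) = 
       PL k n (u(p := \<lambda>c. if c = a then u p b else 0))" .
  qed
  finally show ?thesis .
qed

lemma PL_permute:
  assumes "\<tau> permutes {..<k}"
  shows "PL k n (\<lambda>i. u (\<tau> i)) = of_int (sign \<tau>) * PL k n u"
proof -
  let ?i = "inv_into UNIV \<tau>"
  have it: "?i permutes {..<k}" by (rule permutes_inv[OF assms])
  have sg: "sign ?i = sign \<tau>" using assms permutation_permutes by (intro sign_inverse) blast
  have mem: "permute_list \<rho> s \<in> strings k n" if "\<rho> permutes {..<k}" "s \<in> strings k n" for \<rho> s
    using that by (auto simp: strings_def)
  have "PL k n (\<lambda>i. u (\<tau> i)) = (\<Sum>s\<in>strings k n. const_poly (\<Prod>i<k. u (\<tau> i) (permute_list \<tau> s ! i)) * PS (permute_list \<tau> s))"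
    unfolding PL_def
  proof (rule sum.reindex_bij_witness[of _ "permute_list \<tau>" "permute_list ?i"])
    fix s assume s: "s \<in> strings k n"
    then have l: "length s = k" by (simp add: strings_def)
    have "\<tau> \<circ> ?i = id" "?i \<circ> \<tau> = id" using assms by (auto simp: fun_eq_iff permutes_inverses)
    then show "permute_list \<tau> (permute_list ?i s) = s" "permute_list ?i (permute_list \<tau> s) = s"
      using permute_list_compose[of \<tau> s ?i] permute_list_compose[of ?i s \<tau>] l assms it by auto
    show "permute_list ?i s \<in> strings k n" "permute_list \<tau> s \<in> strings k n" using mem it assms s by blast+
    show "const_poly (\<Prod>i<k. u (\<tau> i) (permute_list \<tau> (permute_list ?i s) ! i)) * PS (permute_list \<tau> (permute_list ?i s)) = const_poly (\<Prod>i<k. u (\<tau> i) (s ! i)) * PS s"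
      using \<open>permute_list \<tau> (permute_list ?i s) = s\<close> by simp
  qed
  also have "\<dots> = (\<Sum>s\<in>strings k n. of_int (sign \<tau>) * (const_poly (\<Prod>i<k. u i (s ! i)) * PS s))"
  proof (intro sum.cong refl)
    fix s assume "s \<in> strings k n"
    then have l: "length s = k" by (simp add: strings_def)
    have "(\<Prod>i<k. u (\<tau> i) (permute_list \<tau> s ! i)) = (\<Prod>i<k. u (\<tau> i) (s ! \<tau> i))"
      using assms l by (intro prod.cong) (auto simp: permute_list_nth)
    also have "\<dots> = (\<Prod>i<k. u i (s ! i))" by (rule prod.permute[OF assms, symmetric, unfolded o_def])
    finally show "const_poly (\<Prod>i<k. u (\<tau> i) (permute_list \<tau> s ! i)) * PS (permute_list \<tau> s) = of_int (sign \<tau>) * (const_poly (\<Prod>i<k. u i (s ! i)) * PS s)"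
      using PS_permute_list[of \<tau> s] assms l by (simp add: mult_ac)
  qed
  finally show ?thesis by (simp add: PL_def sum_distrib_left)
qed

lemma ppoly_eq_neg_self: assumes "(x :: ppoly) = - x" shows "x = 0"
proof -
  have "x + x = 0" using assms by (metis add.right_inverse)
  then have "const_poly (1/2) * x + const_poly (1/2) * x = 0" by (metis distrib_left mult_zero_right)
  then have "const_poly (1/2 + 1/2) * x = 0" unfolding const_poly_simps(3) distrib_right .
  then show ?thesis by simp
qed

lemma PL_repeat:
  assumes "i < k" "j < k" "i \<noteq> j" "u i = u j"
  shows "PL k n u = 0"
proof -
  have p: "transpose i j permutes {..<k}" using assms by (intro permutes_swap_id) auto
  have "(\<lambda>l. u (transpose i j l)) = u" using assms by (auto simp: transpose_def fun_eq_iff)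
  then have "PL k n u = - PL k n u" using PL_permute[OF p, of n u] assms by (simp add: sign_swap_id)
  then show ?thesis by (rule ppoly_eq_neg_self)
qed

text \<open>Multilinearity of the determinant in its columns. Summation over all strings, not only
  increasing ones, lets the sum factor over positions.\<close>

lemma peval_PL:
  "peval (PL k n u) (\<lambda>S. x * pc k M S) = x * det (mat k k (\<lambda>(a, i). \<Sum>c\<in>{1..n}. M a c * u i c))"
proof -
  have "peval (PL k n u) (\<lambda>S. x * pc k M S) = (\<Sum>s\<in>strings k n. (\<Prod>i<k. u i (s ! i)) * (x * sd k M s))"
    unfolding PL_def peval.hev_sum by (intro sum.cong refl) (auto simp: peval.hev_mult peval_PS strings_def)
  also have "\<dots> = x * (\<Sum>p | p permutes {..<k}. of_int (sign p) * (\<Sum>s\<in>strings k n. \<Prod>i<k. M (p i) (s ! i) * u i (s ! i)))"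
    unfolding sd_leibniz sum_distrib_left by (subst sum.swap) (intro sum.cong refl, simp add: prod.distrib mult_ac)
  also have "\<dots> = x * (\<Sum>p | p permutes {..<k}. of_int (sign p) * (\<Prod>i<k. \<Sum>c\<in>{1..n}. M (p i) c * u i c))"
    by (simp only: sum_strings_prod[where h="\<lambda>i c. M (p i) c * u i c" for p])
  also have "(\<Sum>p | p permutes {..<k}. of_int (sign p) * (\<Prod>i<k. \<Sum>c\<in>{1..n}. M (p i) c * u i c)) = sd k (\<lambda>a i. \<Sum>c\<in>{1..n}. M a c * u i c) [0..<k]"
    unfolding sd_leibniz by (intro sum.cong refl arg_cong2[of _ _ _ _ "(*)"] prod.cong) auto
  also have "\<dots> = det (mat k k (\<lambda>(a, i). \<Sum>c\<in>{1..n}. M a c * u i c))"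
    unfolding sd_def by (intro arg_cong[of _ _ det] eq_matI) auto
  finally show ?thesis .
qed

section \<open>An isotropic basis\<close>

text \<open>The involution that sends an isotropic basis vector to the one it pairs with; for odd
  \<open>n\<close> the last vector pairs with itself.\<close>

definition star :: "nat \<Rightarrow> nat \<Rightarrow> nat" where
  "star n c = (if odd n \<and> c = n then n else if odd c then c + 1 else c - 1)"

text \<open>A hyperbolic basis made of \<open>e + i e'\<close> and \<open>(e - i e') / 2\<close> for
  each coordinate plane, with the last unit vector added for odd \<open>n\<close>. The factor 1/2
  sits on the second vector only and makes every pairing equal to 1.\<close>

definition fb :: "nat \<Rightarrow> nat \<Rightarrow> nat \<Rightarrow> complex" where
  "fb n c a = (if odd n \<and> c = n then (if a = n then 1 else 0)
     else if odd c then (if a = c then 1 else if a = c + 1 then \<i> else 0)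
     else (if a = c - 1 then 1/2 else if a = c then - \<i>/2 else 0))"

text \<open>Weight of basis vector \<open>c\<close> under the rotation of plane \<open>j\<close>,
  with planes numbered from 1.\<close>

definition wtc :: "nat \<Rightarrow> nat \<Rightarrow> nat \<Rightarrow> int" where
  "wtc n c j = (if j \<in> {1..n div 2} then (if c = 2 * j - 1 then 1 else if c = 2 * j then -1 else 0) else 0)"

lemma index_cases:
  assumes "(c::nat) \<in> {1..n}"
  obtains j where "j \<in> {1..n div 2}" "c = 2 * j - 1" | j where "j \<in> {1..n div 2}" "c = 2 * j" | "odd n" "c = n"
proof (cases "odd c")
  case True
  then obtain i where i: "c = 2 * i + 1" by (auto elim: oddE)
  show ?thesis
  proof (cases "c = n")
    case True then show ?thesis using that(3) \<open>odd c\<close> by blast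
  next
    case False
    then have "i + 1 \<in> {1..n div 2}" using assms i by auto
    then show ?thesis using that(1)[of "i + 1"] i by simp
  qed
next
  case False
  then obtain i where i: "c = 2 * i" by (auto elim: evenE)
  then have "i \<in> {1..n div 2}" using assms by auto
  then show ?thesis using that(2) i by blast
qed

lemma plane_index [simp]:
  assumes "(j::nat) \<in> {1..n div 2}"
  shows "2 * j - 1 \<in> {1..n}" "2 * j \<in> {1..n}" "2 * j - 1 \<noteq> 2 * j" "odd (2 * j - 1)" "2 * j - 1 + 1 = 2 * j" "2 * j - 1 < n"
  using assms by auto

lemma plane_index_eq:
  assumes "(i::nat) \<in> {1..n div 2}" "j \<in> {1..n div 2}"
  shows "2 * i - 1 = 2 * j - 1 \<longleftrightarrow> i = j" "2 * i = 2 * j \<longleftrightarrow> i = j" "2 * i - 1 \<noteq> 2 * j" "2 * j \<noteq> 2 * i - 1"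
    "odd n \<Longrightarrow> 2 * i - 1 \<noteq> n" "odd n \<Longrightarrow> 2 * i \<noteq> n" "odd n \<Longrightarrow> n \<noteq> 2 * i - 1" "odd n \<Longrightarrow> n \<noteq> 2 * i"
proof -
  have "i \<ge> 1" "j \<ge> 1" "2 * i \<le> n" using assms by auto
  then show "2 * i - 1 = 2 * j - 1 \<longleftrightarrow> i = j" "2 * i = 2 * j \<longleftrightarrow> i = j" "2 * i - 1 \<noteq> 2 * j" "2 * j \<noteq> 2 * i - 1"
    "odd n \<Longrightarrow> 2 * i - 1 \<noteq> n" "odd n \<Longrightarrow> 2 * i \<noteq> n" "odd n \<Longrightarrow> n \<noteq> 2 * i - 1" "odd n \<Longrightarrow> n \<noteq> 2 * i"
    by presburger+
qed

lemma star_plane: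
  assumes "j \<in> {1..n div 2}"
  shows "star n (2 * j - 1) = 2 * j" "star n (2 * j) = 2 * j - 1"
  using assms plane_index_eq[OF assms assms] by (auto simp: star_def)

lemma star_last: "odd n \<Longrightarrow> star n n = n" by (simp add: star_def)

lemma star_in: "c \<in> {1..n} \<Longrightarrow> star n c \<in> {1..n}"
  by (cases rule: index_cases[of c n]) (auto simp: star_plane star_last simp del: One_nat_def atLeastAtMost_iff)

lemma star_star: "c \<in> {1..n} \<Longrightarrow> star n (star n c) = c"
  by (cases rule: index_cases[of c n]) (auto simp: star_plane star_last simp del: One_nat_def atLeastAtMost_iff)

lemma fb_plane:
  assumes "i \<in> {1..n div 2}" "j \<in> {1..n div 2}"
  shows "fb n (2 * i - 1) (2 * j - 1) = (if i = j then 1 else 0)" "fb n (2 * i - 1) (2 * j) = (if i = j then \<i> else 0)"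
    "fb n (2 * i) (2 * j - 1) = (if i = j then 1/2 else 0)" "fb n (2 * i) (2 * j) = (if i = j then - \<i>/2 else 0)"
    "odd n \<Longrightarrow> fb n (2 * i - 1) n = 0" "odd n \<Longrightarrow> fb n (2 * i) n = 0" "odd n \<Longrightarrow> fb n n (2 * i - 1) = 0" "odd n \<Longrightarrow> fb n n (2 * i) = 0"
proof -
  have p: "odd (2 * i - 1)" "2 * i - 1 + 1 = 2 * i" using assms by auto
  note e = plane_index_eq[OF assms] plane_index_eq[OF assms(2,1)]
  show "fb n (2 * i - 1) (2 * j - 1) = (if i = j then 1 else 0)" "fb n (2 * i - 1) (2 * j) = (if i = j then \<i> else 0)"
    "fb n (2 * i) (2 * j - 1) = (if i = j then 1/2 else 0)" "fb n (2 * i) (2 * j) = (if i = j then - \<i>/2 else 0)"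
    "odd n \<Longrightarrow> fb n (2 * i - 1) n = 0" "odd n \<Longrightarrow> fb n (2 * i) n = 0" "odd n \<Longrightarrow> fb n n (2 * i - 1) = 0" "odd n \<Longrightarrow> fb n n (2 * i) = 0"
    unfolding fb_def using e p by (simp_all) (auto split: if_splits)
qed

lemma fb_last: "odd n \<Longrightarrow> fb n n n = 1" by (simp add: fb_def)

lemma wtc_plane:
  assumes "i \<in> {1..n div 2}" "j \<in> {1..n div 2}"
  shows "wtc n (2 * i - 1) j = (if i = j then 1 else 0)" "wtc n (2 * i) j = (if i = j then -1 else 0)"
    "odd n \<Longrightarrow> wtc n n j = 0"
  unfolding wtc_def using plane_index_eq[OF assms] plane_index_eq[OF assms(2,1)] assms(2) by auto

lemma sum_index:
  fixes h :: "nat \<Rightarrow> 'a::comm_monoid_add"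
  shows "(\<Sum>c\<in>{1..n}. h c) = (\<Sum>j\<in>{1..n div 2}. h (2 * j - 1) + h (2 * j)) + (if odd n then h n else 0)"
proof -
  have *: "(\<Sum>c\<in>{1..2*m}. h c) = (\<Sum>j\<in>{1..m}. h (2 * j - 1) + h (2 * j))" for m
    by (induction m) (auto simp: add.assoc)
  show ?thesis
  proof (cases "odd n")
    case True
    then have n: "n = Suc (2 * (n div 2))" by presburger
    have "(\<Sum>c\<in>{1..n}. h c) = (\<Sum>c\<in>{1..2*(n div 2)}. h c) + h n"
      by (subst (1 3) n) simp
    then show ?thesis using True *[of "n div 2"] by (simp only: if_True not_False_eq_True)
  next
    case False
    then have n: "n = 2 * (n div 2)" by presburger
    then show ?thesis using False *[of "n div 2"] by simp
  qed
qed

lemma fb_sum: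
  "j \<in> {1..n div 2} \<Longrightarrow> (\<Sum>a\<in>{1..n}. fb n (2 * j - 1) a * h a) = h (2 * j - 1) + \<i> * h (2 * j)"
  "j \<in> {1..n div 2} \<Longrightarrow> (\<Sum>a\<in>{1..n}. fb n (2 * j) a * h a) = h (2 * j - 1) / 2 - \<i> / 2 * h (2 * j)"
  "odd n \<Longrightarrow> (\<Sum>a\<in>{1..n}. fb n n a * h a) = h n"
proof -
  show "(\<Sum>a\<in>{1..n}. fb n (2 * j - 1) a * h a) = h (2 * j - 1) + \<i> * h (2 * j)" if j: "j \<in> {1..n div 2}"
  proof -
    have "(\<Sum>i\<in>{1..n div 2}. fb n (2 * j - 1) (2 * i - 1) * h (2 * i - 1) + fb n (2 * j - 1) (2 * i) * h (2 * i)) = 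
       (\<Sum>i\<in>{1..n div 2}. if j = i then h (2 * i - 1) + \<i> * h (2 * i) else 0)"
      by (intro sum.cong refl) (simp add: fb_plane j del: atLeastAtMost_iff One_nat_def)
    then show ?thesis using j by (simp add: sum_index[of _ n] fb_plane(5)[OF j j] sum.delta del: One_nat_def)
  qed
  show "(\<Sum>a\<in>{1..n}. fb n (2 * j) a * h a) = h (2 * j - 1) / 2 - \<i> / 2 * h (2 * j)" if j: "j \<in> {1..n div 2}"
  proof -
    have "(\<Sum>i\<in>{1..n div 2}. fb n (2 * j) (2 * i - 1) * h (2 * i - 1) + fb n (2 * j) (2 * i) * h (2 * i)) = 
       (\<Sum>i\<in>{1..n div 2}. if j = i then h (2 * i - 1) / 2 - \<i> / 2 * h (2 * i) else 0)"
      by (intro sum.cong refl) (simp add: fb_plane j del: atLeastAtMost_iff One_nat_def)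
    then show ?thesis using j by (simp add: sum_index[of _ n] fb_plane(6)[OF j j] sum.delta del: One_nat_def)
  qed
  show "(\<Sum>a\<in>{1..n}. fb n n a * h a) = h n" if "odd n"
  proof -
    have "(\<Sum>i\<in>{1..n div 2}. fb n n (2 * i - 1) * h (2 * i - 1) + fb n n (2 * i) * h (2 * i)) = 0"
      by (intro sum.neutral ballI) (simp add: fb_plane that del: atLeastAtMost_iff One_nat_def)
    then show ?thesis using that by (simp add: sum_index[of _ n] fb_last del: One_nat_def)
  qed
qed

lemma fb_gram:
  assumes "c \<in> {1..n}" "e \<in> {1..n}"
  shows "(\<Sum>a\<in>{1..n}. fb n c a * fb n e a) = (if e = star n c then 1 else 0)"
  using assms(1)
proof (cases rule: index_cases)
  case (1 i)
  show ?thesis using assms(2)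
    by (cases rule: index_cases) (use 1 in \<open>auto simp: fb_sum fb_plane star_plane plane_index_eq simp del: atLeastAtMost_iff One_nat_def\<close>)
next
  case (2 i)
  show ?thesis using assms(2)
    by (cases rule: index_cases) (use 2 in \<open>auto simp: fb_sum fb_plane star_plane plane_index_eq simp del: atLeastAtMost_iff One_nat_def\<close>)
next
  case 3
  show ?thesis using assms(2)
    by (cases rule: index_cases) (use 3 in \<open>auto simp: fb_sum fb_plane fb_last star_last plane_index_eq simp del: atLeastAtMost_iff One_nat_def\<close>)
qed

text \<open>The resolution of the identity that belongs to \<open>fb_gram\<close>: each basis vector
  is dual to its \<open>star\<close> partner.\<close>

lemma fb_complete:
  assumes "a \<in> {1..n}" "b \<in> {1..n}"
  shows "(\<Sum>c\<in>{1..n}. fb n c a * fb n (star n c) b) = (if a = b then 1 else 0)"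
proof -
  have "(\<Sum>c\<in>{1..n}. fb n c a * fb n (star n c) b) = 
     (\<Sum>j\<in>{1..n div 2}. fb n (2 * j - 1) a * fb n (2 * j) b + fb n (2 * j) a * fb n (2 * j - 1) b) + (if odd n then fb n n a * fb n n b else 0)"
    unfolding sum_index[of _ n] by (intro arg_cong2[of _ _ _ _ "(+)"] sum.cong) (auto simp: star_plane star_last simp del: atLeastAtMost_iff One_nat_def)
  also have "\<dots> = (if a = b then 1 else 0)"
    using assms(1)
  proof (cases rule: index_cases)
    case (1 i)
    have "(\<Sum>j\<in>{1..n div 2}. fb n (2 * j - 1) a * fb n (2 * j) b + fb n (2 * j) a * fb n (2 * j - 1) b) = 
       (\<Sum>j\<in>{1..n div 2}. if i = j then fb n (2 * j) b + 1/2 * fb n (2 * j - 1) b else 0)"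
      using 1 by (intro sum.cong refl) (auto simp: fb_plane simp del: atLeastAtMost_iff One_nat_def)
    also have "\<dots> = fb n (2 * i) b + 1/2 * fb n (2 * i - 1) b" using 1 by (simp add: sum.delta)
    finally have e: "(\<Sum>j\<in>{1..n div 2}. fb n (2 * j - 1) a * fb n (2 * j) b + fb n (2 * j) a * fb n (2 * j - 1) b) = \<dots>" .
    show ?thesis unfolding e using assms(2)
      by (cases rule: index_cases) (use 1 in \<open>auto simp: fb_plane fb_last plane_index_eq simp del: atLeastAtMost_iff One_nat_def\<close>)
  next
    case (2 i)
    have "(\<Sum>j\<in>{1..n div 2}. fb n (2 * j - 1) a * fb n (2 * j) b + fb n (2 * j) a * fb n (2 * j - 1) b) = 
       (\<Sum>j\<in>{1..n div 2}. if i = j then \<i> * fb n (2 * j) b - \<i>/2 * fb n (2 * j - 1) b else 0)"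
      using 2 by (intro sum.cong refl) (auto simp: fb_plane simp del: atLeastAtMost_iff One_nat_def)
    also have "\<dots> = \<i> * fb n (2 * i) b - \<i>/2 * fb n (2 * i - 1) b" using 2 by (simp add: sum.delta)
    finally have e: "(\<Sum>j\<in>{1..n div 2}. fb n (2 * j - 1) a * fb n (2 * j) b + fb n (2 * j) a * fb n (2 * j - 1) b) = \<dots>" .
    show ?thesis unfolding e using assms(2)
      by (cases rule: index_cases) (use 2 in \<open>auto simp: fb_plane fb_last plane_index_eq simp del: atLeastAtMost_iff One_nat_def\<close>)
  next
    case 3
    have e: "(\<Sum>j\<in>{1..n div 2}. fb n (2 * j - 1) a * fb n (2 * j) b + fb n (2 * j) a * fb n (2 * j - 1) b) = 0"
      using 3 by (intro sum.neutral ballI) (auto simp: fb_plane simp del: atLeastAtMost_iff One_nat_def)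
    show ?thesis unfolding e using assms(2)
      by (cases rule: index_cases) (use 3 in \<open>auto simp: fb_plane fb_last plane_index_eq simp del: atLeastAtMost_iff One_nat_def\<close>)
  qed
  finally show ?thesis .
qed

section \<open>Root vectors\<close>

text \<open>The bilinear extension of \<open>D\<close>, giving the element of so(n) attached to a
  bivector.\<close>

definition Dv :: "nat \<Rightarrow> (nat \<Rightarrow> complex) \<Rightarrow> (nat \<Rightarrow> complex) \<Rightarrow> ppoly \<Rightarrow> ppoly" where
  "Dv n u v f = (\<Sum>a\<in>{1..n}. \<Sum>b\<in>{1..n}. const_poly (u a * v b) * D a b f)"

lemma Dv_add: "Dv n u v (f + g) = Dv n u v f + Dv n u v g"
  by (simp add: Dv_def D_add sum.distrib algebra_simps)
lemma Dv_const_mult: "Dv n u v (const_poly c * f) = const_poly c * Dv n u v f"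
  unfolding Dv_def D_const_mult sum_distrib_left by (intro sum.cong refl) (simp only: mult.left_commute)
lemma Dv_antisym: "Dv n v u f = - Dv n u v f"
proof -
  have "Dv n v u f = (\<Sum>b\<in>{1..n}. \<Sum>a\<in>{1..n}. const_poly (v a * u b) * D a b f)" unfolding Dv_def by (rule sum.swap)
  also have "\<dots> = (\<Sum>b\<in>{1..n}. \<Sum>a\<in>{1..n}. - (const_poly (u b * v a) * D b a f))"
  proof (intro sum.cong refl)
    fix a b
    show "const_poly (v a * u b) * D a b f = - (const_poly (u b * v a) * D b a f)"
      by (simp only: D_antisym[of a b f] mult.commute[of "v a"] mult_minus_right)
  qed
  finally show ?thesis by (simp add: Dv_def sum_negf)
qed

lemma Dv_Dv: "Dv n u v (Dv n x y f) = 
  (\<Sum>a\<in>{1..n}. \<Sum>b\<in>{1..n}. \<Sum>c\<in>{1..n}. \<Sum>d\<in>{1..n}. const_poly (u a * v b * x c * y d) * D a b (D c d f))"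
  unfolding Dv_def D_sum D_const_mult sum_distrib_left by (intro sum.cong refl) (simp add: mult_ac)

lemma Dv_commutator:
  "Dv n u v (Dv n x y f) = Dv n x y (Dv n u v f) + const_poly (\<Sum>a\<in>{1..n}. v a * x a) * Dv n u y f
    - const_poly (\<Sum>a\<in>{1..n}. u a * x a) * Dv n v y f - const_poly (\<Sum>a\<in>{1..n}. v a * y a) * Dv n u x f
    + const_poly (\<Sum>a\<in>{1..n}. u a * y a) * Dv n v x f"
proof -
  let ?A = "{1..n}"
  let ?w = "\<lambda>a b c d. const_poly (u a * v b * x c * y d)"
  have 0: "(\<Sum>a\<in>?A. \<Sum>b\<in>?A. \<Sum>c\<in>?A. \<Sum>d\<in>?A. ?w a b c d * D c d (D a b f)) = Dv n x y (Dv n u v f)"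
  proof -
    have "Dv n x y (Dv n u v f) = (\<Sum>c\<in>?A. \<Sum>d\<in>?A. \<Sum>a\<in>?A. \<Sum>b\<in>?A. ?w a b c d * D c d (D a b f))"
      unfolding Dv_Dv by (intro sum.cong refl) (simp add: mult_ac)
    also have "\<dots> = (\<Sum>a\<in>?A. \<Sum>c\<in>?A. \<Sum>d\<in>?A. \<Sum>b\<in>?A. ?w a b c d * D c d (D a b f))" by (rule sum_swap3)
    also have "\<dots> = (\<Sum>a\<in>?A. \<Sum>b\<in>?A. \<Sum>c\<in>?A. \<Sum>d\<in>?A. ?w a b c d * D c d (D a b f))"
      by (rule sum.cong[OF refl], rule sum_swap3)
    finally show ?thesis by simp
  qed
  have 1: "(\<Sum>a\<in>?A. \<Sum>b\<in>?A. \<Sum>c\<in>?A. \<Sum>d\<in>?A. ?w a b c d * (if b = c then D a d f else 0)) = const_poly (\<Sum>a\<in>?A. v a * x a) * Dv n u y f"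
  proof -
    have "(\<Sum>a\<in>?A. \<Sum>b\<in>?A. \<Sum>c\<in>?A. \<Sum>d\<in>?A. ?w a b c d * (if b = c then D a d f else 0)) = 
      (\<Sum>a\<in>?A. \<Sum>b\<in>?A. \<Sum>d\<in>?A. ?w a b b d * D a d f)"
      by (rule sum.cong[OF refl], rule sum.cong[OF refl], subst sum.swap, rule sum.cong[OF refl]) (auto simp: if_distrib[of "(*) _"] sum.delta cong: if_cong)
    also have "\<dots> = (\<Sum>a\<in>?A. \<Sum>d\<in>?A. \<Sum>b\<in>?A. ?w a b b d * D a d f)" by (rule sum.cong[OF refl], rule sum.swap)
    finally show ?thesis unfolding Dv_def const_poly_sum sum_distrib_left sum_distrib_right by (simp add: mult_ac)
  qed
  have 2: "(\<Sum>a\<in>?A. \<Sum>b\<in>?A. \<Sum>c\<in>?A. \<Sum>d\<in>?A. ?w a b c d * (if a = c then D b d f else 0)) = const_poly (\<Sum>a\<in>?A. u a * x a) * Dv n v y f"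
  proof -
    have "(\<Sum>a\<in>?A. \<Sum>b\<in>?A. \<Sum>c\<in>?A. \<Sum>d\<in>?A. ?w a b c d * (if a = c then D b d f else 0)) = 
      (\<Sum>a\<in>?A. \<Sum>b\<in>?A. \<Sum>d\<in>?A. ?w a b a d * D b d f)"
      by (rule sum.cong[OF refl], rule sum.cong[OF refl], subst sum.swap, rule sum.cong[OF refl]) (auto simp: if_distrib[of "(*) _"] sum.delta cong: if_cong)
    also have "\<dots> = (\<Sum>b\<in>?A. \<Sum>d\<in>?A. \<Sum>a\<in>?A. ?w a b a d * D b d f)" by (rule sum_swap3[symmetric])
    finally show ?thesis unfolding Dv_def const_poly_sum sum_distrib_left sum_distrib_right by (simp add: mult_ac)
  qed
  have 3: "(\<Sum>a\<in>?A. \<Sum>b\<in>?A. \<Sum>c\<in>?A. \<Sum>d\<in>?A. ?w a b c d * (if b = d then D a c f else 0)) = const_poly (\<Sum>a\<in>?A. v a * y a) * Dv n u x f"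
  proof -
    have "(\<Sum>a\<in>?A. \<Sum>b\<in>?A. \<Sum>c\<in>?A. \<Sum>d\<in>?A. ?w a b c d * (if b = d then D a c f else 0)) = 
      (\<Sum>a\<in>?A. \<Sum>b\<in>?A. \<Sum>c\<in>?A. ?w a b c b * D a c f)"
      by (intro sum.cong refl) (auto simp: if_distrib[of "(*) _"] sum.delta cong: if_cong)
    also have "\<dots> = (\<Sum>a\<in>?A. \<Sum>c\<in>?A. \<Sum>b\<in>?A. ?w a b c b * D a c f)" by (rule sum.cong[OF refl], rule sum.swap)
    finally show ?thesis unfolding Dv_def const_poly_sum sum_distrib_left sum_distrib_right by (simp add: mult_ac)
  qed
  have 4: "(\<Sum>a\<in>?A. \<Sum>b\<in>?A. \<Sum>c\<in>?A. \<Sum>d\<in>?A. ?w a b c d * (if a = d then D b c f else 0)) = const_poly (\<Sum>a\<in>?A. u a * y a) * Dv n v x f"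
  proof -
    have "(\<Sum>a\<in>?A. \<Sum>b\<in>?A. \<Sum>c\<in>?A. \<Sum>d\<in>?A. ?w a b c d * (if a = d then D b c f else 0)) = 
      (\<Sum>a\<in>?A. \<Sum>b\<in>?A. \<Sum>c\<in>?A. ?w a b c a * D b c f)"
      by (intro sum.cong refl) (auto simp: if_distrib[of "(*) _"] sum.delta cong: if_cong)
    also have "\<dots> = (\<Sum>b\<in>?A. \<Sum>c\<in>?A. \<Sum>a\<in>?A. ?w a b c a * D b c f)" by (rule sum_swap3[symmetric])
    finally show ?thesis unfolding Dv_def const_poly_sum sum_distrib_left sum_distrib_right by (simp add: mult_ac)
  qed
  have "Dv n u v (Dv n x y f) = (\<Sum>a\<in>?A. \<Sum>b\<in>?A. \<Sum>c\<in>?A. \<Sum>d\<in>?A. ?w a b c d * D c d (D a b f) + ?w a b c d * (if b = c then D a d f else 0)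
    - ?w a b c d * (if a = c then D b d f else 0) - ?w a b c d * (if b = d then D a c f else 0) + ?w a b c d * (if a = d then D b c f else 0))"
    unfolding Dv_Dv by (intro sum.cong refl) (subst D_commutator, simp only: distrib_left right_diff_distrib)
  then show ?thesis by (simp only: sum.distrib sum_subtractf 0 1 2 3 4)
qed

text \<open>Bivectors of isotropic basis vectors: \<open>c' = star n c\<close> gives Cartan
  elements, other distinct pairs give root vectors, and \<open>c' = c\<close> gives zero.\<close>

definition Rv :: "nat \<Rightarrow> nat \<Rightarrow> nat \<Rightarrow> ppoly \<Rightarrow> ppoly" where
  "Rv n c c' = Dv n (fb n c) (fb n c')"

lemma Rv_commutator:
  assumes "c \<in> {1..n}" "c' \<in> {1..n}" "e \<in> {1..n}" "e' \<in> {1..n}"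
  shows "Rv n c c' (Rv n e e' f) = Rv n e e' (Rv n c c' f) + (if e = star n c' then Rv n c e' f else 0)
    - (if e = star n c then Rv n c' e' f else 0) - (if e' = star n c' then Rv n c e f else 0) + (if e' = star n c then Rv n c' e f else 0)"
  unfolding Rv_def Dv_commutator[of n "fb n c" "fb n c'"] fb_gram[OF assms(1,3)] fb_gram[OF assms(1,4)] fb_gram[OF assms(2,3)] fb_gram[OF assms(2,4)]
  by (cases "e = star n c'"; cases "e = star n c"; cases "e' = star n c'"; cases "e' = star n c"; simp)

text \<open>The invariant form does not depend on the basis: the two sums over basis indices
  collapse separately by \<open>fb_complete\<close>.\<close>

lemma Cas_Rv: "Cas n f = (\<Sum>c\<in>{1..n}. \<Sum>c'\<in>{1..n}. Rv n c c' (Rv n (star n c) (star n c') f))"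
proof -
  let ?A = "{1..n}"
  let ?T = "\<lambda>c c' a b x y. const_poly (fb n c a * fb n c' b * fb n (star n c) x * fb n (star n c') y) * D a b (D x y f)"
  have "(\<Sum>c\<in>?A. \<Sum>c'\<in>?A. Rv n c c' (Rv n (star n c) (star n c') f)) = 
    (\<Sum>c\<in>?A. \<Sum>c'\<in>?A. \<Sum>a\<in>?A. \<Sum>b\<in>?A. \<Sum>x\<in>?A. \<Sum>y\<in>?A. ?T c c' a b x y)"
    by (simp only: Rv_def Dv_Dv)
  also have "\<dots> = (\<Sum>a\<in>?A. \<Sum>c\<in>?A. \<Sum>c'\<in>?A. \<Sum>b\<in>?A. \<Sum>x\<in>?A. \<Sum>y\<in>?A. ?T c c' a b x y)" by (rule sum_swap3)
  also have "\<dots> = (\<Sum>a\<in>?A. \<Sum>b\<in>?A. \<Sum>c\<in>?A. \<Sum>c'\<in>?A. \<Sum>x\<in>?A. \<Sum>y\<in>?A. ?T c c' a b x y)"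
    by (rule sum.cong[OF refl], rule sum_swap3)
  also have "\<dots> = (\<Sum>a\<in>?A. \<Sum>b\<in>?A. \<Sum>x\<in>?A. \<Sum>c\<in>?A. \<Sum>c'\<in>?A. \<Sum>y\<in>?A. ?T c c' a b x y)"
    by (rule sum.cong[OF refl], rule sum.cong[OF refl], rule sum_swap3)
  also have "\<dots> = (\<Sum>a\<in>?A. \<Sum>b\<in>?A. \<Sum>x\<in>?A. \<Sum>y\<in>?A. \<Sum>c\<in>?A. \<Sum>c'\<in>?A. ?T c c' a b x y)"
    by (rule sum.cong[OF refl], rule sum.cong[OF refl], rule sum.cong[OF refl], rule sum_swap3)
  also have "\<dots> = (\<Sum>a\<in>?A. \<Sum>b\<in>?A. \<Sum>x\<in>?A. \<Sum>y\<in>?A. const_poly ((if a = x then 1 else 0) * (if b = y then 1 else 0)) * D a b (D x y f))"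
  proof (intro sum.cong refl)
    fix a b x y assume abxy: "a \<in> ?A" "b \<in> ?A" "x \<in> ?A" "y \<in> ?A"
    have "(\<Sum>c\<in>?A. \<Sum>c'\<in>?A. const_poly (fb n c a * fb n c' b * fb n (star n c) x * fb n (star n c') y) * D a b (D x y f)) = 
       const_poly ((\<Sum>c\<in>?A. fb n c a * fb n (star n c) x) * (\<Sum>c'\<in>?A. fb n c' b * fb n (star n c') y)) * D a b (D x y f)"
    proof -
      have "(\<Sum>c\<in>?A. fb n c a * fb n (star n c) x) * (\<Sum>c'\<in>?A. fb n c' b * fb n (star n c') y) = 
        (\<Sum>c\<in>?A. \<Sum>c'\<in>?A. fb n c a * fb n c' b * fb n (star n c) x * fb n (star n c') y)"
        unfolding sum_product by (intro sum.cong refl) (simp only: mult_ac)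
      then show ?thesis by (simp only: const_poly_sum sum_distrib_right)
    qed
    then show "(\<Sum>c\<in>?A. \<Sum>c'\<in>?A. const_poly (fb n c a * fb n c' b * fb n (star n c) x * fb n (star n c') y) * D a b (D x y f)) = 
       const_poly ((if a = x then 1 else 0) * (if b = y then 1 else 0)) * D a b (D x y f)"
      by (simp only: fb_complete abxy)
  qed
  also have "\<dots> = (\<Sum>a\<in>?A. \<Sum>b\<in>?A. \<Sum>x\<in>?A. \<Sum>y\<in>?A. if a = x \<and> b = y then D a b (D x y f) else 0)"
    by (intro sum.cong refl) auto
  also have "\<dots> = Cas n f" unfolding Cas_def by (intro sum.cong refl) (simp add: sum_delta2)
  finally show ?thesis ..
qed

lemma Rv_graded: "f \<in> graded_part k n d \<Longrightarrow> Rv n c c' f \<in> graded_part k n d"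
  unfolding Rv_def Dv_def by (intro graded_sum graded_scale D_graded)

lemma Rv_mult: "Rv n c c' (f * g) = Rv n c c' f * g + f * Rv n c c' g"
  unfolding Rv_def Dv_def by (simp add: D_mult algebra_simps sum.distrib sum_distrib_left)

lemma Rv_antisym: "Rv n c' c f = - Rv n c c' f" unfolding Rv_def by (rule Dv_antisym)

lemma Rv_star:
  "j \<in> {1..n div 2} \<Longrightarrow> Rv n (2 * j - 1) (2 * j) f = const_poly (- \<i>) * D (2 * j - 1) (2 * j) f"
proof -
  assume j: "j \<in> {1..n div 2}"
  have sub: "{2*j-1, 2*j} \<subseteq> {1..n}" using plane_index(1,2)[OF j] by blast
  have "Rv n (2 * j - 1) (2 * j) f = (\<Sum>a\<in>{2*j-1, 2*j}. \<Sum>b\<in>{1..n}. const_poly (fb n (2 * j - 1) a * fb n (2 * j) b) * D a b f)"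
    unfolding Rv_def Dv_def
  proof (rule sum.mono_neutral_right)
    have "fb n (2 * j - 1) a = 0" if "a \<notin> {2*j-1, 2*j}" for a
      using that j plane_index_eq[OF j j] by (auto simp: fb_def)
    then show "\<forall>a\<in>{1..n} - {2*j-1, 2*j}. (\<Sum>b\<in>{1..n}. const_poly (fb n (2 * j - 1) a * fb n (2 * j) b) * D a b f) = 0" by simp
    show "{2*j-1, 2*j} \<subseteq> {1..n}" by (rule sub)
  qed simp
  also have "\<dots> = (\<Sum>a\<in>{2*j-1, 2*j}. \<Sum>b\<in>{2*j-1, 2*j}. const_poly (fb n (2 * j - 1) a * fb n (2 * j) b) * D a b f)"
  proof (rule sum.cong[OF refl], rule sum.mono_neutral_right)
    fix a
    have z: "fb n (2 * j) b = 0" if "b \<notin> {2*j-1, 2*j}" for b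
      using that plane_index_eq(6)[OF j j] by (auto simp: fb_def)
    show "\<forall>b\<in>{1..n} - {2*j-1, 2*j}. const_poly (fb n (2 * j - 1) a * fb n (2 * j) b) * D a b f = 0"
      by (simp add: z)
    show "{2*j-1, 2*j} \<subseteq> {1..n}" by (rule sub)
  qed simp
  also have "\<dots> = const_poly (- \<i>/2) * D (2*j-1) (2*j) f + const_poly (\<i>/2) * D (2*j) (2*j-1) f"
    using plane_index(3)[OF j] by (simp add: fb_plane[OF j j] D_def[of a a for a] del: const_poly_simps One_nat_def)
  also have "D (2*j) (2*j-1) f = - D (2*j-1) (2*j) f" by (rule D_antisym)
  also have "const_poly (- \<i>/2) * D (2*j-1) (2*j) f + const_poly (\<i>/2) * - D (2*j-1) (2*j) f = const_poly (- \<i>/2 + - \<i>/2) * D (2*j-1) (2*j) f"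
    unfolding const_poly_simps(3) distrib_right by (simp add: const_poly_simps)
  also have "- \<i>/2 + - \<i>/2 = - \<i>" by simp
  finally show ?thesis .
qed

text \<open>Each single vector \<open>fb n c\<close> is an eigenvector of the infinitesimal plane
  rotation, so an exterior product of such vectors has the sum of the eigenvalues.\<close>

lemma Rv_star_PL:
  assumes j: "j \<in> {1..n div 2}" and w: "w \<in> strings k n"
  shows "Rv n (2 * j - 1) (2 * j) (PL k n (\<lambda>i. fb n (w ! i))) = const_poly (of_int (\<Sum>i<k. wtc n (w ! i) j)) * PL k n (\<lambda>i. fb n (w ! i))"
proof -
  let ?a = "2 * j - 1" and ?b = "2 * j"
  let ?u = "\<lambda>i. fb n (w ! i)"
  have ab: "?a \<in> {1..n}" "?b \<in> {1..n}" using plane_index(1,2)[OF j] .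
  have "Rv n ?a ?b (PL k n ?u) = (\<Sum>p<k. const_poly (- \<i>) * PL k n (?u(p := \<lambda>c. if c = ?a then ?u p ?b else 0)) + const_poly \<i> * PL k n (?u(p := \<lambda>c. if c = ?b then ?u p ?a else 0)))"
    unfolding Rv_star[OF j] D_def E_PL[OF ab] E_PL[OF ab(2,1)] by (simp add: sum.distrib sum_distrib_left right_diff_distrib sum_negf sum_subtractf)
  also have "\<dots> = (\<Sum>p<k. const_poly (of_int (wtc n (w ! p) j)) * PL k n ?u)"
  proof (rule sum.cong[OF refl])
    fix p assume "p \<in> {..<k}"
    then have p: "p < k" by simp
    have "const_poly (- \<i>) * PL k n (?u(p := \<lambda>c. if c = ?a then ?u p ?b else 0)) + const_poly \<i> * PL k n (?u(p := \<lambda>c. if c = ?b then ?u p ?a else 0)) = 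
      PL k n (?u(p := \<lambda>c. - \<i> * (if c = ?a then ?u p ?b else 0) + \<i> * (if c = ?b then ?u p ?a else 0)))"
      by (rule PL_linear[OF p, symmetric])
    also have "\<dots> = PL k n (?u(p := \<lambda>c. of_int (wtc n (w ! p) j) * ?u p c + 0 * ?u p c))"
    proof (rule PL_cong)
      fix i c assume c: "c \<in> {1..n}"
      have "- \<i> * (if c = ?a then fb n e ?b else 0) + \<i> * (if c = ?b then fb n e ?a else 0) = of_int (wtc n e j) * fb n e c" if e: "e \<in> {1..n}" for e
        using e
      proof (cases rule: index_cases)
        case (1 i) show ?thesis using c
          by (cases rule: index_cases) (use 1 j in \<open>auto simp: fb_plane wtc_plane plane_index_eq simp del: atLeastAtMost_iff One_nat_def\<close>)
      next
        case (2 i) show ?thesis using c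
          by (cases rule: index_cases) (use 2 j in \<open>auto simp: fb_plane wtc_plane plane_index_eq simp del: atLeastAtMost_iff One_nat_def\<close>)
      next
        case 3 show ?thesis using c
          by (cases rule: index_cases) (use 3 j in \<open>auto simp: fb_plane wtc_plane plane_index_eq simp del: atLeastAtMost_iff One_nat_def\<close>)
      qed
      from this[OF strings_nth[OF w p]]
      show "(?u(p := \<lambda>c. - \<i> * (if c = ?a then ?u p ?b else 0) + \<i> * (if c = ?b then ?u p ?a else 0))) i c = (?u(p := \<lambda>c. of_int (wtc n (w ! p) j) * ?u p c + 0 * ?u p c)) i c"
        by simp
    qed
    also have "\<dots> = const_poly (of_int (wtc n (w ! p) j)) * PL k n (?u(p := ?u p)) + const_poly 0 * PL k n (?u(p := ?u p))"
      by (rule PL_linear[OF p])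
    finally have fin: "const_poly (- \<i>) * PL k n (?u(p := \<lambda>c. if c = ?a then ?u p ?b else 0)) + const_poly \<i> * PL k n (?u(p := \<lambda>c. if c = ?b then ?u p ?a else 0)) = 
       const_poly (of_int (wtc n (w ! p) j)) * PL k n (?u(p := ?u p)) + const_poly 0 * PL k n (?u(p := ?u p))" .
    have tr: "?u(p := ?u p) = ?u" by (auto simp: fun_eq_iff)
    show "const_poly (- \<i>) * PL k n (?u(p := \<lambda>c. if c = ?a then ?u p ?b else 0)) + const_poly \<i> * PL k n (?u(p := \<lambda>c. if c = ?b then ?u p ?a else 0)) = 
       const_poly (of_int (wtc n (w ! p) j)) * PL k n ?u" by (simp only: fin tr const_poly_simps(1) mult_zero_left add_0_right)
  qed
  also have "\<dots> = const_poly (of_int (\<Sum>i<k. wtc n (w ! i) j)) * PL k n ?u"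
    by (simp only: of_int_sum const_poly_sum sum_distrib_right)
  finally show ?thesis .
qed

text \<open>Change of basis in every position; the coefficients involve \<open>star\<close> because
  that gives the dual basis.\<close>

lemma PS_as_PL:
  assumes s: "s \<in> strings k n"
  shows "PS s = (\<Sum>w\<in>strings k n. const_poly (\<Prod>i<k. fb n (star n (w ! i)) (s ! i)) * PL k n (\<lambda>i. fb n (w ! i)))"
proof -
  have "(\<Sum>w\<in>strings k n. const_poly (\<Prod>i<k. fb n (star n (w ! i)) (s ! i)) * PL k n (\<lambda>i. fb n (w ! i))) = 
     (\<Sum>t\<in>strings k n. const_poly (\<Sum>w\<in>strings k n. \<Prod>i<k. fb n (w ! i) (t ! i) * fb n (star n (w ! i)) (s ! i)) * PS t)"
    unfolding PL_def sum_distrib_left const_poly_sum sum_distrib_right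
    by (subst sum.swap) (intro sum.cong refl, simp add: prod.distrib mult_ac)
  also have "\<dots> = (\<Sum>t\<in>strings k n. const_poly (\<Prod>i<k. \<Sum>c\<in>{1..n}. fb n c (t ! i) * fb n (star n c) (s ! i)) * PS t)"
    by (simp only: sum_strings_prod[where h="\<lambda>i c. fb n c (t ! i) * fb n (star n c) (s ! i)" for t])
  also have "\<dots> = (\<Sum>t\<in>strings k n. if s = t then PS t else 0)"
  proof (rule sum.cong[OF refl])
    fix t assume t: "t \<in> strings k n"
    have "(\<Prod>i<k. \<Sum>c\<in>{1..n}. fb n c (t ! i) * fb n (star n c) (s ! i)) = (\<Prod>i<k. if t ! i = s ! i then 1 else 0)"
      by (rule prod.cong[OF refl], rule fb_complete) (use strings_nth s t in auto)
    also have "\<dots> = (if s = t then 1 else 0)"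
    proof (cases "s = t")
      case False
      then obtain i where "i < k" "s ! i \<noteq> t ! i" using s t nth_equalityI[of s t] by (auto simp: strings_def)
      then have "(\<Prod>i<k. if t ! i = s ! i then 1 else 0 :: complex) = 0" by (intro prod_zero) (auto intro!: bexI[of _ i])
      then show ?thesis using False by simp
    qed simp
    finally show "const_poly (\<Prod>i<k. \<Sum>c\<in>{1..n}. fb n c (t ! i) * fb n (star n c) (s ! i)) * PS t = (if s = t then PS t else 0)" by simp
  qed
  finally show ?thesis using s by (simp add: sum.delta)
qed

text \<open>The Plucker coordinates with respect to the isotropic basis, all of them weight
  vectors.\<close>

definition yv :: "nat \<Rightarrow> nat \<Rightarrow> nat set \<Rightarrow> ppoly" where
  "yv k n T = PL k n (\<lambda>i. fb n (sorted_list_of_set T ! i))"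

lemma PL_fb_eq_yv:
  assumes w: "w \<in> strings k n"
  shows "PL k n (\<lambda>i. fb n (w ! i)) = (if distinct w then of_int (string_sign w) * yv k n (set w) else 0)"
proof (cases "distinct w")
  case True
  define s0 where "s0 = sorted_list_of_set (set w)"
  obtain \<tau> where t: "\<tau> permutes {..<length w}" "w = permute_list \<tau> s0"
    by (rule distinct_permute_sorted[OF True, folded s0_def])
  have len: "length s0 = k" "length w = k" using True w by (auto simp: s0_def distinct_card strings_def)
  have "string_sign s0 = 1" unfolding s0_def by (rule string_sign_sorted) auto
  then have sg: "string_sign w = sign \<tau>"
    using string_sign_permute_list[of s0 \<tau>, folded t(2)] t(1) len by (simp add: s0_def)
  have "w ! i = s0 ! \<tau> i" if "i < k" for i
    by (subst t(2)) (use that t(1) len in \<open>simp add: permute_list_nth\<close>)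
  then have "PL k n (\<lambda>i. fb n (w ! i)) = PL k n (\<lambda>i. fb n (s0 ! \<tau> i))" by (intro PL_cong) simp
  also have "\<dots> = of_int (sign \<tau>) * PL k n (\<lambda>i. fb n (s0 ! i))"
    by (rule PL_permute[of \<tau> k n "\<lambda>i. fb n (s0 ! i)"]) (use t(1) len in simp)
  finally show ?thesis using True by (simp add: sg yv_def s0_def)
next
  case False
  then obtain i j where "i < k" "j < k" "i \<noteq> j" "w ! i = w ! j" using w by (auto simp: distinct_conv_nth strings_def)
  then have "PL k n (\<lambda>i. fb n (w ! i)) = 0" by (intro PL_repeat[of i k j]) auto
  then show ?thesis using False by simp
qed

lemma pvar_in_yv_span:
  assumes "S \<in> ksubsets k n"
  obtains x where "pvar S = (\<Sum>T\<in>ksubsets k n. const_poly (x T) * yv k n T)"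
proof -
  define s where "s = sorted_list_of_set S"
  have s: "s \<in> strings k n" "PS s = pvar S" using assms ksubsets_finite(1)[OF assms] by (auto simp: s_def strings_def ksubsets_def)
  define g where "g w = (if distinct w then (\<Prod>i<k. fb n (star n (w ! i)) (s ! i)) * of_int (string_sign w) else 0)" for w
  have "pvar S = (\<Sum>w\<in>strings k n. const_poly (\<Prod>i<k. fb n (star n (w ! i)) (s ! i)) * PL k n (\<lambda>i. fb n (w ! i)))"
    using PS_as_PL[OF s(1)] s(2) by simp
  also have "\<dots> = (\<Sum>w\<in>strings k n. const_poly (g w) * yv k n (set w))"
    by (intro sum.cong refl) (simp add: PL_fb_eq_yv g_def mult.assoc)
  also have "\<dots> = (\<Sum>w\<in>{w\<in>strings k n. distinct w}. const_poly (g w) * yv k n (set w))"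
    by (rule sum.mono_neutral_right) (auto simp: g_def)
  also have "\<dots> = (\<Sum>T\<in>ksubsets k n. \<Sum>w\<in>{w\<in>{w\<in>strings k n. distinct w}. set w = T}. const_poly (g w) * yv k n (set w))"
  proof (rule sum.group[symmetric])
    show "finite {w\<in>strings k n. distinct w}" by simp
    show "finite (ksubsets k n)" by (rule ksubsets_finite(2))
    show "set ` {w\<in>strings k n. distinct w} \<subseteq> ksubsets k n"
      by (auto simp: strings_def ksubsets_def distinct_card)
  qed
  also have "\<dots> = (\<Sum>T\<in>ksubsets k n. const_poly (\<Sum>w\<in>{w\<in>{w\<in>strings k n. distinct w}. set w = T}. g w) * yv k n T)"
    unfolding const_poly_sum sum_distrib_right by (intro sum.cong refl) auto
  finally show ?thesis by (rule that)
qed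

section \<open>The trace of the Casimir operator on a graded quotient, and the resulting
  dimension\<close>

section \<open>Matrices of operators on a quotient\<close>

lemma pscale_subspaceI:
  assumes "0 \<in> S" "\<And>x y. x \<in> S \<Longrightarrow> y \<in> S \<Longrightarrow> x + y \<in> S" "\<And>c x. x \<in> S \<Longrightarrow> const_poly c * x \<in> S"
  shows "module.subspace pscale S"
proof -
  interpret V: vector_space pscale by (rule vector_space_pscale)
  show ?thesis using assms by (auto simp: V.subspace_def pscale_eq)
qed

text \<open>The quotient of \<open>S\<close> by \<open>J\<close> is handled inside \<open>S\<close>:
  a maximal subfamily \<open>B\<close> of the spanning family that is independent modulo
  \<open>J\<close>, and coordinates \<open>cf\<close> determined modulo \<open>J\<close>. Families
  are indexed, since \<open>Y\<close> need not be injective on \<open>X\<close>.\<close>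

locale quot_basis =
  fixes S J :: "ppoly set" and X :: "'x set" and Y :: "'x \<Rightarrow> ppoly"
  assumes finX: "finite X" and YS: "\<And>x. x \<in> X \<Longrightarrow> Y x \<in> S"
    and S0: "0 \<in> S" and S_add: "\<And>f g. f \<in> S \<Longrightarrow> g \<in> S \<Longrightarrow> f + g \<in> S" and S_sc: "\<And>c f. f \<in> S \<Longrightarrow> const_poly c * f \<in> S"
    and JS: "J \<subseteq> S"
    and J0: "0 \<in> J" and J_add: "\<And>f g. f \<in> J \<Longrightarrow> g \<in> J \<Longrightarrow> f + g \<in> J" and J_sc: "\<And>c f. f \<in> J \<Longrightarrow> const_poly c * f \<in> J"
    and span: "\<And>f. f \<in> S \<Longrightarrow> \<exists>c. f = (\<Sum>x\<in>X. const_poly (c x) * Y x)"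
begin

lemma J_diff: "f \<in> J \<Longrightarrow> g \<in> J \<Longrightarrow> f - g \<in> J"
  using J_add[of f "const_poly (-1) * g"] J_sc[of g "-1"] by simp
lemma S_sum: "(\<And>x. x \<in> A \<Longrightarrow> F x \<in> S) \<Longrightarrow> (\<Sum>x\<in>A. F x) \<in> S"
  by (induction A rule: infinite_finite_induct) (auto intro: S_add S0)
lemma J_sum: "(\<And>x. x \<in> A \<Longrightarrow> F x \<in> J) \<Longrightarrow> (\<Sum>x\<in>A. F x) \<in> J"
  by (induction A rule: infinite_finite_induct) (auto intro: J_add J0)

definition indep :: "'x set \<Rightarrow> bool" where
  "indep B \<longleftrightarrow> (\<forall>c. (\<Sum>x\<in>B. const_poly (c x) * Y x) \<in> J \<longrightarrow> (\<forall>x\<in>B. c x = 0))"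

lemma basis_exists: "\<exists>B\<subseteq>X. indep B \<and> (\<forall>x\<in>X. \<exists>c. Y x - (\<Sum>b\<in>B. const_poly (c b) * Y b) \<in> J)"
proof -
  have "indep {}" by (simp add: indep_def)
  moreover have "card B \<le> card X" if "B \<subseteq> X" for B using card_mono[OF finX that] .
  ultimately obtain B where B: "B \<subseteq> X" "indep B" and max: "\<And>B'. B' \<subseteq> X \<Longrightarrow> indep B' \<Longrightarrow> card B' \<le> card B"
    using ex_has_greatest_nat[of "\<lambda>B. B \<subseteq> X \<and> indep B" "{}" card "Suc (card X)"] by (auto simp: less_Suc_eq_le)
  have finB: "finite B" using B finX finite_subset by blast
  have "\<exists>c. Y x - (\<Sum>b\<in>B. const_poly (c b) * Y b) \<in> J" if x: "x \<in> X" for x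
  proof (cases "x \<in> B")
    case True
    have "(\<Sum>b\<in>B. const_poly (if b = x then 1 else 0) * Y b) = (\<Sum>b\<in>B. if b = x then Y b else 0)" by (intro sum.cong) auto
    also have "\<dots> = Y x" using True finB by (simp add: sum.delta)
    finally show ?thesis using J0 by (intro exI[of _ "\<lambda>b. if b = x then 1 else 0"]) simp
  next
    case False
    then have "\<not> indep (insert x B)" using max[of "insert x B"] B x finB by auto
    then obtain c where c: "(\<Sum>y\<in>insert x B. const_poly (c y) * Y y) \<in> J" and nz: "\<exists>y\<in>insert x B. c y \<noteq> 0"
      unfolding indep_def by blast
    have s: "const_poly (c x) * Y x + (\<Sum>y\<in>B. const_poly (c y) * Y y) \<in> J" using c False finB by simp
    have cx: "c x \<noteq> 0"
    proof
      assume "c x = 0"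
      then have "(\<Sum>y\<in>B. const_poly (c y) * Y y) \<in> J" using s by simp
      then have "\<forall>y\<in>B. c y = 0" using B(2) by (simp add: indep_def)
      then show False using nz \<open>c x = 0\<close> by auto
    qed
    have "const_poly (1 / c x) * (const_poly (c x) * Y x + (\<Sum>y\<in>B. const_poly (c y) * Y y)) \<in> J" by (rule J_sc[OF s])
    also have "const_poly (1 / c x) * (const_poly (c x) * Y x + (\<Sum>y\<in>B. const_poly (c y) * Y y)) = const_poly (1 / c x * c x) * Y x + (\<Sum>y\<in>B. const_poly (1 / c x * c y) * Y y)"
      unfolding distrib_left sum_distrib_left const_poly_simps(4) mult.assoc ..
    also have "\<dots> = Y x - (\<Sum>y\<in>B. const_poly (- (c y / c x)) * Y y)" using cx by (simp add: sum_negf)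
    finally show ?thesis by (rule exI[of _ "\<lambda>y. - (c y / c x)"])
  qed
  then show ?thesis using B by blast
qed

definition B where "B = (SOME B. B \<subseteq> X \<and> indep B \<and> (\<forall>x\<in>X. \<exists>c. Y x - (\<Sum>b\<in>B. const_poly (c b) * Y b) \<in> J))"

lemma B: "B \<subseteq> X" "indep B" "\<And>x. x \<in> X \<Longrightarrow> \<exists>c. Y x - (\<Sum>b\<in>B. const_poly (c b) * Y b) \<in> J"
  using someI_ex[OF basis_exists] unfolding B_def[symmetric] by blast+

lemma finB: "finite B" using B(1) finX finite_subset by blast

lemma coords_exist: "f \<in> S \<Longrightarrow> \<exists>c. f - (\<Sum>b\<in>B. const_poly (c b) * Y b) \<in> J"
proof -
  assume "f \<in> S"
  then obtain e where e: "f = (\<Sum>x\<in>X. const_poly (e x) * Y x)" using span by blast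
  obtain c where c: "\<And>x. x \<in> X \<Longrightarrow> Y x - (\<Sum>b\<in>B. const_poly (c x b) * Y b) \<in> J" using B(3) by metis
  have "(\<Sum>x\<in>X. const_poly (e x) * (Y x - (\<Sum>b\<in>B. const_poly (c x b) * Y b))) \<in> J"
    by (intro J_sum J_sc c)
  also have "(\<Sum>x\<in>X. const_poly (e x) * (Y x - (\<Sum>b\<in>B. const_poly (c x b) * Y b))) = f - (\<Sum>x\<in>X. \<Sum>b\<in>B. const_poly (e x * c x b) * Y b)"
    unfolding e right_diff_distrib sum_subtractf sum_distrib_left const_poly_simps(4) mult.assoc ..
  also have "(\<Sum>x\<in>X. \<Sum>b\<in>B. const_poly (e x * c x b) * Y b) = (\<Sum>b\<in>B. const_poly (\<Sum>x\<in>X. e x * c x b) * Y b)"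
    unfolding const_poly_sum sum_distrib_right by (rule sum.swap)
  finally show ?thesis by (rule exI[of _ "\<lambda>b. \<Sum>x\<in>X. e x * c x b"])
qed

definition cf :: "ppoly \<Rightarrow> 'x \<Rightarrow> complex" where
  "cf f = (SOME c. f - (\<Sum>b\<in>B. const_poly (c b) * Y b) \<in> J)"

lemma cf: "f \<in> S \<Longrightarrow> f - (\<Sum>b\<in>B. const_poly (cf f b) * Y b) \<in> J"
  using someI_ex[OF coords_exist] unfolding cf_def .

lemma cf_unique:
  assumes "f \<in> S" "f - (\<Sum>b\<in>B. const_poly (c b) * Y b) \<in> J" "b \<in> B"
  shows "cf f b = c b"
proof -
  have "(f - (\<Sum>b\<in>B. const_poly (c b) * Y b)) - (f - (\<Sum>b\<in>B. const_poly (cf f b) * Y b)) \<in> J"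
    by (rule J_diff[OF assms(2) cf[OF assms(1)]])
  also have "(f - (\<Sum>b\<in>B. const_poly (c b) * Y b)) - (f - (\<Sum>b\<in>B. const_poly (cf f b) * Y b)) = (\<Sum>b\<in>B. const_poly (cf f b - c b) * Y b)"
    by (simp add: left_diff_distrib sum_subtractf)
  finally have "cf f b - c b = 0"
    using B(2)[unfolded indep_def, rule_format, of "\<lambda>b. cf f b - c b" b] assms(3) by blast
  then show ?thesis by simp
qed

lemma cf_linear: 
  assumes "finite A" "\<And>x. x \<in> A \<Longrightarrow> F x \<in> S" "b \<in> B"
  shows "cf (\<Sum>x\<in>A. const_poly (c x) * F x) b = (\<Sum>x\<in>A. c x * cf (F x) b)"
proof (rule cf_unique)
  show "(\<Sum>x\<in>A. const_poly (c x) * F x) \<in> S" using assms(1,2) by (induction A) (auto intro: S0 S_add S_sc)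
  have "(\<Sum>x\<in>A. const_poly (c x) * (F x - (\<Sum>b\<in>B. const_poly (cf (F x) b) * Y b))) \<in> J"
    by (intro J_sum J_sc cf assms)
  also have "(\<Sum>x\<in>A. const_poly (c x) * (F x - (\<Sum>b\<in>B. const_poly (cf (F x) b) * Y b))) = 
     (\<Sum>x\<in>A. const_poly (c x) * F x) - (\<Sum>x\<in>A. \<Sum>b\<in>B. const_poly (c x * cf (F x) b) * Y b)"
    unfolding right_diff_distrib sum_subtractf sum_distrib_left const_poly_simps(4) mult.assoc ..
  also have "(\<Sum>x\<in>A. \<Sum>b\<in>B. const_poly (c x * cf (F x) b) * Y b) = (\<Sum>b\<in>B. const_poly (\<Sum>x\<in>A. c x * cf (F x) b) * Y b)"
    unfolding const_poly_sum sum_distrib_right by (rule sum.swap)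
  finally show "(\<Sum>x\<in>A. const_poly (c x) * F x) - (\<Sum>b\<in>B. const_poly (\<Sum>x\<in>A. c x * cf (F x) b) * Y b) \<in> J" .
qed (use assms in auto)

lemma cf_J: "f \<in> J \<Longrightarrow> b \<in> B \<Longrightarrow> cf f b = 0"
  using cf_unique[of f "\<lambda>_. 0" b] JS by auto

lemma cf_cong: "f \<in> S \<Longrightarrow> g \<in> S \<Longrightarrow> f - g \<in> J \<Longrightarrow> b \<in> B \<Longrightarrow> cf f b = cf g b"
proof (rule cf_unique)
  assume fg: "g \<in> S" "f - g \<in> J"
  have "(f - g) + (g - (\<Sum>b\<in>B. const_poly (cf g b) * Y b)) \<in> J" by (rule J_add[OF fg(2) cf[OF fg(1)]])
  then show "f - (\<Sum>b\<in>B. const_poly (cf g b) * Y b) \<in> J" by simp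
qed

lemma cf_add: "f \<in> S \<Longrightarrow> g \<in> S \<Longrightarrow> b \<in> B \<Longrightarrow> cf (f + g) b = cf f b + cf g b"
  using cf_linear[of "{True, False}" "\<lambda>x. if x then f else g" b "\<lambda>_. 1"] by simp
lemma cf_scale: "f \<in> S \<Longrightarrow> b \<in> B \<Longrightarrow> cf (const_poly c * f) b = c * cf f b"
  using cf_linear[of "{()}" "\<lambda>_. f" b "\<lambda>_. c"] by simp
lemma cf_Y: "x \<in> B \<Longrightarrow> b \<in> B \<Longrightarrow> cf (Y x) b = (if b = x then 1 else 0)"
proof (rule cf_unique)
  assume "x \<in> B"
  then show "Y x \<in> S" using YS B(1) by blast
  have "(\<Sum>b\<in>B. const_poly (if b = x then 1 else 0) * Y b) = (\<Sum>b\<in>B. if b = x then Y b else 0)" by (intro sum.cong) auto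
  also have "\<dots> = Y x" using \<open>x \<in> B\<close> finB by (simp add: sum.delta)
  finally show "Y x - (\<Sum>b\<in>B. const_poly (if b = x then 1 else 0) * Y b) \<in> J" using J0 by simp
qed

definition operator :: "(ppoly \<Rightarrow> ppoly) \<Rightarrow> bool" where
  "operator T \<longleftrightarrow> (\<forall>f\<in>S. T f \<in> S) \<and> (\<forall>f\<in>J. T f \<in> J) \<and> (\<forall>f g. T (f + g) = T f + T g) \<and> (\<forall>c f. T (const_poly c * f) = const_poly c * T f)"

lemma operator_sum: "operator T \<Longrightarrow> T (\<Sum>x\<in>A. const_poly (c x) * F x) = (\<Sum>x\<in>A. const_poly (c x) * T (F x))"
proof (induction A rule: infinite_finite_induct)
  case (infinite A)
  have "T (const_poly 0 * 0) = const_poly 0 * T 0" using infinite(2) unfolding operator_def by blast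
  then show ?case using infinite by simp
next
  case empty
  have "T (const_poly 0 * 0) = const_poly 0 * T 0" using empty unfolding operator_def by blast
  then show ?case by simp
qed (auto simp: operator_def)

lemma operator_diff: "operator T \<Longrightarrow> T (f - g) = T f - T g"
proof -
  assume "operator T"
  then have "T (f + const_poly (-1) * g) = T f + const_poly (-1) * T g" unfolding operator_def by metis
  then show ?thesis by simp
qed

text \<open>The entry in row \<open>x\<close> and column \<open>y\<close> of the matrix of \<open>T\<close> on the quotient is \<open>cf (T (Y y)) x\<close>.\<close>

lemma cf_operator:
  assumes T: "operator T" and f: "f \<in> S" and x: "x \<in> B"
  shows "cf (T f) x = (\<Sum>y\<in>B. cf (T (Y y)) x * cf f y)"
proof -
  have YB: "Y y \<in> S" if "y \<in> B" for y using that YS B(1) by blast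
  have TS: "T g \<in> S" if "g \<in> S" for g using T that by (simp add: operator_def)
  have sS: "(\<Sum>y\<in>B. const_poly (cf f y) * T (Y y)) \<in> S"
    by (intro S_sum S_sc TS YB)
  have "T (f - (\<Sum>y\<in>B. const_poly (cf f y) * Y y)) \<in> J" using cf[OF f] T by (simp add: operator_def)
  then have "T f - (\<Sum>y\<in>B. const_poly (cf f y) * T (Y y)) \<in> J" by (simp add: operator_diff[OF T] operator_sum[OF T])
  then have "cf (T f) x = cf (\<Sum>y\<in>B. const_poly (cf f y) * T (Y y)) x" by (intro cf_cong TS f sS x)
  also have "\<dots> = (\<Sum>y\<in>B. cf f y * cf (T (Y y)) x)" by (intro cf_linear finB TS YB x)
  finally show ?thesis by (simp add: mult.commute)
qed

lemma dim_quotient: "vector_space.dim pscale S - vector_space.dim pscale J = card B" "vector_space.dim pscale J \<le> vector_space.dim pscale S"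
proof -
  interpret V: vector_space pscale by (rule vector_space_pscale)
  have YB: "Y y \<in> S" if "y \<in> B" for y using that YS B(1) by blast
  have sub: "V.subspace S" "V.subspace J" by (rule pscale_subspaceI; blast intro: S0 S_add S_sc J0 J_add J_sc)+
  have Sspan: "S \<subseteq> V.span (Y ` X)"
  proof
    fix f assume "f \<in> S"
    then obtain e where "f = (\<Sum>x\<in>X. const_poly (e x) * Y x)" using span by blast
    then show "f \<in> V.span (Y ` X)" unfolding pscale_eq[symmetric] 
      by (simp only:) (intro V.span_sum V.span_scale V.span_base imageI)
  qed
  obtain C where C: "C \<subseteq> J" "V.independent C" "J \<subseteq> V.span C" "card C = V.dim J" using V.basis_exists[of J] by blast
  have finC: "finite C"
    by (rule V.independent_span_bound[of "Y ` X", THEN conjunct1]) (use finX C JS Sspan in auto)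
  have spC: "V.span C = J" using C sub(2) V.span_minimal by blast
  have injY: "inj_on Y B"
  proof (rule inj_onI, rule ccontr)
    fix x y assume xy: "x \<in> B" "y \<in> B" "Y x = Y y" "x \<noteq> y"
    have "cf (Y x) x = 1" "cf (Y y) x = 0" using cf_Y[OF xy(1,1)] cf_Y[OF xy(2,1)] xy(4) by simp_all
    then show False using xy(3) by simp
  qed
  have disj: "C \<inter> Y ` B = {}"
  proof (rule ccontr)
    assume "C \<inter> Y ` B \<noteq> {}"
    then obtain x where "x \<in> B" "Y x \<in> J" using C(1) by auto
    then show False using cf_J[of "Y x" x] cf_Y[of x x] by simp
  qed
  have ind: "V.independent (C \<union> Y ` B)"
  proof (rule V.independent_if_scalars_zero)
    show "finite (C \<union> Y ` B)" using finC finB by simp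
    fix u v assume z: "(\<Sum>v\<in>C \<union> Y ` B. pscale (u v) v) = 0" and v: "v \<in> C \<union> Y ` B"
    have sp: "(\<Sum>v\<in>C. pscale (u v) v) + (\<Sum>v\<in>Y ` B. pscale (u v) v) = 0" using z finC finB disj by (subst (asm) sum.union_disjoint) auto
    have cJ: "(\<Sum>v\<in>C. pscale (u v) v) \<in> J" unfolding spC[symmetric] by (intro V.span_sum V.span_scale V.span_base)
    have "(\<Sum>b\<in>B. const_poly (u (Y b)) * Y b) = (\<Sum>v\<in>Y ` B. pscale (u v) v)" by (simp add: sum.reindex[OF injY] pscale_eq)
    also have "\<dots> = - (\<Sum>v\<in>C. pscale (u v) v)" using sp by (simp add: eq_neg_iff_add_eq_0 add.commute)
    also have "\<dots> \<in> J" using J_sc[OF cJ, of "-1"] by simp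
    finally have ub: "\<forall>b\<in>B. u (Y b) = 0"
      using B(2)[unfolded indep_def, rule_format, of "\<lambda>b. u (Y b)"] by blast
    then have "(\<Sum>v\<in>Y ` B. pscale (u v) v) = 0" by (intro sum.neutral) (auto simp: pscale_eq)
    then have "(\<Sum>v\<in>C. pscale (u v) v) = 0" using sp by simp
    then have "\<forall>v\<in>C. u v = 0" using C(2)[unfolded V.independent_explicit_finite_subsets, rule_format, OF subset_refl finC, of u] by blast
    then show "u v = 0" using v ub by auto
  qed
  have spS: "V.span (C \<union> Y ` B) = S"
  proof
    show "V.span (C \<union> Y ` B) \<subseteq> S" by (rule V.span_minimal) (use C(1) JS YB sub in auto)
    show "S \<subseteq> V.span (C \<union> Y ` B)"
    proof
      fix f assume f: "f \<in> S"
      have "f - (\<Sum>b\<in>B. const_poly (cf f b) * Y b) \<in> V.span (C \<union> Y ` B)" using cf[OF f] spC V.span_mono[of C "C \<union> Y ` B"] by blast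
      moreover have "(\<Sum>b\<in>B. const_poly (cf f b) * Y b) \<in> V.span (C \<union> Y ` B)"
        unfolding pscale_eq[symmetric] by (intro V.span_sum V.span_scale V.span_base UnI2 imageI)
      ultimately have "(f - (\<Sum>b\<in>B. const_poly (cf f b) * Y b)) + (\<Sum>b\<in>B. const_poly (cf f b) * Y b) \<in> V.span (C \<union> Y ` B)" by (rule V.span_add)
      then show "f \<in> V.span (C \<union> Y ` B)" by simp
    qed
  qed
  have "V.dim S = card (C \<union> Y ` B)" using V.dim_span_eq_card_independent[OF ind] spS by simp
  also have "\<dots> = V.dim J + card B" using finC finB disj C(4) by (simp add: card_Un_disjoint card_image[OF injY])
  finally show "V.dim S - V.dim J = card B" "V.dim J \<le> V.dim S" by simp_all
qed

end

section \<open>Weight monomials\<close>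

text \<open>Ordered lists, so a monomial is indexed once for each order of its factors. The
  redundancy disappears when \<open>B\<close> selects an independent subfamily.\<close>

definition mon_idx :: "nat \<Rightarrow> nat \<Rightarrow> nat \<Rightarrow> nat set list set" where
  "mon_idx k n d = {xs. length xs = d \<and> set xs \<subseteq> ksubsets k n}"

definition ymon :: "nat \<Rightarrow> nat \<Rightarrow> nat set list \<Rightarrow> ppoly" where
  "ymon k n xs = prod_list (map (yv k n) xs)"

definition wtT :: "nat \<Rightarrow> nat set \<Rightarrow> nat \<Rightarrow> int" where "wtT n T j = (\<Sum>c\<in>T. wtc n c j)"

definition wtX :: "nat \<Rightarrow> nat set list \<Rightarrow> nat \<Rightarrow> int" where "wtX n xs j = (\<Sum>T\<leftarrow>xs. wtT n T j)"

lemma finite_mon_idx: "finite (mon_idx k n d)"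
  unfolding mon_idx_def using finite_lists_length_eq[OF ksubsets_finite(2), of k n d] by (simp add: conj_commute)

lemma mon_idx_Suc: "mon_idx k n (Suc d) = (\<lambda>(T, xs). T # xs) ` (ksubsets k n \<times> mon_idx k n d)"
  by (auto simp: mon_idx_def image_iff length_Suc_conv)

lemma yv_graded: "yv k n T \<in> graded_part k n 1" unfolding yv_def by (rule PL_graded)

lemma ymon_graded: "xs \<in> mon_idx k n d \<Longrightarrow> ymon k n xs \<in> graded_part k n d"
proof (induction d arbitrary: xs)
  case 0 then show ?case using graded_const[of 1 k n] by (simp add: mon_idx_def ymon_def)
next
  case (Suc d)
  then obtain T ys where "xs = T # ys" "ys \<in> mon_idx k n d" unfolding mon_idx_Suc by auto
  then show ?case using graded_mult[OF yv_graded Suc.IH, of ys T] by (simp add: ymon_def)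
qed

lemma ymon_span:
  assumes "f \<in> graded_part k n d"
  shows "\<exists>c. f = (\<Sum>x\<in>mon_idx k n d. const_poly (c x) * ymon k n x)"
  using assms
proof (induction rule: graded_induct)
  case (zero d) show ?case by (rule exI[of _ "\<lambda>_. 0"]) simp
next
  case one
  have "mon_idx k n 0 = {[]}" by (auto simp: mon_idx_def)
  then show ?case by (intro exI[of _ "\<lambda>_. 1"]) (simp add: ymon_def)
next
  case (add d f g)
  then obtain c c' where "f = (\<Sum>x\<in>mon_idx k n d. const_poly (c x) * ymon k n x)" "g = (\<Sum>x\<in>mon_idx k n d. const_poly (c' x) * ymon k n x)" by blast
  then show ?case by (intro exI[of _ "\<lambda>x. c x + c' x"]) (simp add: sum.distrib distrib_right)
next
  case (scale d a f)
  then obtain c where "f = (\<Sum>x\<in>mon_idx k n d. const_poly (c x) * ymon k n x)" by blast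
  then show ?case by (intro exI[of _ "\<lambda>x. a * c x"]) (simp add: sum_distrib_left mult.assoc)
next
  case (mult d S f)
  then obtain c where c: "f = (\<Sum>x\<in>mon_idx k n d. const_poly (c x) * ymon k n x)" by blast
  obtain e where e: "pvar S = (\<Sum>T\<in>ksubsets k n. const_poly (e T) * yv k n T)" by (rule pvar_in_yv_span[OF mult(2)])
  have "pvar S * f = (\<Sum>T\<in>ksubsets k n. \<Sum>x\<in>mon_idx k n d. const_poly (e T * c x) * ymon k n (T # x))"
    unfolding e c sum_product by (intro sum.cong refl) (simp add: ymon_def mult_ac)
  also have "\<dots> = (\<Sum>(T, x)\<in>ksubsets k n \<times> mon_idx k n d. const_poly (e T * c x) * ymon k n (T # x))"
    by (simp only: sum.cartesian_product)
  also have "\<dots> = (\<Sum>x\<in>mon_idx k n (Suc d). const_poly (e (hd x) * c (tl x)) * ymon k n x)"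
    unfolding mon_idx_Suc by (subst sum.reindex) (auto simp: inj_on_def case_prod_unfold intro!: sum.cong)
  finally show ?case by (rule exI[of _ "\<lambda>x. e (hd x) * c (tl x)"])
qed

lemma Rv_yv:
  assumes j: "j \<in> {1..n div 2}" and T: "T \<in> ksubsets k n"
  shows "Rv n (2 * j - 1) (2 * j) (yv k n T) = const_poly (of_int (wtT n T j)) * yv k n T"
proof -
  define w where "w = sorted_list_of_set T"
  have fT: "finite T" by (rule ksubsets_finite(1)[OF T])
  have w: "w \<in> strings k n" "distinct w" "set w = T" "length w = k" using T fT by (auto simp: w_def strings_def ksubsets_def)
  have "(\<Sum>i<k. wtc n (w ! i) j) = (\<Sum>c\<in>T. wtc n c j)"
    by (rule sum.reindex_bij_betw) (use bij_betw_nth[of w "{..<k}" T] w in auto)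
  then show ?thesis using Rv_star_PL[OF j w(1)] by (simp add: yv_def w_def wtT_def)
qed

lemma Rv_one: "Rv n c c' 1 = 0" by (simp add: Rv_def Dv_def)

lemma Rv_ymon:
  assumes j: "j \<in> {1..n div 2}" and x: "x \<in> mon_idx k n d"
  shows "Rv n (2 * j - 1) (2 * j) (ymon k n x) = const_poly (of_int (wtX n x j)) * ymon k n x"
  using x
proof (induction d arbitrary: x)
  case 0 then show ?case by (simp add: mon_idx_def ymon_def Rv_one wtX_def)
next
  case (Suc d)
  then obtain T ys where ys: "x = T # ys" "ys \<in> mon_idx k n d" "T \<in> ksubsets k n" unfolding mon_idx_Suc by auto
  have m: "ymon k n x = yv k n T * ymon k n ys" by (simp add: ys ymon_def)
  have s: "of_int (wtX n x j) = (of_int (wtT n T j) + of_int (wtX n ys j) :: complex)" by (simp add: ys wtX_def)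
  show ?case unfolding m Rv_mult Rv_yv[OF j ys(3)] Suc.IH[OF ys(2)] s by (simp add: algebra_simps)
qed

lemma wtT_eq:
  assumes j: "j \<in> {1..n div 2}" and T: "T \<in> ksubsets k n"
  shows "wtT n T j = (if 2 * j - 1 \<in> T then 1 else 0) - (if 2 * j \<in> T then 1 else 0)"
proof -
  have fT: "finite T" by (rule ksubsets_finite(1)[OF T])
  have "wtT n T j = (\<Sum>c\<in>T. (if c = 2 * j - 1 then 1 else 0) - (if c = 2 * j then 1 else 0))"
    unfolding wtT_def by (intro sum.cong refl) (use j plane_index(3)[OF j] in \<open>auto simp: wtc_def\<close>)
  then show ?thesis using fT by (simp add: sum_subtractf sum.delta' del: One_nat_def)
qed

text \<open>A plane contributes at most the number of elements that \<open>T\<close> has in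
  it.\<close>

lemma sum_abs_wtT:
  assumes T: "T \<in> ksubsets k n"
  shows "(\<Sum>j\<in>{1..n div 2}. \<bar>wtT n T j\<bar>) \<le> int k"
proof -
  have fT: "finite T" "T \<subseteq> {1..n}" "card T = k" using T ksubsets_finite(1)[OF T] by (auto simp: ksubsets_def)
  have "(\<Sum>j\<in>{1..n div 2}. \<bar>wtT n T j\<bar>) \<le> (\<Sum>j\<in>{1..n div 2}. (if 2 * j - 1 \<in> T then 1 else 0) + (if 2 * j \<in> T then 1 else 0))"
    by (intro sum_mono) (simp add: wtT_eq[OF _ T] del: One_nat_def atLeastAtMost_iff)
  also have "\<dots> \<le> (\<Sum>j\<in>{1..n div 2}. (if 2 * j - 1 \<in> T then 1 else 0) + (if 2 * j \<in> T then 1 else 0)) + (if odd n then (if n \<in> T then 1 else 0) else 0)" by simp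
  also have "\<dots> = (\<Sum>c\<in>{1..n}. if c \<in> T then 1 else 0)"
    using sum_index[of "\<lambda>c. if c \<in> T then 1 else 0 :: int" n] by (simp only:)
  also have "\<dots> = int (card ({1..n} \<inter> T))" using sum.inter_restrict[of "{1..n}" "\<lambda>_. 1::int" T] by simp
  also have "{1..n} \<inter> T = T" using fT by blast
  finally show ?thesis using fT by simp
qed

text \<open>These are the two bounds under which \<open>extremal_weight\<close> singles out the
  extremal weights.\<close>

lemma wtX_bounds:
  assumes x: "x \<in> mon_idx k n d"
  shows "j \<in> {1..n div 2} \<Longrightarrow> \<bar>wtX n x j\<bar> \<le> int d" "(\<Sum>j\<in>{1..n div 2}. \<bar>wtX n x j\<bar>) \<le> int (k * d)"
proof -
  have "(j \<in> {1..n div 2} \<longrightarrow> \<bar>wtX n x j\<bar> \<le> int d) \<and> (\<Sum>j\<in>{1..n div 2}. \<bar>wtX n x j\<bar>) \<le> int (k * d)"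
    using x
  proof (induction d arbitrary: x)
    case 0 then show ?case by (simp add: mon_idx_def wtX_def)
  next
    case (Suc d)
    then obtain T ys where ys: "x = T # ys" "ys \<in> mon_idx k n d" "T \<in> ksubsets k n" unfolding mon_idx_Suc by auto
    have w: "wtX n x j = wtT n T j + wtX n ys j" for j by (simp add: ys wtX_def)
    have "(\<Sum>j\<in>{1..n div 2}. \<bar>wtX n x j\<bar>) \<le> (\<Sum>j\<in>{1..n div 2}. \<bar>wtT n T j\<bar> + \<bar>wtX n ys j\<bar>)"
      unfolding w by (intro sum_mono) (rule abs_triangle_ineq)
    also have "\<dots> \<le> int k + int (k * d)" unfolding sum.distrib by (rule add_mono[OF sum_abs_wtT[OF ys(3)]]) (use Suc.IH[OF ys(2)] in blast)
    finally have "(\<Sum>j\<in>{1..n div 2}. \<bar>wtX n x j\<bar>) \<le> int (k * Suc d)" by simp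
    moreover have "\<bar>wtX n x j\<bar> \<le> int (Suc d)" if j: "j \<in> {1..n div 2}"
    proof -
      have "\<bar>wtT n T j\<bar> \<le> 1" unfolding wtT_eq[OF j ys(3)] by simp
      moreover have "\<bar>wtX n ys j\<bar> \<le> int d" using Suc.IH[OF ys(2)] j by blast
      ultimately show ?thesis unfolding w by linarith
    qed
    ultimately show ?case by blast
  qed
  then show "j \<in> {1..n div 2} \<Longrightarrow> \<bar>wtX n x j\<bar> \<le> int d" "(\<Sum>j\<in>{1..n div 2}. \<bar>wtX n x j\<bar>) \<le> int (k * d)" by blast+
qed

text \<open>The set indexing the extremal weight vector attached to a signed permutation of the (0-based) planes.\<close>

definition ext_idx :: "(nat \<Rightarrow> nat) \<times> nat set \<Rightarrow> nat \<Rightarrow> nat" where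
  "ext_idx w i = (if i \<in> snd w then 2 * (fst w i + 1) - 1 else 2 * (fst w i + 1))"

lemma ext_idx_props:
  assumes w: "w \<in> signed_perms (n div 2)" and k: "k \<le> n div 2"
  shows "ext_idx w ` {..<k} \<in> ksubsets k n" "inj_on (ext_idx w) {..<k}" "\<And>i. i < k \<Longrightarrow> fst w i + 1 \<in> {1..n div 2}"
proof -
  have p: "fst w permutes {0..<n div 2}" using w by (auto simp: signed_perms_def)
  show pl: "fst w i + 1 \<in> {1..n div 2}" if "i < k" for i
    using permutes_in_image[OF p, of i] that k by auto
  show inj: "inj_on (ext_idx w) {..<k}"
  proof (rule inj_onI)
    fix i j assume ij: "i \<in> {..<k}" "j \<in> {..<k}" "ext_idx w i = ext_idx w j"
    have "fst w i + 1 = fst w j + 1"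
      using ij(3) plane_index_eq[OF pl pl, of i j] ij(1,2) unfolding ext_idx_def by (auto split: if_splits simp del: One_nat_def; presburger)
    then show "i = j" using permutes_inj[OF p] by (simp add: inj_eq)
  qed
  have "ext_idx w i \<in> {1..n}" if "i < k" for i
    unfolding ext_idx_def using plane_index(1,2)[OF pl[OF that]] by (simp only: split: if_split) blast
  then show "ext_idx w ` {..<k} \<in> ksubsets k n" using card_image[OF inj] by (auto simp: ksubsets_def)
qed

text \<open>In each of the \<open>k\<close> signed coordinate directions one factor contributes at
  most 1, so a total of \<open>d\<close> forces every factor to contain the corresponding index. All
  \<open>k\<close> indices then lie in every factor, which has only \<open>k\<close> elements. Hence
  extremal weights have multiplicity one already among the spanning monomials.\<close>

lemma extremal_monomial:
  assumes w: "w \<in> signed_perms (n div 2)" and k: "k \<le> n div 2" and x: "x \<in> mon_idx k n d"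
  shows "(\<forall>j<n div 2. real_of_int (wtX n x (j + 1)) = actW (\<lambda>i. if i < k then real d else 0) w j) \<longleftrightarrow> x = replicate d (ext_idx w ` {..<k})"
proof -
  let ?T = "ext_idx w ` {..<k}" and ?m = "n div 2"
  have p: "fst w permutes {0..<?m}" using w by (auto simp: signed_perms_def)
  note ep = ext_idx_props[OF w k]
  have T_iff: "eps (snd w) i * real_of_int (wtT n T (fst w i + 1)) = 1 \<Longrightarrow> ext_idx w i \<in> T" if i: "i < k" and T: "T \<in> ksubsets k n" for i T
    unfolding wtT_eq[OF ep(3)[OF i] T] by (auto simp: eps_def ext_idx_def split: if_splits)
  have le1: "eps (snd w) i * real_of_int (wtT n T (fst w i + 1)) \<le> 1" if i: "i < k" and T: "T \<in> ksubsets k n" for i T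
    unfolding wtT_eq[OF ep(3)[OF i] T] by (auto simp: eps_def)
  have wT: "wtT n ?T (j + 1) = (let i = inv_into UNIV (fst w) j in if i < k then (if i \<in> snd w then 1 else -1) else 0)" if j: "j < ?m" for j
  proof -
    define i where "i = inv_into UNIV (fst w) j"
    have fi: "fst w i = j" unfolding i_def using permutes_inverses(1)[OF p] by simp
    have j1: "j + 1 \<in> {1..?m}" using j by simp
    have im: "ext_idx w i' = 2 * (j + 1) - 1 \<longleftrightarrow> i' = i \<and> i \<in> snd w" "ext_idx w i' = 2 * (j + 1) \<longleftrightarrow> i' = i \<and> i \<notin> snd w" if "i' < k" for i'
    proof -
      have e: "fst w i' + 1 = j + 1 \<longleftrightarrow> i' = i" using fi permutes_inj[OF p] by (auto simp: inj_eq)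
      note pe = plane_index_eq[OF ep(3)[OF that] j1, unfolded e]
      show "ext_idx w i' = 2 * (j + 1) - 1 \<longleftrightarrow> i' = i \<and> i \<in> snd w" "ext_idx w i' = 2 * (j + 1) \<longleftrightarrow> i' = i \<and> i \<notin> snd w"
        unfolding ext_idx_def using pe by (auto simp del: One_nat_def mult_Suc_right add_Suc_right)
    qed
    have "2 * (j + 1) - 1 \<in> ?T \<longleftrightarrow> i < k \<and> i \<in> snd w" "2 * (j + 1) \<in> ?T \<longleftrightarrow> i < k \<and> i \<notin> snd w"
      using im by (metis (no_types, lifting) imageE imageI lessThan_iff)+
    then show ?thesis unfolding wtT_eq[OF j1 ep(1)] i_def[symmetric] Let_def by auto
  qed
  show ?thesis
  proof
    assume h: "\<forall>j<?m. real_of_int (wtX n x (j + 1)) = actW (\<lambda>i. if i < k then real d else 0) w j"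
    have "T = ?T" if T: "T \<in> set x" for T
    proof -
      have Tk: "T' \<in> ksubsets k n" if "T' \<in> set x" for T' using x that by (auto simp: mon_idx_def)
      have "ext_idx w i \<in> T" if i: "i < k" for i
      proof -
        have "fst w i < ?m" using ep(3)[OF i] by simp
        then have "real_of_int (wtX n x (fst w i + 1)) = actW (\<lambda>i. if i < k then real d else 0) w (fst w i)" using h by blast
        then have "real_of_int (wtX n x (fst w i + 1)) = eps (snd w) i * real d" using actW_perm[OF w] i by simp
        then have "eps (snd w) i * real_of_int (wtX n x (fst w i + 1)) = real d" by (simp add: mult.assoc[symmetric])
        moreover have "eps (snd w) i * real_of_int (wtX n x (fst w i + 1)) = (\<Sum>T\<leftarrow>x. eps (snd w) i * real_of_int (wtT n T (fst w i + 1)))"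
          unfolding wtX_def by (induction x) (auto simp: distrib_left)
        moreover have "(\<Sum>T\<leftarrow>x. 1 - eps (snd w) i * real_of_int (wtT n T (fst w i + 1))) = real (length x) - (\<Sum>T\<leftarrow>x. eps (snd w) i * real_of_int (wtT n T (fst w i + 1)))"
          by (induction x) auto
        ultimately have z: "(\<Sum>T\<leftarrow>x. 1 - eps (snd w) i * real_of_int (wtT n T (fst w i + 1))) = 0" using x by (simp add: mon_idx_def)
        have "\<forall>y\<in>set (map (\<lambda>T. 1 - eps (snd w) i * real_of_int (wtT n T (fst w i + 1))) x). y \<ge> 0" using le1[OF i] Tk by auto
        with z have "\<forall>y\<in>set (map (\<lambda>T. 1 - eps (snd w) i * real_of_int (wtT n T (fst w i + 1))) x). y = 0"
          by (subst (asm) sum_list_nonneg_eq_0_iff) auto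
        then show ?thesis using T_iff[OF i Tk[OF T]] T by auto
      qed
      then have sub: "?T \<subseteq> T" by blast
      have "card ?T = card T" "finite T" using Tk[OF T] ep(1) ksubsets_finite(1)[OF Tk[OF T]] by (auto simp: ksubsets_def)
      then show ?thesis using card_subset_eq[OF _ sub] by simp
    qed
    then show "x = replicate d ?T" using x by (auto simp: mon_idx_def intro!: replicate_eqI)
  next
    assume x: "x = replicate d ?T"
    show "\<forall>j<?m. real_of_int (wtX n x (j + 1)) = actW (\<lambda>i. if i < k then real d else 0) w j"
    proof (intro allI impI)
      fix j assume j: "j < ?m"
      have "wtX n x (j + 1) = int d * wtT n ?T (j + 1)" unfolding wtX_def x by (simp add: sum_list_replicate)
      then show "real_of_int (wtX n x (j + 1)) = actW (\<lambda>i. if i < k then real d else 0) w j"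
        unfolding wT[OF j] actW_def eps_def Let_def by auto
    qed
  qed
qed

section \<open>Extremal weight vectors do not vanish on the orbit\<close>

lemma det_diagonal_nonzero:
  fixes z :: "nat \<Rightarrow> complex"
  assumes "\<And>i. i < k \<Longrightarrow> z i \<noteq> 0"
  shows "det (mat k k (\<lambda>(a, i). if a = i then z i else 0)) \<noteq> 0"
proof -
  let ?A = "mat k k (\<lambda>(a, i). if a = i then z i else 0)"
  have "det ?A = prod_list (diag_mat ?A)" by (rule det_upper_triangular) (auto simp: upper_triangular_def)
  also have "\<dots> \<noteq> 0" using assms by (auto simp: diag_mat_def prod_list_zero_iff)
  finally show ?thesis .
qed

text \<open>Evaluation at a suitable orbit point: the base frame is moved by plane permutations and
  reflections until its pairing matrix with the extremal basis vectors is diagonal with nonzero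
  entries.\<close>

lemma ext_not_in_orbit_ideal:
  assumes w: "w \<in> signed_perms (n div 2)" and k: "2 * k < n"
  shows "yv k n (ext_idx w ` {..<k}) ^ d \<notin> orbit_ideal k n"
proof -
  let ?m = "n div 2"
  have km: "k \<le> ?m" using k by auto
  have p: "fst w permutes {0..<?m}" using w by (auto simp: signed_perms_def)
  note ep = ext_idx_props[OF w km]
  \<comment> \<open>The inverse of \<open>fst w\<close>, shifted to planes numbered from 1: plane
    \<open>fst w i + 1\<close> of the new frame is plane \<open>i + 1\<close> of the base frame,
    which belongs to row \<open>i\<close>.\<close>
  define \<sigma> where "\<sigma> j = (if j \<in> {1..?m} then inv_into UNIV (fst w) (j - 1) + 1 else j)" for j
  have ip: "inv_into UNIV (fst w) permutes {0..<?m}" by (rule permutes_inv[OF p])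
  have inv1: "inv_into UNIV (fst w) j < ?m \<longleftrightarrow> j < ?m" for j using permutes_in_image[OF ip, of j] by simp
  have fw1: "fst w j < ?m \<longleftrightarrow> j < ?m" for j using permutes_in_image[OF p, of j] by simp
  have "\<sigma> permutes {1..?m}"
  proof (rule bij_imp_permutes)
    show "bij_betw \<sigma> {1..?m} {1..?m}"
    proof (rule bij_betwI[where g="\<lambda>j. fst w (j - 1) + 1"])
      have s1: "\<sigma> j = inv_into UNIV (fst w) (j - 1) + 1" if "j \<in> {1..?m}" for j unfolding \<sigma>_def by (simp only: that if_True)
      have lt: "j - 1 < ?m" if "j \<in> {1..?m}" for j using that by auto
      have mem: "j + 1 \<in> {1..?m}" if "j < ?m" for j using that by simp
      show "\<sigma> \<in> {1..?m} \<rightarrow> {1..?m}" 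
      proof
        fix j assume j: "j \<in> {1..?m}"
        show "\<sigma> j \<in> {1..?m}" unfolding s1[OF j] by (rule mem) (use inv1 lt[OF j] in blast)
      qed
      show gm: "(\<lambda>j. fst w (j - 1) + 1) \<in> {1..?m} \<rightarrow> {1..?m}"
      proof
        fix j assume j: "j \<in> {1..?m}"
        show "fst w (j - 1) + 1 \<in> {1..?m}" by (rule mem) (use fw1 lt[OF j] in blast)
      qed
      fix j assume j: "j \<in> {1..?m}"
      have j0: "j - 1 + 1 = j" using j by simp
      show "fst w (\<sigma> j - 1) + 1 = j" unfolding s1[OF j] add_diff_cancel_right' permutes_inverses(1)[OF p] by (rule j0)
      show "\<sigma> (fst w (j - 1) + 1) = j" unfolding s1[OF funcset_mem[OF gm j]] add_diff_cancel_right' permutes_inverses(2)[OF p] by (rule j0)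
    qed
    show "\<And>x. x \<notin> {1..?m} \<Longrightarrow> \<sigma> x = x" unfolding \<sigma>_def by (simp only: if_False)
  qed
  \<comment> \<open>An isotropic vector is orthogonal to itself, so \<open>e + i e'\<close> must
    meet the conjugate row. Hence the second column of the plane is reversed exactly for indices in
    \<open>snd w\<close>; the pairings are then 2 there and 1 elsewhere, because of the halved even
    basis vectors.\<close>
  define A where "A = {2 * (fst w i + 1) |i. i < k \<and> i \<in> snd w}"
  define M where "M = (\<lambda>r c. if c \<in> A then - base_frame k r (pcol ?m \<sigma> c) else base_frame k r (pcol ?m \<sigma> c))"
  have "A = (\<lambda>i. 2 * (fst w i + 1)) ` {i. i < k \<and> i \<in> snd w}" by (auto simp: A_def)
  then have fA: "finite A" by simp
  have "A \<subseteq> {1..n}" unfolding A_def using plane_index(2)[OF ep(3)] by blast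
  then have M: "M \<in> orbit k n" unfolding M_def
    by (intro orbit_flips fA orbit_plane_permutation \<open>\<sigma> permutes _\<close> orbit.base k) auto
  have sg: "\<sigma> (fst w i + 1) = i + 1" if "i < k" for i using ep(3)[OF that] by (simp add: \<sigma>_def permutes_inverses[OF p])
  have pc1: "pcol ?m \<sigma> (2 * (fst w i + 1) - 1) = 2 * i + 1" "pcol ?m \<sigma> (2 * (fst w i + 1)) = 2 * i + 2" if i: "i < k" for i
  proof -
    define j where "j = fst w i + 1"
    have j: "j \<in> {1..?m}" "\<sigma> j = i + 1" using ep(3)[OF i] sg[OF i] by (auto simp: j_def)
    have "odd (2 * j - 1)" "(2 * j - 1 + 1) div 2 = j" "2 * j - 1 \<in> {1..2 * ?m}" "2 * j \<in> {1..2 * ?m}" using j(1) by auto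
    then show "pcol ?m \<sigma> (2 * (fst w i + 1) - 1) = 2 * i + 1" "pcol ?m \<sigma> (2 * (fst w i + 1)) = 2 * i + 2"
      unfolding j_def[symmetric] pcol_def using j(2) by simp_all
  qed
  have nA: "2 * (fst w i + 1) - 1 \<notin> A" for i unfolding A_def by (auto; presburger)
  have A_iff: "2 * (fst w i + 1) \<in> A \<longleftrightarrow> i \<in> snd w" if "i < k" for i
    unfolding A_def using that permutes_inj[OF p] by (auto simp: inj_eq)
  define v where "v = map (ext_idx w) [0..<k]"
  have v: "v \<in> strings k n" "distinct v" "set v = ext_idx w ` {..<k}"
    using ep(1,2) by (auto simp: v_def strings_def ksubsets_def distinct_map atLeast0LessThan)
  define z where "z i = (if i \<in> snd w then 2 else 1 :: complex)" for i
  have ent: "(\<Sum>c\<in>{1..n}. M a c * fb n (v ! i) c) = (if a = i then z i else 0)" if ai: "a < k" "i < k" for a i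
  proof -
    define j where "j = fst w i + 1"
    have j: "j \<in> {1..n div 2}" unfolding j_def by (rule ep(3)[OF ai(2)])
    have M1: "M a (2 * j - 1) = (if a = i then 1 else 0)"
      using nA[of i] pc1(1)[OF ai(2)] ai unfolding M_def j_def by (auto simp: base_frame_def; presburger)
    have M2: "M a (2 * j) = (if a = i then (if i \<in> snd w then - \<i> else \<i>) else 0)"
      using A_iff[OF ai(2)] pc1(2)[OF ai(2)] ai unfolding M_def j_def by (auto simp: base_frame_def; presburger)
    have vi: "v ! i = (if i \<in> snd w then 2 * j - 1 else 2 * j)" using ai by (simp add: v_def ext_idx_def j_def)
    have "(\<Sum>c\<in>{1..n}. M a c * fb n (v ! i) c) = (\<Sum>c\<in>{1..n}. fb n (v ! i) c * M a c)" by (simp add: mult.commute)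
    also have "\<dots> = (if i \<in> snd w then M a (2 * j - 1) + \<i> * M a (2 * j) else M a (2 * j - 1) / 2 - \<i> / 2 * M a (2 * j))"
      unfolding vi using fb_sum(1,2)[OF j, of "M a"] by (simp split: if_split)
    also have "\<dots> = (if a = i then z i else 0)" unfolding M1 M2 z_def by simp
    finally show ?thesis .
  qed
  have "peval (PL k n (\<lambda>i. fb n (v ! i))) (\<lambda>S. 1 * pc k M S) = 1 * det (mat k k (\<lambda>(a, i). \<Sum>c\<in>{1..n}. M a c * fb n (v ! i) c))" by (rule peval_PL)
  also have "mat k k (\<lambda>(a, i). \<Sum>c\<in>{1..n}. M a c * fb n (v ! i) c) = mat k k (\<lambda>(a, i). if a = i then z i else 0)"
    by (rule eq_matI) (use ent in auto)
  finally have "peval (PL k n (\<lambda>i. fb n (v ! i))) (\<lambda>S. 1 * pc k M S) \<noteq> 0" using det_diagonal_nonzero[of k z] by (simp add: z_def)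
  then have nz: "peval (yv k n (ext_idx w ` {..<k})) (\<lambda>S. 1 * pc k M S) \<noteq> 0"
    unfolding PL_fb_eq_yv[OF v(1)] using v(2,3) by (auto simp: peval.hev_mult)
  have "peval (f ^ d) q = peval f q ^ d" for f q by (induction d) (auto simp: peval.hev_mult)
  then have "peval (yv k n (ext_idx w ` {..<k}) ^ d) (\<lambda>S. 1 * pc k M S) \<noteq> 0" using nz by simp
  moreover have "(1::complex) \<noteq> 0" by simp
  ultimately show ?thesis using M unfolding orbit_ideal_iff by blast
qed

section \<open>The trace of the Casimir operator\<close>

text \<open>The exponent by which the torus element acts on basis vector \<open>c\<close>. Planes
  count from 1 but torus parameters from 0, whence \<open>j - 1\<close>.\<close>

definition thc :: "nat \<Rightarrow> (nat \<Rightarrow> real) \<Rightarrow> nat \<Rightarrow> real" where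
  "thc n \<theta> c = (\<Sum>j\<in>{1..n div 2}. of_int (wtc n c j) * \<theta> (j - 1))"

lemma wtc_star:
  assumes c: "c \<in> {1..n}" and j: "j \<in> {1..n div 2}"
  shows "wtc n (star n c) j = - wtc n c j"
  using c
proof (cases rule: index_cases)
  case (1 i) show ?thesis unfolding 1(2) star_plane(1)[OF 1(1)] wtc_plane(1,2)[OF 1(1) j] by simp
next
  case (2 i) show ?thesis unfolding 2(2) star_plane(2)[OF 2(1)] wtc_plane(1,2)[OF 2(1) j] by simp
next
  case 3 show ?thesis unfolding 3(2) star_last[OF 3(1)] wtc_plane(3)[OF j j 3(1)] by simp
qed

lemma sum_wtc:
  fixes h :: "nat \<Rightarrow> 'a::comm_ring_1"
  shows "j \<in> {1..n div 2} \<Longrightarrow> (\<Sum>i\<in>{1..n div 2}. of_int (wtc n (2 * j - 1) i) * h i) = h j"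
    "j \<in> {1..n div 2} \<Longrightarrow> (\<Sum>i\<in>{1..n div 2}. of_int (wtc n (2 * j) i) * h i) = - h j"
    "odd n \<Longrightarrow> (\<Sum>i\<in>{1..n div 2}. of_int (wtc n n i) * h i) = 0"
proof -
  assume j: "j \<in> {1..n div 2}"
  have "(\<Sum>i\<in>{1..n div 2}. of_int (wtc n (2 * j - 1) i) * h i) = (\<Sum>i\<in>{1..n div 2}. if j = i then h i else 0)"
  proof (rule sum.cong[OF refl])
    fix i assume i: "i \<in> {1..n div 2}"
    show "of_int (wtc n (2 * j - 1) i) * h i = (if j = i then h i else 0)" unfolding wtc_plane(1)[OF j i] by simp
  qed
  then show "(\<Sum>i\<in>{1..n div 2}. of_int (wtc n (2 * j - 1) i) * h i) = h j" using j by (simp add: sum.delta)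
  have "(\<Sum>i\<in>{1..n div 2}. of_int (wtc n (2 * j) i) * h i) = (\<Sum>i\<in>{1..n div 2}. if j = i then - h i else 0)"
  proof (rule sum.cong[OF refl])
    fix i assume i: "i \<in> {1..n div 2}"
    show "of_int (wtc n (2 * j) i) * h i = (if j = i then - h i else 0)" unfolding wtc_plane(2)[OF j i] by simp
  qed
  then show "(\<Sum>i\<in>{1..n div 2}. of_int (wtc n (2 * j) i) * h i) = - h j" using j by (simp add: sum.delta)
next
  assume o: "odd n"
  have "of_int (wtc n n i) * h i = 0" if "i \<in> {1..n div 2}" for i unfolding wtc_plane(3)[OF that that o] by simp
  then show "(\<Sum>i\<in>{1..n div 2}. of_int (wtc n n i) * h i) = 0" by (rule sum.neutral[rule_format])
qed

lemma thc_plane: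
  "j \<in> {1..n div 2} \<Longrightarrow> thc n \<theta> (2 * j - 1) = \<theta> (j - 1)"
  "j \<in> {1..n div 2} \<Longrightarrow> thc n \<theta> (2 * j) = - \<theta> (j - 1)"
  "odd n \<Longrightarrow> thc n \<theta> n = 0"
  unfolding thc_def by (fact sum_wtc)+

lemma thc_star: "c \<in> {1..n} \<Longrightarrow> thc n \<theta> (star n c) = - thc n \<theta> c"
  unfolding thc_def sum_negf[symmetric] by (rule sum.cong[OF refl]) (simp add: wtc_star del: atLeastAtMost_iff)

lemma thc_inj:
  assumes g: "generic n \<theta>" and c: "c \<in> {1..n}" and e: "e \<in> {1..n}" and eq: "thc n \<theta> c = thc n \<theta> e"
  shows "c = e"
proof -
  have pos: "\<theta> (i - 1) > 0" if "i \<in> {1..n div 2}" for i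
  proof -
    have "i - 1 < n div 2" using that by auto
    then show ?thesis using g by (simp add: generic_def)
  qed
  have inj: "i = j" if "i \<in> {1..n div 2}" "j \<in> {1..n div 2}" "\<theta> (i - 1) = \<theta> (j - 1)" for i j
  proof -
    have "i - 1 \<in> {..<n div 2}" "j - 1 \<in> {..<n div 2}" using that by auto
    then have "i - 1 = j - 1" using g that(3) unfolding generic_def inj_on_def by blast
    then show ?thesis using that by auto
  qed
  have cs: "(\<exists>i\<in>{1..n div 2}. c = 2 * i - 1 \<and> thc n \<theta> c = \<theta> (i - 1)) \<or> (\<exists>i\<in>{1..n div 2}. c = 2 * i \<and> thc n \<theta> c = - \<theta> (i - 1)) \<or> (c = n \<and> thc n \<theta> c = 0)"
    if "c \<in> {1..n}" for c
    using that by (cases rule: index_cases) (use thc_plane in blast)+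
  from cs[OF c] cs[OF e] show ?thesis
  proof (elim disjE bexE conjE)
    fix i j assume h: "i \<in> {1..n div 2}" "j \<in> {1..n div 2}" "c = 2 * i - 1" "thc n \<theta> c = \<theta> (i - 1)" "e = 2 * j - 1" "thc n \<theta> e = \<theta> (j - 1)"
    show ?thesis using inj[OF h(1,2)] h(3-6) eq by simp
  next
    fix i j assume h: "i \<in> {1..n div 2}" "j \<in> {1..n div 2}" "c = 2 * i" "thc n \<theta> c = - \<theta> (i - 1)" "e = 2 * j" "thc n \<theta> e = - \<theta> (j - 1)"
    show ?thesis using inj[OF h(1,2)] h(3-6) eq by simp
  next
    fix i j assume h: "i \<in> {1..n div 2}" "j \<in> {1..n div 2}" "c = 2 * i - 1" "thc n \<theta> c = \<theta> (i - 1)" "e = 2 * j" "thc n \<theta> e = - \<theta> (j - 1)"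
    show ?thesis using pos[OF h(1)] pos[OF h(2)] h(4,6) eq by linarith
  next
    fix i j assume h: "i \<in> {1..n div 2}" "j \<in> {1..n div 2}" "c = 2 * i" "thc n \<theta> c = - \<theta> (i - 1)" "e = 2 * j - 1" "thc n \<theta> e = \<theta> (j - 1)"
    show ?thesis using pos[OF h(1)] pos[OF h(2)] h(4,6) eq by linarith
  next
    fix i assume h: "i \<in> {1..n div 2}" "thc n \<theta> c = \<theta> (i - 1)" "thc n \<theta> e = 0"
    show ?thesis using pos[OF h(1)] h(2,3) eq by linarith
  next
    fix i assume h: "i \<in> {1..n div 2}" "thc n \<theta> c = - \<theta> (i - 1)" "thc n \<theta> e = 0"
    show ?thesis using pos[OF h(1)] h(2,3) eq by linarith
  next
    fix i assume h: "i \<in> {1..n div 2}" "thc n \<theta> e = \<theta> (i - 1)" "thc n \<theta> c = 0"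
    show ?thesis using pos[OF h(1)] h(2,3) eq by linarith
  next
    fix i assume h: "i \<in> {1..n div 2}" "thc n \<theta> e = - \<theta> (i - 1)" "thc n \<theta> c = 0"
    show ?thesis using pos[OF h(1)] h(2,3) eq by linarith
  next
    assume "c = n" "e = n" then show ?thesis by simp
  qed
qed

text \<open>Guarantees that the factor \<open>1 - q\<close> attached to a root can be divided by at
  a generic point.\<close>

lemma thc_ne:
  assumes "generic n \<theta>" "c \<in> {1..n}" "c' \<in> {1..n}" "c' \<noteq> star n c"
  shows "thc n \<theta> c + thc n \<theta> c' \<noteq> 0"
proof
  assume "thc n \<theta> c + thc n \<theta> c' = 0"
  then have "thc n \<theta> c' = thc n \<theta> (star n c)" using thc_star[OF assms(2)] by simp
  then show False using thc_inj[OF assms(1) assms(3) star_in[OF assms(2)]] assms(4) by blast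
qed

lemma sum_star: "(\<Sum>c\<in>{1..n}. h (star n c)) = (\<Sum>c\<in>{1..n}. h c)"
  by (rule sum.reindex_bij_witness[where i="star n" and j="star n"]) (simp_all add: star_star star_in del: atLeastAtMost_iff One_nat_def)

lemma sum_from_1: "(\<Sum>j\<in>{1..m::nat}. f j) = (\<Sum>j<m. f (j + 1))"
  using sum.atLeast1_atMost_eq[of f m] by simp

text \<open>The weights cancel in pairs \<open>c, star n c\<close>; what survives of \<open>q / (1 - q)\<close> is its odd part.\<close>

lemma star_symmetrization:
  fixes H :: "nat \<Rightarrow> real"
  assumes g: "generic n \<theta>" and H: "\<And>c. c \<in> {1..n} \<Longrightarrow> H (star n c) = - H c"
    and q: "\<And>c c'. q c c' = exp (thc n \<theta> c + thc n \<theta> c')"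
  shows "(\<Sum>c\<in>{1..n}. \<Sum>c'\<in>{1..n}. if c' = c \<or> c' = star n c then 0 else q c c' / (1 - q c c') * (H c + H c'))
     = - 2 * (\<Sum>j<n div 2. H (2 * j + 1) * Qfun n \<theta> j)"
proof -
  let ?N = "{1..n}"
  define F where "F c c' = (if c' = c \<or> c' = star n c then 0 else q c c' / (1 - q c c'))" for c c'
  define G where "G c c' = (if c' = c \<or> c' = star n c then 0 else Kfun (q c c'))" for c c'
  have cond: "(c' = c \<or> c' = star n c) \<longleftrightarrow> (c = c' \<or> c = star n c')" if "c \<in> ?N" "c' \<in> ?N" for c c'
    using star_star[OF that(1)] star_star[OF that(2)] by metis
  have cond2: "(star n c' = star n c \<or> star n c' = star n (star n c)) \<longleftrightarrow> (c' = c \<or> c' = star n c)" if "c \<in> ?N" "c' \<in> ?N" for c c'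
    using star_star[OF that(1)] star_star[OF that(2)] by metis
  have Fsym: "F c c' = F c' c" if "c \<in> ?N" "c' \<in> ?N" for c c'
    unfolding F_def q using cond[OF that] by (simp add: add.commute)
  have qs: "q (star n c) (star n c') = 1 / q c c'" if "c \<in> ?N" "c' \<in> ?N" for c c'
    unfolding q thc_star[OF that(1)] thc_star[OF that(2)] by (simp add: exp_add exp_minus exp_diff divide_simps)
  have q1: "q c c' \<noteq> 1" if "c \<in> ?N" "c' \<in> ?N" "\<not> (c' = c \<or> c' = star n c)" for c c'
    unfolding q using thc_ne[OF g that(1,2)] that(3) by simp
  have q0: "q c c' > 0" for c c' unfolding q by simp
  have Fstar: "F c c' - F (star n c) (star n c') = - G c c'" if "c \<in> ?N" "c' \<in> ?N" for c c'
  proof (cases "c' = c \<or> c' = star n c")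
    case True then show ?thesis unfolding F_def G_def cond2[OF that] by simp
  next
    case False
    have "q c c' / (1 - q c c') - (1 / q c c') / (1 - 1 / q c c') = - Kfun (q c c')"
      using q0[of c c'] q1[OF that False] by (simp add: Kfun_def divide_simps) (simp add: algebra_simps)
    then show ?thesis unfolding F_def G_def cond2[OF that] qs[OF that] using False by simp
  qed
  have Gstar: "G (star n c) (star n c') = - G c c'" if "c \<in> ?N" "c' \<in> ?N" for c c'
  proof (cases "c' = c \<or> c' = star n c")
    case True then show ?thesis unfolding G_def cond2[OF that] by simp
  next
    case False
    have "Kfun (1 / q c c') = - Kfun (q c c')"
      using q0[of c c'] q1[OF that False] by (simp add: Kfun_def divide_simps) (simp add: algebra_simps)
    then show ?thesis unfolding G_def cond2[OF that] qs[OF that] using False by simp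
  qed
  define S where "S = (\<Sum>c\<in>?N. \<Sum>c'\<in>?N. F c c' * H c)"
  have "(\<Sum>c\<in>?N. \<Sum>c'\<in>?N. if c' = c \<or> c' = star n c then 0 else q c c' / (1 - q c c') * (H c + H c'))
      = (\<Sum>c\<in>?N. \<Sum>c'\<in>?N. F c c' * H c + F c' c * H c')"
  proof (rule sum.cong[OF refl], rule sum.cong[OF refl])
    fix c c' assume cc: "c \<in> ?N" "c' \<in> ?N"
    show "(if c' = c \<or> c' = star n c then 0 else q c c' / (1 - q c c') * (H c + H c')) = F c c' * H c + F c' c * H c'"
      unfolding Fsym[OF cc(2,1)] unfolding F_def by (simp add: distrib_left)
  qed
  also have "\<dots> = S + (\<Sum>c\<in>?N. \<Sum>c'\<in>?N. F c' c * H c')" by (simp only: sum.distrib S_def)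
  also have "(\<Sum>c\<in>?N. \<Sum>c'\<in>?N. F c' c * H c') = S" unfolding S_def by (rule sum.swap)
  finally have 1: "(\<Sum>c\<in>?N. \<Sum>c'\<in>?N. if c' = c \<or> c' = star n c then 0 else q c c' / (1 - q c c') * (H c + H c')) = S + S" .
  have "S = (\<Sum>c\<in>?N. \<Sum>c'\<in>?N. F (star n c) (star n c') * H (star n c))"
    unfolding S_def by (simp only: sum_star[of "\<lambda>c'. F _ c' * H _"] sum_star[of "\<lambda>c. \<Sum>c'\<in>?N. F c c' * H c"])
  also have "\<dots> = (\<Sum>c\<in>?N. \<Sum>c'\<in>?N. - (F (star n c) (star n c') * H c))"
    by (rule sum.cong[OF refl], rule sum.cong[OF refl]) (simp add: H del: atLeastAtMost_iff)
  finally have "S + S = (\<Sum>c\<in>?N. \<Sum>c'\<in>?N. F c c' * H c) + (\<Sum>c\<in>?N. \<Sum>c'\<in>?N. - (F (star n c) (star n c') * H c))"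
    by (simp only: S_def)
  also have "\<dots> = (\<Sum>c\<in>?N. \<Sum>c'\<in>?N. (F c c' - F (star n c) (star n c')) * H c)"
    unfolding sum.distrib[symmetric] by (rule sum.cong[OF refl], rule sum.cong[OF refl]) (simp add: left_diff_distrib)
  also have "\<dots> = (\<Sum>c\<in>?N. \<Sum>c'\<in>?N. - G c c' * H c)"
    by (rule sum.cong[OF refl], rule sum.cong[OF refl]) (simp only: Fstar)
  also have "\<dots> = - (\<Sum>c\<in>?N. H c * (\<Sum>c'\<in>?N. G c c'))"
    by (simp add: sum_negf sum_distrib_left mult.commute)
  finally have 2: "S + S = - (\<Sum>c\<in>?N. H c * (\<Sum>c'\<in>?N. G c c'))" .
  define KS where "KS c = (\<Sum>c'\<in>?N. G c c')" for c
  have KSs: "KS (star n c) = - KS c" if c: "c \<in> ?N" for c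
  proof -
    have "KS (star n c) = (\<Sum>c'\<in>?N. G (star n c) (star n c'))" unfolding KS_def by (rule sum_star[symmetric])
    also have "\<dots> = (\<Sum>c'\<in>?N. - G c c')" by (rule sum.cong[OF refl]) (rule Gstar[OF c])
    finally show ?thesis by (simp add: KS_def sum_negf)
  qed
  have Hn: "H n = 0" if "odd n"
  proof -
    have "n \<in> ?N" using that by (cases n) auto
    then show ?thesis using H[of n] star_last[OF that] by simp
  qed
  have KQ: "KS (2 * j - 1) = Qfun n \<theta> (j - 1)" if j: "j \<in> {1..n div 2}" for j
  proof -
    have s: "star n (2 * j - 1) = 2 * j" by (rule star_plane(1)[OF j])
    have G1: "G (2 * j - 1) (2 * i - 1) + G (2 * j - 1) (2 * i) = (if i = j then 0 else Kfun (exp (\<theta> (j - 1) + \<theta> (i - 1))) + Kfun (exp (\<theta> (j - 1) - \<theta> (i - 1))))"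
      if i: "i \<in> {1..n div 2}" for i
      unfolding G_def q s thc_plane(1)[OF j] thc_plane(1)[OF i] thc_plane(2)[OF i] using plane_index_eq[OF i j] plane_index_eq[OF j i] 
      by (simp del: One_nat_def)
    have G2: "G (2 * j - 1) n = Kfun (exp (\<theta> (j - 1)))" if o: "odd n"
      unfolding G_def q s thc_plane(1)[OF j] thc_plane(3)[OF o] using plane_index_eq(5-8)[OF j j o] by (simp del: One_nat_def)
    have "KS (2 * j - 1) = (\<Sum>i\<in>{1..n div 2}. G (2 * j - 1) (2 * i - 1) + G (2 * j - 1) (2 * i)) + (if odd n then G (2 * j - 1) n else 0)"
      unfolding KS_def by (rule sum_index)
    also have "(\<Sum>i\<in>{1..n div 2}. G (2 * j - 1) (2 * i - 1) + G (2 * j - 1) (2 * i)) = (\<Sum>i\<in>{1..n div 2}. if i = j then 0 else Kfun (exp (\<theta> (j - 1) + \<theta> (i - 1))) + Kfun (exp (\<theta> (j - 1) - \<theta> (i - 1))))"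
      by (rule sum.cong[OF refl]) (rule G1)
    also have "\<dots> = (\<Sum>i<n div 2. if i = j - 1 then 0 else Kfun (exp (\<theta> (j - 1) + \<theta> i)) + Kfun (exp (\<theta> (j - 1) - \<theta> i)))"
      unfolding sum_from_1 by (rule sum.cong[OF refl]) (use j in auto)
    also have "\<dots> = (\<Sum>i\<in>{..<n div 2} - {j - 1}. Kfun (exp (\<theta> (j - 1) + \<theta> i)) + Kfun (exp (\<theta> (j - 1) - \<theta> i)))"
      by (rule sum.mono_neutral_cong_right) auto
    finally show ?thesis unfolding Qfun_def using G2 by simp
  qed
  have "(\<Sum>c\<in>?N. H c * KS c) = (\<Sum>j\<in>{1..n div 2}. H (2 * j - 1) * KS (2 * j - 1) + H (2 * j) * KS (2 * j)) + (if odd n then H n * KS n else 0)"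
    by (rule sum_index)
  also have "(if odd n then H n * KS n else 0) = 0" using Hn by simp
  also have "(\<Sum>j\<in>{1..n div 2}. H (2 * j - 1) * KS (2 * j - 1) + H (2 * j) * KS (2 * j)) = (\<Sum>j\<in>{1..n div 2}. 2 * (H (2 * j - 1) * Qfun n \<theta> (j - 1)))"
  proof (rule sum.cong[OF refl])
    fix j assume j: "j \<in> {1..n div 2}"
    have "H (2 * j) = - H (2 * j - 1)" "KS (2 * j) = - KS (2 * j - 1)"
      using H[OF plane_index(1)[OF j]] KSs[OF plane_index(1)[OF j]] unfolding star_plane(1)[OF j] by blast+
    then show "H (2 * j - 1) * KS (2 * j - 1) + H (2 * j) * KS (2 * j) = 2 * (H (2 * j - 1) * Qfun n \<theta> (j - 1))"
      using KQ[OF j] by (simp del: One_nat_def)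
  qed
  also have "\<dots> = 2 * (\<Sum>j<n div 2. H (2 * j + 1) * Qfun n \<theta> j)"
    unfolding sum_from_1 sum_distrib_left by simp
  finally show ?thesis using 1 2 by (simp add: KS_def)
qed

lemma graded_minus: "f \<in> graded_part k n d \<Longrightarrow> - f \<in> graded_part k n d"
  using graded_scale[of f k n d "-1"] by simp

lemma Rv_weight:
  assumes j: "j \<in> {1..n div 2}" and c: "c \<in> {1..n}" "c' \<in> {1..n}"
  shows "Rv n (2 * j - 1) (2 * j) (Rv n c c' f) = Rv n c c' (Rv n (2 * j - 1) (2 * j) f) + const_poly (of_int (wtc n c j + wtc n c' j)) * Rv n c c' f"
proof -
  have w: "wtc n c j = (if c = 2 * j - 1 then 1 else 0) - (if c = 2 * j then 1 else 0)" for c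
    unfolding wtc_def using j plane_index(3)[OF j] by (simp del: One_nat_def atLeastAtMost_iff)
  have a: "Rv n c' c f = - Rv n c c' f" by (rule Rv_antisym)
  have ne: "2 * j - 1 \<noteq> 2 * j" by (rule plane_index(3)[OF j])
  show ?thesis
    unfolding Rv_commutator[OF plane_index(1,2)[OF j] c] star_plane[OF j] w
    using ne a by (auto simp del: One_nat_def simp: algebra_simps)
qed

text \<open>What the dimension count requires of a subspace \<open>J\<close> of one degree. It need
  not be part of an ideal, so the image of the shifted Casimir operator qualifies.\<close>

locale casimir_quotient =
  fixes k n d :: nat and J :: "ppoly set"
  assumes k_pos: "1 \<le> k" and k_lt: "2 * k < n"
    and J_graded: "J \<subseteq> graded_part k n d"
    and J_0: "0 \<in> J" and J_plus: "\<And>f g. f \<in> J \<Longrightarrow> g \<in> J \<Longrightarrow> f + g \<in> J" and J_scale: "\<And>c f. f \<in> J \<Longrightarrow> const_poly c * f \<in> J"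
    and J_D: "\<And>a b f. a \<in> {1..n} \<Longrightarrow> b \<in> {1..n} \<Longrightarrow> f \<in> J \<Longrightarrow> D a b f \<in> J"
    and J_Cas: "\<And>f. f \<in> graded_part k n d \<Longrightarrow> Cas n f + of_nat (cas_eig k n d) * f \<in> J"
    and J_ext: "\<And>w. w \<in> signed_perms (n div 2) \<Longrightarrow> yv k n (ext_idx w ` {..<k}) ^ d \<notin> J"
begin

sublocale quot_basis "graded_part k n d" J "mon_idx k n d" "ymon k n"
proof
  show "finite (mon_idx k n d)" by (rule finite_mon_idx)
  show "\<And>x. x \<in> mon_idx k n d \<Longrightarrow> ymon k n x \<in> graded_part k n d" by (rule ymon_graded)
  show "0 \<in> graded_part k n d" by (rule graded_0)
  show "\<And>f g. f \<in> graded_part k n d \<Longrightarrow> g \<in> graded_part k n d \<Longrightarrow> f + g \<in> graded_part k n d" by (rule graded_add)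
  show "\<And>c f. f \<in> graded_part k n d \<Longrightarrow> const_poly c * f \<in> graded_part k n d" by (rule graded_scale)
  show "J \<subseteq> graded_part k n d" by (rule J_graded)
  show "0 \<in> J" by (rule J_0)
  show "\<And>f g. f \<in> J \<Longrightarrow> g \<in> J \<Longrightarrow> f + g \<in> J" by (rule J_plus)
  show "\<And>c f. f \<in> J \<Longrightarrow> const_poly c * f \<in> J" by (rule J_scale)
  show "\<And>f. f \<in> graded_part k n d \<Longrightarrow> \<exists>c. f = (\<Sum>x\<in>mon_idx k n d. const_poly (c x) * ymon k n x)" by (rule ymon_span)
qed

definition Mx where "Mx c c' x y = cf (Rv n c c' (ymon k n y)) x"

lemma Rv_operator: "operator (Rv n c c')"
proof -
  have "Rv n c c' f \<in> J" if "f \<in> J" for f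
    unfolding Rv_def Dv_def by (intro J_sum J_scale J_D that)
  then show ?thesis unfolding operator_def by (simp add: Rv_graded) (simp add: Rv_def Dv_add Dv_const_mult)
qed

lemma YB: "y \<in> B \<Longrightarrow> ymon k n y \<in> graded_part k n d" and B_mon: "y \<in> B \<Longrightarrow> y \<in> mon_idx k n d"
  using B(1) ymon_graded by blast+

lemma cf_sum: "finite A \<Longrightarrow> (\<And>x. x \<in> A \<Longrightarrow> F x \<in> graded_part k n d) \<Longrightarrow> b \<in> B \<Longrightarrow> cf (\<Sum>x\<in>A. F x) b = (\<Sum>x\<in>A. cf (F x) b)"
  using cf_linear[of A F b "\<lambda>_. 1"] by simp

lemma cf_minus: "f \<in> graded_part k n d \<Longrightarrow> b \<in> B \<Longrightarrow> cf (- f) b = - cf f b"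
  using cf_scale[of f b "-1"] by simp

lemma cf_diff: "f \<in> graded_part k n d \<Longrightarrow> g \<in> graded_part k n d \<Longrightarrow> b \<in> B \<Longrightarrow> cf (f - g) b = cf f b - cf g b"
  using cf_add[of f "- g" b] cf_minus[of g b] graded_minus[of g] by simp

lemma Mx_prod: "x \<in> B \<Longrightarrow> y \<in> B \<Longrightarrow> cf (Rv n c c' (Rv n e e' (ymon k n y))) x = (\<Sum>z\<in>B. Mx c c' x z * Mx e e' z y)"
  unfolding Mx_def by (rule cf_operator[OF Rv_operator Rv_graded[OF YB]])

lemma Mx_H: "j \<in> {1..n div 2} \<Longrightarrow> x \<in> B \<Longrightarrow> y \<in> B \<Longrightarrow> Mx (2 * j - 1) (2 * j) x y = (if x = y then of_int (wtX n y j) else 0)"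
proof -
  assume h: "j \<in> {1..n div 2}" "x \<in> B" "y \<in> B"
  show ?thesis unfolding Mx_def Rv_ymon[OF h(1) B_mon[OF h(3)]] cf_scale[OF YB[OF h(3)] h(2)] cf_Y[OF h(3,2)] by simp
qed

text \<open>The quotient basis consists of weight monomials, so Cartan elements have diagonal
  matrices.\<close>

lemma weight_coord:
  assumes j: "j \<in> {1..n div 2}" and x: "x \<in> B" and f: "f \<in> graded_part k n d"
  shows "cf (Rv n (2 * j - 1) (2 * j) f) x = of_int (wtX n x j) * cf f x"
proof -
  have "cf (Rv n (2 * j - 1) (2 * j) f) x = (\<Sum>y\<in>B. Mx (2 * j - 1) (2 * j) x y * cf f y)"
    unfolding Mx_def by (rule cf_operator[OF Rv_operator f x])
  also have "\<dots> = (\<Sum>y\<in>B. if x = y then of_int (wtX n y j) * cf f y else 0)"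
    by (rule sum.cong[OF refl]) (simp add: Mx_H[OF j x] del: One_nat_def)
  finally show ?thesis using x finB by (simp add: sum.delta)
qed

definition hw :: "nat \<Rightarrow> nat set list \<Rightarrow> int" where "hw c x = (\<Sum>j\<in>{1..n div 2}. wtc n c j * wtX n x j)"

lemma hw_plane: "j \<in> {1..n div 2} \<Longrightarrow> hw (2 * j - 1) x = wtX n x j" "j \<in> {1..n div 2} \<Longrightarrow> hw (2 * j) x = - wtX n x j" "odd n \<Longrightarrow> hw n x = 0"
  unfolding hw_def using sum_wtc[where ?'a=int] by simp_all

lemma hw_star: "c \<in> {1..n} \<Longrightarrow> hw (star n c) x = - hw c x"
  unfolding hw_def sum_negf[symmetric] by (rule sum.cong[OF refl]) (simp add: wtc_star del: atLeastAtMost_iff)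

lemma Mx_diag: "x \<in> B \<Longrightarrow> y \<in> B \<Longrightarrow> Mx c c x y = 0"
proof -
  assume "x \<in> B"
  have "Rv n c c (ymon k n y) = 0" by (rule ppoly_eq_neg_self) (rule Rv_antisym)
  then show ?thesis unfolding Mx_def using cf_J[OF J_0 \<open>x \<in> B\<close>] by simp
qed

lemma Mx_star:
  assumes c: "c \<in> {1..n}" and x: "x \<in> B" and y: "y \<in> B"
  shows "Mx c (star n c) x y = (if x = y then of_int (hw c y) else 0)"
  using c
proof (cases rule: index_cases)
  case (1 j) show ?thesis unfolding 1(2) star_plane(1)[OF 1(1)] hw_plane(1)[OF 1(1)] by (rule Mx_H[OF 1(1) x y])
next
  case (2 j)
  have "Mx (2 * j) (2 * j - 1) x y = - Mx (2 * j - 1) (2 * j) x y"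
    unfolding Mx_def Rv_antisym[of n "2 * j"] by (rule cf_minus[OF Rv_graded[OF YB[OF y]] x])
  then show ?thesis unfolding 2(2) star_plane(2)[OF 2(1)] hw_plane(2)[OF 2(1)] Mx_H[OF 2(1) x y] by simp
next
  case 3 show ?thesis unfolding 3(2) star_last[OF 3(1)] hw_plane(3)[OF 3(1)] Mx_diag[OF x y] by simp
qed

text \<open>A root operator shifts weights by its root; comparing the Cartan eigenvalue before and
  after kills all other matrix entries.\<close>

lemma Mx_weight:
  assumes c: "c \<in> {1..n}" "c' \<in> {1..n}" and j: "j \<in> {1..n div 2}" and x: "x \<in> B" and y: "y \<in> B" and nz: "Mx c c' x y \<noteq> 0"
  shows "wtX n x j = wtX n y j + wtc n c j + wtc n c' j"
proof -
  let ?R = "Rv n c c' (ymon k n y)"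
  have R: "?R \<in> graded_part k n d" by (rule Rv_graded[OF YB[OF y]])
  have "Rv n (2 * j - 1) (2 * j) ?R = const_poly (of_int (wtX n y j) + of_int (wtc n c j + wtc n c' j)) * ?R"
    unfolding Rv_weight[OF j c] Rv_ymon[OF j B_mon[OF y]] unfolding Rv_def Dv_const_mult const_poly_simps(3) distrib_right ..
  then have "of_int (wtX n x j) * cf ?R x = (of_int (wtX n y j) + of_int (wtc n c j + wtc n c' j)) * cf ?R x"
    using weight_coord[OF j x R] cf_scale[OF R x] by metis
  then have "(of_int (wtX n x j) :: complex) = of_int (wtX n y j + (wtc n c j + wtc n c' j))" using nz by (simp add: Mx_def)
  then show ?thesis unfolding of_int_eq_iff by simp
qed

text \<open>The torus-weighted trace of the Casimir operator is computed in two ways: as a scalar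
  multiple of the character, by \<open>J_Cas\<close>, and as the sum over pairs \<open>c\<close>,
  \<open>c'\<close> of traces \<open>T c c'\<close>, where each root pair is reduced to Cartan
  traces.\<close>

lemma trace_identity:
  assumes g: "generic n \<theta>"
  shows "(\<Sum>x\<in>B. exp (\<Sum>j<n div 2. of_int (wtX n x (j + 1)) * \<theta> j) *
        ((\<Sum>j<n div 2. (of_int (wtX n x (j + 1)))\<^sup>2) + (\<Sum>j<n div 2. Qfun n \<theta> j * of_int (wtX n x (j + 1))) - real (k * d * (d + n - k - 1)))) = 0"
proof -
  let ?N = "{1..n}" and ?s = "star n"
  define e where "e x = exp (\<Sum>j\<in>{1..n div 2}. of_int (wtX n x j) * \<theta> (j - 1))" for x
  define q where "q c c' = exp (thc n \<theta> c + thc n \<theta> c')" for c c'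
  define T where "T c c' = (\<Sum>x\<in>B. of_real (e x) * cf (Rv n c c' (Rv n (?s c) (?s c') (ymon k n x))) x)" for c c'
  define Hs where "Hs c = (\<Sum>x\<in>B. e x * of_int (hw c x))" for c
  have T_sum: "T c c' = (\<Sum>x\<in>B. \<Sum>z\<in>B. of_real (e x) * Mx c c' x z * Mx (?s c) (?s c') z x)" for c c'
    unfolding T_def by (rule sum.cong[OF refl]) (simp add: Mx_prod sum_distrib_left mult.assoc)
  \<comment> \<open>Moving the torus element past a root operator, at the level of matrix
    entries.\<close>
  have e_rel: "of_real (e x) * Mx c c' x y = of_real (q c c') * (of_real (e y) * Mx c c' x y)"
    if cc: "c \<in> ?N" "c' \<in> ?N" and xy: "x \<in> B" "y \<in> B" for c c' x y
  proof (cases "Mx c c' x y = 0")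
    case False
    have "(\<Sum>j\<in>{1..n div 2}. of_int (wtX n x j) * \<theta> (j - 1)) = (\<Sum>j\<in>{1..n div 2}. of_int (wtc n c j) * \<theta> (j - 1) + of_int (wtc n c' j) * \<theta> (j - 1) + of_int (wtX n y j) * \<theta> (j - 1))"
      by (rule sum.cong[OF refl]) (simp only: Mx_weight[OF cc _ xy False], simp add: algebra_simps)
    also have "\<dots> = thc n \<theta> c + thc n \<theta> c' + (\<Sum>j\<in>{1..n div 2}. of_int (wtX n y j) * \<theta> (j - 1))"
      by (simp only: sum.distrib thc_def)
    finally have "e x = q c c' * e y" unfolding e_def q_def by (simp add: exp_add)
    then show ?thesis by simp
  qed simp
  \<comment> \<open>Let \<open>s\<close> be the trace with the two operators in the opposite order.
    Cyclicity gives \<open>T = q * s\<close>, and the commutator gives \<open>T = s\<close> minus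
    the Cartan traces; solving for \<open>s\<close> uses that \<open>q\<close> is not 1.\<close>
  have T_off: "T c c' = of_real (q c c' / (1 - q c c') * (Hs c + Hs c'))"
    if cc: "c \<in> ?N" "c' \<in> ?N" and ne: "\<not> (c' = c \<or> c' = ?s c)" for c c'
  proof -
    define A where "A x = cf (Rv n (?s c) (?s c') (Rv n c c' (ymon k n x))) x" for x
    define s where "s = (\<Sum>x\<in>B. of_real (e x) * A x)"
    have sc: "?s c \<in> ?N" "?s c' \<in> ?N" using cc star_in by blast+
    have "T c c' = (\<Sum>x\<in>B. \<Sum>z\<in>B. of_real (q c c') * (of_real (e z) * (Mx (?s c) (?s c') z x * Mx c c' x z)))"
      unfolding T_sum by (rule sum.cong[OF refl], rule sum.cong[OF refl]) (simp only: e_rel[OF cc] mult_ac)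
    also have "\<dots> = (\<Sum>z\<in>B. \<Sum>x\<in>B. of_real (q c c') * (of_real (e z) * (Mx (?s c) (?s c') z x * Mx c c' x z)))"
      by (rule sum.swap)
    also have "\<dots> = of_real (q c c') * s"
      unfolding s_def A_def sum_distrib_left by (rule sum.cong[OF refl]) (simp add: Mx_prod sum_distrib_left)
    finally have 1: "T c c' = of_real (q c c') * s" .
    have inj: "?s c \<noteq> ?s c'" using ne star_star[OF cc(1)] star_star[OF cc(2)] by metis
    have "cf (Rv n c c' (Rv n (?s c) (?s c') (ymon k n x))) x = A x - of_int (hw c x) - of_int (hw c' x)" if x: "x \<in> B" for x
    proof -
      let ?Y = "ymon k n x"
      have "Rv n c c' (Rv n (?s c) (?s c') ?Y) = Rv n (?s c) (?s c') (Rv n c c' ?Y) - Rv n c' (?s c') ?Y - Rv n c (?s c) ?Y"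
        unfolding Rv_commutator[OF cc sc] using inj by auto
      then have "cf (Rv n c c' (Rv n (?s c) (?s c') ?Y)) x = A x - Mx c' (?s c') x x - Mx c (?s c) x x"
        unfolding A_def Mx_def by (simp add: cf_diff x YB Rv_graded graded_diff)
      then show ?thesis unfolding Mx_star[OF cc(1) x x] Mx_star[OF cc(2) x x] by simp
    qed
    then have "T c c' = (\<Sum>x\<in>B. of_real (e x) * A x - of_real (e x * of_int (hw c x)) - of_real (e x * of_int (hw c' x)))"
      unfolding T_def by (intro sum.cong[OF refl]) (simp add: right_diff_distrib)
    then have 2: "T c c' = s - of_real (Hs c + Hs c')" by (simp add: sum_subtractf s_def Hs_def)
    have "q c c' \<noteq> 1" unfolding q_def using thc_ne[OF g cc] ne by simp
    then have q1: "1 - complex_of_real (q c c') \<noteq> 0" using of_real_eq_1_iff[of "q c c'"] by auto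
    have "s * (1 - of_real (q c c')) = of_real (Hs c + Hs c')" using 1 2 by (simp add: algebra_simps)
    then have "s = of_real (Hs c + Hs c') / (1 - of_real (q c c'))" using q1 by (simp add: eq_divide_eq)
    then show ?thesis unfolding 1 by simp
  qed
  \<comment> \<open>For a Cartan element both factors are diagonal, and the second one has the
    opposite eigenvalue; this is the origin of the minus sign.\<close>
  have T_star: "T c (?s c) = - of_real (\<Sum>x\<in>B. e x * (of_int (hw c x))\<^sup>2)" if c: "c \<in> ?N" for c
  proof -
    have "T c (?s c) = (\<Sum>x\<in>B. \<Sum>z\<in>B. if x = z then - of_real (e x * (of_int (hw c x))\<^sup>2) else 0)"
      unfolding T_sum
    proof (rule sum.cong[OF refl], rule sum.cong[OF refl])
      fix x z assume xz: "x \<in> B" "z \<in> B"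
      show "of_real (e x) * Mx c (?s c) x z * Mx (?s c) (?s (?s c)) z x = (if x = z then - of_real (e x * (of_int (hw c x))\<^sup>2) else 0)"
        unfolding Mx_star[OF c xz] Mx_star[OF star_in[OF c] xz(2,1)] hw_star[OF c] by (simp add: power2_eq_square)
    qed
    then show ?thesis using finB by (simp add: sum.delta sum_negf)
  qed
  have T_diag: "T c c = 0" for c unfolding T_sum by (intro sum.neutral ballI) (simp add: Mx_diag)
  have T_all: "T c c' = of_real ((if c' = c \<or> c' = ?s c then 0 else q c c' / (1 - q c c') * (Hs c + Hs c')) - (if ?s c = c' then (\<Sum>x\<in>B. e x * (of_int (hw c x))\<^sup>2) else 0))"
    if cc: "c \<in> ?N" "c' \<in> ?N" for c c'
  proof -
    consider "c' = ?s c" | "c' = c" "c' \<noteq> ?s c" | "\<not> (c' = c \<or> c' = ?s c)" by blast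
    then show ?thesis
    proof cases
      case 1 show ?thesis unfolding 1 T_star[OF cc(1)] by simp
    next
      case 2 then show ?thesis using T_diag[of c] by simp
    next
      case 3 then show ?thesis using T_off[OF cc 3] by auto
    qed
  qed
  have "(\<Sum>c\<in>?N. \<Sum>c'\<in>?N. T c c') = of_real (\<Sum>c\<in>?N. \<Sum>c'\<in>?N. (if c' = c \<or> c' = ?s c then 0 else q c c' / (1 - q c c') * (Hs c + Hs c')) - (if ?s c = c' then (\<Sum>x\<in>B. e x * (of_int (hw c x))\<^sup>2) else 0))"
    unfolding of_real_sum by (rule sum.cong[OF refl], rule sum.cong[OF refl]) (rule T_all)
  also have "(\<Sum>c\<in>?N. \<Sum>c'\<in>?N. (if c' = c \<or> c' = ?s c then 0 else q c c' / (1 - q c c') * (Hs c + Hs c')) - (if ?s c = c' then (\<Sum>x\<in>B. e x * (of_int (hw c x))\<^sup>2) else 0))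
     = (\<Sum>c\<in>?N. \<Sum>c'\<in>?N. (if c' = c \<or> c' = ?s c then 0 else q c c' / (1 - q c c') * (Hs c + Hs c'))) - (\<Sum>c\<in>?N. \<Sum>c'\<in>?N. (if ?s c = c' then (\<Sum>x\<in>B. e x * (of_int (hw c x))\<^sup>2) else 0))"
    by (simp only: sum_subtractf)
  also have "(\<Sum>c\<in>?N. \<Sum>c'\<in>?N. if c' = c \<or> c' = ?s c then 0 else q c c' / (1 - q c c') * (Hs c + Hs c')) = - 2 * (\<Sum>j<n div 2. Hs (2 * j + 1) * Qfun n \<theta> j)"
  proof (rule star_symmetrization[OF g])
    show "Hs (?s c) = - Hs c" if "c \<in> ?N" for c unfolding Hs_def hw_star[OF that] by (simp add: sum_negf)
  qed (rule q_def)
  also have "(\<Sum>c\<in>?N. \<Sum>c'\<in>?N. (if ?s c = c' then (\<Sum>x\<in>B. e x * (of_int (hw c x))\<^sup>2) else 0)) = (\<Sum>c\<in>?N. \<Sum>x\<in>B. e x * (of_int (hw c x))\<^sup>2)"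
    by (rule sum.cong[OF refl]) (use star_in in \<open>simp add: sum.delta del: atLeastAtMost_iff\<close>)
  also have "\<dots> = (\<Sum>x\<in>B. e x * (\<Sum>c\<in>?N. (of_int (hw c x))\<^sup>2))" unfolding sum_distrib_left by (rule sum.swap)
  also have "\<dots> = (\<Sum>x\<in>B. e x * (2 * (\<Sum>j<n div 2. (of_int (wtX n x (j + 1)))\<^sup>2)))"
  proof (rule sum.cong[OF refl])
    fix x
    have "(\<Sum>c\<in>?N. (real_of_int (hw c x))\<^sup>2) = (\<Sum>j\<in>{1..n div 2}. (of_int (hw (2 * j - 1) x))\<^sup>2 + (of_int (hw (2 * j) x))\<^sup>2) + (if odd n then (of_int (hw n x))\<^sup>2 else 0)"
      by (rule sum_index)
    also have "(if odd n then (real_of_int (hw n x))\<^sup>2 else 0) = 0" using hw_plane(3) by simp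
    also have "(\<Sum>j\<in>{1..n div 2}. (real_of_int (hw (2 * j - 1) x))\<^sup>2 + (of_int (hw (2 * j) x))\<^sup>2) = (\<Sum>j\<in>{1..n div 2}. 2 * (of_int (wtX n x j))\<^sup>2)"
      by (rule sum.cong[OF refl]) (simp add: hw_plane del: One_nat_def atLeastAtMost_iff)
    finally show "e x * (\<Sum>c\<in>?N. (of_int (hw c x))\<^sup>2) = e x * (2 * (\<Sum>j<n div 2. (of_int (wtX n x (j + 1)))\<^sup>2))"
      unfolding sum_from_1 by (simp add: sum_distrib_left)
  qed
  finally have tot: "(\<Sum>c\<in>?N. \<Sum>c'\<in>?N. T c c') = of_real (- 2 * (\<Sum>j<n div 2. Hs (2 * j + 1) * Qfun n \<theta> j) - (\<Sum>x\<in>B. e x * (2 * (\<Sum>j<n div 2. (of_int (wtX n x (j + 1)))\<^sup>2))))" .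
  \<comment> \<open>Summed over all pairs, the traces reassemble the Casimir operator by
    \<open>Cas_Rv\<close>.\<close>
  have "(\<Sum>c\<in>?N. \<Sum>c'\<in>?N. T c c') = (\<Sum>x\<in>B. of_real (e x) * cf (Cas n (ymon k n x)) x)"
  proof -
    have "(\<Sum>c\<in>?N. \<Sum>c'\<in>?N. T c c') = (\<Sum>c\<in>?N. \<Sum>x\<in>B. \<Sum>c'\<in>?N. of_real (e x) * cf (Rv n c c' (Rv n (?s c) (?s c') (ymon k n x))) x)"
      unfolding T_def by (rule sum.cong[OF refl]) (rule sum.swap)
    also have "\<dots> = (\<Sum>x\<in>B. \<Sum>c\<in>?N. \<Sum>c'\<in>?N. of_real (e x) * cf (Rv n c c' (Rv n (?s c) (?s c') (ymon k n x))) x)" by (rule sum.swap)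
    also have "\<dots> = (\<Sum>x\<in>B. of_real (e x) * cf (Cas n (ymon k n x)) x)"
    proof (rule sum.cong[OF refl])
      fix x assume x: "x \<in> B"
      have "cf (Cas n (ymon k n x)) x = (\<Sum>c\<in>?N. \<Sum>c'\<in>?N. cf (Rv n c c' (Rv n (?s c) (?s c') (ymon k n x))) x)"
        unfolding Cas_Rv by (subst cf_sum; (simp add: cf_sum graded_sum Rv_graded YB x)?)
      then show "(\<Sum>c\<in>?N. \<Sum>c'\<in>?N. of_real (e x) * cf (Rv n c c' (Rv n (?s c) (?s c') (ymon k n x))) x) = of_real (e x) * cf (Cas n (ymon k n x)) x"
        by (simp only: sum_distrib_left)
    qed
    finally show ?thesis .
  qed
  also have "\<dots> = (\<Sum>x\<in>B. of_real (- real (cas_eig k n d) * e x))"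
  proof (rule sum.cong[OF refl])
    fix x assume x: "x \<in> B"
    let ?Y = "ymon k n x"
    have eq: "of_nat (cas_eig k n d) * ?Y = const_poly (of_nat (cas_eig k n d)) * ?Y" using const_poly_of_int[of "int (cas_eig k n d)"] by simp
    have "cf (Cas n ?Y + const_poly (of_nat (cas_eig k n d)) * ?Y) x = 0" using cf_J[OF J_Cas[OF YB[OF x]] x] unfolding eq .
    then have "cf (Cas n ?Y) x + of_nat (cas_eig k n d) * 1 = 0"
      unfolding cf_add[OF Cas_graded[OF YB[OF x]] graded_scale[OF YB[OF x]] x] cf_scale[OF YB[OF x] x] cf_Y[OF x x] by simp
    then show "of_real (e x) * cf (Cas n ?Y) x = of_real (- real (cas_eig k n d) * e x)" by (simp add: add_eq_0_iff)
  qed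
  finally have "complex_of_real (- real (cas_eig k n d) * (\<Sum>x\<in>B. e x)) = of_real (- 2 * (\<Sum>j<n div 2. Hs (2 * j + 1) * Qfun n \<theta> j) - (\<Sum>x\<in>B. e x * (2 * (\<Sum>j<n div 2. (of_int (wtX n x (j + 1)))\<^sup>2))))"
    unfolding tot by (simp only: of_real_sum[symmetric] sum_distrib_left)
  then have fin: "- real (cas_eig k n d) * (\<Sum>x\<in>B. e x) = - 2 * (\<Sum>j<n div 2. Hs (2 * j + 1) * Qfun n \<theta> j) - (\<Sum>x\<in>B. e x * (2 * (\<Sum>j<n div 2. (of_int (wtX n x (j + 1)))\<^sup>2)))"
    by (simp only: of_real_eq_iff)
  have HQ: "(\<Sum>j<n div 2. Hs (2 * j + 1) * Qfun n \<theta> j) = (\<Sum>x\<in>B. e x * (\<Sum>j<n div 2. Qfun n \<theta> j * of_int (wtX n x (j + 1))))"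
  proof -
    have "(\<Sum>j<n div 2. Hs (2 * j + 1) * Qfun n \<theta> j) = (\<Sum>j<n div 2. \<Sum>x\<in>B. e x * (Qfun n \<theta> j * of_int (wtX n x (j + 1))))"
    proof (rule sum.cong[OF refl])
      fix j assume "j \<in> {..<n div 2}"
      then have j: "j + 1 \<in> {1..n div 2}" by auto
      have "hw (2 * j + 1) x = wtX n x (j + 1)" for x using hw_plane(1)[OF j] by simp
      then show "Hs (2 * j + 1) * Qfun n \<theta> j = (\<Sum>x\<in>B. e x * (Qfun n \<theta> j * of_int (wtX n x (j + 1))))"
        unfolding Hs_def sum_distrib_right by (simp add: mult_ac)
    qed
    also have "\<dots> = (\<Sum>x\<in>B. \<Sum>j<n div 2. e x * (Qfun n \<theta> j * of_int (wtX n x (j + 1))))" by (rule sum.swap)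
    finally show ?thesis by (simp only: sum_distrib_left)
  qed
  define K where "K = real (k * d * (d + n - k - 1))"
  have ce: "real (cas_eig k n d) = 2 * K" unfolding cas_eig_def K_def by (simp only: of_nat_mult)
  have "2 * (\<Sum>x\<in>B. e x * ((\<Sum>j<n div 2. (of_int (wtX n x (j + 1)))\<^sup>2) + (\<Sum>j<n div 2. Qfun n \<theta> j * of_int (wtX n x (j + 1))) - K))
     = (\<Sum>x\<in>B. e x * (2 * (\<Sum>j<n div 2. (of_int (wtX n x (j + 1)))\<^sup>2))) + 2 * (\<Sum>x\<in>B. e x * (\<Sum>j<n div 2. Qfun n \<theta> j * of_int (wtX n x (j + 1)))) - (2 * K) * (\<Sum>x\<in>B. e x)"
    unfolding sum_distrib_left sum.distrib[symmetric] sum_subtractf[symmetric]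
    by (rule sum.cong[OF refl]) (simp add: algebra_simps sum_distrib_left)
  also have "\<dots> = 0" using fin unfolding HQ ce by simp
  finally have "(\<Sum>x\<in>B. e x * ((\<Sum>j<n div 2. (of_int (wtX n x (j + 1)))\<^sup>2) + (\<Sum>j<n div 2. Qfun n \<theta> j * of_int (wtX n x (j + 1))) - K)) = 0" by simp
  then show ?thesis unfolding e_def sum_from_1 K_def by simp
qed

text \<open>The extremal monomial is nonzero modulo \<open>J\<close>, so it has a nonzero coordinate
  at some \<open>b\<close> in \<open>B\<close>. Such a \<open>b\<close> has the same weight, and
  multiplicity one forces it to be the monomial itself.\<close>

lemma ext_in_B:
  assumes w: "w \<in> signed_perms (n div 2)"
  shows "replicate d (ext_idx w ` {..<k}) \<in> B"
proof -
  let ?x = "replicate d (ext_idx w ` {..<k})"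
  have km: "k \<le> n div 2" using k_lt by auto
  have xm: "?x \<in> mon_idx k n d" using ext_idx_props(1)[OF w km] by (auto simp: mon_idx_def)
  have "ymon k n ?x = yv k n (ext_idx w ` {..<k}) ^ d" unfolding ymon_def by (simp add: prod_list_replicate)
  then have nJ: "ymon k n ?x \<notin> J" using J_ext[OF w] by simp
  have "\<exists>b\<in>B. cf (ymon k n ?x) b \<noteq> 0"
  proof (rule ccontr)
    assume "\<not> ?thesis"
    then have "(\<Sum>b\<in>B. const_poly (cf (ymon k n ?x) b) * ymon k n b) = 0" by (intro sum.neutral) auto
    then show False using cf[OF ymon_graded[OF xm]] nJ by simp
  qed
  then obtain b where b: "b \<in> B" "cf (ymon k n ?x) b \<noteq> 0" by blast
  have wt: "wtX n b j = wtX n ?x j" if j: "j \<in> {1..n div 2}" for j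
  proof -
    have "of_int (wtX n b j) * cf (ymon k n ?x) b = of_int (wtX n ?x j) * cf (ymon k n ?x) b"
      using weight_coord[OF j b(1) ymon_graded[OF xm]] unfolding Rv_ymon[OF j xm] cf_scale[OF ymon_graded[OF xm] b(1)] by (rule sym)
    then show ?thesis using b(2) by simp
  qed
  have "\<forall>j<n div 2. real_of_int (wtX n ?x (j + 1)) = actW (\<lambda>i. if i < k then real d else 0) w j"
    using extremal_monomial[OF w km xm] by blast
  then have "\<forall>j<n div 2. real_of_int (wtX n b (j + 1)) = actW (\<lambda>i. if i < k then real d else 0) w j" using wt by simp
  then have "b = ?x" using extremal_monomial[OF w km B_mon[OF b(1)]] by blast
  then show ?thesis using b(1) by simp
qed

lemma card_B: "real (card B) = (if odd n then (\<Prod>j<n div 2. lvec n k d j / rho n j) else 1) *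
    (\<Prod>b<n div 2. \<Prod>a<b. ((lvec n k d b)\<^sup>2 - (lvec n k d a)\<^sup>2) / ((rho n b)\<^sup>2 - (rho n a)\<^sup>2))"
proof (rule character_dimension[where wt="\<lambda>x j. wtX n x (j + 1)", OF finB k_pos k_lt], rule alternant_times_character[OF finB k_pos k_lt trace_identity])
  fix x assume x: "x \<in> B"
  show "\<bar>wtX n x (j + 1)\<bar> \<le> int d" if "j < n div 2" for j using wtX_bounds(1)[OF B_mon[OF x], of "j + 1"] that by simp
  show "(\<Sum>j<n div 2. \<bar>wtX n x (j + 1)\<bar>) \<le> int (k * d)" using wtX_bounds(2)[OF B_mon[OF x]] unfolding sum_from_1 .
next
  fix w assume w: "w \<in> signed_perms (n div 2)"
  have km: "k \<le> n div 2" using k_lt by auto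
  have "{x\<in>B. \<forall>j<n div 2. real_of_int (wtX n x (j + 1)) = actW (\<lambda>i. if i < k then real d else 0) w j} = {x\<in>B. x = replicate d (ext_idx w ` {..<k})}"
    using extremal_monomial[OF w km B_mon] by blast
  also have "\<dots> = {replicate d (ext_idx w ` {..<k})}" using ext_in_B[OF w] by auto
  finally show "card {x\<in>B. \<forall>j<n div 2. real_of_int (wtX n x (j + 1)) = actW (\<lambda>i. if i < k then real d else 0) w j} = 1" by simp
qed

end

section \<open>Equality of the two ideals degree by degree\<close>

section \<open>Comparing the two ideals\<close>

text \<open>The least subspace modulo which the Casimir operator is the prescribed scalar:
  \<open>J_Cas\<close> says that every admissible \<open>J\<close> contains it.\<close>

definition casimir_image :: "nat \<Rightarrow> nat \<Rightarrow> nat \<Rightarrow> ppoly set" where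
  "casimir_image k n d = (\<lambda>f. Cas n f + const_poly (of_nat (cas_eig k n d)) * f) ` graded_part k n d"

lemma of_nat_mult_ppoly: "of_nat c * (f :: ppoly) = const_poly (of_nat c) * f"
  using const_poly_of_int[of "int c"] by simp

lemma casimir_image_subset_OPI:
  assumes "1 \<le> k" "2 * k < n"
  shows "casimir_image k n d \<subseteq> ortho_plucker_ideal k n"
  using Cas_in_OPI[OF assms(1)] assms(2) unfolding casimir_image_def of_nat_mult_ppoly by auto

lemma OPI_subset_orbit_ideal:
  assumes "1 \<le> k" "2 * k < n"
  shows "ortho_plucker_ideal k n \<subseteq> orbit_ideal k n"
  using OPI_subset_vanishing[of k n] vanishing_subset_orbit_ideal[of k n] assms by auto

text \<open>Stability under so(n) is centrality of the operator. Survival of extremal vectors is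
  inherited from the larger orbit ideal.\<close>

lemma casimir_quotient_casimir_image:
  assumes k: "1 \<le> k" "2 * k < n"
  shows "casimir_quotient k n d (casimir_image k n d)"
proof
  let ?c = "const_poly (of_nat (cas_eig k n d))"
  show "1 \<le> k" "2 * k < n" by fact+
  show "casimir_image k n d \<subseteq> graded_part k n d"
    unfolding casimir_image_def by (rule image_subsetI) (intro graded_add Cas_graded graded_scale)
  have z: "Cas n (0::ppoly) + ?c * 0 = 0" using Cas_const_mult[of n 0 0] by simp
  show "0 \<in> casimir_image k n d" unfolding casimir_image_def by (rule image_eqI[where x=0], rule z[symmetric], rule graded_0)
  show "f + g \<in> casimir_image k n d" if fg: "f \<in> casimir_image k n d" "g \<in> casimir_image k n d" for f g
  proof -
    obtain f' g' where h: "f' \<in> graded_part k n d" "g' \<in> graded_part k n d" "f = Cas n f' + ?c * f'" "g = Cas n g' + ?c * g'"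
      using fg unfolding casimir_image_def by blast
    have "f + g = Cas n (f' + g') + ?c * (f' + g')" unfolding h(3,4) Cas_add by (simp add: algebra_simps)
    then show ?thesis unfolding casimir_image_def using graded_add[OF h(1,2)] by blast
  qed
  show "const_poly c * f \<in> casimir_image k n d" if f: "f \<in> casimir_image k n d" for c f
  proof -
    obtain f' where h: "f' \<in> graded_part k n d" "f = Cas n f' + ?c * f'" using f unfolding casimir_image_def by blast
    have "const_poly c * f = Cas n (const_poly c * f') + ?c * (const_poly c * f')" unfolding h(2) Cas_const_mult by (simp add: algebra_simps)
    then show ?thesis unfolding casimir_image_def using graded_scale[OF h(1)] by blast
  qed
  show "D a b f \<in> casimir_image k n d" if ab: "a \<in> {1..n}" "b \<in> {1..n}" and f: "f \<in> casimir_image k n d" for a b f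
  proof -
    obtain f' where h: "f' \<in> graded_part k n d" "f = Cas n f' + ?c * f'" using f unfolding casimir_image_def by blast
    have "D a b f = Cas n (D a b f') + ?c * D a b f'" unfolding h(2) D_add D_const_mult Cas_D[OF ab] ..
    then show ?thesis unfolding casimir_image_def using D_graded[OF h(1) ab] by blast
  qed
  show "Cas n f + of_nat (cas_eig k n d) * f \<in> casimir_image k n d" if "f \<in> graded_part k n d" for f
    unfolding casimir_image_def of_nat_mult_ppoly using that by blast
  show "yv k n (ext_idx w ` {..<k}) ^ d \<notin> casimir_image k n d" if "w \<in> signed_perms (n div 2)" for w
    using ext_not_in_orbit_ideal[OF that k(2)] casimir_image_subset_OPI[OF k] OPI_subset_orbit_ideal[OF k] by blast
qed

lemma casimir_quotient_orbit_ideal: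
  assumes k: "1 \<le> k" "2 * k < n"
  shows "casimir_quotient k n d (orbit_ideal k n \<inter> graded_part k n d)"
proof
  interpret I: ideal "orbit_ideal k n" "plucker_ring k n" by (rule ideal_orbit_ideal)
  note ag = ideal.axioms(1)[OF ideal_orbit_ideal[of k n]]
  show "1 \<le> k" "2 * k < n" by fact+
  show "orbit_ideal k n \<inter> graded_part k n d \<subseteq> graded_part k n d" by blast
  show "0 \<in> orbit_ideal k n \<inter> graded_part k n d" using additive_subgroup.zero_closed[OF ag] graded_0 by auto
  show "f + g \<in> orbit_ideal k n \<inter> graded_part k n d" if "f \<in> orbit_ideal k n \<inter> graded_part k n d" "g \<in> orbit_ideal k n \<inter> graded_part k n d" for f g
    using that additive_subgroup.a_closed[OF ag, of f g] graded_add[of f k n d g] by auto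
  show "const_poly c * f \<in> orbit_ideal k n \<inter> graded_part k n d" if "f \<in> orbit_ideal k n \<inter> graded_part k n d" for c f
    using that I.I_l_closed[OF _ carrier_const, of f c] graded_scale[of f k n d c] by auto
  show "D a b f \<in> orbit_ideal k n \<inter> graded_part k n d" if ab: "a \<in> {1..n}" "b \<in> {1..n}" and f: "f \<in> orbit_ideal k n \<inter> graded_part k n d" for a b f
    using orbit_ideal_D[OF _ ab, of f k] D_graded[OF _ ab, of f k d] graded_subset[of k n d] f by blast
  show "Cas n f + of_nat (cas_eig k n d) * f \<in> orbit_ideal k n \<inter> graded_part k n d" if f: "f \<in> graded_part k n d" for f
  proof
    show "Cas n f + of_nat (cas_eig k n d) * f \<in> orbit_ideal k n" using Cas_in_OPI[OF k(1) f] OPI_subset_orbit_ideal[OF k] k(2) by auto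
    show "Cas n f + of_nat (cas_eig k n d) * f \<in> graded_part k n d" unfolding of_nat_mult_ppoly by (rule graded_add[OF Cas_graded[OF f] graded_scale[OF f]])
  qed
  show "yv k n (ext_idx w ` {..<k}) ^ d \<notin> orbit_ideal k n \<inter> graded_part k n d" if "w \<in> signed_perms (n div 2)" for w
    using ext_not_in_orbit_ideal[OF that k(2)] by blast
qed

text \<open>One subspace contains the other, and by \<open>card_B\<close> both have the same
  codimension, given by a formula that does not mention \<open>J\<close>; in finite dimension they
  coincide.\<close>

lemma casimir_image_eq_orbit_ideal:
  assumes k: "1 \<le> k" "2 * k < n"
  shows "casimir_image k n d = orbit_ideal k n \<inter> graded_part k n d"
proof
  interpret V: vector_space pscale by (rule vector_space_pscale)
  interpret L: casimir_quotient k n d "casimir_image k n d" by (rule casimir_quotient_casimir_image[OF k])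
  interpret K: casimir_quotient k n d "orbit_ideal k n \<inter> graded_part k n d" by (rule casimir_quotient_orbit_ideal[OF k])
  let ?L = "casimir_image k n d" and ?K = "orbit_ideal k n \<inter> graded_part k n d"
  show sub: "?L \<subseteq> ?K"
    using casimir_image_subset_OPI[OF k] OPI_subset_orbit_ideal[OF k] L.J_graded by blast
  have subL: "V.subspace ?L" by (rule pscale_subspaceI[OF L.J_0 L.J_plus L.J_scale])
  have subK: "V.subspace ?K" by (rule pscale_subspaceI[OF K.J_0 K.J_plus K.J_scale])
  have "real (card L.B) = real (card K.B)" unfolding L.card_B K.card_B ..
  then have dimeq: "V.dim ?L = V.dim ?K" using L.dim_quotient(1,2) K.dim_quotient(1,2) by linarith
  have Sspan: "graded_part k n d \<subseteq> V.span (ymon k n ` mon_idx k n d)"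
  proof
    fix f assume "f \<in> graded_part k n d"
    then obtain e where "f = (\<Sum>x\<in>mon_idx k n d. const_poly (e x) * ymon k n x)" using ymon_span by blast
    then show "f \<in> V.span (ymon k n ` mon_idx k n d)" unfolding pscale_eq[symmetric] 
      by (simp only:) (intro V.span_sum V.span_scale V.span_base imageI)
  qed
  obtain C where C: "C \<subseteq> ?L" "V.independent C" "?L \<subseteq> V.span C" "card C = V.dim ?L" using V.basis_exists[of ?L] by blast
  obtain C' where C': "C \<subseteq> C'" "C' \<subseteq> ?K" "V.independent C'" "?K \<subseteq> V.span C'"
    using V.maximal_independent_subset_extend[of C ?K] C sub by blast
  have fin: "finite C'"
    by (rule V.independent_span_bound[of "ymon k n ` mon_idx k n d", THEN conjunct1]) (use finite_mon_idx C' Sspan in auto)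
  have "V.dim ?K = card C'" by (rule V.basis_card_eq_dim[OF C'(2,4,3), symmetric])
  then have "C = C'" using card_subset_eq[OF fin C'(1)] C(4) dimeq by simp
  then have "?K \<subseteq> V.span C" using C'(4) by simp
  also have "\<dots> \<subseteq> ?L" using V.span_minimal[OF C(1) subL] .
  finally show "?K \<subseteq> ?L" .
qed

text \<open>In each degree the ideal lies between two subspaces now known to be equal, and the orbit
  ideal is the sum of its homogeneous components.\<close>

lemma OPI_eq_orbit_ideal:
  assumes k: "1 \<le> k" "2 * k < n"
  shows "ortho_plucker_ideal k n = orbit_ideal k n"
proof
  show "ortho_plucker_ideal k n \<subseteq> orbit_ideal k n" by (rule OPI_subset_orbit_ideal[OF k])
  show "orbit_ideal k n \<subseteq> ortho_plucker_ideal k n"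
  proof
    fix f assume f: "f \<in> orbit_ideal k n"
    then have fc: "f \<in> carrier (plucker_ring k n)" by (simp add: orbit_ideal_iff)
    have "hcomp d f \<in> ortho_plucker_ideal k n" for d
      using hcomp_orbit_ideal[OF f, of d] hcomp_graded[OF fc, of d] casimir_image_eq_orbit_ideal[OF k, of d] casimir_image_subset_OPI[OF k, of d] by blast
    then have "(\<Sum>d\<in>monom_degree ` Poly_Mapping.keys f. hcomp d f) \<in> ortho_plucker_ideal k n" by (intro OPI_sum[OF k(1)])
    then show "f \<in> ortho_plucker_ideal k n" unfolding sum_hcomp[symmetric] .
  qed
qed

lemma primeideal_orbit_ideal:
  assumes k: "2 * k < n"
  shows "primeideal (orbit_ideal k n) (plucker_ring k n)"
proof (rule primeidealI)
  show "ideal (orbit_ideal k n) (plucker_ring k n)" by (rule ideal_orbit_ideal)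
  show "cring (plucker_ring k n)" by (rule cring_plucker_ring)
  \<comment> \<open>Degree 0 of the nonvanishing result: a zeroth power is 1, so the ideal is
    proper.\<close>
  have "(id, {}) \<in> signed_perms (n div 2)" by (auto simp: signed_perms_def permutes_id)
  then have "1 \<notin> orbit_ideal k n" using ext_not_in_orbit_ideal[OF _ k, of "(id, {})" 0] by simp
  moreover have "1 \<in> carrier (plucker_ring k n)" using carrier_const[of 1] by simp
  ultimately show "carrier (plucker_ring k n) \<noteq> orbit_ideal k n" by blast
  fix a b assume "a \<in> carrier (plucker_ring k n)" "b \<in> carrier (plucker_ring k n)" "a \<otimes>\<^bsub>plucker_ring k n\<^esub> b \<in> orbit_ideal k n"
  then show "a \<in> orbit_ideal k n \<or> b \<in> orbit_ideal k n" using orbit_ideal_prime[of a b] by simp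
qed

section \<open>The Hilbert polynomial, its leading coefficient and the degree\<close>

section \<open>The Hilbert polynomial\<close>

text \<open>Weyl's formula as a function of \<open>d\<close>. A short root of one of the first
  \<open>k\<close> coordinates gives a linear factor, a pair inside the first \<open>k\<close> a
  linear one after cancellation, a mixed pair a quadratic one; pairs beyond \<open>k\<close>
  cancel.\<close>

definition hpoly :: "nat \<Rightarrow> nat \<Rightarrow> real poly" where
  "hpoly k n = (if odd n then \<Prod>j<k. [:1, 1 / rho n j:] else 1) * (\<Prod>b<k. \<Prod>a<b. [:1, 2 / (rho n a + rho n b):]) *
    (\<Prod>b\<in>{k..<n div 2}. \<Prod>a<k. [:1, 2 * rho n a / ((rho n a)\<^sup>2 - (rho n b)\<^sup>2), 1 / ((rho n a)\<^sup>2 - (rho n b)\<^sup>2):])"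

lemma prod_pairs_split:
  fixes g :: "nat \<Rightarrow> nat \<Rightarrow> 'a::comm_monoid_mult"
  assumes km: "k \<le> m" and g: "\<And>a b. k \<le> a \<Longrightarrow> a < b \<Longrightarrow> b < m \<Longrightarrow> g a b = 1"
  shows "(\<Prod>b<m. \<Prod>a<b. g a b) = (\<Prod>b<k. \<Prod>a<b. g a b) * (\<Prod>b\<in>{k..<m}. \<Prod>a<k. g a b)"
proof -
  have e: "{..<m} = {..<k} \<union> {k..<m}" using km by auto
  have "(\<Prod>b<m. \<Prod>a<b. g a b) = (\<Prod>b<k. \<Prod>a<b. g a b) * (\<Prod>b\<in>{k..<m}. \<Prod>a<b. g a b)"
    unfolding e by (rule prod.union_disjoint) auto
  also have "(\<Prod>b\<in>{k..<m}. \<Prod>a<b. g a b) = (\<Prod>b\<in>{k..<m}. \<Prod>a<k. g a b)"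
  proof (rule prod.cong[OF refl])
    fix b assume b: "b \<in> {k..<m}"
    show "(\<Prod>a<b. g a b) = (\<Prod>a<k. g a b)" by (rule prod.mono_neutral_right) (use b g in auto)
  qed
  finally show ?thesis .
qed

lemma rho_square_less:
  assumes k: "1 \<le> k" "2 * k < n" and ab: "a < b" "b < n div 2"
  shows "(rho n b)\<^sup>2 < (rho n a)\<^sup>2" "rho n a + rho n b > 0"
proof -
  have "0 \<le> rho n b" "rho n b < rho n a" using rho_props(1,2)[OF k] ab by auto
  then show "(rho n b)\<^sup>2 < (rho n a)\<^sup>2" "rho n a + rho n b > 0" by (auto intro: power_strict_mono)
qed

lemma poly_hpoly:
  assumes k: "1 \<le> k" "2 * k < n"
  shows "poly (hpoly k n) (real d) = (if odd n then (\<Prod>j<n div 2. lvec n k d j / rho n j) else 1) *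
    (\<Prod>b<n div 2. \<Prod>a<b. ((lvec n k d b)\<^sup>2 - (lvec n k d a)\<^sup>2) / ((rho n b)\<^sup>2 - (rho n a)\<^sup>2))"
proof -
  let ?m = "n div 2"
  have km: "k \<le> ?m" by (rule rho_props(4)[OF k])
  note rs = rho_square_less[OF k]
  have 1: "(\<Prod>j<?m. lvec n k d j / rho n j) = (\<Prod>j<k. 1 + real d / rho n j)" if o: "odd n"
  proof -
    have r0: "rho n j \<noteq> 0" if "j < ?m" for j using rho_props(5)[OF k that o] by simp
    have "(\<Prod>j<?m. lvec n k d j / rho n j) = (\<Prod>j<k. lvec n k d j / rho n j)"
      by (rule prod.mono_neutral_right) (use km r0 in \<open>auto simp: lvec_def\<close>)
    also have "\<dots> = (\<Prod>j<k. 1 + real d / rho n j)"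
      by (rule prod.cong[OF refl]) (use km r0 in \<open>auto simp: lvec_def add_divide_distrib\<close>)
    finally show ?thesis .
  qed
  have "(\<Prod>b<?m. \<Prod>a<b. ((lvec n k d b)\<^sup>2 - (lvec n k d a)\<^sup>2) / ((rho n b)\<^sup>2 - (rho n a)\<^sup>2)) =
     (\<Prod>b<k. \<Prod>a<b. ((lvec n k d b)\<^sup>2 - (lvec n k d a)\<^sup>2) / ((rho n b)\<^sup>2 - (rho n a)\<^sup>2)) *
     (\<Prod>b\<in>{k..<?m}. \<Prod>a<k. ((lvec n k d b)\<^sup>2 - (lvec n k d a)\<^sup>2) / ((rho n b)\<^sup>2 - (rho n a)\<^sup>2))"
  proof (rule prod_pairs_split[OF km])
    fix a b assume ab: "k \<le> a" "a < b" "b < ?m"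
    then show "((lvec n k d b)\<^sup>2 - (lvec n k d a)\<^sup>2) / ((rho n b)\<^sup>2 - (rho n a)\<^sup>2) = 1" using rs(1)[OF ab(2,3)] by (simp add: lvec_def)
  qed
  also have "(\<Prod>b<k. \<Prod>a<b. ((lvec n k d b)\<^sup>2 - (lvec n k d a)\<^sup>2) / ((rho n b)\<^sup>2 - (rho n a)\<^sup>2)) = (\<Prod>b<k. \<Prod>a<b. 1 + real d * 2 / (rho n a + rho n b))"
  proof (rule prod.cong[OF refl], rule prod.cong[OF refl])
    fix b a assume ab: "b \<in> {..<k}" "a \<in> {..<b}"
    then have ab': "a < b" "b < ?m" "b < k" "a < k" using km by auto
    have ne: "rho n a + rho n b \<noteq> 0" "rho n b - rho n a \<noteq> 0" using rs(2)[OF ab'(1,2)] rho_props(1)[OF k ab'(1)] by auto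
    have "(lvec n k d b)\<^sup>2 - (lvec n k d a)\<^sup>2 = (rho n b - rho n a) * (rho n a + rho n b + 2 * real d)"
      using ab' by (simp add: lvec_def power2_eq_square algebra_simps)
    moreover have "(rho n b)\<^sup>2 - (rho n a)\<^sup>2 = (rho n b - rho n a) * (rho n a + rho n b)" by (simp add: power2_eq_square algebra_simps)
    ultimately have "((lvec n k d b)\<^sup>2 - (lvec n k d a)\<^sup>2) / ((rho n b)\<^sup>2 - (rho n a)\<^sup>2) = (rho n a + rho n b + 2 * real d) / (rho n a + rho n b)"
      using ne by simp
    then show "((lvec n k d b)\<^sup>2 - (lvec n k d a)\<^sup>2) / ((rho n b)\<^sup>2 - (rho n a)\<^sup>2) = 1 + real d * 2 / (rho n a + rho n b)"
      using ne by (simp add: add_divide_distrib)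
  qed
  also have "(\<Prod>b\<in>{k..<?m}. \<Prod>a<k. ((lvec n k d b)\<^sup>2 - (lvec n k d a)\<^sup>2) / ((rho n b)\<^sup>2 - (rho n a)\<^sup>2)) =
     (\<Prod>b\<in>{k..<?m}. \<Prod>a<k. 1 + real d * (2 * rho n a / ((rho n a)\<^sup>2 - (rho n b)\<^sup>2) + real d * (1 / ((rho n a)\<^sup>2 - (rho n b)\<^sup>2))))"
  proof (rule prod.cong[OF refl], rule prod.cong[OF refl])
    fix b a assume ab: "b \<in> {k..<?m}" "a \<in> {..<k}"
    then have ab': "a < b" "b < ?m" "\<not> b < k" "a < k" by auto
    define R where "R = (rho n a)\<^sup>2 - (rho n b)\<^sup>2"
    have R: "R \<noteq> 0" "(rho n b)\<^sup>2 - (rho n a)\<^sup>2 = - R" using rs(1)[OF ab'(1,2)] by (auto simp: R_def)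
    have "(lvec n k d b)\<^sup>2 - (lvec n k d a)\<^sup>2 = - (R + real d * (2 * rho n a + real d))"
      using ab' by (simp add: lvec_def R_def power2_eq_square algebra_simps)
    then have "((lvec n k d b)\<^sup>2 - (lvec n k d a)\<^sup>2) / - R = (R + real d * (2 * rho n a + real d)) / R" by (simp only: minus_divide_divide)
    also have "\<dots> = 1 + real d * (2 * rho n a / R + real d * (1 / R))" using R(1) by (simp add: field_simps)
    finally show "((lvec n k d b)\<^sup>2 - (lvec n k d a)\<^sup>2) / ((rho n b)\<^sup>2 - (rho n a)\<^sup>2) = 1 + real d * (2 * rho n a / ((rho n a)\<^sup>2 - (rho n b)\<^sup>2) + real d * (1 / ((rho n a)\<^sup>2 - (rho n b)\<^sup>2)))"
      unfolding R(2) R_def[symmetric] .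
  qed
  finally show ?thesis unfolding hpoly_def using 1 by (simp add: poly_prod mult.assoc)
qed

text \<open>Strict decrease and nonnegativity of \<open>rho\<close> keep all leading coefficients
  nonzero, so degrees add: \<open>k\<close> for odd \<open>n\<close>, then
  \<open>k * (k - 1) / 2\<close>, then \<open>2 * k\<close> for each of the
  \<open>n div 2 - k\<close> remaining coordinates. The total is the dimension of the orthogonal
  Grassmannian.\<close>

lemma hpoly_degree_lead:
  assumes k: "1 \<le> k" "2 * k < n"
  shows "degree (hpoly k n) = k * (n - k) - (k + 1 choose 2)"
    "lead_coeff (hpoly k n) = (if odd n then \<Prod>j<k. 1 / rho n j else 1) * (\<Prod>b<k. \<Prod>a<b. 2 / (rho n a + rho n b)) *
       (\<Prod>b\<in>{k..<n div 2}. \<Prod>a<k. 1 / ((rho n a)\<^sup>2 - (rho n b)\<^sup>2))"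
proof -
  let ?m = "n div 2"
  have km: "k \<le> ?m" by (rule rho_props(4)[OF k])
  note rs = rho_square_less[OF k]
  define P1 where "P1 = (if odd n then \<Prod>j<k. [:1, 1 / rho n j:] else 1)"
  define P2 where "P2 = (\<Prod>b<k. \<Prod>a<b. [:1, 2 / (rho n a + rho n b):])"
  define P3 where "P3 = (\<Prod>b\<in>{k..<?m}. \<Prod>a<k. [:1, 2 * rho n a / ((rho n a)\<^sup>2 - (rho n b)\<^sup>2), 1 / ((rho n a)\<^sup>2 - (rho n b)\<^sup>2):])"
  have r1: "1 / rho n j \<noteq> 0" if "odd n" "j < k" for j using rho_props(5)[OF k _ that(1), of j] that km by simp
  have r2: "2 / (rho n a + rho n b) \<noteq> 0" if "a < b" "b < k" for a b using rs(2)[OF that(1)] that km by simp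
  have r3: "1 / ((rho n a)\<^sup>2 - (rho n b)\<^sup>2) \<noteq> 0" if "a < k" "b \<in> {k..<?m}" for a b
    using rs(1)[of a b] that by simp
  have nz: "P1 \<noteq> 0" "P2 \<noteq> 0" "P3 \<noteq> 0" unfolding P1_def P2_def P3_def by (auto simp: prod_zero_iff)
  have h: "hpoly k n = P1 * P2 * P3" by (simp only: hpoly_def P1_def P2_def P3_def)
  have d1: "degree P1 = (if odd n then k else 0)"
  proof (cases "odd n")
    case True
    have "degree P1 = (\<Sum>j<k. degree [:1, 1 / rho n j:])" unfolding P1_def using True by (simp add: degree_prod_sum_eq)
    also have "\<dots> = (\<Sum>j<k. 1)" by (rule sum.cong[OF refl]) (use r1[OF True] in simp)
    finally show ?thesis using True by simp
  qed (simp add: P1_def)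
  have d2: "degree P2 = (\<Sum>b<k. b)"
  proof -
    have "degree P2 = (\<Sum>b<k. \<Sum>a<b. degree [:1, 2 / (rho n a + rho n b):])"
      unfolding P2_def by (subst degree_prod_sum_eq; (simp add: prod_zero_iff degree_prod_sum_eq del: degree_pCons_eq_if)?)
    also have "\<dots> = (\<Sum>b<k. \<Sum>a<b. 1)"
      by (rule sum.cong[OF refl], rule sum.cong[OF refl]) (use r2 in simp)
    finally show ?thesis by simp
  qed
  have d3: "degree P3 = (?m - k) * (2 * k)"
  proof -
    have "degree P3 = (\<Sum>b\<in>{k..<?m}. \<Sum>a<k. degree [:1, 2 * rho n a / ((rho n a)\<^sup>2 - (rho n b)\<^sup>2), 1 / ((rho n a)\<^sup>2 - (rho n b)\<^sup>2):])"
      unfolding P3_def by (subst degree_prod_sum_eq; (simp add: prod_zero_iff degree_prod_sum_eq del: degree_pCons_eq_if)?)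
    also have "\<dots> = (\<Sum>b\<in>{k..<?m}. \<Sum>a<k. 2)"
      by (rule sum.cong[OF refl], rule sum.cong[OF refl]) (use r3 in simp)
    finally show ?thesis by simp
  qed
  have dt: "degree (hpoly k n) = degree P1 + degree P2 + degree P3" unfolding h using nz by (simp add: degree_mult_eq)
  define s where "s = (\<Sum>b<k. b)"
  have s1: "2 * s + k = k * k" unfolding s_def by (induction k) auto
  have s2: "(k + 1 choose 2) = s + k" unfolding s_def by (induction k) (auto simp: numeral_2_eq_2)
  obtain r where r: "?m = k + r" using km le_Suc_ex by blast
  have "n = 2 * (k + r) + (if odd n then 1 else 0)" using r odd_two_times_div_two_succ[of n] even_two_times_div_two[of n] by (auto split: if_splits)
  then have nk: "n - k = k + 2 * r + (if odd n then 1 else 0)" by (auto split: if_splits)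
  have "k * (n - k) = k * k + 2 * k * r + (if odd n then k else 0)" unfolding nk by (simp add: algebra_simps)
  then have "k * (n - k) - (s + k) = s + 2 * k * r + (if odd n then k else 0)" using s1 by linarith
  then show "degree (hpoly k n) = k * (n - k) - (k + 1 choose 2)"
    unfolding dt d1 d2 d3 s2 s_def[symmetric] r by simp
  have l1: "lead_coeff P1 = (if odd n then \<Prod>j<k. 1 / rho n j else 1)"
    unfolding P1_def using r1 by (auto simp: lead_coeff_prod intro!: prod.cong)
  have l2: "lead_coeff P2 = (\<Prod>b<k. \<Prod>a<b. 2 / (rho n a + rho n b))"
    unfolding P2_def lead_coeff_prod by (rule prod.cong[OF refl], rule prod.cong[OF refl]) (use r2 in simp)
  have l3: "lead_coeff P3 = (\<Prod>b\<in>{k..<?m}. \<Prod>a<k. 1 / ((rho n a)\<^sup>2 - (rho n b)\<^sup>2))"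
    unfolding P3_def lead_coeff_prod by (rule prod.cong[OF refl], rule prod.cong[OF refl]) (use r3 in simp)
  show "lead_coeff (hpoly k n) = (if odd n then \<Prod>j<k. 1 / rho n j else 1) * (\<Prod>b<k. \<Prod>a<b. 2 / (rho n a + rho n b)) *
       (\<Prod>b\<in>{k..<n div 2}. \<Prod>a<k. 1 / ((rho n a)\<^sup>2 - (rho n b)\<^sup>2))"
    unfolding h lead_coeff_mult l1 l2 l3 ..
qed

lemma poly_eq_if_eventually_eq:
  fixes p q :: "real poly"
  assumes "\<forall>\<^sub>F d in sequentially. poly p (real d) = poly q (real d)"
  shows "p = q"
proof (rule ccontr)
  assume "p \<noteq> q"
  then have fin: "finite {x. poly (p - q) x = 0}" by (intro poly_roots_finite) simp
  obtain N where N: "\<And>d. d \<ge> N \<Longrightarrow> poly p (real d) = poly q (real d)" using assms by (auto simp: eventually_sequentially)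
  have "real ` {N..} \<subseteq> {x. poly (p - q) x = 0}" using N by auto
  then have "finite (real ` {N..})" using fin finite_subset by blast
  then have "finite {N..}" by (rule finite_imageD) simp
  then show False using infinite_Ici by blast
qed

text \<open>Hilbert function and polynomial agree in every degree, and a polynomial is determined by
  its values at large integers, so the definite description is resolved.\<close>

lemma hilbert_polynomial_eq:
  assumes k: "1 \<le> k" "2 * k < n"
  shows "hilbert_polynomial k n (ortho_plucker_ideal k n) = hpoly k n"
proof -
  have h: "poly (hpoly k n) (real d) = real (hilbert_function k n (ortho_plucker_ideal k n) d)" for d
  proof -
    interpret K: casimir_quotient k n d "orbit_ideal k n \<inter> graded_part k n d" by (rule casimir_quotient_orbit_ideal[OF k])
    show ?thesis unfolding hilbert_function_def OPI_eq_orbit_ideal[OF k] K.dim_quotient(1) K.card_B by (rule poly_hpoly[OF k])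
  qed
  show ?thesis unfolding hilbert_polynomial_def
  proof (rule the_equality)
    show "\<forall>\<^sub>F d in sequentially. poly (hpoly k n) (real d) = real (hilbert_function k n (ortho_plucker_ideal k n) d)" using h by simp
    fix p assume "\<forall>\<^sub>F d in sequentially. poly p (real d) = real (hilbert_function k n (ortho_plucker_ideal k n) d)"
    then show "p = hpoly k n" unfolding h[symmetric] by (rule poly_eq_if_eventually_eq)
  qed
qed

text \<open>Coordinates count from 0 in \<open>rho\<close> but from 1 in the stated degree; the pair
  also changes order, \<open>(b, a)\<close> becoming \<open>(a + 1, b + 1)\<close>.\<close>

lemma prod_rectangle_shift:
  fixes k m :: nat
  shows "(\<Prod>(i, j)\<in>{1..k} \<times> {k<..m}. f i j) = (\<Prod>b\<in>{k..<m}. \<Prod>a<k. f (a + 1) (b + 1))"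
  unfolding prod.cartesian_product
  by (rule prod.reindex_bij_witness[where i="\<lambda>(b, a). (a + 1, b + 1)" and j="\<lambda>(i, j). (j - 1, i - 1)"]) auto

lemma prod_triangle_shift:
  fixes k :: nat
  shows "(\<Prod>(i, j)\<in>{(i, j). 1 \<le> i \<and> i < j \<and> j \<le> k}. f i j) = (\<Prod>b<k. \<Prod>a<b. f (a + 1) (b + 1))"
proof -
  have "(\<Prod>b<k. \<Prod>a<b. f (a + 1) (b + 1)) = (\<Prod>(b, a)\<in>(SIGMA b:{..<k}. {..<b}). f (a + 1) (b + 1))" by (rule prod.Sigma) auto
  also have "\<dots> = (\<Prod>(i, j)\<in>{(i, j). 1 \<le> i \<and> i < j \<and> j \<le> k}. f i j)"
    by (rule prod.reindex_bij_witness[where j="\<lambda>(b, a). (a + 1, b + 1)" and i="\<lambda>(i, j). (j - 1, i - 1)"]) auto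
  finally show ?thesis ..
qed

theorem theorem2p10:
  fixes k n m D :: nat
  assumes k: "k \<ge> 1" and n: "n > 2 * k"
    and m: "m = n div 2"
    and D: "D = k * (n - k) - (k + 1 choose 2)"
  shows "primeideal (ortho_plucker_ideal k n) (plucker_ring k n) \<and>
    ortho_plucker_ideal k n = vanishing_ideal k n (plucker_point n ` OGr k n) \<and>
    (n = 2 * m \<longrightarrow> ideal_degree k n (ortho_plucker_ideal k n) =
      fact D *
      (\<Prod>(i, j) \<in> {1..k} \<times> {k<..m}.
         1 / ((2 * real m - real i - real j) * (real j - real i))) *
      (\<Prod>(i, j) \<in> {(i, j). 1 \<le> i \<and> i < j \<and> j \<le> k}.
         2 / (2 * real m - real i - real j))) \<and>
    (n = 2 * m + 1 \<longrightarrow> ideal_degree k n (ortho_plucker_ideal k n) =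
      fact D *
      (\<Prod>i \<in> {1..k}. 2 / (2 * real m - 2 * real i + 1)) *
      (\<Prod>(i, j) \<in> {1..k} \<times> {k<..m}.
         1 / ((2 * real m - real i - real j + 1) * (real j - real i))) *
      (\<Prod>(i, j) \<in> {(i, j). 1 \<le> i \<and> i < j \<and> j \<le> k}.
         2 / (2 * real m - real i - real j + 1)))"
proof -
  have eq: "ortho_plucker_ideal k n = orbit_ideal k n" by (rule OPI_eq_orbit_ideal[OF k n])
  have prime: "primeideal (ortho_plucker_ideal k n) (plucker_ring k n)" unfolding eq by (rule primeideal_orbit_ideal[OF n])
  have van: "ortho_plucker_ideal k n = vanishing_ideal k n (plucker_point n ` OGr k n)"
    using OPI_subset_vanishing[OF k, of n] vanishing_subset_orbit_ideal[of k n] n eq by auto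
  have deg: "ideal_degree k n (ortho_plucker_ideal k n) = fact D * ((if odd n then \<Prod>j<k. 1 / rho n j else 1) * (\<Prod>b<k. \<Prod>a<b. 2 / (rho n a + rho n b)) *
       (\<Prod>b\<in>{k..<m}. \<Prod>a<k. 1 / ((rho n a)\<^sup>2 - (rho n b)\<^sup>2)))"
    unfolding ideal_degree_def hilbert_polynomial_eq[OF k n] hpoly_degree_lead(2)[OF k n] unfolding hpoly_degree_lead(1)[OF k n] D m ..
  \<comment> \<open>With \<open>i = a + 1\<close> and \<open>j = b + 1\<close> these are the factors
    \<open>n - i - j\<close> and \<open>(n - i - j) * (j - i)\<close> of the stated degree; the two
    parities differ only in how \<open>n\<close> is written in terms of \<open>m\<close>.\<close>
  have sum: "rho n a + rho n b = real n - real (a + 1) - real (b + 1)" for a b by (simp add: rho_def)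
  have dif: "(rho n a)\<^sup>2 - (rho n b)\<^sup>2 = (real n - real (a + 1) - real (b + 1)) * (real (b + 1) - real (a + 1))" for a b
  proof -
    have "(rho n a)\<^sup>2 - (rho n b)\<^sup>2 = (rho n a + rho n b) * (rho n a - rho n b)" by (simp add: power2_eq_square algebra_simps)
    moreover have "rho n a - rho n b = real (b + 1) - real (a + 1)" by (simp add: rho_def)
    ultimately show ?thesis unfolding sum by simp
  qed
  have even: "ideal_degree k n (ortho_plucker_ideal k n) =
      fact D *
      (\<Prod>(i, j) \<in> {1..k} \<times> {k<..m}.
         1 / ((2 * real m - real i - real j) * (real j - real i))) *
      (\<Prod>(i, j) \<in> {(i, j). 1 \<le> i \<and> i < j \<and> j \<le> k}.
         2 / (2 * real m - real i - real j))" if e: "n = 2 * m"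
  proof -
    have ev: "\<not> odd n" "real n = 2 * real m" using e by simp_all
    show ?thesis unfolding deg sum dif prod_rectangle_shift prod_triangle_shift unfolding ev(2) using ev(1)
      by (simp only: if_False mult_1 mult.assoc mult.commute mult.left_commute)
  qed
  have odd: "ideal_degree k n (ortho_plucker_ideal k n) =
      fact D *
      (\<Prod>i \<in> {1..k}. 2 / (2 * real m - 2 * real i + 1)) *
      (\<Prod>(i, j) \<in> {1..k} \<times> {k<..m}.
         1 / ((2 * real m - real i - real j + 1) * (real j - real i))) *
      (\<Prod>(i, j) \<in> {(i, j). 1 \<le> i \<and> i < j \<and> j \<le> k}.
         2 / (2 * real m - real i - real j + 1))" if o: "n = 2 * m + 1"
  proof -
    have od: "odd n" "real n = 2 * real m + 1" using o by simp_all
    have n1: "2 * real m + 1 - x - y = 2 * real m - x - y + 1" for x y by simp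
    have "(\<Prod>i \<in> {1..k}. 2 / (2 * real m - 2 * real i + 1)) = (\<Prod>j<k. 2 / (2 * real m - 2 * real (j + 1) + 1))"
      using prod.atLeast1_atMost_eq[of "\<lambda>i. 2 / (2 * real m - 2 * real i + 1)" k] by simp
    also have "\<dots> = (\<Prod>j<k. 1 / rho n j)"
    proof (rule prod.cong[OF refl])
      fix j
      have r: "rho n j = (2 * real m - 2 * real (j + 1) + 1) / 2" unfolding rho_def od(2) by (simp add: field_simps)
      show "2 / (2 * real m - 2 * real (j + 1) + 1) = 1 / rho n j" unfolding r by simp
    qed
    finally have p1: "(\<Prod>i \<in> {1..k}. 2 / (2 * real m - 2 * real i + 1)) = (\<Prod>j<k. 1 / rho n j)" .
    show ?thesis unfolding deg p1 sum dif prod_rectangle_shift prod_triangle_shift unfolding od(2) n1 using od(1)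
      by (simp only: if_True not_False_eq_True mult.assoc mult.commute mult.left_commute)
  qed
  show ?thesis using prime van even odd by blast
qed

end
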